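(* Let $D,\mathcal S,f,U$ be as in the context, $r>0$, and let $k_0:D\to\mathbb R_+$ be a bounded measurable function (initial capital) with $\inf_{z\in D}k_0(z)>0$. Then the operator $\mathcal T$ admits a fixed point in $Y$, and hence there exists a rational expectations equilibrium for the spatial economy.
   Context: $\mathbb R_+=[0,\infty)$. $D\subset\mathbb R^2$ is a compact set. $\mathcal M_{loc}(\mathbb R_+)$ is the space of real-valued Radon measures on $\mathbb R_+$ and $BV_{loc}(\mathbb R_+)$ is the space of functions that are $L^1$ with distributional derivative a finite measure on every compact subset of $\mathbb R_+$. Assumptions on $\mathcal S$. $\bar I\subset(0,\infty)$ is a fixed interval (possibly unbounded). $\mathcal S:L^\infty(D)\to C(D;\bar I)$ is a (possibly nonlinear) map, Lipschitz for the $L^\infty$ topology, mapping bounded sets of $L^\infty(D)$ into compact subsets of $C(D;\bar I)$, the space of continuous functions on $D$ with values in $\bar I$, with the topology of uniform convergence. For $k:\mathbb R_+\times D\to\mathbb R_+$, $\mathcal S k$ is defined at each fixed time: $(\mathcal S k)(t,\cdot)=\mathcal S(k(t,\cdot))$. Assumptions on $f$. $f:\mathbb R_+\times\mathbb R_+\to\mathbb R$, $(k,K)\mapsto f(k,K)$, satisfies: (i) $f$ is continuous and $f(0,K)=0$ for every $K\in\bar I$; (ii) $f$ is $C^1$ on $(0,\infty)\times(0,\infty)$, with partial derivatives $f_k,f_K$; (iii) there is $\delta>0$ with $f_k\ge-\delta$, and $f_k$ is bounded from above on every set $[a,\infty)\times[0,b]$ (intersected with the domain of $f_k$), $a>0$,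 $b>0$; (iv) for every $M$ there is $\bar k(M)$ such that $f(k,K)\le 0$ whenever $K\le M$ and $k\ge\bar k(M)$, and $\bar k(M)=o(M)$ as $M\to\infty$; (v) there is $k_1>0$ such that $f(k,K)>0$ for all $K\in\bar I$ and $0<k<k_1$; (vi) $k\mapsto f(k,K)$ is strictly concave for every $K\in\bar I$. Assumptions on $U$. $U:\mathbb R_+\to\mathbb R_+$ is concave and strictly increasing (continuous on $[0,\infty)$, differentiable on $(0,\infty)$), with $U'(0)=\infty$ and $U'(\infty)=0$. Individual problem. For $\kappa_0\ge0$ and a bounded continuous $\kappa:\mathbb R_+\to\bar I$, consider the maximisation of $J_\infty(c)=\int_0^\infty e^{-rt}U(c^{ac}(t))\,dt$ ($c^{ac}$ being the density of the absolutely continuous part of the measure $c$) among pairs $(k,c)\in BV_{loc}(\mathbb R_+)\times\mathcal M_{loc}(\mathbb R_+)$ with $k\ge0$, $k(0)=\kappa_0$ (i.e. $k(t)=\kappa_0+k'([0,t])$ for a.e. $t$), $c\ge0$ and $k'+c\le f(k,\kappa)$ as measures. This problem has a unique maximiser $(k,c)$. Operators. $Y$ is the Banach space of continuous functions $y$ on $\mathbb R_+\times D$ with $\|y\|_Y=\sum_{m\ge0}2^{-m}\|y\|_{L^\infty([0,m]\times D)}<\infty$. For a bounded continuous $K:\mathbb R_+\times D\to\bar I$ (such functions belong to $Y$), let $k^*(\cdot,z;K)$ be, for each $z\in D$, the optimal $k$ of the individual problem with $\kappa=K(\cdot,z)$ and $\kappa_0=k_0(z)$. The operator $\mathcal T$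 is $\mathcal T K=\mathcal S\,k^*(\cdot,\cdot;K)$. A rational expectations equilibrium for the spatial economy is a fixed point of $\mathcal T$. *)

theory Defs
  imports "HOL-Analysis.Analysis" "HOL-Probability.Essential_Supremum"
    "HOL-Library.Landau_Symbols"
begin

section \<open>Function spaces on the spatial domain\<close>

text \<open>
  Elements of \<open>L\<^sup>\<infinity>(D)\<close> are represented by functions that are Lebesgue measurable on \<open>D\<close>;
  functions at distance 0 represent the same element. The essential supremum is taken
  in the extended nonnegative reals, so that a Lebesgue-null \<open>D\<close> gives the zero space.
\<close>

definition Linf :: "'a::euclidean_space set \<Rightarrow> ('a \<Rightarrow> real) set" where
  "Linf D = {u \<in> borel_measurable (lebesgue_on D).
               esssup (lebesgue_on D) (\<lambda>x. ennreal \<bar>u x\<bar>) < top}"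

definition Linf_norm :: "'a::euclidean_space set \<Rightarrow> ('a \<Rightarrow> real) \<Rightarrow> real" where
  "Linf_norm D u = enn2real (esssup (lebesgue_on D) (\<lambda>x. ennreal \<bar>u x\<bar>))"

text \<open>\<open>C(D; I)\<close> with the uniform metric; its points are \<^const>\<open>undefined\<close> outside \<open>D\<close>.\<close>

definition Cspace :: "'a::euclidean_space set \<Rightarrow> real set \<Rightarrow> ('a \<Rightarrow> real) metric" where
  "Cspace D I = cfunspace (top_of_set D) (submetric euclidean_metric I)"

text \<open>
  The Lipschitz bound makes \<open>S\<close> independent of the representative chosen in \<open>L\<^sup>\<infinity>(D)\<close>.
\<close>

definition admissible_S ::
  "'a::euclidean_space set \<Rightarrow> real set \<Rightarrow> (('a \<Rightarrow> real) \<Rightarrow> 'a \<Rightarrow> real) \<Rightarrow> bool" where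
  "admissible_S D I S \<longleftrightarrow>
     (\<forall>u\<in>Linf D. S u \<in> mspace (Cspace D I)) \<and>
     (\<exists>L. \<forall>u\<in>Linf D. \<forall>v\<in>Linf D.
        mdist (Cspace D I) (S u) (S v) \<le> L * Linf_norm D (\<lambda>x. u x - v x)) \<and>
     (\<forall>B\<subseteq>Linf D. (\<exists>R. \<forall>u\<in>B. Linf_norm D u \<le> R) \<longrightarrow>
        (\<exists>C. compactin (mtopology_of (Cspace D I)) C \<and> S ` B \<subseteq> C))"

section \<open>Production function and utility\<close>

definition strictly_concave_on :: "real set \<Rightarrow> (real \<Rightarrow> real) \<Rightarrow> bool" where
  "strictly_concave_on A g \<longleftrightarrow>
     (\<forall>x\<in>A. \<forall>y\<in>A. \<forall>s. x \<noteq> y \<and> 0 < s \<and> s < 1 \<longrightarrow>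
        s * g x + (1 - s) * g y < g (s * x + (1 - s) * y))"

definition production_function ::
  "real set \<Rightarrow> (real \<Rightarrow> real \<Rightarrow> real) \<Rightarrow> bool" where
  "production_function I f \<longleftrightarrow>
     continuous_on ({0..} \<times> {0..}) (\<lambda>(k, K). f k K) \<and>
     (\<forall>K\<in>I. f 0 K = 0) \<and>
     (\<exists>fk fK.
        (\<forall>k>0. \<forall>K>0. ((\<lambda>x. f x K) has_real_derivative fk k K) (at k) \<and>
                      ((\<lambda>y. f k y) has_real_derivative fK k K) (at K)) \<and>
        continuous_on ({0<..} \<times> {0<..}) (\<lambda>(k, K). fk k K) \<and>
        continuous_on ({0<..} \<times> {0<..}) (\<lambda>(k, K). fK k K) \<and>
        (\<exists>\<delta>>0. \<forall>k>0. \<forall>K>0. - \<delta> \<le> fk k K) \<and>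
        (\<forall>a>0. \<forall>b>0. \<exists>C. \<forall>k\<ge>a. \<forall>K. 0 < K \<and> K \<le> b \<longrightarrow> fk k K \<le> C)) \<and>
     (\<exists>kbar. (\<forall>M. \<forall>k\<ge>0. \<forall>K\<ge>0. K \<le> M \<and> kbar M \<le> k \<longrightarrow> f k K \<le> 0) \<and>
             kbar \<in> o[at_top](\<lambda>M. M)) \<and>
     (\<exists>k1>0. \<forall>K\<in>I. \<forall>k. 0 < k \<and> k < k1 \<longrightarrow> 0 < f k K) \<and>
     (\<forall>K\<in>I. strictly_concave_on {0..} (\<lambda>k. f k K))"

definition utility_function :: "(real \<Rightarrow> real) \<Rightarrow> bool" where
  "utility_function U \<longleftrightarrow>
     (\<forall>c\<ge>0. 0 \<le> U c) \<and>
     concave_on {0..} U \<and>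
     strict_mono_on {0..} U \<and>
     continuous_on {0..} U \<and>
     (\<forall>c>0. U differentiable (at c)) \<and>
     filterlim (deriv U) at_top (at_right 0) \<and>
     (deriv U \<longlongrightarrow> 0) at_top"

section \<open>Individual problem\<close>

text \<open>
  A real-valued Radon measure on \<open>[0,\<infinity>)\<close> is a countably additive real set function on the
  bounded Borel sets; it need not extend to unbounded sets. Values elsewhere are ignored.
\<close>

definition bounded_borel :: "real set set" where
  "bounded_borel = {B \<in> sets borel. B \<subseteq> {0..} \<and> bounded B}"

definition Mloc :: "(real set \<Rightarrow> real) set" where
  "Mloc = {\<mu>. \<forall>A :: nat \<Rightarrow> real set.
      range A \<subseteq> bounded_borel \<and> disjoint_family A \<and> (\<Union>n. A n) \<in> bounded_borel \<longrightarrow>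
      (\<lambda>n. \<mu> (A n)) sums \<mu> (\<Union>n. A n)}"

text \<open>
  Density of the absolutely continuous part of \<open>c\<close>: the remaining part of \<open>c\<close> is carried by
  a Lebesgue-null set \<open>N\<close>. Densities agree almost everywhere, so the choice in \<open>payoff\<close>
  is immaterial.
\<close>

definition is_ac_density :: "(real set \<Rightarrow> real) \<Rightarrow> (real \<Rightarrow> real) \<Rightarrow> bool" where
  "is_ac_density c g \<longleftrightarrow>
     (\<exists>N\<in>null_sets lborel. \<forall>B\<in>bounded_borel.
        set_integrable lborel B g \<and> c B = (LINT t:B|lborel. g t) + c (B \<inter> N))"

definition ac_density :: "(real set \<Rightarrow> real) \<Rightarrow> real \<Rightarrow> real" where
  "ac_density c = (SOME g. is_ac_density c g)"

definition payoff :: "real \<Rightarrow> (real \<Rightarrow> real) \<Rightarrow> (real set \<Rightarrow> real) \<Rightarrow> ennreal" where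
  "payoff r U c = (\<integral>\<^sup>+t\<in>{0..}. ennreal (exp (- r * t) * U (ac_density c t)) \<partial>lborel)"

text \<open>
  A function \<open>k \<in> BV\<^sub>l\<^sub>o\<^sub>c([0,\<infinity>))\<close> is represented by its right-continuous version, for which
  \<open>k(t) = \<kappa>0 + k'([0,t])\<close> holds for every \<open>t\<close>. For \<open>t < 0\<close> this reads \<open>k(t) = \<kappa>0\<close>, so \<open>k'\<close>
  is the distributional derivative of \<open>k\<close> extended by \<open>\<kappa>0\<close>, including a possible atom at 0
  when \<open>k\<close> jumps away from its initial value.
\<close>

definition feasible ::
  "(real \<Rightarrow> real \<Rightarrow> real) \<Rightarrow> real \<Rightarrow> (real \<Rightarrow> real) \<Rightarrow> (real \<Rightarrow> real) \<Rightarrow> (real set \<Rightarrow> real) \<Rightarrow> bool" where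
  "feasible f \<kappa>0 \<kappa> k c \<longleftrightarrow>
     c \<in> Mloc \<and> (\<forall>B\<in>bounded_borel. 0 \<le> c B) \<and>
     (\<forall>t\<ge>0. 0 \<le> k t) \<and>
     (\<exists>k'\<in>Mloc. (\<forall>t. k t = \<kappa>0 + k' {0..t}) \<and>
        (\<forall>B\<in>bounded_borel. k' B + c B \<le> (LINT t:B|lborel. f (k t) (\<kappa> t))))"

definition maximiser ::
  "(real \<Rightarrow> real \<Rightarrow> real) \<Rightarrow> real \<Rightarrow> (real \<Rightarrow> real) \<Rightarrow>
   real \<Rightarrow> (real \<Rightarrow> real) \<Rightarrow> (real \<Rightarrow> real) \<Rightarrow> (real set \<Rightarrow> real) \<Rightarrow> bool" where
  "maximiser f r U \<kappa>0 \<kappa> k c \<longleftrightarrow>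
     feasible f \<kappa>0 \<kappa> k c \<and>
     (\<forall>h d. feasible f \<kappa>0 \<kappa> h d \<longrightarrow> payoff r U d \<le> payoff r U c)"

definition kopt ::
  "(real \<Rightarrow> real \<Rightarrow> real) \<Rightarrow> real \<Rightarrow> (real \<Rightarrow> real) \<Rightarrow> real \<Rightarrow> (real \<Rightarrow> real) \<Rightarrow> real \<Rightarrow> real" where
  "kopt f r U \<kappa>0 \<kappa> = (THE k. \<exists>c. maximiser f r U \<kappa>0 \<kappa> k c)"

section \<open>Spatial economy\<close>

text \<open>For continuous functions the norm over \<open>[0,m] \<times> D\<close> in \<open>Y\<close> is the supremum.\<close>

definition Y_norm :: "'a::euclidean_space set \<Rightarrow> (real \<Rightarrow> 'a \<Rightarrow> real) \<Rightarrow> ennreal" where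
  "Y_norm D y = (\<Sum>m. ennreal ((1/2) ^ m) * (SUP (t, z)\<in>{0..real m} \<times> D. ennreal \<bar>y t z\<bar>))"

definition Y_space :: "'a::euclidean_space set \<Rightarrow> (real \<Rightarrow> 'a \<Rightarrow> real) set" where
  "Y_space D = {y. continuous_on ({0..} \<times> D) (\<lambda>(t, z). y t z) \<and> Y_norm D y < top}"

definition kstar ::
  "(real \<Rightarrow> real \<Rightarrow> real) \<Rightarrow> real \<Rightarrow> (real \<Rightarrow> real) \<Rightarrow> ('a \<Rightarrow> real) \<Rightarrow>
   (real \<Rightarrow> 'a \<Rightarrow> real) \<Rightarrow> real \<Rightarrow> 'a \<Rightarrow> real" where
  "kstar f r U k0 K t z = kopt f r U (k0 z) (\<lambda>s. K s z) t"

definition T_op ::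
  "(('a \<Rightarrow> real) \<Rightarrow> 'a \<Rightarrow> real) \<Rightarrow> (real \<Rightarrow> real \<Rightarrow> real) \<Rightarrow> real \<Rightarrow> (real \<Rightarrow> real) \<Rightarrow>
   ('a \<Rightarrow> real) \<Rightarrow> (real \<Rightarrow> 'a \<Rightarrow> real) \<Rightarrow> real \<Rightarrow> 'a \<Rightarrow> real" where
  "T_op S f r U k0 K t = S (kstar f r U k0 K t)"

text \<open>
  \<open>K\<close> lies in the domain of \<open>T\<close>. The last two clauses say that the definite description
  in \<open>kopt\<close> denotes and that \<open>S\<close> is applied inside \<open>L\<^sup>\<infinity>(D)\<close>, so that a fixed point cannot
  be an artefact of unspecified values.
\<close>

definition T_dom ::
  "'a::euclidean_space set \<Rightarrow> real set \<Rightarrow> (real \<Rightarrow> real \<Rightarrow> real) \<Rightarrow> real \<Rightarrow> (real \<Rightarrow> real) \<Rightarrow>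
   ('a \<Rightarrow> real) \<Rightarrow> (real \<Rightarrow> 'a \<Rightarrow> real) set" where
  "T_dom D I f r U k0 = {K.
     continuous_on ({0..} \<times> D) (\<lambda>(t, z). K t z) \<and>
     bounded ((\<lambda>(t, z). K t z) ` ({0..} \<times> D)) \<and>
     (\<forall>t\<ge>0. \<forall>z\<in>D. K t z \<in> I) \<and>
     (\<forall>z\<in>D. \<exists>!k. \<exists>c. maximiser f r U (k0 z) (\<lambda>t. K t z) k c) \<and>
     (\<forall>t\<ge>0. kstar f r U k0 K t \<in> Linf D)}"

definition rational_expectations_equilibrium ::
  "'a::euclidean_space set \<Rightarrow> real set \<Rightarrow> (('a \<Rightarrow> real) \<Rightarrow> 'a \<Rightarrow> real) \<Rightarrow>
   (real \<Rightarrow> real \<Rightarrow> real) \<Rightarrow> real \<Rightarrow> (real \<Rightarrow> real) \<Rightarrow> ('a \<Rightarrow> real) \<Rightarrow>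
   (real \<Rightarrow> 'a \<Rightarrow> real) \<Rightarrow> bool" where
  "rational_expectations_equilibrium D I S f r U k0 K \<longleftrightarrow>
     K \<in> T_dom D I f r U k0 \<and> (\<forall>t\<ge>0. \<forall>z\<in>D. T_op S f r U k0 K t z = K t z)"

end

theory Submission
  imports Defs "HOL-Complex_Analysis.Great_Picard"
begin

text \<open>
  A field \<open>K\<close> of expected externalities determines at every location \<open>z\<close> an individual problem; its
  optimal path gives the capital stock at \<open>z\<close>, and \<open>S\<close> turns the stocks at time \<open>t\<close> into a new field
  at time \<open>t\<close>. An equilibrium is a fixed point of this map \<open>K \<mapsto> expectations_map K\<close>. It exists
  because the new field always lies in one class of functions on \<open>[0,\<infinity>) \<times> D\<close> with a common range
  \<open>[a,b]\<close> and a common modulus of continuity: optimal paths are Lipschitz in time with a constant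
  that depends neither on \<open>z\<close> nor on \<open>K\<close>, which \<open>S\<close> turns into a Lipschitz bound in \<open>t\<close>, and the images
  under \<open>S\<close> of all bounded stocks are equicontinuous in \<open>z\<close> because they form a relatively compact
  set. Such a class is convex and compact for pointwise convergence, so a continuous self-map
  has a fixed point (\<open>modulus_class_fixed_point\<close>). This is Schauder's argument: with the help of
  finite nets the map is replaced by self-maps of finite-dimensional cubes, for which Brouwer's
  theorem follows from Kuhn's combinatorial lemma.

  It remains to prove that optimal paths exist, are unique, are uniformly Lipschitz, and depend
  continuously on the initial stock \<open>\<kappa>0\<close> and on the path \<open>\<kappa>\<close> of the externality. First, measures are
  removed. Since \<open>f\<^sub>k \<ge> - \<delta>\<close>, the function \<open>F(x,K) = f(x,K) + \<delta> x\<close> is nonnegative and nondecreasing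
  in \<open>x\<close>. Multiplying \<open>k' + c \<le> f(k,\<kappa>)\<close> by \<open>exp(\<delta> t)\<close> and integrating from \<open>0\<close> gives
  \<open>exp(\<delta> t) k(t) + (\<integral>\<^sub>0\<^sup>t exp(\<delta> s) g(s) ds) \<le> \<kappa>0 + (\<integral>\<^sub>0\<^sup>t exp(\<delta> s) F(k(s),\<kappa>(s)) ds)\<close>, where \<open>g\<close> is the
  density of the absolutely continuous part of \<open>c\<close>. These subsolutions have the same optimal paths
  as the original problem (\<open>maximiser_characterisation\<close>).

  Monotonicity of \<open>F\<close> allows a monotone iteration that turns a subsolution into a solution, with
  equality and with the same consumption (\<open>no_waste\<close>). Consumption above a high level can be moved
  to the following unit of time without loss of welfare (\<open>truncation\<close>): there is always time at
  which consumption is moderate and its marginal utility bounded below, whereas the marginal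
  utility at high levels tends to \<open>0\<close>. Hence consumption may be bounded once and for all, and
  solutions with bounded consumption have uniformly Lipschitz paths. A sequence of such
  solutions has a limit: the paths converge along a subsequence by equicontinuity, and for the
  consumption rates midpoints with nearly minimal \<open>L\<^sup>2\<close> norm converge almost everywhere, which
  suffices because \<open>U\<close> is concave (\<open>bounded_controls_limit\<close>). This gives existence. Two different
  optimal paths would contradict strict concavity of \<open>f\<close>: their midpoint has resources to spare,
  which can be consumed later (\<open>optimal_unique_AE\<close>).

  For continuous dependence, a limit of optimal solutions is a solution whose welfare is at
  least the lower limit of the values. It is optimal, and therefore the unique optimal one, as
  soon as the value is lower semicontinuous. To see this, an optimal path is mixed with a small
  constant path, which keeps it away from \<open>0\<close> where \<open>f\<^sub>k\<close> may be unbounded, and is then lowered by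
  \<open>\<zeta> exp(C t)\<close> up to a time \<open>T\<close> and put to \<open>0\<close> afterwards; a small \<open>\<zeta>\<close> compensates for a small change of
  \<open>\<kappa>0\<close> and \<open>\<kappa>\<close> (\<open>perturbed_competitor\<close>).

  All these bounds need an upper bound \<open>R\<close> on the stocks such that \<open>f(x,K) \<le> 0\<close> for \<open>x \<ge> R\<close> and all \<open>K\<close>
  that can arise as values of \<open>S\<close> at stocks bounded by \<open>R\<close>. Since \<open>S\<close> grows at most linearly and the
  threshold \<open>kbar(M)\<close> of \<open>f\<close> is \<open>o(M)\<close>, such an \<open>R\<close> exists.
\<close>

section \<open>A fixed point theorem for equicontinuous families\<close>

text \<open>
  The label of a grid point in direction \<open>i\<close> records the sign of \<open>G x i - x i\<close>. Kuhn's lemma yields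
  grid cubes of arbitrarily small size in which both signs occur in every direction; at a limit
  \<open>x\<close> of such cubes \<open>(G x i - x i)\<^sup>2 \<le> 0\<close>. The dimension \<open>N\<close> is a number, not a type, because the nets
  to which the theorem is applied below have no bounded size.
\<close>

lemma brouwer_nat_cube:
  fixes G :: "(nat \<Rightarrow> real) \<Rightarrow> nat \<Rightarrow> real"
  assumes maps: "\<And>x i. (\<And>j. j < N \<Longrightarrow> x j \<in> {0..1}) \<Longrightarrow> i < N \<Longrightarrow> G x i \<in> {0..1}"
    and cont: "\<And>y x i. (\<And>n j. j < N \<Longrightarrow> y n j \<in> {0..1}) \<Longrightarrow>
      (\<And>j. j < N \<Longrightarrow> (\<lambda>n::nat. y n j) \<longlonglongrightarrow> x j) \<Longrightarrow> i < N \<Longrightarrow> (\<lambda>n. G (y n) i) \<longlonglongrightarrow> G x i"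
  shows "\<exists>x. \<forall>i<N. x i \<in> {0..1} \<and> G x i = x i"
proof -
  define sc where "sc p x j = real (x j) / real p" for p :: nat and x :: "nat \<Rightarrow> nat" and j
  (* The values on the boundary are those that Kuhn's lemma prescribes; they agree with the sign
     rule because G maps into the cube. *)
  define label where "label p x i = (if x i = 0 then 0 else if x i = p then 1
      else if sc p x i \<le> G (sc p x) i then 0 else (1::nat))" for p x i
  have sc01: "sc (Suc n) x j \<in> {0..1}" if "x j \<le> Suc n" for n x j
    using that by (auto simp: sc_def divide_simps)
  have maps': "0 \<le> G (sc (Suc n) x) i" "G (sc (Suc n) x) i \<le> 1" if "i < N" "\<forall>j<N. x j \<le> Suc n" for n x i
  proof -
    have "sc (Suc n) x j \<in> {0..1}" if "j < N" for j
      using sc01[of x j n] \<open>\<forall>j<N. x j \<le> Suc n\<close> that by blast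
    from maps[OF this that(1)] show "0 \<le> G (sc (Suc n) x) i" "G (sc (Suc n) x) i \<le> 1" by auto
  qed
  have sc0: "sc (Suc n) x i = 0" if "x i = 0" for n x i
    using that by (simp add: sc_def)
  have sc1: "sc (Suc n) x i = 1" if "x i = Suc n" for n x i
    using that by (simp add: sc_def)
  have lab0: "sc (Suc n) x i \<le> G (sc (Suc n) x) i" if "label (Suc n) x i = 0" "i < N" "\<forall>j<N. x j \<le> Suc n" for n x i
    using that(1) maps'(1)[OF that(2,3)] sc0[of x i n] by (simp add: label_def split: if_splits)
  have lab1: "sc (Suc n) x i \<ge> G (sc (Suc n) x) i" if "label (Suc n) x i \<noteq> 0" "i < N" "\<forall>j<N. x j \<le> Suc n" for n x i
    using that(1) maps'(2)[OF that(2,3)] sc1[of x i n] by (simp add: label_def split: if_splits)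
  define ok where "ok n q \<longleftrightarrow> (\<forall>i<N. q i < Suc n) \<and> (\<forall>i<N. \<exists>r s. (\<forall>j<N. q j \<le> r j \<and> r j \<le> q j + 1) \<and>
      (\<forall>j<N. q j \<le> s j \<and> s j \<le> q j + 1) \<and> label (Suc n) r i \<noteq> label (Suc n) s i)" for n q
  have "\<exists>q. ok n q" for n
  proof (rule kuhn_lemma[of "Suc n" N "label (Suc n)"])
    fix q assume "\<forall>i<N. q i < Suc n" "\<forall>i<N. \<exists>r s. (\<forall>j<N. q j \<le> r j \<and> r j \<le> q j + 1) \<and>
      (\<forall>j<N. q j \<le> s j \<and> s j \<le> q j + 1) \<and> label (Suc n) r i \<noteq> label (Suc n) s i"
    then have "ok n q" unfolding ok_def by (rule conjI)
    then show "\<exists>q. ok n q" by blast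
  qed (auto simp: label_def)
  then obtain q where "\<And>n. ok n (q n)" by metis
  note q' = this[unfolded ok_def]
  have q: "q n i < Suc n" if "i < N" for n i using q'[of n] that by simp
  define adm where "adm n i rs \<longleftrightarrow> (\<forall>j<N. q n j \<le> fst rs j \<and> fst rs j \<le> q n j + 1) \<and>
      (\<forall>j<N. q n j \<le> snd rs j \<and> snd rs j \<le> q n j + 1) \<and>
      label (Suc n) (fst rs) i \<noteq> label (Suc n) (snd rs) i" for n i rs
  have "\<exists>rs. i < N \<longrightarrow> adm n i rs" for n i
    using q'[of n] unfolding adm_def by fastforce
  then have "i < N \<longrightarrow> adm n i (SOME p. i < N \<longrightarrow> adm n i p)" for n i
    by (rule someI_ex)
  moreover define rs where "rs n i = (SOME p. i < N \<longrightarrow> adm n i p)" for n i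
  ultimately have "i < N \<longrightarrow> adm n i (rs n i)" for n i by simp
  then have rs': "\<And>n i. i < N \<Longrightarrow> (\<forall>j<N. q n j \<le> fst (rs n i) j \<and> fst (rs n i) j \<le> q n j + 1) \<and>
      (\<forall>j<N. q n j \<le> snd (rs n i) j \<and> snd (rs n i) j \<le> q n j + 1) \<and>
      label (Suc n) (fst (rs n i)) i \<noteq> label (Suc n) (snd (rs n i)) i"
    unfolding adm_def by simp
  define r where "r n i = fst (rs n i)" for n i
  define s where "s n i = snd (rs n i)" for n i
  have rs: "\<And>n i j. i < N \<Longrightarrow> j < N \<Longrightarrow> q n j \<le> r n i j \<and> r n i j \<le> q n j + 1"
      "\<And>n i j. i < N \<Longrightarrow> j < N \<Longrightarrow> q n j \<le> s n i j \<and> s n i j \<le> q n j + 1"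
      "\<And>n i. i < N \<Longrightarrow> label (Suc n) (r n i) i \<noteq> label (Suc n) (s n i) i"
    using rs' by (auto simp: r_def s_def)
  have bd: "norm (sc (Suc n) (q n) j) \<le> 1" if "j \<in> {..<N}" for n j
    using sc01[of "q n" j n] q[of j n] that by auto
  obtain \<sigma> where \<sigma>: "strict_mono (\<sigma>::nat\<Rightarrow>nat)"
    and "\<And>j. j \<in> {..<N} \<Longrightarrow> \<exists>l. (\<lambda>n. sc (Suc (\<sigma> n)) (q (\<sigma> n)) j) \<longlonglongrightarrow> l"
    by (rule function_convergent_subsequence[where S="{..<N}" and f="\<lambda>n. sc (Suc n) (q n)" and M=1]) (use bd in \<open>auto intro: countable_finite\<close>)
  then obtain x where x: "\<And>j. j < N \<Longrightarrow> (\<lambda>n. sc (Suc (\<sigma> n)) (q (\<sigma> n)) j) \<longlonglongrightarrow> x j"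
    by (metis lessThan_iff)
  have inv0: "(\<lambda>n. 1 / real (Suc (\<sigma> n))) \<longlonglongrightarrow> 0"
    using LIMSEQ_subseq_LIMSEQ[OF lim_1_over_n[THEN LIMSEQ_Suc] \<sigma>] by (simp add: o_def)
  have near: "(\<lambda>n. sc (Suc (\<sigma> n)) (z (\<sigma> n)) j) \<longlonglongrightarrow> x j"
    if "j < N" "\<And>n. q n j \<le> z n j \<and> z n j \<le> q n j + 1" for z j
  proof (rule Lim_transform[OF x[OF \<open>j < N\<close>]], rule Lim_null_comparison[OF _ inv0], rule always_eventually, rule allI)
    fix n
    have "real (q (\<sigma> n) j) \<le> z (\<sigma> n) j" "z (\<sigma> n) j \<le> real (q (\<sigma> n) j) + 1"
      using that(2)[of "\<sigma> n"] by linarith+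
    then show "norm (sc (Suc (\<sigma> n)) (z (\<sigma> n)) j - sc (Suc (\<sigma> n)) (q (\<sigma> n)) j) \<le> 1 / real (Suc (\<sigma> n))"
      by (simp add: sc_def divide_simps flip: diff_divide_distrib)
  qed
  have x01: "x j \<in> {0..1}" if "j < N" for j
  proof (rule closed_sequentially[OF _ _ x[OF that]])
    show "sc (Suc (\<sigma> n)) (q (\<sigma> n)) j \<in> {0..1}" for n
      by (rule sc01) (use q[OF that, of "\<sigma> n"] in simp)
  qed auto
  have "G x i = x i" if i: "i < N" for i
  proof -
    have r1: "r n i j \<le> Suc n" "s n i j \<le> Suc n" if "j < N" for n j
      using rs(1,2)[OF i that, of n] q[OF that, of n] by linarith+
    let ?R = "\<lambda>n. sc (Suc (\<sigma> n)) (r (\<sigma> n) i)" and ?S = "\<lambda>n. sc (Suc (\<sigma> n)) (s (\<sigma> n) i)"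
    have nearR: "(\<lambda>n. ?R n j) \<longlonglongrightarrow> x j" if "j < N" for j
      by (rule near[where z="\<lambda>n. r n i", OF that]) (rule rs(1)[OF i that])
    have nearS: "(\<lambda>n. ?S n j) \<longlonglongrightarrow> x j" if "j < N" for j
      by (rule near[where z="\<lambda>n. s n i", OF that]) (rule rs(2)[OF i that])
    have "(\<lambda>n. G (?R n) i) \<longlonglongrightarrow> G x i"
      by (rule cont[OF sc01 nearR i]) (use r1 in auto)
    moreover have "(\<lambda>n. G (?S n) i) \<longlonglongrightarrow> G x i"
      by (rule cont[OF sc01 nearS i]) (use r1 in auto)
    moreover note nearR[OF i] nearS[OF i]
    ultimately have lim: "(\<lambda>n. (G (?R n) i - ?R n i) * (G (?S n) i - ?S n i)) \<longlonglongrightarrow> (G x i - x i) * (G x i - x i)"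
      by (intro tendsto_intros)
    have "(G (?R n) i - ?R n i) * (G (?S n) i - ?S n i) \<le> 0" for n
    proof (cases "label (Suc (\<sigma> n)) (r (\<sigma> n) i) i = 0")
      case True
      with lab0[OF True i] lab1[of "\<sigma> n" "s (\<sigma> n) i" i] rs(3)[OF i, of "\<sigma> n"] r1 i show ?thesis
        by (intro mult_nonneg_nonpos) auto
    next
      case False
      then have "label (Suc (\<sigma> n)) (s (\<sigma> n) i) i = 0"
        using rs(3)[OF i, of "\<sigma> n"] by (auto simp: label_def split: if_splits)
      with lab1[OF False i] lab0[of "\<sigma> n" "s (\<sigma> n) i" i] r1 i show ?thesis
        by (intro mult_nonpos_nonneg) auto
    qed
    then have "(G x i - x i) * (G x i - x i) \<le> 0"
      by (intro LIMSEQ_le_const2[OF lim]) auto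
    then show ?thesis
      by (auto simp: mult_le_0_iff)
  qed
  with x01 show ?thesis by blast
qed

text \<open>
  The bound \<open>c\<close> for the differences is arbitrary, rather than a function of a distance, so that it
  can combine a Lipschitz bound in time with a modulus in space that is only known as a supremum
  over the images of an operator.
\<close>

definition modulus_class :: "'b set \<Rightarrow> real \<Rightarrow> real \<Rightarrow> ('b \<Rightarrow> 'b \<Rightarrow> real) \<Rightarrow> ('b \<Rightarrow> real) set" where
  "modulus_class X a b c = {K. \<forall>p\<in>X. a \<le> K p \<and> K p \<le> b \<and> (\<forall>q\<in>X. \<bar>K p - K q\<bar> \<le> c p q)}"

lemma modulus_class_limit:
  assumes "\<And>n. K n \<in> modulus_class X a b c" "\<And>p. p \<in> X \<Longrightarrow> (\<lambda>n. K n p) \<longlonglongrightarrow> L p"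
  shows "L \<in> modulus_class X a b c"
proof -
  have *: "a \<le> K n p" "K n p \<le> b" "\<bar>K n p - K n q\<bar> \<le> c p q" if "p \<in> X" "q \<in> X" for n p q
    using assms(1)[of n] that by (auto simp: modulus_class_def)
  have "\<bar>L p - L q\<bar> \<le> c p q" if "p \<in> X" "q \<in> X" for p q
    by (rule LIMSEQ_le_const2[where X="\<lambda>n. \<bar>K n p - K n q\<bar>"])
       (use * that in \<open>auto intro!: tendsto_intros assms(2)\<close>)
  moreover have "a \<le> L p" "L p \<le> b" if "p \<in> X" for p
    using LIMSEQ_le_const[OF assms(2)[OF that]] LIMSEQ_le_const2[OF assms(2)[OF that]] *[OF that that] by auto
  ultimately show ?thesis by (auto simp: modulus_class_def)
qed

lemma modulus_class_convex:
  assumes K: "\<And>j. j < (N::nat) \<Longrightarrow> K j \<in> modulus_class X a b c"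
    and y: "\<And>j. j < N \<Longrightarrow> 0 \<le> y j" "(\<Sum>j<N. y j) = 1"
  shows "(\<lambda>x. \<Sum>j<N. y j * K j x) \<in> modulus_class X a b c"
proof -
  have *: "a \<le> K j p" "K j p \<le> b" "\<bar>K j p - K j q\<bar> \<le> c p q" if "p \<in> X" "q \<in> X" "j < N" for j p q
    using K[of j] that by (auto simp: modulus_class_def)
  have "(\<Sum>j<N. y j * a) \<le> (\<Sum>j<N. y j * K j p)" "(\<Sum>j<N. y j * K j p) \<le> (\<Sum>j<N. y j * b)" if "p \<in> X" for p
    by (intro sum_mono mult_left_mono; use * that y in simp)+
  moreover have "\<bar>(\<Sum>j<N. y j * K j p) - (\<Sum>j<N. y j * K j q)\<bar> \<le> (\<Sum>j<N. y j * c p q)" if "p \<in> X" "q \<in> X" for p q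
    unfolding sum_subtractf[symmetric] right_diff_distrib[symmetric]
    by (rule order_trans[OF sum_abs], rule sum_mono) (use * that y in \<open>auto simp: abs_mult intro!: mult_left_mono\<close>)
  ultimately show ?thesis
    by (simp add: modulus_class_def y(2) flip: sum_distrib_right)
qed

text \<open>
  The Arzela-Ascoli argument: a diagonal sequence converges on \<open>Q\<close>, and the common modulus carries
  convergence from \<open>Q\<close> to all of \<open>X\<close>.
\<close>

lemma modulus_class_compact:
  assumes Q: "countable Q" "Q \<subseteq> X" "\<And>p e. p \<in> X \<Longrightarrow> e > 0 \<Longrightarrow> \<exists>q\<in>Q. c p q < e"
    and K: "\<And>n::nat. K n \<in> modulus_class X a b c"
  obtains \<sigma> L where "strict_mono (\<sigma>::nat\<Rightarrow>nat)" "L \<in> modulus_class X a b c"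
    "\<And>p. p \<in> X \<Longrightarrow> (\<lambda>n. K (\<sigma> n) p) \<longlonglongrightarrow> L p"
proof -
  have *: "a \<le> K n p" "K n p \<le> b" "\<bar>K n p - K n q\<bar> \<le> c p q" if "p \<in> X" "q \<in> X" for n p q
    using K[of n] that by (auto simp: modulus_class_def)
  have bd: "norm (K n p) \<le> max \<bar>a\<bar> \<bar>b\<bar>" if "p \<in> Q" for n p
    using *(1,2)[of p p n] that Q(2) by auto
  obtain \<sigma> where \<sigma>: "strict_mono (\<sigma>::nat\<Rightarrow>nat)"
    and conv: "\<And>q. q \<in> Q \<Longrightarrow> \<exists>l. (\<lambda>n. K (\<sigma> n) q) \<longlonglongrightarrow> l"
    by (rule function_convergent_subsequence[where S=Q and f=K and M="max \<bar>a\<bar> \<bar>b\<bar>"]) (use Q(1) bd in auto)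
  have "convergent (\<lambda>n. K (\<sigma> n) p)" if p: "p \<in> X" for p
  proof (rule Cauchy_convergent, rule metric_CauchyI)
    fix e :: real assume "e > 0"
    then obtain q where q: "q \<in> Q" "c p q < e / 3" using Q(3)[OF p, of "e/3"] by auto
    have "Cauchy (\<lambda>n. K (\<sigma> n) q)" using conv[OF q(1)] LIMSEQ_imp_Cauchy by blast
    then obtain M where M: "\<And>m n. m \<ge> M \<Longrightarrow> n \<ge> M \<Longrightarrow> dist (K (\<sigma> m) q) (K (\<sigma> n) q) < e / 3"
      using \<open>e > 0\<close> by (metis metric_CauchyD zero_less_divide_iff zero_less_numeral)
    have "dist (K (\<sigma> m) p) (K (\<sigma> n) p) < e" if "m \<ge> M" "n \<ge> M" for m n
    proof -
      have "q \<in> X" using q Q(2) by auto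
      then show ?thesis
        using M[OF that] *(3)[OF p, of q "\<sigma> m"] *(3)[OF p, of q "\<sigma> n"] q(2)
        unfolding dist_real_def by linarith
    qed
    then show "\<exists>M. \<forall>m\<ge>M. \<forall>n\<ge>M. dist (K (\<sigma> m) p) (K (\<sigma> n) p) < e" by blast
  qed
  then have lim: "(\<lambda>n. K (\<sigma> n) p) \<longlonglongrightarrow> lim (\<lambda>n. K (\<sigma> n) p)" if "p \<in> X" for p
    using that convergent_LIMSEQ_iff by blast
  have "(\<lambda>p. lim (\<lambda>n. K (\<sigma> n) p)) \<in> modulus_class X a b c"
    by (rule modulus_class_limit[OF K lim])
  with that \<sigma> lim show thesis by blast
qed

text \<open>
  The Schauder projection. For the pseudometric given by the values on \<open>F\<close> the class is totally
  bounded. The weights \<open>max 0 (e - d u (h j))\<close> of the points \<open>h j\<close> of a net write every \<open>u\<close> of the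
  class, up to an error of \<open>e\<close>, as a convex combination of the net, and so turn \<open>T\<close> into a
  continuous map of a cube.
\<close>

lemma modulus_class_approx_fixed_point:
  fixes T :: "('b \<Rightarrow> real) \<Rightarrow> 'b \<Rightarrow> real"
    and X :: "'b set" and a b :: real and c :: "'b \<Rightarrow> 'b \<Rightarrow> real"
  defines "C \<equiv> modulus_class X a b c"
  assumes ne: "C \<noteq> {}"
    and T: "\<And>K. K \<in> C \<Longrightarrow> T K \<in> C"
    and cont: "\<And>K L p. (\<And>n. K n \<in> C) \<Longrightarrow> L \<in> C \<Longrightarrow> (\<And>p. p \<in> X \<Longrightarrow> (\<lambda>n::nat. K n p) \<longlonglongrightarrow> L p) \<Longrightarrow> p \<in> X \<Longrightarrow>
      (\<lambda>n. T (K n) p) \<longlonglongrightarrow> T L p"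
    and F: "finite F" "F \<subseteq> X" and e: "(e::real) > 0"
  shows "\<exists>K\<in>C. \<forall>q\<in>F. \<bar>T K q - K q\<bar> \<le> e"
proof -
  define d where "d u v = (\<Sum>q\<in>F. \<bar>u q - v q\<bar>)" for u v :: "'b \<Rightarrow> real"
  define \<eta> where "\<eta> = e / (real (card F) + 1)"
  have \<eta>: "\<eta> > 0" using e by (simp add: \<eta>_def)
  (* Functions in the same cell differ by at most \<eta> at every point of F, and there are only
     finitely many cells. *)
  define cell where "cell K = restrict (\<lambda>q. \<lfloor>K q / \<eta>\<rfloor>) F" for K :: "'b \<Rightarrow> real"
  have "cell ` C \<subseteq> PiE F (\<lambda>_. {\<lfloor>a / \<eta>\<rfloor>..\<lfloor>b / \<eta>\<rfloor>})"
    using F \<eta> by (auto simp: cell_def C_def modulus_class_def subset_eq intro!: floor_mono divide_right_mono)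
  then have "finite (cell ` C)"
    using F finite_PiE[of F "\<lambda>_. {\<lfloor>a / \<eta>\<rfloor>..\<lfloor>b / \<eta>\<rfloor>}"] finite_subset by auto
  then obtain Rr where Rr: "Rr \<subseteq> C" "finite Rr" "cell ` C = cell ` Rr"
    by (meson finite_subset_image subset_refl)
  have net: "\<exists>L\<in>Rr. d u L < e" if "u \<in> C" for u
  proof -
    obtain L where L: "L \<in> Rr" "cell u = cell L" using Rr(3) \<open>u \<in> C\<close> by (metis image_eqI imageE)
    have "\<bar>u q - L q\<bar> \<le> \<eta>" if "q \<in> F" for q
    proof -
      have "\<lfloor>u q / \<eta>\<rfloor> = \<lfloor>L q / \<eta>\<rfloor>" using fun_cong[OF L(2), of q] that by (simp add: cell_def)
      then have "\<bar>u q / \<eta> - L q / \<eta>\<bar> \<le> 1" by linarith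
      then show ?thesis using \<eta> by (simp add: field_simps flip: diff_divide_distrib)
    qed
    then have "d u L \<le> real (card F) * \<eta>"
      unfolding d_def by (rule sum_bounded_above)
    also have "\<dots> < e" using e by (simp add: \<eta>_def divide_simps)
    finally show ?thesis using L by blast
  qed
  obtain h N where h: "bij_betw h {0..<(N::nat)} Rr" using ex_bij_betw_nat_finite[OF Rr(2)] by auto
  have hC: "h j \<in> C" if "j < N" for j using h that Rr(1) by (auto simp: bij_betw_def)
  have N: "0 < N"
  proof (rule ccontr)
    assume "\<not> 0 < N"
    then have "Rr = {}" using h by (auto simp: bij_betw_def)
    with ne net show False by blast
  qed
  define w where "w u j = max 0 (e - d u (h j))" for u j
  define W where "W u = (\<Sum>j<N. w u j)" for u
  have w0: "0 \<le> w u j" for u j by (simp add: w_def)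
  have W: "W u > 0" if uC: "u \<in> C" for u
  proof -
    obtain L where L: "L \<in> Rr" "d u L < e" using net[OF uC] by blast
    moreover have "Rr = h ` {0..<N}" using h by (simp add: bij_betw_def)
    ultimately obtain j where "j < N" "d u (h j) < e" by auto
    then show ?thesis unfolding W_def by (intro sum_pos2[of _ j]) (auto simp: w_def)
  qed
  (* A retraction of the cube onto the simplex of weights: y is divided by its sum if that
     exceeds 1, and otherwise the missing mass goes to the first point. *)
  define sz where "sz y = max 1 (\<Sum>j<N. y j)" for y :: "nat \<Rightarrow> real"
  define wt where "wt y j = y j / sz y + (if j = 0 then 1 - (\<Sum>j<N. y j) / sz y else 0)" for y j
  define mix where "mix y = (\<lambda>x. \<Sum>j<N. wt y j * h j x)" for y
  define G where "G y j = w (T (mix y)) j / W (T (mix y))" for y j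
  have sz: "sz y \<ge> 1" "(\<Sum>j<N. y j) \<le> sz y" for y by (auto simp: sz_def)
  have wt_sum: "(\<Sum>j<N. wt y j) = 1" for y
  proof -
    have "(\<Sum>j<N. (if j = 0 then 1 - (\<Sum>j<N. y j) / sz y else 0)) = 1 - (\<Sum>j<N. y j) / sz y"
      using N by (subst sum.delta) auto
    then show ?thesis unfolding wt_def sum.distrib by (simp flip: sum_divide_distrib)
  qed
  have wt0: "0 \<le> wt y j" if "\<And>j. j < N \<Longrightarrow> y j \<in> {0..1}" "j < N" for y j
    using sz[of y] that by (auto simp: wt_def divide_simps)
  have mixC: "mix y \<in> C" if "\<And>j. j < N \<Longrightarrow> y j \<in> {0..1}" for y
    unfolding mix_def C_def by (rule modulus_class_convex) (use hC wt0 that wt_sum in \<open>auto simp: C_def\<close>)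
  have "\<exists>x. \<forall>i<N. x i \<in> {0..1} \<and> G x i = x i"
  proof (rule brouwer_nat_cube)
    fix x :: "nat \<Rightarrow> real" and i assume x: "\<And>j. j < N \<Longrightarrow> x j \<in> {0..1}" and i: "i < N"
    have "W (T (mix x)) > 0" using W T mixC x by blast
    moreover have "w (T (mix x)) i \<le> W (T (mix x))" unfolding W_def
      by (rule member_le_sum) (use i w0 in auto)
    ultimately show "G x i \<in> {0..1}" using w0 by (auto simp: G_def)
  next
    fix y :: "nat \<Rightarrow> nat \<Rightarrow> real" and x i
    assume y: "\<And>n j. j < N \<Longrightarrow> y n j \<in> {0..1}" and lim: "\<And>j. j < N \<Longrightarrow> (\<lambda>n. y n j) \<longlonglongrightarrow> x j" and i: "i < N"
    have x: "x j \<in> {0..1}" if "j < N" for j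
      by (rule closed_sequentially[OF _ _ lim[OF that]]) (use y[OF that] in auto)
    have szl: "(\<lambda>n. sz (y n)) \<longlonglongrightarrow> sz x" unfolding sz_def by (intro tendsto_intros lim) auto
    have wtl: "(\<lambda>n. wt (y n) j) \<longlonglongrightarrow> wt x j" if "j < N" for j
      unfolding wt_def using sz(1)[of x] by (cases "j = 0") (auto intro!: tendsto_intros lim szl that N)
    have mixl: "(\<lambda>n. mix (y n) p) \<longlonglongrightarrow> mix x p" for p
      unfolding mix_def by (intro tendsto_intros wtl) auto
    have Tl: "(\<lambda>n. T (mix (y n)) p) \<longlonglongrightarrow> T (mix x) p" if "p \<in> X" for p
      by (rule cont) (use mixC y x mixl that in auto)
    have wl: "(\<lambda>n. w (T (mix (y n))) j) \<longlonglongrightarrow> w (T (mix x)) j" for j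
      unfolding w_def d_def using F(2) by (intro tendsto_intros Tl) auto
    show "(\<lambda>n. G (y n) i) \<longlonglongrightarrow> G x i"
      unfolding G_def W_def using W[OF T[OF mixC[of x]]] x
      by (intro tendsto_intros wl) (auto simp: W_def)
  qed
  then obtain y where y: "\<And>i. i < N \<Longrightarrow> y i \<in> {0..1}" "\<And>i. i < N \<Longrightarrow> G y i = y i" by blast
  let ?K = "mix y"
  have KC: "?K \<in> C" using mixC y by blast
  have WK: "W (T ?K) > 0" using W T KC by blast
  have "(\<Sum>i<N. y i) = (\<Sum>i<N. G y i)" using y(2) by simp
  also have "\<dots> = 1" using WK unfolding G_def by (simp add: W_def flip: sum_divide_distrib)
  (* The fixed point lies in the simplex, where the retraction is the identity. *)
  finally have s1: "(\<Sum>i<N. y i) = 1" .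
  then have wty: "wt y j = y j" for j by (simp add: wt_def sz_def)
  have "\<bar>T ?K q - ?K q\<bar> \<le> e" if q: "q \<in> F" for q
  proof -
    have "T ?K q - ?K q = (\<Sum>j<N. y j * (T ?K q - h j q))"
      by (simp add: mix_def wty right_diff_distrib sum_subtractf s1 flip: sum_distrib_right)
    also have "\<bar>\<dots>\<bar> \<le> (\<Sum>j<N. y j * e)"
    proof (rule order_trans[OF sum_abs], rule sum_mono)
      fix j assume "j \<in> {..<N}"
      then have j: "j < N" by simp
      show "\<bar>y j * (T ?K q - h j q)\<bar> \<le> y j * e"
      proof (cases "y j = 0")
        case False
        then have "w (T ?K) j \<noteq> 0" using y(2)[OF j] by (auto simp: G_def)
        then have "d (T ?K) (h j) < e" by (auto simp: w_def max_def split: if_splits)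
        moreover have "\<bar>T ?K q - h j q\<bar> \<le> d (T ?K) (h j)"
          unfolding d_def by (rule member_le_sum[of _ _ "\<lambda>q. \<bar>T ?K q - h j q\<bar>"]) (use q F in auto)
        ultimately show ?thesis using y(1)[OF j] by (auto simp: abs_mult intro!: mult_left_mono)
      qed simp
    qed
    also have "\<dots> = e" using s1 by (simp flip: sum_distrib_right)
    finally show ?thesis .
  qed
  with KC show ?thesis by blast
qed

text \<open>
  Solve the fixed point equation approximately on larger and larger finite parts of \<open>Q\<close>; a limit
  of the approximate solutions solves it on \<open>Q\<close>, hence on \<open>X\<close> by the common modulus.
\<close>

theorem modulus_class_fixed_point:
  fixes T :: "('b \<Rightarrow> real) \<Rightarrow> 'b \<Rightarrow> real"
    and X :: "'b set" and a b :: real and c :: "'b \<Rightarrow> 'b \<Rightarrow> real"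
  defines "C \<equiv> modulus_class X a b c"
  assumes ne: "C \<noteq> {}"
    and Q: "countable Q" "Q \<subseteq> X" "\<And>p e. p \<in> X \<Longrightarrow> e > 0 \<Longrightarrow> \<exists>q\<in>Q. c p q < e"
    and T: "\<And>K. K \<in> C \<Longrightarrow> T K \<in> C"
    and cont: "\<And>K L p. (\<And>n. K n \<in> C) \<Longrightarrow> L \<in> C \<Longrightarrow> (\<And>p. p \<in> X \<Longrightarrow> (\<lambda>n::nat. K n p) \<longlonglongrightarrow> L p) \<Longrightarrow> p \<in> X \<Longrightarrow>
      (\<lambda>n. T (K n) p) \<longlonglongrightarrow> T L p"
  shows "\<exists>K\<in>C. \<forall>p\<in>X. T K p = K p"
proof (cases "Q = {}")
  case True
  then have "X = {}" using Q(3)[of _ 1] by auto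
  with ne show ?thesis by auto
next
  case False
  define F where "F n = from_nat_into Q ` {..n::nat}" for n
  have F: "finite (F n)" "F n \<subseteq> X" for n
    using from_nat_into[OF False] Q(2) by (auto simp: F_def)
  have "\<exists>K\<in>C. \<forall>q\<in>F n. \<bar>T K q - K q\<bar> \<le> 1 / real (Suc n)" for n
    unfolding C_def
    by (rule modulus_class_approx_fixed_point) (use ne T cont F in \<open>auto simp: C_def\<close>)
  then have "\<forall>n. \<exists>K. K \<in> C \<and> (\<forall>q\<in>F n. \<bar>T K q - K q\<bar> \<le> 1 / real (Suc n))" by blast
  from choice[OF this] obtain K where
    "\<forall>n. K n \<in> C \<and> (\<forall>q\<in>F n. \<bar>T (K n) q - K n q\<bar> \<le> 1 / real (Suc n))" ..
  then have K: "\<And>n. K n \<in> C" "\<And>n q. q \<in> F n \<Longrightarrow> \<bar>T (K n) q - K n q\<bar> \<le> 1 / real (Suc n)"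
    by simp_all
  have K1: "K n \<in> modulus_class X a b c" for n using K(1) by (simp add: C_def)
  obtain \<sigma> L where \<sigma>: "strict_mono (\<sigma>::nat\<Rightarrow>nat)" and L: "L \<in> C"
    and lim: "\<And>p. p \<in> X \<Longrightarrow> (\<lambda>n. K (\<sigma> n) p) \<longlonglongrightarrow> L p"
  proof (rule modulus_class_compact[where K=K and a=a and b=b, OF Q K1])
    fix \<sigma> L assume "strict_mono (\<sigma>::nat\<Rightarrow>nat)" "L \<in> modulus_class X a b c"
      "\<And>p. p \<in> X \<Longrightarrow> (\<lambda>n. K (\<sigma> n) p) \<longlonglongrightarrow> L p"
    then show thesis by (intro that) (auto simp: C_def)
  qed
  have Tlim: "(\<lambda>n. T (K (\<sigma> n)) p) \<longlonglongrightarrow> T L p" if "p \<in> X" for p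
    by (rule cont) (use K(1) L lim that in auto)
  have eqQ: "T L q = L q" if qQ: "q \<in> Q" for q
  proof -
    have qX: "q \<in> X" using that Q by auto
    obtain m where m: "q = from_nat_into Q m" using from_nat_into_surj[OF Q(1) qQ] by (metis (no_types))
    have "(\<lambda>n. T (K (\<sigma> n)) q - K (\<sigma> n) q) \<longlonglongrightarrow> 0"
    proof (rule Lim_null_comparison)
      show "(\<lambda>n. 1 / real (Suc (\<sigma> n))) \<longlonglongrightarrow> 0"
        using LIMSEQ_subseq_LIMSEQ[OF lim_1_over_n[THEN LIMSEQ_Suc] \<sigma>] by (simp add: o_def)
      have "q \<in> F (\<sigma> n)" if "n \<ge> m" for n
        using seq_suble[OF \<sigma>, of n] that m by (auto simp: F_def)
      then show "\<forall>\<^sub>F n in sequentially. norm (T (K (\<sigma> n)) q - K (\<sigma> n) q) \<le> 1 / real (Suc (\<sigma> n))"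
        using K(2) by (auto simp: eventually_sequentially intro!: exI[of _ m])
    qed
    then have "T L q - L q = 0"
      using LIMSEQ_unique[OF _ tendsto_diff[OF Tlim[OF qX] lim[OF qX]]] by auto
    then show ?thesis by simp
  qed
  have "T L p = L p" if p: "p \<in> X" for p
  proof -
    have "\<bar>T L p - L p\<bar> \<le> e" if "e > 0" for e
    proof -
      obtain q where q: "q \<in> Q" "c p q < e/2" using Q(3)[OF p, of "e/2"] \<open>e > 0\<close> by auto
      have "\<bar>T L p - T L q\<bar> \<le> c p q" "\<bar>L p - L q\<bar> \<le> c p q"
        using T[OF L] L p q Q(2) by (auto simp: C_def modulus_class_def)
      then show ?thesis using eqQ[OF q(1)] q(2) by linarith
    qed
    then show ?thesis using field_le_epsilon[of "\<bar>T L p - L p\<bar>" 0] by force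
  qed
  with L show ?thesis by blast
qed

section \<open>Locally finite signed measures on the half line\<close>

lemma bounded_borel_subset:
  assumes "B \<in> bounded_borel" "A \<in> sets borel" "A \<subseteq> B"
  shows "A \<in> bounded_borel"
  using assms bounded_subset by (auto simp: bounded_borel_def)

lemma bounded_borel_Icc: "0 \<le> s \<Longrightarrow> {s..t} \<in> bounded_borel"
  and bounded_borel_Ioc: "0 \<le> s \<Longrightarrow> {s<..t} \<in> bounded_borel"
  by (auto simp: bounded_borel_def bounded_subset[OF bounded_cbox[of s t]] intro: bounded_subset[OF bounded_closed_interval[of s t]])

lemma bounded_borel_ex_bound:
  assumes "B \<in> bounded_borel"
  obtains T where "T \<ge> 0" "B \<subseteq> {0..T}"
proof -
  obtain b where "\<And>x. x \<in> B \<Longrightarrow> norm x \<le> b" using assms by (auto simp: bounded_borel_def bounded_iff)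
  then have "B \<subseteq> {0..max 0 b}" using assms by (force simp: bounded_borel_def)
  then show thesis by (intro that[of "max 0 b"]) auto
qed

lemma bounded_borel_sets: "B \<in> bounded_borel \<Longrightarrow> B \<in> sets borel"
  by (simp add: bounded_borel_def)

lemma Mloc_sums:
  assumes "\<mu> \<in> Mloc" "\<And>n. A n \<in> sets borel" "disjoint_family A" "(\<Union>n::nat. A n) \<in> bounded_borel"
  shows "(\<lambda>n. \<mu> (A n)) sums \<mu> (\<Union>n. A n)"
proof -
  have "range A \<subseteq> bounded_borel" using bounded_borel_subset[OF assms(4) assms(2)] by auto
  then show ?thesis using assms by (auto simp: Mloc_def)
qed

lemma Mloc_empty:
  assumes "\<mu> \<in> Mloc" shows "\<mu> {} = 0"
proof -
  have "(\<lambda>n::nat. \<mu> {}) sums \<mu> (\<Union>n::nat. {})"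
    by (rule Mloc_sums[OF assms]) (auto simp: disjoint_family_on_def bounded_borel_def)
  then have "summable (\<lambda>n::nat. \<mu> {})" by (rule sums_summable)
  then show ?thesis by (simp add: summable_const_iff)
qed

lemma Mloc_Un:
  assumes "\<mu> \<in> Mloc" "A \<union> B \<in> bounded_borel" "A \<in> sets borel" "B \<in> sets borel" "A \<inter> B = {}"
  shows "\<mu> (A \<union> B) = \<mu> A + \<mu> B"
proof -
  have "(\<lambda>n. \<mu> (binaryset A B n)) sums \<mu> (\<Union>n. binaryset A B n)"
    by (rule Mloc_sums)
       (use assms in \<open>auto simp: disjoint_family_on_def binaryset_def UN_binaryset_eq\<close>)
  moreover have "(\<lambda>n. \<mu> (binaryset A B n)) sums (\<mu> A + \<mu> B)"
    by (rule binaryset_sums[of \<mu>]) (rule Mloc_empty[OF assms(1)])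
  ultimately show ?thesis using sums_unique2 by (metis UN_binaryset_eq)
qed

lemma Mloc_Icc_diff:
  assumes "\<mu> \<in> Mloc" "0 \<le> s" "s \<le> t"
  shows "\<mu> {0..t} = \<mu> {0..s} + \<mu> {s<..t}"
proof -
  have "{0..t} = {0..s} \<union> {s<..t}" using assms by auto
  then show ?thesis
    using Mloc_Un[OF assms(1), of "{0..s}" "{s<..t}"] bounded_borel_Icc[of 0 t] assms
    by (simp add: ivl_disj_int)
qed

text \<open>
  Countable additivity over the intervals \<open>(t(n+1), t(n)]\<close>, whose sum telescopes.
\<close>

lemma Mloc_Icc_right_limit:
  assumes "\<mu> \<in> Mloc" "decseq t" "t \<longlonglongrightarrow> s" "0 \<le> s"
  shows "(\<lambda>n. \<mu> {0..t n}) \<longlonglongrightarrow> \<mu> {0..s}"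
proof -
  have ts: "s \<le> t n" for n using decseq_ge[OF assms(2,3)] .
  have dec: "t n \<le> t m" if "m \<le> n" for m n using assms(2) that by (rule decseqD)
  let ?A = "\<lambda>n. {t (Suc n)<..t n}"
  have disj: "disjoint_family ?A"
    unfolding disjoint_family_on_def
  proof (intro ballI impI)
    fix m n :: nat assume "m \<noteq> n"
    then consider "Suc m \<le> n" | "Suc n \<le> m" by linarith
    then show "?A m \<inter> ?A n = {}" by cases (use dec in \<open>fastforce+\<close>)
  qed
  have un: "(\<Union>n. ?A n) = {s<..t 0}"
  proof (intro equalityI subsetI)
    fix x assume "x \<in> (\<Union>n. ?A n)"
    then obtain n where "t (Suc n) < x" "x \<le> t n" by auto
    then show "x \<in> {s<..t 0}" using ts[of "Suc n"] dec[of 0 n] by auto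
  next
    fix x assume x: "x \<in> {s<..t 0}"
    then have "\<exists>n. t n < x" using order_tendstoD(2)[OF assms(3), of x] by (auto simp: eventually_sequentially)
    then obtain n where n: "t n < x" "\<And>m. m < n \<Longrightarrow> \<not> t m < x" using exists_least_iff[of "\<lambda>n. t n < x"] by blast
    then obtain m where "n = Suc m" using x by (cases n) auto
    then have "\<not> t m < x" "t (Suc m) < x" using n by simp_all
    then have "x \<in> ?A m" by simp
    then show "x \<in> (\<Union>n. ?A n)" by blast
  qed
  have "(\<lambda>n. \<mu> (?A n)) sums \<mu> {s<..t 0}"
    using Mloc_sums[OF assms(1) _ disj] bounded_borel_Ioc[OF assms(4)] unfolding un by auto
  moreover have "\<mu> (?A n) = \<mu> {0..t n} - \<mu> {0..t (Suc n)}" for n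
    using Mloc_Icc_diff[OF assms(1), of "t (Suc n)" "t n"] ts[of "Suc n"] assms(4) dec[of n "Suc n"] by auto
  ultimately have "(\<lambda>N. \<Sum>n<N. \<mu> {0..t n} - \<mu> {0..t (Suc n)}) \<longlonglongrightarrow> \<mu> {s<..t 0}"
    by (simp add: sums_def)
  then have "(\<lambda>N. \<mu> {0..t 0} - \<mu> {0..t N}) \<longlonglongrightarrow> \<mu> {s<..t 0}"
    by (simp add: sum_lessThan_telescope'[of "\<lambda>n. \<mu> {0..t n}"])
  then have "(\<lambda>N. \<mu> {0..t 0} - (\<mu> {0..t 0} - \<mu> {0..t N})) \<longlonglongrightarrow> \<mu> {0..t 0} - \<mu> {s<..t 0}"
    by (intro tendsto_intros)
  then show ?thesis using Mloc_Icc_diff[OF assms(1), of s "t 0"] ts[of 0] assms(4) by auto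
qed

lemma Mloc_Icc_left_convergent:
  assumes "\<mu> \<in> Mloc" "incseq t" "\<And>n. 0 \<le> t n" "\<And>n. t n \<le> T"
  shows "convergent (\<lambda>n. \<mu> {0..t n})"
proof -
  have inc: "t m \<le> t n" if "m \<le> n" for m n using assms(2) that by (rule incseqD)
  let ?A = "\<lambda>n. {t n<..t (Suc n)}"
  have disj: "disjoint_family ?A"
    unfolding disjoint_family_on_def
  proof (intro ballI impI)
    fix m n :: nat assume "m \<noteq> n"
    then consider "Suc m \<le> n" | "Suc n \<le> m" by linarith
    then show "?A m \<inter> ?A n = {}" by cases (use inc in \<open>fastforce+\<close>)
  qed
  have "(\<Union>n. ?A n) \<in> bounded_borel"
  proof (rule bounded_borel_subset[OF bounded_borel_Icc[of 0 T]])
    show "(\<Union>n. ?A n) \<subseteq> {0..T}"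
    proof
      fix x assume "x \<in> (\<Union>n. ?A n)"
      then obtain n where "t n < x" "x \<le> t (Suc n)" by auto
      then show "x \<in> {0..T}" using assms(3)[of n] assms(4)[of "Suc n"] by auto
    qed
  qed auto
  then have "(\<lambda>n. \<mu> (?A n)) sums \<mu> (\<Union>n. ?A n)"
    using Mloc_sums[OF assms(1) _ disj] by auto
  moreover have "\<mu> (?A n) = \<mu> {0..t (Suc n)} - \<mu> {0..t n}" for n
    using Mloc_Icc_diff[OF assms(1), of "t n" "t (Suc n)"] assms(3)[of n] inc[of n "Suc n"] by auto
  ultimately have "(\<lambda>N. \<Sum>n<N. \<mu> {0..t (Suc n)} - \<mu> {0..t n}) \<longlonglongrightarrow> \<mu> (\<Union>n. ?A n)"
    by (simp add: sums_def)
  then have "(\<lambda>N. \<mu> {0..t N} - \<mu> {0..t 0}) \<longlonglongrightarrow> \<mu> (\<Union>n. ?A n)"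
    by (simp add: sum_lessThan_telescope[of "\<lambda>n. \<mu> {0..t n}"])
  then have "(\<lambda>N. \<mu> {0..t N} - \<mu> {0..t 0} + \<mu> {0..t 0}) \<longlonglongrightarrow> \<mu> (\<Union>n. ?A n) + \<mu> {0..t 0}"
    by (intro tendsto_intros)
  then show ?thesis by (auto simp: convergent_def)
qed

text \<open>
  Along a monotone sequence of end points the values converge, and every sequence has a monotone
  subsequence.
\<close>

lemma Mloc_Icc_bounded:
  assumes "\<mu> \<in> Mloc"
  shows "\<exists>B. \<forall>t\<in>{0..T}. \<bar>\<mu> {0..t}\<bar> \<le> B"
proof (rule ccontr)
  assume "\<not> ?thesis"
  then have "\<forall>n. \<exists>t. t \<in> {0..T} \<and> \<bar>\<mu> {0..t}\<bar> > real n" by (meson not_le)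
  from choice[OF this] obtain t where t: "\<And>n. t n \<in> {0..T}" "\<And>n. \<bar>\<mu> {0..t n}\<bar> > real n" by blast
  obtain \<phi> where \<phi>: "strict_mono \<phi>" "monoseq (\<lambda>n. t (\<phi> n))" using seq_monosub[of t] by auto
  have "convergent (\<lambda>n. \<mu> {0..t (\<phi> n)})"
    using \<phi>(2) unfolding monoseq_iff
  proof
    assume "incseq (\<lambda>n. t (\<phi> n))"
    then show ?thesis by (rule Mloc_Icc_left_convergent[OF assms, where T=T]) (use t(1) in auto)
  next
    assume d: "decseq (\<lambda>n. t (\<phi> n))"
    obtain s where s: "(\<lambda>n. t (\<phi> n)) \<longlonglongrightarrow> s"
      by (rule decseq_convergent[OF d, of 0]) (use t(1) in auto)
    have "0 \<le> s" by (rule LIMSEQ_le_const[OF s]) (use t(1) in auto)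
    from Mloc_Icc_right_limit[OF assms d s this] show ?thesis by (auto simp: convergent_def)
  qed
  then have "Bseq (\<lambda>n. \<mu> {0..t (\<phi> n)})" by (rule convergent_imp_Bseq)
  then obtain B where B: "\<And>n. \<bar>\<mu> {0..t (\<phi> n)}\<bar> \<le> B" by (auto simp: Bseq_def)
  obtain n where "B < real n" using reals_Archimedean2 by blast
  moreover have "real n \<le> real (\<phi> n)" using seq_suble[OF \<phi>(1), of n] by simp
  ultimately show False using B[of n] t(2)[of "\<phi> n"] by linarith
qed

text \<open>
  By continuity from the right, \<open>t\<close> may be replaced by the next dyadic number of order \<open>n\<close>; this
  gives step functions that converge to \<open>\<mu>([0,t])\<close>.
\<close>

lemma Mloc_Icc_measurable:
  assumes "\<mu> \<in> Mloc"
  shows "(\<lambda>t. \<mu> {0..t}) \<in> borel_measurable borel"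
proof -
  define d where "d n t = (real_of_int \<lfloor>2 ^ n * t\<rfloor> + 1) / 2 ^ n" for n :: nat and t :: real
  have d1: "t \<le> d n t" "d n t \<le> t + 1 / 2 ^ n" for n t
    unfolding d_def by (simp_all add: field_simps) linarith+
  have "\<lfloor>2 ^ Suc n * t\<rfloor> \<le> 2 * \<lfloor>2 ^ n * t\<rfloor> + 1" for n and t :: real
  proof -
    have "2 ^ n * t < \<lfloor>2 ^ n * t\<rfloor> + 1" by linarith
    then have "2 * (2 ^ n * t) < 2 * real_of_int \<lfloor>2 ^ n * t\<rfloor> + 2" by linarith
    then have "2 ^ Suc n * t < real_of_int (2 * \<lfloor>2 ^ n * t\<rfloor> + 2)" by simp
    then show ?thesis by (subst floor_le_iff) simp
  qed
  then have fl: "real_of_int \<lfloor>2 ^ Suc n * t\<rfloor> \<le> real_of_int (2 * \<lfloor>2 ^ n * t\<rfloor> + 1)" for n and t :: real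
    using of_int_le_iff by blast
  have dec: "decseq (\<lambda>n. d n t)" for t
  proof (rule decseq_SucI)
    fix n
    have "d (Suc n) t \<le> (2 * (real_of_int \<lfloor>2 ^ n * t\<rfloor> + 1)) / 2 ^ Suc n"
      unfolding d_def by (rule divide_right_mono) (use fl[of n t] in \<open>auto simp del: power_Suc\<close>)
    also have "\<dots> = d n t" unfolding d_def power_Suc by (rule mult_divide_mult_cancel_left) simp
    finally show "d (Suc n) t \<le> d n t" .
  qed
  have "(\<lambda>n. d n t) \<longlonglongrightarrow> t" for t
  proof (rule real_tendsto_sandwich[of "\<lambda>_. t" _ _ "\<lambda>n. t + (1/2) ^ n"])
    have "(\<lambda>n. t + (1/2) ^ n) \<longlonglongrightarrow> t + 0" by (intro tendsto_intros) auto
    then show "(\<lambda>n. t + (1/2) ^ n) \<longlonglongrightarrow> t" by simp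
  qed (use d1 in \<open>auto simp: power_one_over\<close>)
  then have lim: "(\<lambda>n. \<mu> {0..d n t}) \<longlonglongrightarrow> \<mu> {0..t}" if "0 \<le> t" for t
    using Mloc_Icc_right_limit[OF assms dec _ that] by blast
  have "(\<lambda>t. indicator {0..} t * \<mu> {0..t}) \<in> borel_measurable borel"
  proof (rule borel_measurable_LIMSEQ_real)
    show "(\<lambda>n. indicator {0..} t * \<mu> {0..d n t}) \<longlonglongrightarrow> indicator {0..} t * \<mu> {0..t}" for t :: real
      using lim[of t] by (cases "0 \<le> t") auto
    fix n
    have "(\<lambda>t::real. \<lfloor>2 ^ n * t\<rfloor>) \<in> borel \<rightarrow>\<^sub>M count_space UNIV" by measurable
    then have "(\<lambda>t. \<mu> {0..(real_of_int \<lfloor>(2::real) ^ n * t\<rfloor> + 1) / 2 ^ n}) \<in> borel_measurable borel"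
      by (rule measurable_compose[where g="\<lambda>i. \<mu> {0..(real_of_int i + 1) / 2 ^ n}"]) auto
    then show "(\<lambda>t. indicator {0..} t * \<mu> {0..d n t}) \<in> borel_measurable borel"
      unfolding d_def by measurable
  qed
  moreover have "indicator {0..} t * \<mu> {0..t} = \<mu> {0..t}" for t :: real
    using Mloc_empty[OF assms] by (auto simp: indicator_def)
  ultimately show ?thesis by simp
qed

lemma set_integral_in_Mloc:
  fixes h :: "real \<Rightarrow> real"
  assumes "\<And>B. B \<in> bounded_borel \<Longrightarrow> set_integrable lborel B h"
  shows "(\<lambda>B. LINT t:B|lborel. h t) \<in> Mloc"
  unfolding Mloc_def
proof (intro CollectI allI impI, elim conjE)
  fix A :: "nat \<Rightarrow> real set"
  assume A: "range A \<subseteq> bounded_borel" "disjoint_family A" "(\<Union>n. A n) \<in> bounded_borel"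
  have An: "A n \<in> sets lborel" "set_integrable lborel (A n) h" for n
    using A(1) assms[of "A n"] bounded_borel_sets[of "A n"] by auto
  have U: "set_integrable lborel (\<Union>n. A n) h" using assms A(3) .
  have "(\<lambda>n. LINT t:(\<Union>i<n. A i)|lborel. h t) \<longlonglongrightarrow> (LINT t:(\<Union>n. \<Union>i<n. A i)|lborel. h t)"
  proof (rule set_integral_cont_up)
    show "incseq (\<lambda>n. \<Union>i<n. A i)" by (auto simp: incseq_def intro: order_less_le_trans)
    have "(\<Union>n. \<Union>i<n. A i) = (\<Union>n. A n)" by auto
    then show "set_integrable lborel (\<Union>n. \<Union>i<n. A i) h" using U by simp
  qed (use An in auto)
  moreover have "(\<Union>n. \<Union>i<n. A i) = (\<Union>n. A n)" by auto
  moreover have "(LINT t:(\<Union>i<n. A i)|lborel. h t) = (\<Sum>i<n. LINT t:A i|lborel. h t)" for n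
    by (rule set_integral_finite_Union) (use An A(2) in \<open>auto simp: disjoint_family_on_def\<close>)
  ultimately show "(\<lambda>n. LINT t:A n|lborel. h t) sums (LINT t:(\<Union>n. A n)|lborel. h t)"
    by (simp add: sums_def)
qed

section \<open>The absolutely continuous part\<close>

lemma Mloc_Diff:
  assumes "\<mu> \<in> Mloc" "B \<in> bounded_borel" "A \<in> sets borel"
  shows "\<mu> B = \<mu> (B - A) + \<mu> (B \<inter> A)"
proof -
  have eq: "(B - A) \<union> (B \<inter> A) = B" by auto
  have "\<mu> ((B - A) \<union> (B \<inter> A)) = \<mu> (B - A) + \<mu> (B \<inter> A)"
    by (rule Mloc_Un[OF assms(1)]) (use assms(2,3) eq in \<open>auto simp: bounded_borel_sets\<close>)
  then show ?thesis unfolding eq .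
qed

locale positive_Mloc =
  fixes c :: "real set \<Rightarrow> real"
  assumes Mloc: "c \<in> Mloc" and nonneg: "B \<in> bounded_borel \<Longrightarrow> 0 \<le> c B"
begin

lemma mono:
  assumes "B \<in> bounded_borel" "A \<in> sets borel" "A \<subseteq> B"
  shows "c A \<le> c B"
proof -
  have "c B = c (B - A) + c (B \<inter> A)" by (rule Mloc_Diff[OF Mloc assms(1,2)])
  moreover have "B \<inter> A = A" using assms(3) by auto
  moreover have "B - A \<in> bounded_borel"
    using bounded_borel_subset[OF assms(1)] bounded_borel_sets[OF assms(1)] assms(2) by auto
  ultimately show ?thesis using nonneg by fastforce
qed

text \<open>
  Exhaustion: in each \<open>[0,n]\<close> choose Lebesgue-null sets whose \<open>c\<close>-values approach the supremum over
  all null subsets of \<open>[0,n]\<close>, and let \<open>N\<close> be their union. A null set disjoint from \<open>N\<close> with positive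
  value could be added to them and would exceed the supremum.
\<close>

lemma carrier_of_singular_part:
  obtains N where "N \<in> null_sets lborel"
    "\<And>B. B \<in> bounded_borel \<Longrightarrow> B \<in> null_sets lborel \<Longrightarrow> B \<inter> N = {} \<Longrightarrow> c B = 0"
proof -
  define \<N> where "\<N> n = {B \<in> null_sets lborel. B \<subseteq> {0..real n}}" for n
  have bdN: "B \<in> bounded_borel" if "B \<in> \<N> n" for B n
    by (rule bounded_borel_subset[OF bounded_borel_Icc[of 0 "real n"]]) (use that in \<open>auto simp: \<N>_def\<close>)
  have bdd: "bdd_above (c ` \<N> n)" for n
    by (rule bdd_aboveI2[where M="c {0..real n}"], rule mono)
       (auto simp: \<N>_def bounded_borel_Icc)
  have ne: "c ` \<N> n \<noteq> {}" for n by (auto simp: \<N>_def intro!: exI[of _ "{}"])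
  have "\<exists>B. B \<in> \<N> n \<and> Sup (c ` \<N> n) - 1 / real (Suc j) < c B" for n j
  proof -
    have "Sup (c ` \<N> n) - 1 / real (Suc j) < Sup (c ` \<N> n)" by simp
    from less_cSupD[OF ne this] show ?thesis by blast
  qed
  then have ex: "(SOME B. B \<in> \<N> n \<and> Sup (c ` \<N> n) - 1 / real (Suc j) < c B) \<in> \<N> n \<and>
    Sup (c ` \<N> n) - 1 / real (Suc j) < c (SOME B. B \<in> \<N> n \<and> Sup (c ` \<N> n) - 1 / real (Suc j) < c B)" for n j
    by (rule someI_ex)
  define E where "E n j = (SOME B. B \<in> \<N> n \<and> Sup (c ` \<N> n) - 1 / real (Suc j) < c B)" for n j
  have E: "E n j \<in> \<N> n" "Sup (c ` \<N> n) - 1 / real (Suc j) < c (E n j)" for n j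
    using ex[of n j] by (auto simp: E_def)
  define N where "N = (\<Union>n. \<Union>j. E n j)"
  have N: "N \<in> null_sets lborel"
    unfolding N_def using E(1) by (intro null_sets_UN) (auto simp: \<N>_def)
  have "c B = 0" if B: "B \<in> bounded_borel" "B \<in> null_sets lborel" "B \<inter> N = {}" for B
  proof -
    obtain T where T: "T \<ge> 0" "B \<subseteq> {0..T}" using bounded_borel_ex_bound[OF B(1)] .
    obtain n where n: "T \<le> real n" using real_arch_simple by blast
    have "c B \<le> 1 / real (Suc j)" for j
    proof -
      have "B \<union> E n j \<in> \<N> n" using E(1)[of n j] B(2) T n by (auto simp: \<N>_def)
      then have "c (B \<union> E n j) \<le> Sup (c ` \<N> n)" using bdd by (intro cSup_upper) auto
      moreover have "c (B \<union> E n j) = c B + c (E n j)"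
      proof (rule Mloc_Un[OF Mloc bdN])
        show "B \<union> E n j \<in> \<N> n" by fact
        show "B \<inter> E n j = {}" using B(3) by (auto simp: N_def)
      qed (use B(1) bdN[OF E(1)] in \<open>auto intro: bounded_borel_sets\<close>)
      ultimately show ?thesis using E(2)[of n j] by linarith
    qed
    then have "c B \<le> 0" using LIMSEQ_le_const[OF lim_1_over_n[THEN LIMSEQ_Suc]] by blast
    then show ?thesis using nonneg[OF B(1)] by linarith
  qed
  with N show thesis by (rule that)
qed

lemma sums_unit_intervals:
  assumes "B \<in> bounded_borel"
  shows "(\<lambda>n. c (B \<inter> {real n..<real (Suc n)})) sums c B"
proof -
  have un: "(\<Union>n. B \<inter> {real n..<real (Suc n)}) = B"
  proof (intro equalityI subsetI)
    fix x assume "x \<in> B"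
    moreover from this assms have "0 \<le> x" by (auto simp: bounded_borel_def)
    then have "x \<in> {real (nat \<lfloor>x\<rfloor>)..<real (Suc (nat \<lfloor>x\<rfloor>))}" by simp linarith
    ultimately show "x \<in> (\<Union>n. B \<inter> {real n..<real (Suc n)})" by blast
  qed auto
  have "disjoint_family (\<lambda>n. B \<inter> {real n..<real (Suc n)})"
    unfolding disjoint_family_on_def
  proof (intro ballI impI)
    fix m n :: nat assume "m \<noteq> n"
    then consider "real (Suc m) \<le> real n" | "real (Suc n) \<le> real m" by linarith
    then show "B \<inter> {real m..<real (Suc m)} \<inter> (B \<inter> {real n..<real (Suc n)}) = {}" by cases auto
  qed
  then show ?thesis
    using Mloc_sums[OF Mloc, of "\<lambda>n. B \<inter> {real n..<real (Suc n)}"] un assms bounded_borel_sets by auto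
qed

text \<open>
  Off the carrier of the singular part, \<open>c\<close> is absolutely continuous, and Radon-Nikodym applies.
  Since \<open>c\<close> is given on bounded sets only, it is first extended to a measure on all Borel sets by
  summing over unit intervals.
\<close>

lemma Lebesgue_decomposition:
  obtains g where "g \<in> borel_measurable borel" "\<And>t. 0 \<le> g t" "is_ac_density c g"
proof -
  obtain N where N: "N \<in> null_sets lborel"
    and cN: "\<And>B. B \<in> bounded_borel \<Longrightarrow> B \<in> null_sets lborel \<Longrightarrow> B \<inter> N = {} \<Longrightarrow> c B = 0"
    by (rule carrier_of_singular_part) blast
  have Nb: "N \<in> sets borel" using N by auto
  (* Nonnegativity of c makes the order of summation irrelevant. *)
  define m where "m B = (\<Sum>n. ennreal (c ((B - N) \<inter> {real n..<real (Suc n)})))" for B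
  define \<nu> where "\<nu> = measure_of UNIV (sets borel) m"
  have piece: "(B - N) \<inter> {real n..<real (Suc n)} \<inter> {0..} \<in> bounded_borel" if "B \<in> sets borel" for B n
    by (rule bounded_borel_subset[OF bounded_borel_Icc[of 0 "real (Suc n)"]]) (use that Nb in auto)
  then have piece: "(B - N) \<inter> {real n..<real (Suc n)} \<in> bounded_borel" if "B \<in> sets borel" for B n
  proof -
    have "(B - N) \<inter> {real n..<real (Suc n)} \<inter> {0..} = (B - N) \<inter> {real n..<real (Suc n)}" by auto
    then show ?thesis using piece[OF that, of n] by simp
  qed
  have em: "emeasure \<nu> B = m B" if "B \<in> sets borel" for B
    unfolding \<nu>_def
  proof (rule emeasure_measure_of_sigma)
    show "sigma_algebra UNIV (sets (borel :: real measure))" using sets.sigma_algebra_axioms[of borel] by simp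
    show "positive (sets borel) m" using Mloc_empty[OF Mloc] by (simp add: positive_def m_def)
    show "countably_additive (sets borel) m"
    proof (rule countably_additiveI)
      fix A :: "nat \<Rightarrow> real set"
      assume A: "range A \<subseteq> sets borel" "disjoint_family A" "\<Union> (range A) \<in> sets borel"
      let ?p = "\<lambda>B n. (B - N) \<inter> {real n..<real (Suc n)}"
      have "(\<Sum>i. ennreal (c (?p (A i) n))) = ennreal (c (?p (\<Union> (range A)) n))" for n
      proof (rule sums_unique[symmetric], subst sums_ennreal)
        show "0 \<le> c (?p (A i) n)" for i using piece A(1) by (auto intro!: nonneg)
        show "0 \<le> c (?p (\<Union> (range A)) n)" using piece A(3) by (auto intro!: nonneg)
        have eq: "(\<Union>i. ?p (A i) n) = ?p (\<Union> (range A)) n" by auto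
        have "(\<lambda>i. c (?p (A i) n)) sums c (\<Union>i. ?p (A i) n)"
        proof (rule Mloc_sums[OF Mloc])
          show "(\<Union>i. ?p (A i) n) \<in> bounded_borel" unfolding eq by (rule piece[OF A(3)])
          show "disjoint_family (\<lambda>i. ?p (A i) n)" using A(2) by (auto simp: disjoint_family_on_def)
        qed (use piece A(1) in \<open>auto intro!: bounded_borel_sets\<close>)
        then show "(\<lambda>i. c (?p (A i) n)) sums c (?p (\<Union> (range A)) n)" unfolding eq .
      qed
      then have "m (\<Union> (range A)) = (\<Sum>n. \<Sum>i. ennreal (c (?p (A i) n)))" by (simp add: m_def)
      also have "\<dots> = (\<Sum>i. \<Sum>n. ennreal (c (?p (A i) n)))"
      proof -
        define u where "u i n = ennreal (c (?p (A i) n))" for i n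
        have "(\<Sum>n. \<Sum>i. u i n) = (\<integral>\<^sup>+n. (\<Sum>i. u i n) \<partial>count_space UNIV)"
          by (simp add: nn_integral_count_space_nat)
        also have "\<dots> = (\<Sum>i. \<integral>\<^sup>+n. u i n \<partial>count_space UNIV)" by (rule nn_integral_suminf) simp
        also have "\<dots> = (\<Sum>i. \<Sum>n. u i n)" by (simp add: nn_integral_count_space_nat)
        finally show ?thesis by (simp add: u_def)
      qed
      finally show "(\<Sum>i. m (A i)) = m (\<Union> (range A))" by (simp add: m_def)
    qed
  qed (use that in auto)
  have sets_\<nu>: "sets \<nu> = sets lborel" using sets.sigma_sets_eq[of borel] by (simp add: \<nu>_def)
  have "absolutely_continuous lborel \<nu>"
    unfolding absolutely_continuous_def
  proof
    fix B :: "real set" assume B: "B \<in> null_sets lborel"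
    then have Bb: "B \<in> sets borel" by auto
    have "c ((B - N) \<inter> {real n..<real (Suc n)}) = 0" for n
    proof (rule cN[OF piece[OF Bb]])
      show "(B - N) \<inter> {real n..<real (Suc n)} \<in> null_sets lborel"
        by (rule null_sets_subset[OF B]) (use Bb Nb in auto)
    qed auto
    then have "emeasure \<nu> B = 0" using em[OF Bb] by (simp add: m_def)
    then show "B \<in> null_sets \<nu>" using Bb sets_\<nu> by auto
  qed
  from sigma_finite_measure.Radon_Nikodym[OF sigma_finite_lborel this sets_\<nu>] obtain h where
    h: "h \<in> borel_measurable lborel" "density lborel h = \<nu>" by blast
  define g where "g t = enn2real (h t)" for t
  have g: "g \<in> borel_measurable borel" using h(1) unfolding g_def by measurable
  have "set_integrable lborel B g \<and> c B = (LINT t:B|lborel. g t) + c (B \<inter> N)" if B: "B \<in> bounded_borel" for B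
  proof -
    have Bb: "B \<in> sets borel" using B by (rule bounded_borel_sets)
    have BN: "B - N \<in> bounded_borel" using bounded_borel_subset[OF B, of "B - N"] Bb Nb by auto
    have "(\<Sum>n. ennreal (c ((B - N) \<inter> {real n..<real (Suc n)}))) = ennreal (c (B - N))"
      using sums_unit_intervals[OF BN] nonneg[OF piece[OF Bb]] nonneg[OF BN]
      by (intro sums_unique[symmetric]) (simp add: sums_ennreal)
    then have "(\<integral>\<^sup>+t\<in>B. h t \<partial>lborel) = ennreal (c (B - N))"
      using em[OF Bb] emeasure_density[OF h(1), of B] Bb by (simp add: m_def h(2))
    then have int: "(\<integral>\<^sup>+t. h t * indicator B t \<partial>lborel) = ennreal (c (B - N))" by simp
    have "AE t in lborel. h t * indicator B t \<noteq> \<infinity>"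
    proof (rule nn_integral_PInf_AE)
      show "(\<lambda>t. h t * indicator B t) \<in> borel_measurable lborel"
        using h(1) Bb by (intro borel_measurable_times_ennreal borel_measurable_indicator) auto
      show "(\<integral>\<^sup>+t. h t * indicator B t \<partial>lborel) \<noteq> \<infinity>" unfolding int by simp
    qed
    then have ae: "AE t in lborel. ennreal (indicator B t * g t) = h t * indicator B t"
      by eventually_elim (auto simp: g_def indicator_def less_top ennreal_enn2real_if)
    have i2: "(\<integral>\<^sup>+t. ennreal (indicator B t * g t) \<partial>lborel) = ennreal (c (B - N))"
      using int nn_integral_cong_AE[OF ae] by simp
    have "has_bochner_integral lborel (\<lambda>t. indicator B t * g t) (c (B - N))"
    proof (rule has_bochner_integral_nn_integral[OF _ _ nonneg[OF BN] i2])
      show "(\<lambda>t. indicator B t * g t) \<in> borel_measurable lborel" using g Bb by simp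
      show "AE t in lborel. 0 \<le> indicator B t * g t" by (intro AE_I2) (simp add: g_def)
    qed
    then show ?thesis
      using Mloc_Diff[OF Mloc B Nb]
      by (auto simp: set_integrable_def set_lebesgue_integral_def has_bochner_integral_iff)
  qed
  then have "is_ac_density c g" using N unfolding is_ac_density_def by blast
  with g show thesis by (intro that[of g]) (auto simp: g_def)
qed

end

lemma is_ac_density_unique:
  assumes c: "c \<in> Mloc" and g: "is_ac_density c g" and h: "is_ac_density c h"
  shows "AE t in lborel. 0 \<le> t \<longrightarrow> g t = h t"
proof -
  obtain N1 where N1: "N1 \<in> null_sets lborel" "\<And>B. B \<in> bounded_borel \<Longrightarrow>
      set_integrable lborel B g \<and> c B = (LINT t:B|lborel. g t) + c (B \<inter> N1)"
    using g by (auto simp: is_ac_density_def)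
  obtain N2 where N2: "N2 \<in> null_sets lborel" "\<And>B. B \<in> bounded_borel \<Longrightarrow>
      set_integrable lborel B h \<and> c B = (LINT t:B|lborel. h t) + c (B \<inter> N2)"
    using h by (auto simp: is_ac_density_def)
  let ?N = "N1 \<union> N2"
  have N: "?N \<in> null_sets lborel" using N1(1) N2(1) by (rule null_sets.Un)
  have "AE t in lborel. indicator {0..real n} t *\<^sub>R g t = indicator {0..real n} t *\<^sub>R h t" for n
  proof (rule density_unique_real)
    have I: "{0..real n} \<in> bounded_borel" by (rule bounded_borel_Icc) simp
    show "integrable lborel (\<lambda>t. indicator {0..real n} t *\<^sub>R g t)"
      "integrable lborel (\<lambda>t. indicator {0..real n} t *\<^sub>R h t)"
      using N1(2)[OF I] N2(2)[OF I] by (auto simp: set_integrable_def)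
    fix A :: "real set" assume "A \<in> sets lborel"
    then have A: "A \<in> sets borel" by simp
    let ?B = "A \<inter> {0..real n}"
    have B: "?B \<in> bounded_borel" "?B - ?N \<in> bounded_borel"
      using A N by (auto intro!: bounded_borel_subset[OF I])
    have e: "(?B - ?N) \<inter> N1 = {}" "(?B - ?N) \<inter> N2 = {}" by auto
    have "(LINT t:?B - ?N|lborel. g t) = (LINT t:?B - ?N|lborel. h t)"
      using N1(2)[OF B(2)] N2(2)[OF B(2)] unfolding e by simp
    moreover have "(LINT t:?B - ?N|lborel. u t) = (LINT t:?B|lborel. u t)" if "set_integrable lborel ?B u" for u :: "real \<Rightarrow> real"
    proof -
      have "AE t in lborel. t \<notin> ?N" using N by (rule AE_not_in)
      then have "AE t in lborel. (t \<in> ?B - ?N) = (t \<in> ?B)" by eventually_elim auto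
      moreover have "set_integrable lborel (?B - ?N) u"
        by (rule set_integrable_subset[OF that]) (use bounded_borel_sets[OF B(2)] in auto)
      then have "set_borel_measurable lborel ?B u" "set_borel_measurable lborel (?B - ?N) u"
        using that borel_measurable_integrable by (auto simp: set_borel_measurable_def set_integrable_def)
      ultimately show ?thesis by (intro set_integral_cong_set) auto
    qed
    ultimately have "(LINT t:?B|lborel. g t) = (LINT t:?B|lborel. h t)"
      using N1(2)[OF B(1)] N2(2)[OF B(1)] by simp
    then show "(LINT t:A|lborel. indicator {0..real n} t *\<^sub>R g t) = (LINT t:A|lborel. indicator {0..real n} t *\<^sub>R h t)"
      by (simp add: set_lebesgue_integral_def indicator_inter_arith mult.assoc)
  qed
  then have "AE t in lborel. \<forall>n. indicator {0..real n} t *\<^sub>R g t = indicator {0..real n} t *\<^sub>R h t"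
    unfolding AE_all_countable by blast
  then show ?thesis
  proof eventually_elim
    case (elim t)
    show ?case
    proof
      assume "0 \<le> t"
      obtain n where "t \<le> real n" using real_arch_simple by blast
      with elim[rule_format, of n] \<open>0 \<le> t\<close> show "g t = h t" by simp
    qed
  qed
qed

lemma ac_density_eq:
  assumes "c \<in> Mloc" "is_ac_density c g"
  shows "AE t in lborel. 0 \<le> t \<longrightarrow> ac_density c t = g t"
proof (rule is_ac_density_unique[OF assms(1) _ assms(2)])
  show "is_ac_density c (ac_density c)" unfolding ac_density_def by (rule someI[of _ g]) (rule assms(2))
qed

section \<open>Compactness by convexity\<close>

text \<open>
  A substitute for weak compactness. Choose \<open>w n\<close> in \<open>X n\<close> with nearly minimal \<open>L\<^sup>2\<close> norm. As the sets
  decrease, their minimal norms increase to a limit, and since midpoints stay in the sets, the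
  parallelogram identity makes the sequence Cauchy in \<open>L\<^sup>2\<close>; a subsequence then converges almost
  everywhere.
\<close>

lemma midpoint_closed_AE_convergent:
  fixes X :: "nat \<Rightarrow> ('a \<Rightarrow> real) set"
  assumes M: "finite_measure M"
    and meas: "\<And>n u. u \<in> X n \<Longrightarrow> u \<in> borel_measurable M"
    and bound: "\<And>n u x. u \<in> X n \<Longrightarrow> 0 \<le> u x \<and> u x \<le> \<Lambda>"
    and mid: "\<And>n u v. u \<in> X n \<Longrightarrow> v \<in> X n \<Longrightarrow> (\<lambda>x. (u x + v x) / 2) \<in> X n"
    and ne: "\<And>n. X n \<noteq> {}"
    and dec: "decseq X"
  shows "\<exists>a w u. strict_mono (a::nat\<Rightarrow>nat) \<and> (\<forall>n. w n \<in> X (a n)) \<and> u \<in> borel_measurable M \<and>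
    (\<forall>x. 0 \<le> u x \<and> u x \<le> \<Lambda>) \<and> (AE x in M. (\<lambda>n. w n x) \<longlonglongrightarrow> u x)"
proof -
  interpret M: finite_measure M by (rule M)
  define q where "q u = (\<integral>x. (u x)\<^sup>2 \<partial>M)" for u :: "'a \<Rightarrow> real"
  have \<Lambda>0: "0 \<le> \<Lambda>"
  proof -
    obtain u where "u \<in> X 0" using ne by blast
    from bound[OF this] show ?thesis by force
  qed
  have int_bd: "integrable M u" if "u \<in> borel_measurable M" "\<And>x. \<bar>u x\<bar> \<le> B" for u :: "'a \<Rightarrow> real" and B
    by (rule M.integrable_const_bound[of u B]) (use that in auto)
  have sq_bd: "(u x)\<^sup>2 \<le> \<Lambda>\<^sup>2" if "u \<in> X n" for u x n
    using bound[OF that, of x] by (intro power_mono) auto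
  have int2: "integrable M (\<lambda>x. (u x)\<^sup>2)" if "u \<in> X n" for u n
    by (rule int_bd[of _ "\<Lambda>\<^sup>2"]) (use meas[OF that] sq_bd[OF that] in auto)
  have q0: "0 \<le> q u" for u unfolding q_def by (rule integral_nonneg_AE) auto
  have qle: "q u \<le> \<Lambda>\<^sup>2 * measure M (space M)" if "u \<in> X n" for u n
  proof -
    have "q u \<le> (\<integral>x. \<Lambda>\<^sup>2 \<partial>M)" unfolding q_def
      by (rule integral_mono[OF int2[OF that]]) (use sq_bd[OF that] in auto)
    then show ?thesis by (simp add: mult.commute)
  qed
  define v where "v n = Inf (q ` X n)" for n
  have bb: "bdd_below (q ` X n)" for n by (rule bdd_belowI2[of _ 0]) (rule q0)
  have sub: "X n \<subseteq> X m" if "m \<le> n" for m n using dec that by (simp add: decseq_def)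
  have v_le: "v n \<le> q u" if "u \<in> X n" for n u
    unfolding v_def by (rule cInf_lower) (use that bb in auto)
  have inc: "incseq v"
    unfolding incseq_def v_def using sub ne bb by (auto intro!: cInf_superset_mono)
  have vB: "v n \<le> \<Lambda>\<^sup>2 * measure M (space M)" for n
  proof -
    obtain u where "u \<in> X n" using ne by blast
    then show ?thesis using v_le qle order_trans by blast
  qed
  obtain L where L: "v \<longlonglongrightarrow> L" "\<And>n. v n \<le> L"
    using incseq_convergent[OF inc, of "\<Lambda>\<^sup>2 * measure M (space M)"] vB by blast
  have "\<exists>u. u \<in> X n \<and> q u < v n + 1 / real (Suc n)" for n
  proof -
    have "q ` X n \<noteq> {}" "Inf (q ` X n) < v n + 1 / real (Suc n)" using ne by (auto simp: v_def)
    from cInf_lessD[OF this] show ?thesis by blast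
  qed
  then have "\<forall>n. \<exists>u. u \<in> X n \<and> q u < v n + 1 / real (Suc n)" by blast
  from choice[OF this] obtain w where w: "\<And>n. w n \<in> X n" "\<And>n. q (w n) < v n + 1 / real (Suc n)"
    by blast
  have wint: "integrable M (w n)" for n
    by (rule int_bd[of _ \<Lambda>]) (use meas[OF w(1)] bound[OF w(1)] in auto)
  have diff: "q (\<lambda>x. w i x - w j x) \<le> 4 * (L - v N) + 4 / real (Suc N)" if "i \<ge> N" "j \<ge> N" for i j N
  proof -
    have wN: "w i \<in> X N" "w j \<in> X N" using w(1) sub that by blast+
    have "v N \<le> q (\<lambda>x. (w i x + w j x) / 2)" by (rule v_le[OF mid[OF wN]])
    moreover have "q (\<lambda>x. w i x - w j x) = 2 * q (w i) + 2 * q (w j) - 4 * q (\<lambda>x. (w i x + w j x) / 2)"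
    proof -
      have "q (\<lambda>x. w i x - w j x) = (\<integral>x. (2 * (w i x)\<^sup>2 + 2 * (w j x)\<^sup>2) - 4 * ((w i x + w j x) / 2)\<^sup>2 \<partial>M)"
        unfolding q_def by (rule Bochner_Integration.integral_cong) (auto simp: power2_eq_square field_simps)
      then show ?thesis
        using int2[OF wN(1)] int2[OF wN(2)] int2[OF mid[OF wN]] by (simp add: q_def)
    qed
    moreover have "q (w i) \<le> L + 1 / real (Suc N)" "q (w j) \<le> L + 1 / real (Suc N)"
      using w(2)[of i] w(2)[of j] L(2)[of i] L(2)[of j] that
        divide_left_mono[of "real (Suc N)" "real (Suc i)" 1] divide_left_mono[of "real (Suc N)" "real (Suc j)" 1]
      by auto
    ultimately show ?thesis by (simp add: algebra_simps)
  qed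
  have L1: "\<exists>N. \<forall>i\<ge>N. \<forall>j\<ge>N. (\<integral>x. norm (w i x - w j x) \<partial>M) < e" if e: "e > 0" for e
  proof -
    let ?\<mu> = "measure M (space M)"
    define \<eta> where "\<eta> = (e / 2) / (?\<mu> + 1)"
    have mu0: "?\<mu> \<ge> 0" by simp
    have eta0: "\<eta> > 0" unfolding \<eta>_def using e mu0 by (intro divide_pos_pos mult_pos_pos add_nonneg_pos) auto
    have ne1: "?\<mu> + 1 \<noteq> 0" using mu0 by linarith
    have "\<eta> * (?\<mu> + 1) = e / 2" by (rule nonzero_eq_divide_eq[OF ne1, of \<eta> "e/2", THEN iffD1, OF \<eta>_def])
    moreover have "\<eta> * ?\<mu> < \<eta> * (?\<mu> + 1)" using eta0 by simp
    ultimately have eta: "\<eta> > 0" "\<eta> * ?\<mu> < e / 2" using eta0 by auto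
    have "(\<lambda>N. 4 * (L - v N) + 4 * (1 / real (Suc N))) \<longlonglongrightarrow> 4 * (L - L) + 4 * 0"
      by (intro tendsto_intros L(1) lim_1_over_n[THEN LIMSEQ_Suc])
    then have "\<forall>\<^sub>F N in sequentially. 4 * (L - v N) + 4 * (1 / real (Suc N)) < \<eta> * (e / 2)"
      by (rule order_tendstoD) (use eta e in auto)
    then obtain N where N: "4 * (L - v N) + 4 / real (Suc N) < \<eta> * (e / 2)"
      by (auto simp: eventually_sequentially)
    have "(\<integral>x. norm (w i x - w j x) \<partial>M) < e" if "i \<ge> N" "j \<ge> N" for i j
    proof -
      have bd: "\<bar>w i x - w j x\<bar> \<le> \<Lambda>" for x using bound[OF w(1), of i x] bound[OF w(1), of j x] by auto
      have int: "integrable M (\<lambda>x. (w i x - w j x)\<^sup>2)"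
        by (rule int_bd[of _ "\<Lambda>\<^sup>2"]) (use meas[OF w(1)] bd \<Lambda>0 in \<open>auto simp: abs_le_square_iff[symmetric]\<close>)
      have "(\<integral>x. norm (w i x - w j x) \<partial>M) \<le> (\<integral>x. \<eta> + (w i x - w j x)\<^sup>2 / \<eta> \<partial>M)"
      proof (rule integral_mono)
        fix x
        have "2 * \<bar>w i x - w j x\<bar> * \<eta> \<le> \<eta>\<^sup>2 + (w i x - w j x)\<^sup>2"
          using sum_squares_bound[of "\<bar>w i x - w j x\<bar>" \<eta>] by (simp add: algebra_simps)
        moreover have "\<bar>w i x - w j x\<bar> * \<eta> \<ge> 0" using eta(1) by simp
        ultimately have "\<bar>w i x - w j x\<bar> * \<eta> \<le> \<eta>\<^sup>2 + (w i x - w j x)\<^sup>2" by linarith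
        then show "norm (w i x - w j x) \<le> \<eta> + (w i x - w j x)\<^sup>2 / \<eta>"
          using eta(1) by (simp add: field_simps power2_eq_square)
      qed (use wint int in auto)
      also have "\<dots> = \<eta> * ?\<mu> + q (\<lambda>x. w i x - w j x) / \<eta>" using int by (simp add: q_def mult.commute)
      also have "q (\<lambda>x. w i x - w j x) / \<eta> < e / 2"
        using diff[OF that] N eta(1) by (simp add: divide_less_eq mult.commute)
      finally show ?thesis using eta(2) by linarith
    qed
    then show ?thesis by blast
  qed
  obtain a where a: "strict_mono (a::nat\<Rightarrow>nat)" "AE x in M. Cauchy (\<lambda>i. w (a i) x)"
    by (rule cauchy_L1_AE_cauchy_subseq[of M w]) (use wint L1 in auto)
  (* Clipping makes the bounds hold everywhere; it changes the limit at no point of convergence. *)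
  define u where "u x = max 0 (min \<Lambda> (lim (\<lambda>i. w (a i) x)))" for x
  have "u \<in> borel_measurable M" unfolding u_def using meas[OF w(1)] by measurable
  moreover have "AE x in M. (\<lambda>n. w (a n) x) \<longlonglongrightarrow> u x"
    using a(2)
  proof eventually_elim
    case (elim x)
    then have l: "(\<lambda>n. w (a n) x) \<longlonglongrightarrow> lim (\<lambda>i. w (a i) x)"
      using Cauchy_convergent convergent_LIMSEQ_iff by blast
    have "0 \<le> lim (\<lambda>i. w (a i) x)" by (rule LIMSEQ_le_const[OF l]) (use bound[OF w(1)] in auto)
    moreover have "lim (\<lambda>i. w (a i) x) \<le> \<Lambda>" by (rule LIMSEQ_le_const2[OF l]) (use bound[OF w(1)] in auto)
    ultimately show ?case using l by (simp add: u_def)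
  qed
  moreover have "0 \<le> u x \<and> u x \<le> \<Lambda>" for x using \<Lambda>0 by (auto simp: u_def)
  ultimately show ?thesis using a(1) w(1) by (intro exI[of _ a] exI[of _ "\<lambda>n. w (a n)"] exI[of _ u]) auto
qed

section \<open>The individual problem\<close>

lemma nn_integral_exp_Icc:
  assumes "\<delta> > 0" "c \<ge> 0" "s \<le> (t::real)"
  shows "(\<integral>\<^sup>+u\<in>{s..t}. ennreal (exp (\<delta> * u) * c) \<partial>lborel) = ennreal (c / \<delta> * (exp (\<delta> * t) - exp (\<delta> * s)))"
proof -
  have "(\<integral>\<^sup>+u. ennreal (exp (\<delta> * u) * c) * indicator {s..t} u \<partial>lborel) = ennreal (c / \<delta> * exp (\<delta> * t) - c / \<delta> * exp (\<delta> * s))"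
    by (rule nn_integral_FTC_Icc) (use assms in \<open>auto intro!: derivative_eq_intros simp: field_simps\<close>)
  then show ?thesis by (simp add: algebra_simps)
qed

lemma nn_integral_exp_Icc_0:
  assumes "\<delta> > 0" "c \<ge> 0" "t \<ge> (0::real)"
  shows "(\<integral>\<^sup>+s\<in>{0..t}. ennreal (exp (\<delta> * s) * c) \<partial>lborel) = ennreal (c / \<delta> * (exp (\<delta> * t) - 1))"
  using nn_integral_exp_Icc[of \<delta> c 0 t] assms by simp

lemma nn_integral_exp_atLeast:
  assumes "c > 0"
  shows "(\<integral>\<^sup>+s\<in>{t..}. ennreal (exp (- c * s)) \<partial>lborel) = ennreal (exp (- c * t) / c)"
proof -
  have "(\<integral>\<^sup>+s. ennreal (exp (- c * s)) * indicator {t..} s \<partial>lborel) = ennreal (0 - (- exp (- c * t) / c))"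
  proof (rule nn_integral_FTC_atLeast)
    show "((\<lambda>t. - exp (- c * t) / c) \<longlongrightarrow> 0) at_top"
    proof -
      have "filterlim (\<lambda>t. - c * t) at_bot at_top"
        using assms by (intro filterlim_tendsto_neg_mult_at_bot[OF tendsto_const]) (auto simp: filterlim_ident)
      then have "((\<lambda>t. exp (- c * t)) \<longlongrightarrow> 0) at_top" by (rule filterlim_compose[OF exp_at_bot])
      then show ?thesis using tendsto_divide[OF tendsto_minus, of "\<lambda>t. exp (- c * t)" 0 at_top "\<lambda>_. c" c] assms by simp
    qed
  qed (use assms in \<open>auto intro!: derivative_eq_intros\<close>)
  then show ?thesis by simp
qed

text \<open>
  The consequences of the assumptions on \<open>f\<close> and \<open>U\<close> that the individual problem uses, with the
  conditions on derivatives in integrated form: \<open>f_mono\<close> is \<open>f\<^sub>k \<ge> - \<delta>\<close>, \<open>f_upper\<close> bounds \<open>f\<^sub>k\<close> from above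
  away from \<open>0\<close>, and \<open>U_slope\<close> says that marginal utility tends to \<open>0\<close>. The externality takes values
  in \<open>[a,b]\<close> only, and no stock above \<open>R\<close> is productive.
\<close>

locale individual_problem =
  fixes f :: "real \<Rightarrow> real \<Rightarrow> real" and U :: "real \<Rightarrow> real" and a b \<delta> R k1 r :: real
  assumes pos: "0 < a" "a \<le> b" "0 < \<delta>" "0 < R" "0 < k1" "0 < r"
    and f_cont: "continuous_on ({0..} \<times> {a..b}) (\<lambda>(x, K). f x K)"
    and f_zero: "K \<in> {a..b} \<Longrightarrow> f 0 K = 0"
    and f_mono: "K \<in> {a..b} \<Longrightarrow> 0 \<le> x \<Longrightarrow> x \<le> y \<Longrightarrow> f x K + \<delta> * x \<le> f y K + \<delta> * y"
    and f_upper: "\<eta> > 0 \<Longrightarrow> \<exists>C\<ge>0. \<forall>K\<in>{a..b}. \<forall>x y. \<eta> \<le> x \<and> x \<le> y \<longrightarrow> f y K - f x K \<le> C * (y - x)"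
    and f_nonpos: "K \<in> {a..b} \<Longrightarrow> R \<le> x \<Longrightarrow> f x K \<le> 0"
    and f_pos: "K \<in> {a..b} \<Longrightarrow> 0 < x \<Longrightarrow> x < k1 \<Longrightarrow> 0 < f x K"
    and f_concave: "K \<in> {a..b} \<Longrightarrow> strictly_concave_on {0..} (\<lambda>x. f x K)"
    and U_nonneg: "0 \<le> x \<Longrightarrow> 0 \<le> U x"
    and U_concave: "concave_on {0..} U"
    and U_mono: "strict_mono_on {0..} U"
    and U_cont: "continuous_on {0..} U"
    and U_slope: "p > 0 \<Longrightarrow> \<exists>\<Lambda>\<ge>m. \<forall>x\<ge>\<Lambda>. U x - U \<Lambda> \<le> p * (x - \<Lambda>)"
begin

definition F :: "real \<Rightarrow> real \<Rightarrow> real" where "F x K = f x K + \<delta> * x"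

definition environment :: "(real \<Rightarrow> real) \<Rightarrow> bool" where
  "environment \<kappa> \<longleftrightarrow> \<kappa> \<in> borel_measurable borel \<and> (\<forall>t. \<kappa> t \<in> {a..b})"

definition profile :: "(real \<Rightarrow> real) \<Rightarrow> bool" where
  "profile k \<longleftrightarrow> k \<in> borel_measurable borel \<and> (\<forall>t. 0 \<le> k t)"

text \<open>
  The two running integrals of the weighted budget: consumption on one side, and production plus
  the restored depreciation \<open>\<delta> k\<close> on the other. Both integrands are nonnegative, so they are taken
  in \<open>[0,\<infinity>]\<close> and need no integrability.
\<close>

definition outflow :: "(real \<Rightarrow> real) \<Rightarrow> real \<Rightarrow> ennreal" where
  "outflow g t = (\<integral>\<^sup>+s\<in>{0..t}. ennreal (exp (\<delta> * s) * g s) \<partial>lborel)"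

definition inflow :: "(real \<Rightarrow> real) \<Rightarrow> (real \<Rightarrow> real) \<Rightarrow> real \<Rightarrow> ennreal" where
  "inflow \<kappa> k t = (\<integral>\<^sup>+s\<in>{0..t}. ennreal (exp (\<delta> * s) * F (k s) (\<kappa> s)) \<partial>lborel)"

definition welfare :: "(real \<Rightarrow> real) \<Rightarrow> ennreal" where
  "welfare g = (\<integral>\<^sup>+t\<in>{0..}. ennreal (exp (- r * t) * U (g t)) \<partial>lborel)"

text \<open>
  Feasibility in weighted form. The singular part of consumption does not appear: it yields no
  utility and can only lower the stock. A solution wastes nothing.
\<close>

definition subsolution :: "real \<Rightarrow> (real \<Rightarrow> real) \<Rightarrow> (real \<Rightarrow> real) \<Rightarrow> (real \<Rightarrow> real) \<Rightarrow> bool" where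
  "subsolution \<kappa>0 \<kappa> k g \<longleftrightarrow> profile k \<and> profile g \<and> (\<forall>T. \<exists>B. \<forall>t\<in>{0..T}. k t \<le> B) \<and>
     (\<forall>t\<ge>0. ennreal (exp (\<delta> * t) * k t) + outflow g t \<le> ennreal \<kappa>0 + inflow \<kappa> k t)"

definition solution :: "real \<Rightarrow> (real \<Rightarrow> real) \<Rightarrow> (real \<Rightarrow> real) \<Rightarrow> (real \<Rightarrow> real) \<Rightarrow> bool" where
  "solution \<kappa>0 \<kappa> k g \<longleftrightarrow> profile k \<and> profile g \<and> (\<forall>T. \<exists>B. \<forall>t\<in>{0..T}. k t \<le> B) \<and>
     (\<forall>t\<ge>0. ennreal (exp (\<delta> * t) * k t) + outflow g t = ennreal \<kappa>0 + inflow \<kappa> k t)"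

lemma solution_imp_subsolution: "solution \<kappa>0 \<kappa> k g \<Longrightarrow> subsolution \<kappa>0 \<kappa> k g"
  by (simp add: solution_def subsolution_def)

lemma profile_measurable: "profile k \<Longrightarrow> k \<in> borel_measurable borel"
  and profile_nonneg: "profile k \<Longrightarrow> 0 \<le> k t"
  by (auto simp: profile_def)

lemma environment_range: "environment \<kappa> \<Longrightarrow> \<kappa> t \<in> {a..b}"
  by (auto simp: environment_def)

lemma f_measurable:
  assumes "profile k" "environment \<kappa>"
  shows "(\<lambda>t. f (k t) (\<kappa> t)) \<in> borel_measurable borel"
proof -
  have [measurable]: "k \<in> borel_measurable borel" "\<kappa> \<in> borel_measurable borel"
    using assms by (auto simp: profile_def environment_def)
  have "(\<lambda>t. (k t, \<kappa> t)) \<in> borel \<rightarrow>\<^sub>M restrict_space borel ({0..} \<times> {a..b})"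
  proof (rule measurable_restrict_space2)
    show "(\<lambda>t. (k t, \<kappa> t)) \<in> space borel \<rightarrow> {0..} \<times> {a..b}" using assms by (auto simp: profile_def environment_def)
    show "(\<lambda>t. (k t, \<kappa> t)) \<in> borel_measurable borel" by measurable
  qed
  from measurable_compose[OF this borel_measurable_continuous_on_restrict[OF f_cont]]
  show ?thesis by simp
qed

lemma F_measurable:
  assumes "profile k" "environment \<kappa>"
  shows "(\<lambda>t. F (k t) (\<kappa> t)) \<in> borel_measurable borel"
  using f_measurable[OF assms] profile_measurable[OF assms(1)] unfolding F_def by measurable

lemma U_measurable:
  assumes "profile g" shows "(\<lambda>t. U (g t)) \<in> borel_measurable borel"
proof -
  have "g \<in> borel \<rightarrow>\<^sub>M restrict_space borel {0..}"
    by (rule measurable_restrict_space2) (use assms in \<open>auto simp: profile_def\<close>)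
  from measurable_compose[OF this borel_measurable_continuous_on_restrict[OF U_cont]]
  show ?thesis .
qed

lemma F_mono: "K \<in> {a..b} \<Longrightarrow> 0 \<le> x \<Longrightarrow> x \<le> y \<Longrightarrow> F x K \<le> F y K"
  by (simp add: F_def f_mono)

lemma F_nonneg: "K \<in> {a..b} \<Longrightarrow> 0 \<le> x \<Longrightarrow> 0 \<le> F x K"
  using F_mono[of K 0 x] f_zero by (simp add: F_def)

lemma F_le: assumes "K \<in> {a..b}" "0 \<le> x" shows "F x K \<le> \<delta> * max R x"
proof (cases "R \<le> x")
  case True
  then show ?thesis using f_nonpos[OF assms(1)] by (simp add: F_def)
next
  case False
  then have "F x K \<le> F R K" using assms by (intro F_mono) auto
  also have "\<dots> \<le> \<delta> * R" using f_nonpos[OF assms(1), of R] by (simp add: F_def)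
  finally show ?thesis using False by simp
qed

lemma f_tendsto:
  assumes "\<And>n. x n \<ge> 0" "\<And>n. K n \<in> {a..b}" "x \<longlonglongrightarrow> y" "K \<longlonglongrightarrow> L"
  shows "(\<lambda>n. f (x n) (K n)) \<longlonglongrightarrow> f y L"
proof -
  have "y \<ge> 0" by (rule LIMSEQ_le_const[OF assms(3)]) (use assms(1) in auto)
  moreover have "L \<in> {a..b}"
    by (rule closed_sequentially[OF _ _ assms(4)]) (use assms(2) in auto)
  ultimately have "((\<lambda>n. (\<lambda>(x, K). f x K) (x n, K n)) \<longlongrightarrow> (\<lambda>(x, K). f x K) (y, L)) sequentially"
    by (intro continuous_on_tendsto_compose[OF f_cont] tendsto_Pair assms(3,4)) (use assms(1,2) in auto)
  then show ?thesis by simp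
qed

lemma inflow_le:
  assumes "environment \<kappa>" "profile k" "\<And>s. s \<in> {0..t} \<Longrightarrow> k s \<le> y" "R \<le> y" "t \<ge> 0"
  shows "inflow \<kappa> k t \<le> ennreal (y * (exp (\<delta> * t) - 1))"
proof -
  have "inflow \<kappa> k t \<le> (\<integral>\<^sup>+s\<in>{0..t}. ennreal (exp (\<delta> * s) * (\<delta> * y)) \<partial>lborel)"
    unfolding inflow_def
  proof (rule nn_integral_mono)
    fix s :: real
    have "F (k s) (\<kappa> s) \<le> \<delta> * y" if "s \<in> {0..t}"
      using F_le[OF environment_range[OF assms(1)] profile_nonneg[OF assms(2)], of s s] assms(3)[OF that] assms(4) pos(3)
      by (smt (verit, best) mult_left_mono)
    then show "ennreal (exp (\<delta> * s) * F (k s) (\<kappa> s)) * indicator {0..t} s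
        \<le> ennreal (exp (\<delta> * s) * (\<delta> * y)) * indicator {0..t} s"
      by (auto simp: indicator_def intro!: ennreal_leI)
  qed
  also have "\<dots> = ennreal (y * (exp (\<delta> * t) - 1))"
    using nn_integral_exp_Icc_0[of \<delta> "\<delta> * y" t] pos assms(4,5) by simp
  finally show ?thesis .
qed

lemma inflow_mono:
  assumes "environment \<kappa>" "profile k" "\<And>s. s \<in> {0..t} \<Longrightarrow> k s \<le> h s"
  shows "inflow \<kappa> k t \<le> inflow \<kappa> h t"
  unfolding inflow_def
proof (rule nn_integral_mono)
  fix s :: real
  show "ennreal (exp (\<delta> * s) * F (k s) (\<kappa> s)) * indicator {0..t} s \<le> ennreal (exp (\<delta> * s) * F (h s) (\<kappa> s)) * indicator {0..t} s"
    using F_mono[OF environment_range[OF assms(1)] profile_nonneg[OF assms(2)], of s "h s" s] assms(3)[of s]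
    by (auto simp: indicator_def intro!: ennreal_leI)
qed

text \<open>
  Let \<open>y \<ge> R\<close> bound the stock up to time \<open>t\<close>. Then \<open>F \<le> \<delta> y\<close>, so the budget improves the bound to
  \<open>y - (y - R) exp(- \<delta> t)\<close>. For the least bound \<open>y\<close> this forces \<open>y = R\<close>.
\<close>

lemma subsolution_le_R:
  assumes subsolution: "subsolution \<kappa>0 \<kappa> k g" and environment: "environment \<kappa>" and \<kappa>0: "0 \<le> \<kappa>0" "\<kappa>0 \<le> R" and t: "0 \<le> t"
  shows "k t \<le> R"
proof -
  have k: "profile k" using subsolution by (simp add: subsolution_def)
  have "\<exists>B. \<forall>s\<in>{0..t}. k s \<le> B" using subsolution by (simp add: subsolution_def)
  then obtain B where B: "\<And>s. s \<in> {0..t} \<Longrightarrow> k s \<le> B" by blast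
  define Z where "Z = (\<lambda>s. max R (k s)) ` {0..t}"
  define y where "y = Sup Z"
  have bdd: "bdd_above Z" unfolding Z_def by (rule bdd_aboveI2[of _ _ "max R B"]) (use B in \<open>auto intro!: max.mono max.coboundedI2\<close>)
  have up: "max R (k s) \<le> y" if "s \<in> {0..t}" for s
    unfolding y_def by (rule cSup_upper[OF _ bdd]) (use that in \<open>auto simp: Z_def\<close>)
  have yR: "R \<le> y" using up[of 0] t by auto
  let ?E = "exp (\<delta> * t)"
  have E: "?E \<ge> 1" using pos t by simp
  have "z \<le> y - (y - R) / ?E" if "z \<in> Z" for z
  proof -
    obtain s where s: "s \<in> {0..t}" "z = max R (k s)" using \<open>z \<in> Z\<close> by (auto simp: Z_def)
    let ?e = "exp (\<delta> * s)"
    have e: "1 \<le> ?e" "?e \<le> ?E" using s pos by auto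
    have "ennreal (?e * k s) \<le> ennreal (?e * k s) + outflow g s" by simp
    also have "\<dots> \<le> ennreal \<kappa>0 + inflow \<kappa> k s" using subsolution s by (auto simp: subsolution_def)
    also have "\<dots> \<le> ennreal \<kappa>0 + ennreal (y * (?e - 1))"
      by (rule add_left_mono, rule inflow_le[OF environment k]) (use s up yR in \<open>auto intro: order_trans[OF max.cobounded2]\<close>)
    also have "\<dots> = ennreal (\<kappa>0 + y * (?e - 1))" using \<kappa>0 yR pos e by (subst ennreal_plus) auto
    finally have "?e * k s \<le> \<kappa>0 + y * (?e - 1)"
      using \<kappa>0 yR pos e by (subst (asm) ennreal_le_iff) (auto intro!: add_nonneg_nonneg)
    then have "?e * k s \<le> R + y * (?e - 1)" using \<kappa>0 by linarith
    then have "k s \<le> y - (y - R) / ?e" using e by (simp add: field_simps)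
    also have "\<dots> \<le> y - (y - R) / ?E" using e yR by (auto intro!: divide_left_mono)
    finally have 1: "k s \<le> y - (y - R) / ?E" .
    have "(y - R) / ?E \<le> (y - R) / 1" using E yR by (intro divide_left_mono) auto
    then show ?thesis using 1 s by auto
  qed
  then have "y \<le> y - (y - R) / ?E" unfolding y_def using t by (intro cSup_least) (auto simp: Z_def)
  then have "(y - R) / ?E \<le> 0" by simp
  then have "y \<le> R" by (simp add: divide_le_0_iff)
  then show ?thesis using up[of t] t by auto
qed

lemma subsolution_inflow_le:
  assumes "subsolution \<kappa>0 \<kappa> k g" "environment \<kappa>" "0 \<le> \<kappa>0" "\<kappa>0 \<le> R" "0 \<le> t"
  shows "inflow \<kappa> k t \<le> ennreal (R * (exp (\<delta> * t) - 1))"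
  by (rule inflow_le) (use assms subsolution_le_R[OF assms(1-4)] in \<open>auto simp: subsolution_def\<close>)

lemma subsolution_outflow_le:
  assumes "subsolution \<kappa>0 \<kappa> k g" "environment \<kappa>" "0 \<le> \<kappa>0" "\<kappa>0 \<le> R" "0 \<le> t"
  shows "outflow g t \<le> ennreal (R * exp (\<delta> * t))"
proof -
  have "outflow g t \<le> ennreal (exp (\<delta> * t) * k t) + outflow g t" by simp
  also have "\<dots> \<le> ennreal \<kappa>0 + inflow \<kappa> k t" using assms by (auto simp: subsolution_def)
  also have "\<dots> \<le> ennreal R + ennreal (R * (exp (\<delta> * t) - 1))"
    by (intro add_mono subsolution_inflow_le[OF assms] ennreal_leI assms)
  also have "\<dots> = ennreal (R + R * (exp (\<delta> * t) - 1))" using pos assms(5) by (subst ennreal_plus) auto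
  finally show ?thesis by (simp add: algebra_simps)
qed

lemma subsolution_real:
  assumes "subsolution \<kappa>0 \<kappa> k g" "environment \<kappa>" "0 \<le> \<kappa>0" "\<kappa>0 \<le> R" "0 \<le> t"
  shows "inflow \<kappa> k t = ennreal (enn2real (inflow \<kappa> k t))" "outflow g t = ennreal (enn2real (outflow g t))"
    "exp (\<delta> * t) * k t + enn2real (outflow g t) \<le> \<kappa>0 + enn2real (inflow \<kappa> k t)"
proof -
  show i: "inflow \<kappa> k t = ennreal (enn2real (inflow \<kappa> k t))"
    using order.strict_trans1[OF subsolution_inflow_le[OF assms] ennreal_less_top] by simp
  show o: "outflow g t = ennreal (enn2real (outflow g t))"
    using order.strict_trans1[OF subsolution_outflow_le[OF assms] ennreal_less_top] by simp
  have k: "0 \<le> k t" using assms(1) by (simp add: subsolution_def profile_def)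
  have "ennreal (exp (\<delta> * t) * k t) + outflow g t \<le> ennreal \<kappa>0 + inflow \<kappa> k t"
    using assms by (auto simp: subsolution_def)
  then have "ennreal (exp (\<delta> * t) * k t) + ennreal (enn2real (outflow g t)) \<le> ennreal \<kappa>0 + ennreal (enn2real (inflow \<kappa> k t))"
    using i o by simp
  then have "ennreal (exp (\<delta> * t) * k t + enn2real (outflow g t)) \<le> ennreal (\<kappa>0 + enn2real (inflow \<kappa> k t))"
    using k assms(3) by (simp add: ennreal_plus)
  then show "exp (\<delta> * t) * k t + enn2real (outflow g t) \<le> \<kappa>0 + enn2real (inflow \<kappa> k t)"
    using assms(3) by (subst (asm) ennreal_le_iff) auto
qed

text \<open>
  Write \<open>exp(- r t) = exp(\<delta> t) \<integral>\<^sub>t\<^sup>\<infinity> (r + \<delta>) exp(- (r + \<delta>) u) du\<close>; by Tonelli, discounted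
  consumption is the integral of \<open>(r + \<delta>) exp(- (r + \<delta>) u)\<close> times the outflow up to \<open>u\<close>, which is at
  most \<open>R exp(\<delta> u)\<close>.
\<close>

lemma discounted_consumption_le:
  assumes "subsolution \<kappa>0 \<kappa> k g" "environment \<kappa>" "0 \<le> \<kappa>0" "\<kappa>0 \<le> R"
  shows "(\<integral>\<^sup>+t\<in>{0..}. ennreal (exp (- r * t) * g t) \<partial>lborel) \<le> ennreal ((r + \<delta>) * R / r)"
proof -
  have [measurable]: "g \<in> borel_measurable borel" using assms(1) by (simp add: subsolution_def profile_def)
  have g0: "0 \<le> g t" for t using assms(1) by (simp add: subsolution_def profile_def)
  let ?c = "r + \<delta>"
  have c: "?c > 0" using pos by simp
  define J where "J t u = ennreal (exp (\<delta> * t) * g t) * indicator {0..u} t * ennreal (?c * exp (- ?c * u))" for t u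
  have J_meas: "case_prod J \<in> borel_measurable (lborel \<Otimes>\<^sub>M lborel)"
    unfolding J_def indicator_def atLeastAtMost_iff of_bool_def by measurable
  have "(\<integral>\<^sup>+u. J t u \<partial>lborel) = ennreal (exp (- r * t) * g t) * indicator {0..} t" for t
  proof -
    have "(\<integral>\<^sup>+u. J t u \<partial>lborel) = (\<integral>\<^sup>+u. (ennreal (exp (\<delta> * t) * g t) * indicator {0..} t * ennreal ?c) * (ennreal (exp (- ?c * u)) * indicator {t..} u) \<partial>lborel)"
      using c by (intro nn_integral_cong) (auto simp: J_def indicator_def ennreal_mult' mult_ac)
    also have "\<dots> = (ennreal (exp (\<delta> * t) * g t) * indicator {0..} t * ennreal ?c) * ennreal (exp (- ?c * t) / ?c)"
      by (subst nn_integral_cmult, measurable) (simp only: nn_integral_exp_atLeast[OF c])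
    also have "\<dots> = ennreal ((exp (\<delta> * t) * g t) * ?c * (exp (- ?c * t) / ?c)) * indicator {0..} t"
      using c g0[of t] by (auto simp: indicator_def simp flip: ennreal_mult'')
    also have "(exp (\<delta> * t) * g t) * ?c * (exp (- ?c * t) / ?c) = exp (- r * t) * g t"
    proof -
      have "(exp (\<delta> * t) * g t) * ?c * (exp (- ?c * t) / ?c) = (exp (\<delta> * t) * exp (- ?c * t)) * g t"
        using c by simp
      also have "exp (\<delta> * t) * exp (- ?c * t) = exp (- r * t)"
        unfolding exp_add[symmetric] by (simp add: algebra_simps)
      finally show ?thesis .
    qed
    finally show ?thesis .
  qed
  then have "(\<integral>\<^sup>+t\<in>{0..}. ennreal (exp (- r * t) * g t) \<partial>lborel) = (\<integral>\<^sup>+t. \<integral>\<^sup>+u. J t u \<partial>lborel \<partial>lborel)"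
    by simp
  also have "\<dots> = (\<integral>\<^sup>+u. \<integral>\<^sup>+t. J t u \<partial>lborel \<partial>lborel)"
    by (rule lborel_pair.Fubini'[OF J_meas, symmetric])
  also have "\<dots> \<le> (\<integral>\<^sup>+u. ennreal (?c * R) * (ennreal (exp (- r * u)) * indicator {0..} u) \<partial>lborel)"
  proof (rule nn_integral_mono)
    fix u :: real
    have "(\<integral>\<^sup>+t. J t u \<partial>lborel) = outflow g u * ennreal (?c * exp (- ?c * u))"
      unfolding J_def outflow_def by (rule nn_integral_multc) measurable
    also have "\<dots> \<le> ennreal (?c * R) * (ennreal (exp (- r * u)) * indicator {0..} u)"
    proof (cases "0 \<le> u")
      case True
      have "outflow g u * ennreal (?c * exp (- ?c * u)) \<le> ennreal (R * exp (\<delta> * u)) * ennreal (?c * exp (- ?c * u))"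
        by (intro mult_right_mono subsolution_outflow_le[OF assms True]) simp
      also have "\<dots> = ennreal (?c * R * exp (- r * u))"
        using c pos by (simp add: algebra_simps flip: ennreal_mult'' exp_add)
      finally show ?thesis using True c pos by (simp add: ennreal_mult'')
    next
      case False
      then show ?thesis by (simp add: outflow_def)
    qed
    finally show "(\<integral>\<^sup>+t. J t u \<partial>lborel) \<le> ennreal (?c * R) * (ennreal (exp (- r * u)) * indicator {0..} u)" .
  qed
  also have "\<dots> = ennreal (?c * R) * ennreal (exp (- r * 0) / r)"
    by (subst nn_integral_cmult, measurable) (simp only: nn_integral_exp_atLeast[OF pos(6)])
  also have "\<dots> = ennreal (?c * R / r)" using pos by (simp flip: ennreal_mult'')
  finally show ?thesis .
qed

lemma U_le: "0 \<le> x \<Longrightarrow> x \<le> y \<Longrightarrow> U x \<le> U y"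
  using strict_mono_onD[OF U_mono, of x y] by (cases "x = y") auto

lemma U_affine_bound: "\<exists>A\<ge>0. \<forall>x\<ge>0. U x \<le> A + x"
proof -
  obtain \<Lambda> where \<Lambda>: "\<Lambda> \<ge> 0" "\<And>x. x \<ge> \<Lambda> \<Longrightarrow> U x - U \<Lambda> \<le> 1 * (x - \<Lambda>)" using U_slope[of 1 0] by auto
  have "U x \<le> U \<Lambda> + x" if "x \<ge> 0" for x
    using \<Lambda>(1) \<Lambda>(2)[of x] U_le[of x \<Lambda>] that by (cases "x \<le> \<Lambda>") auto
  then show ?thesis using U_nonneg[OF \<Lambda>(1)] by blast
qed

lemma payoff_const: "(\<integral>\<^sup>+t\<in>{0..}. ennreal (exp (- r * t) * A) \<partial>lborel) = ennreal (A / r)" if "A \<ge> 0"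
proof -
  have "(\<integral>\<^sup>+t\<in>{0..}. ennreal (exp (- r * t) * A) \<partial>lborel) = (\<integral>\<^sup>+t. ennreal A * (ennreal (exp (- r * t)) * indicator {0..} t) \<partial>lborel)"
    using that by (intro nn_integral_cong) (simp add: ennreal_mult'' mult_ac)
  also have "\<dots> = ennreal A * ennreal (exp (- r * 0) / r)"
    by (subst nn_integral_cmult, measurable) (simp only: nn_integral_exp_atLeast[OF pos(6)])
  finally show ?thesis using that pos by (simp flip: ennreal_mult'')
qed

lemma subsolution_welfare_finite:
  assumes "subsolution \<kappa>0 \<kappa> k g" "environment \<kappa>" "0 \<le> \<kappa>0" "\<kappa>0 \<le> R"
  shows "welfare g < top"
proof -
  have [measurable]: "g \<in> borel_measurable borel" using assms(1) by (simp add: subsolution_def profile_def)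
  have g0: "0 \<le> g t" for t using assms(1) by (simp add: subsolution_def profile_def)
  obtain A where A: "A \<ge> 0" "\<And>x. x \<ge> 0 \<Longrightarrow> U x \<le> A + x" using U_affine_bound by blast
  have "welfare g \<le> (\<integral>\<^sup>+t. ennreal (exp (- r * t) * A) * indicator {0..} t + ennreal (exp (- r * t) * g t) * indicator {0..} t \<partial>lborel)"
    unfolding welfare_def using A g0
    by (intro nn_integral_mono) (auto simp: indicator_def distrib_left[symmetric] simp flip: ennreal_plus intro!: ennreal_leI)
  also have "\<dots> = ennreal (A / r) + (\<integral>\<^sup>+t\<in>{0..}. ennreal (exp (- r * t) * g t) \<partial>lborel)"
    by (subst nn_integral_add, measurable) (simp only: payoff_const[OF A(1)])
  also have "\<dots> \<le> ennreal (A / r) + ennreal ((r + \<delta>) * R / r)"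
    by (intro add_left_mono discounted_consumption_le[OF assms])
  also have "\<dots> < top" by simp
  finally show ?thesis .
qed

end

section \<open>Removing waste and moving consumption\<close>

lemma running_integral_measurable:
  fixes h :: "real \<Rightarrow> ennreal" and l u :: "real \<Rightarrow> real"
  assumes [measurable]: "h \<in> borel_measurable borel" "l \<in> borel_measurable borel" "u \<in> borel_measurable borel"
  shows "(\<lambda>t. \<integral>\<^sup>+s\<in>{l t..u t}. h s \<partial>lborel) \<in> borel_measurable borel"
proof -
  have "(\<lambda>(t, s). h s * indicator {l t..u t} s) \<in> borel_measurable (borel \<Otimes>\<^sub>M lborel)"
    unfolding indicator_def atLeastAtMost_iff of_bool_def by measurable
  then show ?thesis by (rule lborel.borel_measurable_nn_integral)
qed

context individual_problem
begin

lemma inflow_measurable: "environment \<kappa> \<Longrightarrow> profile k \<Longrightarrow> inflow \<kappa> k \<in> borel_measurable borel"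
  unfolding inflow_def[abs_def]
  by (rule running_integral_measurable) (use F_measurable[of k \<kappa>] in measurable)

lemma outflow_measurable: "profile g \<Longrightarrow> outflow g \<in> borel_measurable borel"
  unfolding outflow_def[abs_def]
  by (rule running_integral_measurable) (use profile_measurable[of g] in measurable)

lemma inflow_tendsto:
  assumes "\<And>n. environment (\<kappa>n n)" "environment \<kappa>" "\<And>n. profile (kn n)" "profile k"
    and "\<And>n s. 0 \<le> s \<Longrightarrow> kn n s \<le> R"
    and "\<And>s. 0 \<le> s \<Longrightarrow> (\<lambda>n. kn n s) \<longlonglongrightarrow> k s" "\<And>s. 0 \<le> s \<Longrightarrow> (\<lambda>n. \<kappa>n n s) \<longlonglongrightarrow> \<kappa> s"
  shows "(\<lambda>n. inflow (\<kappa>n n) (kn n) t) \<longlonglongrightarrow> inflow \<kappa> k t"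
  unfolding inflow_def
proof (rule nn_integral_dominated_convergence[where w="\<lambda>s. ennreal (exp (\<delta> * s) * (\<delta> * R)) * indicator {0..t} s"])
  have [measurable]: "(\<lambda>t. F (k t) (\<kappa> t)) \<in> borel_measurable borel" "(\<lambda>t. F (kn n t) (\<kappa>n n t)) \<in> borel_measurable borel" for n
    using F_measurable assms by auto
  show "(\<lambda>x. ennreal (exp (\<delta> * x) * F (kn i x) (\<kappa>n i x)) * indicator {0..t} x) \<in> borel_measurable lborel" for i
    by measurable
  show "(\<lambda>x. ennreal (exp (\<delta> * x) * F (k x) (\<kappa> x)) * indicator {0..t} x) \<in> borel_measurable lborel"
    by measurable
  show "(\<lambda>s. ennreal (exp (\<delta> * s) * (\<delta> * R)) * indicator {0..t} s) \<in> borel_measurable lborel"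
    by measurable
  show "AE x in lborel. ennreal (exp (\<delta> * x) * F (kn j x) (\<kappa>n j x)) * indicator {0..t} x \<le> ennreal (exp (\<delta> * x) * (\<delta> * R)) * indicator {0..t} x" for j
  proof (rule AE_I2)
    fix x
    show "ennreal (exp (\<delta> * x) * F (kn j x) (\<kappa>n j x)) * indicator {0..t} x \<le> ennreal (exp (\<delta> * x) * (\<delta> * R)) * indicator {0..t} x"
    proof (cases "x \<in> {0..t}")
      case True
      then show ?thesis
        using F_le[OF environment_range[OF assms(1)] profile_nonneg[OF assms(3)], of j x j x] assms(5)[of x j]
        by (auto intro!: ennreal_leI mult_left_mono)
    qed simp
  qed
  show "(\<integral>\<^sup>+s\<in>{0..t}. ennreal (exp (\<delta> * s) * (\<delta> * R)) \<partial>lborel) < \<infinity>"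
  proof (cases "0 \<le> t")
    case True
    then show ?thesis using pos by (subst nn_integral_exp_Icc) auto
  qed simp
  show "AE x in lborel. (\<lambda>i. ennreal (exp (\<delta> * x) * F (kn i x) (\<kappa>n i x)) * indicator {0..t} x) \<longlonglongrightarrow> ennreal (exp (\<delta> * x) * F (k x) (\<kappa> x)) * indicator {0..t} x"
  proof (rule AE_I2)
    fix x
    show "(\<lambda>i. ennreal (exp (\<delta> * x) * F (kn i x) (\<kappa>n i x)) * indicator {0..t} x) \<longlonglongrightarrow> ennreal (exp (\<delta> * x) * F (k x) (\<kappa> x)) * indicator {0..t} x"
    proof (cases "x \<in> {0..t}")
      case True
      have x: "0 \<le> x" using True by simp
      have "(\<lambda>i. f (kn i x) (\<kappa>n i x)) \<longlonglongrightarrow> f (k x) (\<kappa> x)"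
        by (rule f_tendsto[OF profile_nonneg[OF assms(3)] environment_range[OF assms(1)] assms(6)[OF x] assms(7)[OF x]])
      then have "(\<lambda>i. F (kn i x) (\<kappa>n i x)) \<longlonglongrightarrow> F (k x) (\<kappa> x)"
        unfolding F_def by (intro tendsto_add tendsto_mult tendsto_const assms(6)[OF x])
      then show ?thesis using True by (auto intro!: tendsto_intros tendsto_ennrealI)
    qed simp
  qed
qed

text \<open>
  The stock at time \<open>t\<close> if, with production still computed from \<open>k\<close>, nothing is wasted.
\<close>

definition supply_step :: "real \<Rightarrow> (real \<Rightarrow> real) \<Rightarrow> (real \<Rightarrow> real) \<Rightarrow> (real \<Rightarrow> real) \<Rightarrow> real \<Rightarrow> real" where
  "supply_step \<kappa>0 \<kappa> g k t =
     (if t < 0 then k t else exp (- \<delta> * t) * enn2real (ennreal \<kappa>0 + inflow \<kappa> k t - outflow g t))"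

lemma step_increases:
  assumes subsolution: "subsolution \<kappa>0 \<kappa> k g" and environment: "environment \<kappa>" and \<kappa>0: "0 \<le> \<kappa>0" "\<kappa>0 \<le> R"
  defines "h \<equiv> supply_step \<kappa>0 \<kappa> g k"
  shows "subsolution \<kappa>0 \<kappa> h g" "\<And>t. 0 \<le> t \<Longrightarrow> k t \<le> h t"
    "\<And>t. 0 \<le> t \<Longrightarrow> ennreal (exp (\<delta> * t) * h t) + outflow g t = ennreal \<kappa>0 + inflow \<kappa> k t"
proof -
  have pk: "profile k" and pg: "profile g" using subsolution by (auto simp: subsolution_def)
  have eq: "exp (\<delta> * t) * h t = \<kappa>0 + enn2real (inflow \<kappa> k t) - enn2real (outflow g t)"
    and h0: "0 \<le> h t" if t: "0 \<le> t" for t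
  proof -
    let ?i = "enn2real (inflow \<kappa> k t)" and ?o = "enn2real (outflow g t)"
    note s = subsolution_real[OF subsolution environment \<kappa>0 t]
    have "ennreal \<kappa>0 + inflow \<kappa> k t - outflow g t = ennreal (\<kappa>0 + ?i) - ennreal ?o"
      using s(1,2) \<kappa>0 by (simp add: ennreal_plus)
    also have "\<dots> = ennreal (\<kappa>0 + ?i - ?o)" by (rule ennreal_minus) simp
    finally have "ennreal \<kappa>0 + inflow \<kappa> k t - outflow g t = ennreal (\<kappa>0 + ?i - ?o)" .
    moreover have "enn2real (ennreal (\<kappa>0 + ?i - ?o)) = \<kappa>0 + ?i - ?o"
    proof (rule enn2real_ennreal)
      have "0 \<le> exp (\<delta> * t) * k t" using profile_nonneg[OF pk, of t] by simp
      then show "0 \<le> \<kappa>0 + ?i - ?o" using s(3) by linarith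
    qed
    ultimately have ht: "h t = exp (- \<delta> * t) * (\<kappa>0 + ?i - ?o)"
      using t by (simp add: h_def supply_step_def)
    then show "exp (\<delta> * t) * h t = \<kappa>0 + ?i - ?o"
      by (simp add: exp_minus field_simps)
    have "0 \<le> exp (\<delta> * t) * k t" using profile_nonneg[OF pk, of t] by simp
    then have "0 \<le> \<kappa>0 + ?i - ?o" using s(3) by linarith
    then show "0 \<le> h t" unfolding ht by simp
  qed
  show kh: "k t \<le> h t" if t: "0 \<le> t" for t
  proof -
    have "exp (\<delta> * t) * k t \<le> exp (\<delta> * t) * h t" using eq[OF t] subsolution_real(3)[OF subsolution environment \<kappa>0 t] by linarith
    then show ?thesis by simp
  qed
  show en: "ennreal (exp (\<delta> * t) * h t) + outflow g t = ennreal \<kappa>0 + inflow \<kappa> k t" if t: "0 \<le> t" for t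
  proof -
    let ?i = "enn2real (inflow \<kappa> k t)" and ?o = "enn2real (outflow g t)"
    note s = subsolution_real[OF subsolution environment \<kappa>0 t]
    have "ennreal (exp (\<delta> * t) * h t) + outflow g t = ennreal (exp (\<delta> * t) * h t + ?o)"
      using s(2) h0[OF t] by (simp add: ennreal_plus)
    also have "\<dots> = ennreal (\<kappa>0 + ?i)" using eq[OF t] by simp
    also have "\<dots> = ennreal \<kappa>0 + inflow \<kappa> k t" using s(1) \<kappa>0 by (simp add: ennreal_plus)
    finally show ?thesis .
  qed
  have ph: "profile h"
  proof -
    have [measurable]: "inflow \<kappa> k \<in> borel_measurable borel" "outflow g \<in> borel_measurable borel" "k \<in> borel_measurable borel"
      using inflow_measurable outflow_measurable environment pk pg profile_measurable by auto
    have "h \<in> borel_measurable borel" unfolding h_def supply_step_def[abs_def] by measurable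
    moreover have "0 \<le> h t" for t
      using h0[of t] profile_nonneg[OF pk, of t] by (cases "0 \<le> t") (auto simp: h_def supply_step_def)
    ultimately show ?thesis by (simp add: profile_def)
  qed
  have hR: "h t \<le> R" if t: "0 \<le> t" for t
  proof -
    have "enn2real (inflow \<kappa> k t) \<le> R * (exp (\<delta> * t) - 1)"
      using subsolution_inflow_le[OF subsolution environment \<kappa>0 t] pos t by (intro enn2real_leI) auto
    then have "enn2real (inflow \<kappa> k t) \<le> R * exp (\<delta> * t) - R" by (simp only: right_diff_distrib mult_1_right)
    then have "exp (\<delta> * t) * h t \<le> R * exp (\<delta> * t)"
      using eq[OF t] \<kappa>0 enn2real_nonneg[of "outflow g t"] by linarith
    then show ?thesis by simp
  qed
  show "subsolution \<kappa>0 \<kappa> h g"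
    unfolding subsolution_def
  proof (intro conjI ph pg allI impI)
    show "\<exists>B. \<forall>t\<in>{0..T}. h t \<le> B" for T by (rule exI[of _ R]) (simp add: hR)
    fix t :: real assume t: "0 \<le> t"
    have "inflow \<kappa> k t \<le> inflow \<kappa> h t" by (rule inflow_mono[OF environment pk]) (use kh in auto)
    then show "ennreal (exp (\<delta> * t) * h t) + outflow g t \<le> ennreal \<kappa>0 + inflow \<kappa> h t"
      unfolding en[OF t] by (rule add_left_mono)
  qed
qed

text \<open>
  Iterating \<open>supply_step\<close> increases the stock, because a larger stock produces more. The iterates
  stay below \<open>R\<close>, and at their limit the budget holds with equality.
\<close>

lemma no_waste:
  assumes subsolution: "subsolution \<kappa>0 \<kappa> k g" and environment: "environment \<kappa>" and \<kappa>0: "0 \<le> \<kappa>0" "\<kappa>0 \<le> R"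
  shows "\<exists>h. solution \<kappa>0 \<kappa> h g \<and> (\<forall>t\<ge>0. k t \<le> h t)"
proof -
  define q where "q n = (supply_step \<kappa>0 \<kappa> g ^^ n) k" for n
  have q0: "q 0 = k" and qS: "q (Suc n) = supply_step \<kappa>0 \<kappa> g (q n)" for n by (auto simp: q_def)
  have sq: "subsolution \<kappa>0 \<kappa> (q n) g" for n
    by (induction n) (use subsolution step_increases(1)[OF _ environment \<kappa>0] q0 qS in auto)
  have mono: "q n t \<le> q (Suc n) t" if "0 \<le> t" for n t
    using step_increases(2)[OF sq environment \<kappa>0 that] by (simp add: qS)
  have le: "q n t \<le> R" if "0 \<le> t" for n t using subsolution_le_R[OF sq environment \<kappa>0 that] .
  have nn: "0 \<le> q n t" for n t using sq by (auto simp: subsolution_def profile_def)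
  define h where "h t = (if t < 0 then 0 else lim (\<lambda>n. q n t))" for t
  have lim: "(\<lambda>n. q n t) \<longlonglongrightarrow> h t" if t: "0 \<le> t" for t
  proof -
    have "incseq (\<lambda>n. q n t)" using mono[OF t] by (rule incseq_SucI)
    then obtain l where "(\<lambda>n. q n t) \<longlonglongrightarrow> l" by (rule incseq_convergent[where B=R]) (use le[OF t] in auto)
    then have "convergent (\<lambda>n. q n t)" by (rule convergentI)
    then show ?thesis using t by (simp add: h_def convergent_LIMSEQ_iff)
  qed
  have hR: "0 \<le> h t \<and> h t \<le> R" if "0 \<le> t" for t
    using LIMSEQ_le_const[OF lim[OF that]] LIMSEQ_le_const2[OF lim[OF that]] nn le[OF that] by blast
  have "q n \<in> borel_measurable borel" for n using sq by (auto simp: subsolution_def profile_def)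
  then have "h \<in> borel_measurable borel" unfolding h_def by measurable
  moreover have "0 \<le> h t" for t using hR[of t] by (cases "0 \<le> t") (auto simp: h_def)
  ultimately have ph: "profile h" by (simp add: profile_def)
  have pg: "profile g" and pq: "profile (q n)" for n using sq by (auto simp: subsolution_def)
  have "ennreal (exp (\<delta> * t) * h t) + outflow g t = ennreal \<kappa>0 + inflow \<kappa> h t" if t: "0 \<le> t" for t
  proof (rule LIMSEQ_unique)
    show "(\<lambda>n. ennreal (exp (\<delta> * t) * q (Suc n) t) + outflow g t) \<longlonglongrightarrow> ennreal (exp (\<delta> * t) * h t) + outflow g t"
      by (intro tendsto_intros tendsto_ennrealI LIMSEQ_Suc lim t)
    have "(\<lambda>n. ennreal \<kappa>0 + inflow \<kappa> (q n) t) \<longlonglongrightarrow> ennreal \<kappa>0 + inflow \<kappa> h t"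
      by (intro tendsto_intros inflow_tendsto environment pq ph le lim)
    then show "(\<lambda>n. ennreal (exp (\<delta> * t) * q (Suc n) t) + outflow g t) \<longlonglongrightarrow> ennreal \<kappa>0 + inflow \<kappa> h t"
      using step_increases(3)[OF sq environment \<kappa>0 t] by (simp add: qS)
  qed
  moreover have "k t \<le> h t" if t: "0 \<le> t" for t
  proof (rule LIMSEQ_le_const[OF lim[OF t]])
    have "k t \<le> q n t" for n by (induction n) (use q0 mono[OF t] in \<open>auto intro: order_trans\<close>)
    then show "\<exists>N. \<forall>n\<ge>N. k t \<le> q n t" by blast
  qed
  moreover have "\<exists>B. \<forall>t\<in>{0..T}. h t \<le> B" for T by (rule exI[of _ R]) (simp add: hR)
  ultimately show ?thesis using ph pg unfolding solution_def
    by (intro exI[of _ h]) auto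
qed

text \<open>
  Postponing consumption is feasible: what has not yet been consumed is added to the stock.
\<close>

lemma subsolution_less_outflow:
  assumes subsolution: "subsolution \<kappa>0 \<kappa> k g" and environment: "environment \<kappa>" and \<kappa>0: "0 \<le> \<kappa>0" "\<kappa>0 \<le> R"
    and g2: "profile g2" and le: "\<And>t. 0 \<le> t \<Longrightarrow> outflow g2 t \<le> outflow g t"
  shows "\<exists>h. subsolution \<kappa>0 \<kappa> h g2"
proof -
  have pk: "profile k" and pg: "profile g" using subsolution by (auto simp: subsolution_def)
  define h where "h t = k t + exp (- \<delta> * t) * enn2real (outflow g t - outflow g2 t)" for t
  have kh: "k t \<le> h t" for t by (simp add: h_def)
  have ph: "profile h"
  proof -
    have [measurable]: "outflow g \<in> borel_measurable borel" "outflow g2 \<in> borel_measurable borel" "k \<in> borel_measurable borel"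
      using outflow_measurable g2 pk pg profile_measurable by auto
    have "h \<in> borel_measurable borel" unfolding h_def by measurable
    then show ?thesis using order_trans[OF profile_nonneg[OF pk] kh] by (simp add: profile_def)
  qed
  have diff: "outflow g t - outflow g2 t \<le> ennreal (R * exp (\<delta> * t))" if t: "0 \<le> t" for t
    by (rule order_trans[OF diff_le_self_ennreal subsolution_outflow_le[OF subsolution environment \<kappa>0 t]])
  have h2R: "h t \<le> 2 * R" if t: "0 \<le> t" for t
  proof -
    have "enn2real (outflow g t - outflow g2 t) \<le> R * exp (\<delta> * t)"
      using diff[OF t] pos by (intro enn2real_leI) auto
    then have "exp (- \<delta> * t) * enn2real (outflow g t - outflow g2 t) \<le> exp (- \<delta> * t) * (R * exp (\<delta> * t))"
      by (intro mult_left_mono) auto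
    also have "\<dots> = R" by (simp add: exp_minus field_simps)
    finally show ?thesis using subsolution_le_R[OF subsolution environment \<kappa>0 t] by (simp add: h_def)
  qed
  have "\<exists>B. \<forall>t\<in>{0..T}. h t \<le> B" for T by (rule exI[of _ "2 * R"]) (simp add: h2R)
  moreover have "ennreal (exp (\<delta> * t) * h t) + outflow g2 t \<le> ennreal \<kappa>0 + inflow \<kappa> h t" if t: "0 \<le> t" for t
  proof -
    let ?d = "outflow g t - outflow g2 t"
    have "ennreal (enn2real ?d) = ?d"
      using order.strict_trans1[OF diff[OF t] ennreal_less_top] by simp
    moreover have "exp (\<delta> * t) * h t = exp (\<delta> * t) * k t + enn2real ?d"
      by (simp add: h_def exp_minus field_simps)
    ultimately have "ennreal (exp (\<delta> * t) * h t) + outflow g2 t = ennreal (exp (\<delta> * t) * k t) + (?d + outflow g2 t)"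
      using profile_nonneg[OF pk, of t] by (simp add: ennreal_plus add.assoc)
    also have "?d + outflow g2 t = outflow g t" by (rule diff_add_cancel_ennreal[OF le[OF t]])
    also have "ennreal (exp (\<delta> * t) * k t) + outflow g t \<le> ennreal \<kappa>0 + inflow \<kappa> k t" using subsolution t by (simp add: subsolution_def)
    also have "\<dots> \<le> ennreal \<kappa>0 + inflow \<kappa> h t" by (intro add_left_mono inflow_mono[OF environment pk] kh)
    finally show ?thesis .
  qed
  ultimately have "subsolution \<kappa>0 \<kappa> h g2" using ph g2 unfolding subsolution_def by auto
  then show ?thesis by blast
qed

text \<open>
  By concavity, the slope of \<open>U\<close> below \<open>M\<close> is at least its slope between \<open>M\<close> and \<open>M + 1\<close>.
\<close>

lemma U_slope_lower:
  assumes "0 \<le> x" "0 \<le> y" "x + y \<le> M"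
  shows "U x + (U (M + 1) - U M) * y \<le> U (x + y)"
proof (cases "y = 0")
  case False
  then have y: "y > 0" using assms by simp
  let ?V = "\<lambda>x. - U x"
  have V: "convex_on {0..} ?V" using U_concave by (simp add: concave_on_def)
  have "(?V x - ?V (x + y)) / (x - (x + y)) \<le> (?V x - ?V (M + 1)) / (x - (M + 1))"
    by (rule convex_on_slope_le(1)[OF V]) (use assms y in auto)
  also have "\<dots> \<le> (?V M - ?V (M + 1)) / (M - (M + 1))"
    by (rule convex_on_slope_le(2)[OF V]) (use assms y in auto)
  finally have 1: "(?V x - ?V (x + y)) / (x - (x + y)) \<le> (?V M - ?V (M + 1)) / (M - (M + 1))" .
  have "(?V x - ?V (x + y)) / (x - (x + y)) = - ((U (x + y) - U x) / y)" by simp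
  moreover have "(?V M - ?V (M + 1)) / (M - (M + 1)) = - (U (M + 1) - U M)" by simp
  ultimately have "U (M + 1) - U M \<le> (U (x + y) - U x) / y" using 1 by linarith
  then have "(U (M + 1) - U M) * y \<le> U (x + y) - U x" using y by (simp only: pos_le_divide_eq)
  then show ?thesis by linarith
qed simp

text \<open>
  Consumption above a level \<open>\<Lambda>1\<close> at time \<open>s\<close> is spread over \<open>[s, s+1]\<close>. The outflow over a unit of
  time is bounded, so consumption is below \<open>m\<close> during at least half of \<open>[s, s+1]\<close>, and there each
  additional unit is worth at least \<open>p\<close>. If the slope of \<open>U\<close> beyond \<open>\<Lambda>1\<close> is at most \<open>p'\<close>, which is \<open>p\<close>
  times one half for the fraction of time and \<open>exp(- (r + \<delta>))\<close> for the delay, then the gain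
  outweighs the loss. The added consumption is at most \<open>R\<close>, so that the result is bounded by
  \<open>\<Lambda>1 + R\<close>.
\<close>

lemma truncation:
  obtains \<Lambda> where "\<Lambda> \<ge> 0" "\<And>\<kappa>0 \<kappa> k g. subsolution \<kappa>0 \<kappa> k g \<Longrightarrow> environment \<kappa> \<Longrightarrow> 0 \<le> \<kappa>0 \<Longrightarrow> \<kappa>0 \<le> R \<Longrightarrow>
    \<exists>h c. subsolution \<kappa>0 \<kappa> h c \<and> (\<forall>t. c t \<le> \<Lambda>) \<and> welfare g \<le> welfare c"
proof -
  (* m is twice the bound for the outflow over [s, s+1], divided by exp(\<delta> s), so that
     consumption exceeds m during at most half of the interval. *)
  define m where "m = 2 * R * exp \<delta>"
  have m: "m > 0" using pos by (simp add: m_def)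
  define p where "p = U (m + R + 1) - U (m + R)"
  have p: "p > 0" unfolding p_def using strict_mono_onD[OF U_mono, of "m + R" "m + R + 1"] m pos by simp
  let ?c = "r + \<delta>"
  (* A unit of weighted stock consumed at time u contributes with the factor exp(- (r + \<delta>) u). *)
  define p' where "p' = p * exp (- ?c) / 2"
  have p': "p' > 0" using p by (simp add: p'_def)
  obtain \<Lambda>1 where \<Lambda>1: "\<Lambda>1 \<ge> m" "\<And>x. x \<ge> \<Lambda>1 \<Longrightarrow> U x - U \<Lambda>1 \<le> p' * (x - \<Lambda>1)"
    using U_slope[OF p', of m] by auto
  have "\<exists>h c. subsolution \<kappa>0 \<kappa> h c \<and> (\<forall>t. c t \<le> \<Lambda>1 + R) \<and> welfare g \<le> welfare c"
    if subsolution: "subsolution \<kappa>0 \<kappa> k g" and environment: "environment \<kappa>" and \<kappa>0: "0 \<le> \<kappa>0" "\<kappa>0 \<le> R" for \<kappa>0 \<kappa> k g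
  proof -
    have pg: "profile g" using subsolution by (simp add: subsolution_def)
    have gm[measurable]: "g \<in> borel_measurable borel" and g0: "0 \<le> g t" for t using pg by (auto simp: profile_def)
    (* \<phi> is the weighted excess over \<Lambda>1, X its integral over the preceding unit of time, and x
       the resulting additional rate of consumption. *)
    define \<phi> where "\<phi> s = ennreal (exp (\<delta> * s) * max 0 (g s - \<Lambda>1)) * indicator {0..} s" for s
    have [measurable]: "\<phi> \<in> borel_measurable borel" unfolding \<phi>_def by measurable
    define X where "X t = (\<integral>\<^sup>+s\<in>{t - 1..t}. \<phi> s \<partial>lborel)" for t
    have [measurable]: "X \<in> borel_measurable borel" unfolding X_def by (rule running_integral_measurable) measurable
    have X_le: "X t \<le> ennreal (R * exp (\<delta> * t))" if t: "0 \<le> t" for t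
    proof -
      have "X t \<le> outflow g t"
        unfolding X_def outflow_def \<phi>_def using \<Lambda>1(1) m g0
        by (intro nn_integral_mono) (auto simp: indicator_def intro!: ennreal_leI)
      then show ?thesis using subsolution_outflow_le[OF subsolution environment \<kappa>0 t] by (rule order_trans)
    qed
    define x where "x t = (if 0 \<le> t then exp (- \<delta> * t) * enn2real (X t) else 0)" for t
    have [measurable]: "x \<in> borel_measurable borel" unfolding x_def by measurable
    have x0: "0 \<le> x t" for t by (simp add: x_def)
    have xX: "ennreal (exp (\<delta> * t) * x t) = X t" if t: "0 \<le> t" for t
      using order.strict_trans1[OF X_le[OF t] ennreal_less_top] t by (simp add: x_def exp_minus field_simps)
    have xR: "x t \<le> R" for t
    proof (cases "0 \<le> t")
      case True
      have "enn2real (X t) \<le> R * exp (\<delta> * t)" using X_le[OF True] pos by (intro enn2real_leI) auto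
      then have "exp (- \<delta> * t) * enn2real (X t) \<le> exp (- \<delta> * t) * (R * exp (\<delta> * t))" by (intro mult_left_mono) auto
      also have "\<dots> = R" by (simp add: exp_minus field_simps)
      finally show ?thesis using True by (simp add: x_def)
    qed (use pos in \<open>simp add: x_def\<close>)
    define c where "c t = min (g t) \<Lambda>1 + x t" for t
    have pc: "profile c" unfolding profile_def c_def using g0 x0 \<Lambda>1(1) m by (auto intro!: add_nonneg_nonneg)
    have c_le: "c t \<le> \<Lambda>1 + R" for t using xR[of t] by (simp add: c_def)
    have "outflow c t \<le> outflow g t" if t: "0 \<le> t" for t
    proof -
      have "outflow c t = (\<integral>\<^sup>+s. ennreal (exp (\<delta> * s) * min (g s) \<Lambda>1) * indicator {0..t} s + X s * indicator {0..t} s \<partial>lborel)"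
        unfolding outflow_def c_def using g0 x0 \<Lambda>1(1) m
        by (intro nn_integral_cong) (auto simp: indicator_def distrib_left ennreal_plus xX)
      also have "\<dots> = (\<integral>\<^sup>+s\<in>{0..t}. ennreal (exp (\<delta> * s) * min (g s) \<Lambda>1) \<partial>lborel) + (\<integral>\<^sup>+s\<in>{0..t}. X s \<partial>lborel)"
        by (rule nn_integral_add) measurable
      also have "(\<integral>\<^sup>+u\<in>{0..t}. X u \<partial>lborel) \<le> (\<integral>\<^sup>+s\<in>{0..t}. \<phi> s \<partial>lborel)"
      proof -
        define J where "J s u = \<phi> s * indicator {u - 1..u} s * indicator {0..t} u" for s u :: real
        have J: "case_prod J \<in> borel_measurable (lborel \<Otimes>\<^sub>M lborel)"
          unfolding J_def indicator_def atLeastAtMost_iff of_bool_def by measurable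
        have "(\<integral>\<^sup>+u\<in>{0..t}. X u \<partial>lborel) = (\<integral>\<^sup>+u. \<integral>\<^sup>+s. J s u \<partial>lborel \<partial>lborel)"
          unfolding J_def X_def by (subst nn_integral_multc) auto
        also have "\<dots> = (\<integral>\<^sup>+s. \<integral>\<^sup>+u. J s u \<partial>lborel \<partial>lborel)" by (rule lborel_pair.Fubini'[OF J])
        also have "\<dots> \<le> (\<integral>\<^sup>+s\<in>{0..t}. \<phi> s \<partial>lborel)"
        proof (rule nn_integral_mono)
          fix s :: real
          have "(\<integral>\<^sup>+u. J s u \<partial>lborel) \<le> (\<integral>\<^sup>+u. (\<phi> s * indicator {0..t} s) * indicator {s..s + 1} u \<partial>lborel)"
            by (intro nn_integral_mono) (auto simp: J_def \<phi>_def indicator_def)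
          also have "\<dots> = \<phi> s * indicator {0..t} s" by (subst nn_integral_cmult) auto
          finally show "(\<integral>\<^sup>+u. J s u \<partial>lborel) \<le> \<phi> s * indicator {0..t} s" .
        qed
        finally show ?thesis .
      qed
      also have "(\<integral>\<^sup>+s\<in>{0..t}. ennreal (exp (\<delta> * s) * min (g s) \<Lambda>1) \<partial>lborel) + (\<integral>\<^sup>+s\<in>{0..t}. \<phi> s \<partial>lborel)
        = (\<integral>\<^sup>+s. ennreal (exp (\<delta> * s) * min (g s) \<Lambda>1) * indicator {0..t} s + \<phi> s * indicator {0..t} s \<partial>lborel)"
        by (rule nn_integral_add[symmetric]) measurable
      also have "\<dots> = outflow g t"
        unfolding outflow_def \<phi>_def using g0 \<Lambda>1(1) m
        by (intro nn_integral_cong) (auto simp: indicator_def min_def max_def algebra_simps simp flip: ennreal_plus)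
      finally show ?thesis by (auto intro: add_left_mono)
    qed
    from subsolution_less_outflow[OF subsolution environment \<kappa>0 pc this] obtain h where h: "subsolution \<kappa>0 \<kappa> h c" by blast
    define L where "L = (\<integral>\<^sup>+t\<in>{0..}. ennreal (exp (- r * t) * (p' * max 0 (g t - \<Lambda>1))) \<partial>lborel)"
    (* L bounds the loss of welfare at times of excess, G the gain at times of moderate
       consumption. *)
    define A where "A = {t. g t < m}"
    have [measurable]: "A \<in> sets borel" unfolding A_def by measurable
    define G where "G = (\<integral>\<^sup>+t. ennreal (exp (- r * t) * (p * x t)) * indicator A t * indicator {0..} t \<partial>lborel)"
    have pointwise: "U (g t) + p * x t * indicator A t \<le> U (c t) + p' * max 0 (g t - \<Lambda>1)" for t
    proof -
      consider "g t < m" | "m \<le> g t" "g t < \<Lambda>1" | "\<Lambda>1 \<le> g t" by linarith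
      then show ?thesis
      proof cases
        case 1
        have "U (g t) + p * x t \<le> U (g t + x t)"
          unfolding p_def by (rule U_slope_lower) (use 1 g0 x0 xR[of t] in auto)
        moreover have "c t = g t + x t" using 1 \<Lambda>1(1) by (simp add: c_def)
        ultimately show ?thesis using 1 \<Lambda>1(1) by (simp add: A_def)
      next
        case 2
        then have "U (g t) \<le> U (c t)" using g0 x0 by (intro U_le) (auto simp: c_def)
        then show ?thesis using 2 by (simp add: A_def)
      next
        case 3
        have "U \<Lambda>1 \<le> U (c t)" using 3 x0 \<Lambda>1(1) m by (intro U_le) (auto simp: c_def)
        then show ?thesis using \<Lambda>1(2)[OF 3] 3 \<Lambda>1(1) by (simp add: A_def)
      qed
    qed
    have Um[measurable]: "(\<lambda>t. U (g t)) \<in> borel_measurable borel" "(\<lambda>t. U (c t)) \<in> borel_measurable borel"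
      using U_measurable pg pc by auto
    have "welfare g + G = (\<integral>\<^sup>+t. ennreal (exp (- r * t) * U (g t)) * indicator {0..} t + ennreal (exp (- r * t) * (p * x t)) * indicator A t * indicator {0..} t \<partial>lborel)"
      unfolding welfare_def G_def by (rule nn_integral_add[symmetric]) measurable
    also have "\<dots> \<le> (\<integral>\<^sup>+t. ennreal (exp (- r * t) * U (c t)) * indicator {0..} t + ennreal (exp (- r * t) * (p' * max 0 (g t - \<Lambda>1))) * indicator {0..} t \<partial>lborel)"
    proof (rule nn_integral_mono)
      fix t
      have "ennreal (exp (- r * t) * (U (g t) + p * x t * indicator A t)) \<le> ennreal (exp (- r * t) * (U (c t) + p' * max 0 (g t - \<Lambda>1)))"
        by (intro ennreal_leI mult_left_mono pointwise) simp
      then show "ennreal (exp (- r * t) * U (g t)) * indicator {0..} t + ennreal (exp (- r * t) * (p * x t)) * indicator A t * indicator {0..} t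
        \<le> ennreal (exp (- r * t) * U (c t)) * indicator {0..} t + ennreal (exp (- r * t) * (p' * max 0 (g t - \<Lambda>1))) * indicator {0..} t"
        using U_nonneg[OF g0, of t] U_nonneg[OF profile_nonneg[OF pc], of t] p p' x0[of t]
        by (auto simp: indicator_def distrib_left ennreal_plus)
    qed
    also have "\<dots> = welfare c + L"
      unfolding welfare_def L_def by (rule nn_integral_add) measurable
    finally have 1: "welfare g + G \<le> welfare c + L" .
    have L_fin: "L < top"
    proof -
      have "L \<le> (\<integral>\<^sup>+t. ennreal p' * (ennreal (exp (- r * t) * g t) * indicator {0..} t) \<partial>lborel)"
        unfolding L_def using p' g0 \<Lambda>1(1) m
        by (intro nn_integral_mono) (auto simp: indicator_def mult_ac simp flip: ennreal_mult'' intro!: ennreal_leI mult_left_mono)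
      also have "\<dots> = ennreal p' * (\<integral>\<^sup>+t\<in>{0..}. ennreal (exp (- r * t) * g t) \<partial>lborel)"
        by (rule nn_integral_cmult) measurable
      also have "\<dots> \<le> ennreal p' * ennreal ((r + \<delta>) * R / r)"
        by (intro mult_left_mono discounted_consumption_le[OF subsolution environment \<kappa>0]) simp
      also have "\<dots> < top" by (simp add: ennreal_mult_less_top)
      finally show ?thesis .
    qed
    have "L \<le> G"
    proof -
      define J where "J s u = \<phi> s * indicator {u - 1..u} s * (ennreal (p * exp (- ?c * u)) * indicator A u * indicator {0..} u)" for s u :: real
      have J: "case_prod J \<in> borel_measurable (lborel \<Otimes>\<^sub>M lborel)"
        unfolding J_def indicator_def atLeastAtMost_iff of_bool_def by measurable
      have "G = (\<integral>\<^sup>+u. X u * (ennreal (p * exp (- ?c * u)) * indicator A u * indicator {0..} u) \<partial>lborel)"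
        unfolding G_def
      proof (rule nn_integral_cong)
        fix t
        have "ennreal (exp (- r * t) * (p * x t)) = X t * ennreal (p * exp (- ?c * t))" if "0 \<le> t"
        proof -
          have "exp (- r * t) * (p * x t) = (exp (\<delta> * t) * x t) * (p * exp (- ?c * t))"
          proof -
            have "exp (- r * t) = exp (\<delta> * t) * exp (- ?c * t)" unfolding exp_add[symmetric] by (simp add: algebra_simps)
            then show ?thesis by simp
          qed
          then have "ennreal (exp (- r * t) * (p * x t)) = ennreal (exp (\<delta> * t) * x t) * ennreal (p * exp (- ?c * t))"
            using p by (simp only: ennreal_mult'' exp_ge_zero mult_nonneg_nonneg less_imp_le)
          then show ?thesis unfolding xX[OF that] .
        qed
        then show "ennreal (exp (- r * t) * (p * x t)) * indicator A t * indicator {0..} t = X t * (ennreal (p * exp (- ?c * t)) * indicator A t * indicator {0..} t)"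
          by (auto simp: indicator_def)
      qed
      also have "\<dots> = (\<integral>\<^sup>+u. \<integral>\<^sup>+s. J s u \<partial>lborel \<partial>lborel)"
        unfolding J_def X_def by (subst nn_integral_multc) auto
      also have "\<dots> = (\<integral>\<^sup>+s. \<integral>\<^sup>+u. J s u \<partial>lborel \<partial>lborel)" by (rule lborel_pair.Fubini'[OF J])
      also have "\<dots> \<ge> (\<integral>\<^sup>+s. \<phi> s * ennreal (p' * exp (- ?c * s)) \<partial>lborel)"
      proof (rule nn_integral_mono)
        fix s :: real
        show "\<phi> s * ennreal (p' * exp (- ?c * s)) \<le> (\<integral>\<^sup>+u. J s u \<partial>lborel)"
        proof (cases "0 \<le> s")
          case False
          then show ?thesis by (simp add: \<phi>_def)
        next
          case True
          let ?B = "{s..s + 1} \<inter> A" and ?C = "{s..s + 1} - A"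
          define q where "q = m * exp (\<delta> * s)"
          have q: "q > 0" using m by (simp add: q_def)
          have "ennreal q * emeasure lborel ?C = (\<integral>\<^sup>+u. ennreal q * indicator ?C u \<partial>lborel)"
            by (subst nn_integral_cmult) auto
          also have "\<dots> \<le> outflow g (s + 1)"
            unfolding outflow_def
          proof (rule nn_integral_mono)
            fix u
            have "q \<le> exp (\<delta> * u) * g u" if "u \<in> ?C"
            proof -
              have "m * exp (\<delta> * s) \<le> g u * exp (\<delta> * u)" using that m pos by (intro mult_mono) (auto simp: A_def)
              then show ?thesis by (simp add: q_def mult.commute)
            qed
            then show "ennreal q * indicator ?C u \<le> ennreal (exp (\<delta> * u) * g u) * indicator {0..s + 1} u"
              using True by (auto simp: indicator_def intro!: ennreal_leI)
          qed
          also have "\<dots> \<le> ennreal (R * exp (\<delta> * (s + 1)))" using True by (intro subsolution_outflow_le[OF subsolution environment \<kappa>0]) simp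
          also have "R * exp (\<delta> * (s + 1)) = q * (1 / 2)" by (simp add: q_def m_def distrib_left exp_add)
          also have "ennreal (q * (1 / 2)) = ennreal q * ennreal (1 / 2)" by (rule ennreal_mult) (use q in auto)
          finally have "ennreal q * emeasure lborel ?C \<le> ennreal q * ennreal (1 / 2)" .
          then have C: "emeasure lborel ?C \<le> ennreal (1 / 2)"
            by (rule ennreal_mult_le_mult_iff[THEN iffD1, rotated 2]) (use q in auto)
          have "emeasure lborel ?B + emeasure lborel ?C = emeasure lborel (?B \<union> ?C)"
            by (intro plus_emeasure) auto
          also have "?B \<union> ?C = {s..s + 1}" by auto
          finally have BC: "emeasure lborel ?B + emeasure lborel ?C = 1" by simp
          have B: "ennreal (1 / 2) \<le> emeasure lborel ?B"
          proof -
            have "ennreal (1 / 2) + ennreal (1 / 2) = emeasure lborel ?C + emeasure lborel ?B"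
              unfolding add.commute[of "emeasure lborel ?C"] BC by (subst ennreal_plus[symmetric]) auto
            also have "\<dots> \<le> ennreal (1 / 2) + emeasure lborel ?B" by (rule add_right_mono[OF C])
            finally show ?thesis unfolding ennreal_add_left_cancel_le by simp
          qed
          have "p' * exp (- ?c * s) = p * exp (- ?c * (s + 1)) * (1 / 2)"
          proof -
            have "exp (- ?c * (s + 1)) = exp (- ?c * s) * exp (- ?c)"
              unfolding exp_add[symmetric] by (simp add: algebra_simps)
            then show ?thesis unfolding p'_def by simp
          qed
          then have "\<phi> s * ennreal (p' * exp (- ?c * s)) = \<phi> s * ennreal (p * exp (- ?c * (s + 1))) * ennreal (1 / 2)"
          proof -
            note e = \<open>p' * exp (- ?c * s) = p * exp (- ?c * (s + 1)) * (1 / 2)\<close>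
            have "ennreal (p * exp (- ?c * (s + 1)) * (1 / 2)) = ennreal (p * exp (- ?c * (s + 1))) * ennreal (1 / 2)"
              by (rule ennreal_mult) (use p in auto)
            then show ?thesis by (simp only: e mult.assoc)
          qed
          also have "\<dots> \<le> \<phi> s * ennreal (p * exp (- ?c * (s + 1))) * emeasure lborel ?B"
            by (intro mult_left_mono B) simp
          also have "\<dots> = (\<integral>\<^sup>+u. \<phi> s * ennreal (p * exp (- ?c * (s + 1))) * indicator ?B u \<partial>lborel)"
            by (subst nn_integral_cmult) auto
          also have "\<dots> \<le> (\<integral>\<^sup>+u. J s u \<partial>lborel)"
          proof (rule nn_integral_mono)
            fix u
            show "\<phi> s * ennreal (p * exp (- ?c * (s + 1))) * indicator ?B u \<le> J s u"
            proof (cases "u \<in> ?B")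
              case inB: True
              have "exp (- ?c * (s + 1)) \<le> exp (- ?c * u)" using inB pos by simp
              then have "ennreal (p * exp (- ?c * (s + 1))) \<le> ennreal (p * exp (- ?c * u))"
                using p by (intro ennreal_leI mult_left_mono) auto
              then show ?thesis using inB True by (auto simp: J_def indicator_def intro!: mult_left_mono)
            qed simp
          qed
          finally show ?thesis .
        qed
      qed
      also have "(\<integral>\<^sup>+s. \<phi> s * ennreal (p' * exp (- ?c * s)) \<partial>lborel) = L"
        unfolding L_def
      proof (rule nn_integral_cong)
        fix t
        have "exp (\<delta> * t) * max 0 (g t - \<Lambda>1) * (p' * exp (- ?c * t)) = exp (- r * t) * (p' * max 0 (g t - \<Lambda>1))"
        proof -
          have "exp (- r * t) = exp (\<delta> * t) * exp (- ?c * t)" unfolding exp_add[symmetric] by (simp add: algebra_simps)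
          then show ?thesis by simp
        qed
        then show "\<phi> t * ennreal (p' * exp (- ?c * t)) = ennreal (exp (- r * t) * (p' * max 0 (g t - \<Lambda>1))) * indicator {0..} t"
          using p' by (auto simp: \<phi>_def indicator_def simp flip: ennreal_mult'')
      qed
      finally show ?thesis .
    qed
    then have "L + welfare g \<le> L + welfare c" using 1 by (metis add.commute add_left_mono order_trans)
    then have "welfare g \<le> welfare c" using L_fin by (auto simp: ennreal_add_left_cancel_le)
    then show ?thesis using h c_le by blast
  qed
  then show thesis by (intro that[of "\<Lambda>1 + R"]) (use \<Lambda>1(1) m pos in auto)
qed

end

section \<open>Limits of solutions\<close>

lemma ennreal_double_le_cancel:
  fixes x y :: ennreal
  assumes "x + x \<le> y + y"
  shows "x \<le> y"
proof (rule ccontr)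
  assume "\<not> x \<le> y"
  then have yx: "y < x" by simp
  then have "y \<noteq> \<infinity>" by (auto simp: infinity_ennreal_def)
  then have "y + y < y + x" using yx by (simp add: ennreal_add_left_cancel_less)
  also have "\<dots> \<le> x + x" using yx by (intro add_right_mono) simp
  finally show False using assms by simp
qed

lemma Liminf_le_limit_of_blocks:
  fixes u :: "nat \<Rightarrow> ennreal"
  assumes a: "strict_mono a" and le: "\<And>n. (INF j\<in>{a n..}. u j) \<le> w n" and w: "w \<longlonglongrightarrow> l"
  shows "liminf u \<le> l"
proof -
  have "(\<lambda>n. INF j\<in>{n..}. u j) \<longlonglongrightarrow> (SUP n. INF j\<in>{n..}. u j)"
    by (rule LIMSEQ_SUP) (auto simp: incseq_def intro!: INF_superset_mono)
  then have "((\<lambda>n. INF j\<in>{n..}. u j) \<circ> a) \<longlonglongrightarrow> liminf u"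
    unfolding liminf_SUP_INF by (rule LIMSEQ_subseq_LIMSEQ[OF _ a])
  then show ?thesis
    by (rule LIMSEQ_le[OF _ w]) (use le in auto)
qed

lemma Limsup_ge_limit_of_blocks:
  fixes u :: "nat \<Rightarrow> ennreal"
  assumes a: "strict_mono a" and le: "\<And>n. w n \<le> (SUP j\<in>{a n..}. u j)" and w: "w \<longlonglongrightarrow> l"
  shows "l \<le> limsup u"
proof -
  have "(\<lambda>n. SUP j\<in>{n..}. u j) \<longlonglongrightarrow> (INF n. SUP j\<in>{n..}. u j)"
    by (rule LIMSEQ_INF) (auto simp: decseq_def intro!: SUP_subset_mono)
  then have "((\<lambda>n. SUP j\<in>{n..}. u j) \<circ> a) \<longlonglongrightarrow> limsup u"
    unfolding limsup_INF_SUP by (rule LIMSEQ_subseq_LIMSEQ[OF _ a])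
  from LIMSEQ_le[OF w this] show ?thesis using le by auto
qed

context individual_problem
begin

lemma U_midpoint:
  assumes "0 \<le> x" "0 \<le> y" shows "(U x + U y) / 2 \<le> U ((x + y) / 2)"
  using concave_onD[OF U_concave, of "1/2" x y] assms by (simp add: field_simps)

lemma welfare_midpoint:
  assumes "profile u" "profile v" shows "welfare u + welfare v \<le> welfare (\<lambda>t. (u t + v t) / 2) + welfare (\<lambda>t. (u t + v t) / 2)"
proof -
  let ?w = "\<lambda>t. (u t + v t) / 2"
  have w: "profile ?w" using assms by (auto simp: profile_def)
  have [measurable]: "(\<lambda>t. U (u t)) \<in> borel_measurable borel" "(\<lambda>t. U (v t)) \<in> borel_measurable borel" "(\<lambda>t. U (?w t)) \<in> borel_measurable borel"
    using U_measurable assms w by auto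
  have "welfare u + welfare v = (\<integral>\<^sup>+t. ennreal (exp (- r * t) * U (u t)) * indicator {0..} t + ennreal (exp (- r * t) * U (v t)) * indicator {0..} t \<partial>lborel)"
    unfolding welfare_def by (rule nn_integral_add[symmetric]) measurable
  also have "\<dots> \<le> (\<integral>\<^sup>+t. ennreal (exp (- r * t) * U (?w t)) * indicator {0..} t + ennreal (exp (- r * t) * U (?w t)) * indicator {0..} t \<partial>lborel)"
  proof (rule nn_integral_mono)
    fix t
    have nn: "0 \<le> U (u t)" "0 \<le> U (v t)" "0 \<le> U (?w t)" using U_nonneg profile_nonneg assms w by auto
    have "U (u t) + U (v t) \<le> U (?w t) + U (?w t)" using U_midpoint[of "u t" "v t"] profile_nonneg assms by auto
    then have "exp (- r * t) * (U (u t) + U (v t)) \<le> exp (- r * t) * (U (?w t) + U (?w t))"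
      by (intro mult_left_mono) auto
    then have "ennreal (exp (- r * t) * U (u t) + exp (- r * t) * U (v t)) \<le> ennreal (exp (- r * t) * U (?w t) + exp (- r * t) * U (?w t))"
      by (intro ennreal_leI) (simp only: distrib_left)
    then have "ennreal (exp (- r * t) * U (u t)) + ennreal (exp (- r * t) * U (v t)) \<le> ennreal (exp (- r * t) * U (?w t)) + ennreal (exp (- r * t) * U (?w t))"
      using nn by (subst (asm) (1 2) ennreal_plus) (auto intro: mult_nonneg_nonneg)
    then show "ennreal (exp (- r * t) * U (u t)) * indicator {0..} t + ennreal (exp (- r * t) * U (v t)) * indicator {0..} t
       \<le> ennreal (exp (- r * t) * U (?w t)) * indicator {0..} t + ennreal (exp (- r * t) * U (?w t)) * indicator {0..} t"
      by (cases "0 \<le> t") (simp_all only: indicator_simps atLeast_iff mult_1_right mult_zero_right simp_thms)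
  qed
  also have "\<dots> = welfare ?w + welfare ?w" unfolding welfare_def by (rule nn_integral_add) measurable
  finally show ?thesis .
qed

lemma outflow_midpoint:
  assumes "profile u" "profile v"
  shows "outflow u t + outflow v t = outflow (\<lambda>t. (u t + v t) / 2) t + outflow (\<lambda>t. (u t + v t) / 2) t"
proof -
  let ?w = "\<lambda>t. (u t + v t) / 2"
  have [measurable]: "u \<in> borel_measurable borel" "v \<in> borel_measurable borel" using assms by (auto simp: profile_def)
  have nn: "0 \<le> u t" "0 \<le> v t" for t using assms by (auto simp: profile_def)
  have "outflow u t + outflow v t = (\<integral>\<^sup>+s. ennreal (exp (\<delta> * s) * u s) * indicator {0..t} s + ennreal (exp (\<delta> * s) * v s) * indicator {0..t} s \<partial>lborel)"
    unfolding outflow_def by (rule nn_integral_add[symmetric]) measurable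
  also have "\<dots> = (\<integral>\<^sup>+s. ennreal (exp (\<delta> * s) * ?w s) * indicator {0..t} s + ennreal (exp (\<delta> * s) * ?w s) * indicator {0..t} s \<partial>lborel)"
    using nn by (intro nn_integral_cong) (auto simp: indicator_def distrib_left add_divide_distrib simp flip: ennreal_plus)
  also have "\<dots> = outflow ?w t + outflow ?w t" unfolding outflow_def by (rule nn_integral_add) measurable
  finally show ?thesis .
qed

lemma outflow_tendsto:
  assumes "\<And>n. profile (gn n)" "profile g" "\<And>n s. gn n s \<le> \<Lambda>" "AE s in lborel. 0 \<le> s \<longrightarrow> (\<lambda>n. gn n s) \<longlonglongrightarrow> g s" "0 \<le> t"
  shows "(\<lambda>n. outflow (gn n) t) \<longlonglongrightarrow> outflow g t"
  unfolding outflow_def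
proof (rule nn_integral_dominated_convergence[where w="\<lambda>s. ennreal (exp (\<delta> * s) * \<Lambda>) * indicator {0..t} s"])
  have [measurable]: "g \<in> borel_measurable borel" "gn n \<in> borel_measurable borel" for n
    using assms profile_measurable by auto
  have \<Lambda>: "0 \<le> \<Lambda>" using order_trans[OF profile_nonneg[OF assms(1)] assms(3)] .
  show "(\<lambda>s. ennreal (exp (\<delta> * s) * gn i s) * indicator {0..t} s) \<in> borel_measurable lborel" for i by measurable
  show "(\<lambda>s. ennreal (exp (\<delta> * s) * g s) * indicator {0..t} s) \<in> borel_measurable lborel" by measurable
  show "(\<lambda>s. ennreal (exp (\<delta> * s) * \<Lambda>) * indicator {0..t} s) \<in> borel_measurable lborel" by measurable
  show "AE s in lborel. ennreal (exp (\<delta> * s) * gn j s) * indicator {0..t} s \<le> ennreal (exp (\<delta> * s) * \<Lambda>) * indicator {0..t} s" for j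
    by (intro AE_I2 mult_right_mono ennreal_leI mult_left_mono assms(3)) auto
  show "(\<integral>\<^sup>+s\<in>{0..t}. ennreal (exp (\<delta> * s) * \<Lambda>) \<partial>lborel) < \<infinity>"
    using pos assms(5) \<Lambda> by (subst nn_integral_exp_Icc) auto
  show "AE s in lborel. (\<lambda>i. ennreal (exp (\<delta> * s) * gn i s) * indicator {0..t} s) \<longlonglongrightarrow> ennreal (exp (\<delta> * s) * g s) * indicator {0..t} s"
    using assms(4)
  proof eventually_elim
    case (elim s)
    then show ?case by (cases "s \<in> {0..t}") (auto intro!: tendsto_intros tendsto_ennrealI)
  qed
qed

lemma welfare_tendsto:
  assumes "\<And>n. profile (gn n)" "profile g" "\<And>n s. gn n s \<le> \<Lambda>" "AE s in lborel. 0 \<le> s \<longrightarrow> (\<lambda>n. gn n s) \<longlonglongrightarrow> g s"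
  shows "(\<lambda>n. welfare (gn n)) \<longlonglongrightarrow> welfare g"
  unfolding welfare_def
proof (rule nn_integral_dominated_convergence[where w="\<lambda>s. ennreal (exp (- r * s) * U \<Lambda>) * indicator {0..} s"])
  have [measurable]: "(\<lambda>t. U (g t)) \<in> borel_measurable borel" "(\<lambda>t. U (gn n t)) \<in> borel_measurable borel" for n
    using U_measurable assms(1,2) by auto
  have \<Lambda>: "0 \<le> \<Lambda>" using order_trans[OF profile_nonneg[OF assms(1)] assms(3)] .
  show "(\<lambda>s. ennreal (exp (- r * s) * U (gn i s)) * indicator {0..} s) \<in> borel_measurable lborel" for i by measurable
  show "(\<lambda>s. ennreal (exp (- r * s) * U (g s)) * indicator {0..} s) \<in> borel_measurable lborel" by measurable
  show "(\<lambda>s. ennreal (exp (- r * s) * U \<Lambda>) * indicator {0..} s) \<in> borel_measurable lborel" by measurable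
  show "AE s in lborel. ennreal (exp (- r * s) * U (gn j s)) * indicator {0..} s \<le> ennreal (exp (- r * s) * U \<Lambda>) * indicator {0..} s" for j
    by (intro AE_I2 mult_right_mono ennreal_leI mult_left_mono U_le assms(3) profile_nonneg[OF assms(1)]) auto
  show "(\<integral>\<^sup>+s\<in>{0..}. ennreal (exp (- r * s) * U \<Lambda>) \<partial>lborel) < \<infinity>"
    by (subst payoff_const[OF U_nonneg[OF \<Lambda>]]) simp
  show "AE s in lborel. (\<lambda>i. ennreal (exp (- r * s) * U (gn i s)) * indicator {0..} s) \<longlonglongrightarrow> ennreal (exp (- r * s) * U (g s)) * indicator {0..} s"
    using assms(4)
  proof eventually_elim
    case (elim s)
    show ?case
    proof (cases "0 \<le> s")
      case True
      have "(\<lambda>i. U (gn i s)) \<longlonglongrightarrow> U (g s)"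
        by (rule continuous_on_tendsto_compose[OF U_cont]) (use True elim profile_nonneg[OF assms(1)] profile_nonneg[OF assms(2)] in auto)
      then show ?thesis using True by (auto intro!: tendsto_intros tendsto_ennrealI)
    qed simp
  qed
qed

text \<open>
  Apply \<open>midpoint_closed_AE_convergent\<close> to the sets of controls whose outflow at every time lies
  between the infimum and the supremum over the tail of the sequence, and whose welfare is at
  least the infimum over the tail. The former condition passes to midpoints by linearity, the
  latter by concavity of \<open>U\<close>.
\<close>

lemma bounded_controls_limit:
  assumes g: "\<And>n. profile (g n)" "\<And>n t. g n t \<le> \<Lambda>"
  shows "\<exists>c. profile c \<and> (\<forall>t. c t \<le> \<Lambda>) \<and>
    (\<forall>t\<ge>0. \<forall>L. (\<lambda>n. outflow (g n) t) \<longlonglongrightarrow> L \<longrightarrow> outflow c t = L) \<and> liminf (\<lambda>n. welfare (g n)) \<le> welfare c"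
proof -
  define M where "M = density lborel (\<lambda>t. ennreal (exp (- r * t)) * indicator {0..} t)"
  have "emeasure M (space M) = (\<integral>\<^sup>+t\<in>{0..}. ennreal (exp (- r * t)) \<partial>lborel)"
    unfolding M_def by (subst emeasure_density) auto
  also have "\<dots> = ennreal (exp (- r * 0) / r)" by (rule nn_integral_exp_atLeast[OF pos(6)])
  finally have emM: "emeasure M (space M) = ennreal (exp (- r * 0) / r)" .
  have M: "finite_measure M" by (rule finite_measureI) (simp add: emM)
  have setsM: "sets M = sets borel" by (simp add: M_def)
  have bm: "u \<in> borel_measurable M \<longleftrightarrow> u \<in> borel_measurable borel" for u :: "real \<Rightarrow> real"
    using setsM measurable_cong_sets by blast
  define X where "X n = {u. profile u \<and> (\<forall>t. u t \<le> \<Lambda>) \<and>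
     (\<forall>t\<ge>0. (INF j\<in>{n..}. outflow (g j) t) \<le> outflow u t \<and> outflow u t \<le> (SUP j\<in>{n..}. outflow (g j) t)) \<and>
     (INF j\<in>{n..}. welfare (g j)) \<le> welfare u}" for n
  have "\<exists>a w u. strict_mono (a::nat\<Rightarrow>nat) \<and> (\<forall>n. w n \<in> X (a n)) \<and> u \<in> borel_measurable M \<and>
    (\<forall>x. 0 \<le> u x \<and> u x \<le> \<Lambda>) \<and> (AE x in M. (\<lambda>n. w n x) \<longlonglongrightarrow> u x)"
  proof (rule midpoint_closed_AE_convergent[OF M])
    show "u \<in> borel_measurable M" if "u \<in> X n" for n u using that by (auto simp: X_def profile_def bm)
    show "0 \<le> u x \<and> u x \<le> \<Lambda>" if "u \<in> X n" for n u x using that by (auto simp: X_def profile_def)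
    show "X n \<noteq> {}" for n
    proof -
      have "g n \<in> X n" using g by (auto simp: X_def intro!: INF_lower SUP_upper)
      then show ?thesis by blast
    qed
    show "decseq X"
    proof (rule decseq_SucI, rule subsetI)
      fix n u assume u: "u \<in> X (Suc n)"
      have i: "(INF j\<in>{n..}. h j) \<le> (INF j\<in>{Suc n..}. h j)" and s: "(SUP j\<in>{Suc n..}. h j) \<le> (SUP j\<in>{n..}. h j)"
        for h :: "nat \<Rightarrow> ennreal"
        by (rule INF_superset_mono SUP_subset_mono; auto)+
      show "u \<in> X n"
        unfolding X_def
      proof (intro CollectI conjI allI impI)
        show "profile u" "u t \<le> \<Lambda>" for t using u by (simp_all add: X_def)
        show "(INF j\<in>{n..}. outflow (g j) t) \<le> outflow u t" if "0 \<le> t" for t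
          by (rule order_trans[OF i]) (use u that in \<open>simp add: X_def\<close>)
        show "outflow u t \<le> (SUP j\<in>{n..}. outflow (g j) t)" if "0 \<le> t" for t
          by (rule order_trans[OF _ s]) (use u that in \<open>simp add: X_def\<close>)
        show "(INF j\<in>{n..}. welfare (g j)) \<le> welfare u"
          by (rule order_trans[OF i]) (use u in \<open>simp add: X_def\<close>)
      qed
    qed
    fix n u v assume uv: "u \<in> X n" "v \<in> X n"
    let ?w = "\<lambda>x. (u x + v x) / 2"
    have p: "profile u" "profile v" using uv by (auto simp: X_def)
    have "profile ?w" using p by (auto simp: profile_def)
    moreover have "?w t \<le> \<Lambda>" for t
    proof -
      have "u t \<le> \<Lambda>" "v t \<le> \<Lambda>" using uv by (auto simp: X_def)
      then show ?thesis by simp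
    qed
    moreover have "(INF j\<in>{n..}. outflow (g j) t) \<le> outflow ?w t" "outflow ?w t \<le> (SUP j\<in>{n..}. outflow (g j) t)" if "0 \<le> t" for t
    proof -
      show "(INF j\<in>{n..}. outflow (g j) t) \<le> outflow ?w t"
        by (rule ennreal_double_le_cancel, subst outflow_midpoint[OF p, symmetric], rule add_mono) (use uv that in \<open>auto simp: X_def\<close>)
      show "outflow ?w t \<le> (SUP j\<in>{n..}. outflow (g j) t)"
        by (rule ennreal_double_le_cancel, subst outflow_midpoint[OF p, symmetric], rule add_mono) (use uv that in \<open>auto simp: X_def\<close>)
    qed
    moreover have "(INF j\<in>{n..}. welfare (g j)) \<le> welfare ?w"
      by (rule ennreal_double_le_cancel, rule order_trans[OF _ welfare_midpoint[OF p]], rule add_mono) (use uv in \<open>auto simp: X_def\<close>)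
    ultimately show "?w \<in> X n" by (auto simp: X_def)
  qed
  then obtain a w u where a: "strict_mono (a::nat\<Rightarrow>nat)" and w: "\<And>n. w n \<in> X (a n)"
    and u: "u \<in> borel_measurable M" "\<And>x. 0 \<le> u x" "\<And>x. u x \<le> \<Lambda>" and ae: "AE x in M. (\<lambda>n. w n x) \<longlonglongrightarrow> u x"
    by (elim exE conjE) blast
  have pu: "profile u" using u bm by (auto simp: profile_def)
  have pw: "profile (w n)" "w n t \<le> \<Lambda>" for n t using w[of n] by (auto simp: X_def)
  have ae': "AE s in lborel. 0 \<le> s \<longrightarrow> (\<lambda>n. w n s) \<longlonglongrightarrow> u s"
    using ae unfolding M_def by (subst (asm) AE_density) (auto simp: indicator_def elim: eventually_mono)
  have "outflow u t = L" if t: "0 \<le> t" and L: "(\<lambda>n. outflow (g n) t) \<longlonglongrightarrow> L" for t L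
  proof (rule antisym)
    have lim: "(\<lambda>n. outflow (w n) t) \<longlonglongrightarrow> outflow u t" by (rule outflow_tendsto[OF pw(1) pu pw(2) ae' t])
    have LL: "liminf (\<lambda>n. outflow (g n) t) = L" "limsup (\<lambda>n. outflow (g n) t) = L"
      using lim_imp_Liminf[OF _ L] lim_imp_Limsup[OF _ L] by auto
    show "L \<le> outflow u t"
      using Liminf_le_limit_of_blocks[OF a _ lim, of "\<lambda>n. outflow (g n) t"] w t LL by (auto simp: X_def)
    show "outflow u t \<le> L"
      using Limsup_ge_limit_of_blocks[OF a _ lim, of "\<lambda>n. outflow (g n) t"] w t LL by (auto simp: X_def)
  qed
  moreover have "liminf (\<lambda>n. welfare (g n)) \<le> welfare u"
    by (rule Liminf_le_limit_of_blocks[OF a _ welfare_tendsto[OF pw(1) pu pw(2) ae']]) (use w in \<open>auto simp: X_def\<close>)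
  ultimately show ?thesis using pu u(3) by blast
qed

text \<open>
  Along convergent paths production converges, so the budget equation makes the outflows
  converge; this identifies the outflow of the limit control.
\<close>

lemma solutions_closed:
  assumes solution: "\<And>n. solution (\<kappa>0n n) (\<kappa>n n) (kn n) (gn n)" and bd: "\<And>n t. gn n t \<le> \<Lambda>"
    and environment: "\<And>n. environment (\<kappa>n n)" "environment \<kappa>" and \<kappa>0: "\<And>n. 0 \<le> \<kappa>0n n" "\<And>n. \<kappa>0n n \<le> R"
    and lim: "\<kappa>0n \<longlonglongrightarrow> \<kappa>0" "\<And>t. 0 \<le> t \<Longrightarrow> (\<lambda>n. \<kappa>n n t) \<longlonglongrightarrow> \<kappa> t" "\<And>t. 0 \<le> t \<Longrightarrow> (\<lambda>n. kn n t) \<longlonglongrightarrow> k t"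
    and k: "profile k"
  shows "\<exists>g. solution \<kappa>0 \<kappa> k g \<and> (\<forall>t. g t \<le> \<Lambda>) \<and> liminf (\<lambda>n. welfare (gn n)) \<le> welfare g"
proof -
  have pg: "profile (gn n)" and pk: "profile (kn n)" for n using solution[of n] by (auto simp: solution_def)
  obtain c where c: "profile c" "\<And>t. c t \<le> \<Lambda>"
    "\<And>t L. 0 \<le> t \<Longrightarrow> (\<lambda>n. outflow (gn n) t) \<longlonglongrightarrow> L \<Longrightarrow> outflow c t = L" "liminf (\<lambda>n. welfare (gn n)) \<le> welfare c"
    using bounded_controls_limit[where g=gn and \<Lambda>=\<Lambda>, OF pg bd] by blast
  have knR: "kn n t \<le> R" if "0 \<le> t" for n t by (rule subsolution_le_R[OF solution_imp_subsolution[OF solution] environment(1) \<kappa>0 that])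
  have kR: "k t \<le> R" if "0 \<le> t" for t by (rule LIMSEQ_le_const2[OF lim(3)[OF that]]) (use knR[OF that] in auto)
  have \<kappa>00: "0 \<le> \<kappa>0" by (rule LIMSEQ_le_const[OF lim(1)]) (use \<kappa>0 in auto)
  have eq: "ennreal (exp (\<delta> * t) * k t) + outflow c t = ennreal \<kappa>0 + inflow \<kappa> k t" if t: "0 \<le> t" for t
  proof -
    have inf_fin: "inflow \<kappa> k t < top"
      by (rule order.strict_trans1[OF inflow_le[OF environment(2) k, of t R] ennreal_less_top]) (use kR t in auto)
    have I: "(\<lambda>n. inflow (\<kappa>n n) (kn n) t) \<longlonglongrightarrow> inflow \<kappa> k t"
      by (rule inflow_tendsto) (use environment pk k knR lim in auto)
    let ?i = "\<lambda>n. enn2real (inflow (\<kappa>n n) (kn n) t)" and ?o = "\<lambda>n. enn2real (outflow (gn n) t)"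
    have i: "?i \<longlonglongrightarrow> enn2real (inflow \<kappa> k t)" by (rule tendsto_enn2real) (use I inf_fin in auto)
    note sr = subsolution_real[OF solution_imp_subsolution[OF solution] environment(1) \<kappa>0 t]
    have oeq: "?o n = \<kappa>0n n + ?i n - exp (\<delta> * t) * kn n t" for n
    proof -
      have "ennreal (exp (\<delta> * t) * kn n t) + outflow (gn n) t = ennreal (\<kappa>0n n) + inflow (\<kappa>n n) (kn n) t"
        using solution[of n] t by (simp add: solution_def)
      then have "ennreal (exp (\<delta> * t) * kn n t) + ennreal (?o n) = ennreal (\<kappa>0n n) + ennreal (?i n)"
        using sr(1,2)[of n] by simp
      then have "ennreal (exp (\<delta> * t) * kn n t + ?o n) = ennreal (\<kappa>0n n + ?i n)"
        using profile_nonneg[OF pk, of n t] \<kappa>0(1)[of n] by (simp add: ennreal_plus)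
      then have "exp (\<delta> * t) * kn n t + ?o n = \<kappa>0n n + ?i n"
        using profile_nonneg[OF pk, of n t] \<kappa>0(1)[of n] by (subst (asm) ennreal_inj) auto
      then show ?thesis by simp
    qed
    let ?L = "\<kappa>0 + enn2real (inflow \<kappa> k t) - exp (\<delta> * t) * k t"
    have "?o \<longlonglongrightarrow> ?L" unfolding oeq by (intro tendsto_intros lim(1) i lim(3)[OF t])
    moreover from this have L0: "0 \<le> ?L" by (rule LIMSEQ_le_const) auto
    ultimately have "(\<lambda>n. ennreal (?o n)) \<longlonglongrightarrow> ennreal ?L" by (intro tendsto_ennrealI)
    then have "(\<lambda>n. outflow (gn n) t) \<longlonglongrightarrow> ennreal ?L" using sr(2) by simp
    from c(3)[OF t this] have "ennreal (exp (\<delta> * t) * k t) + outflow c t = ennreal (exp (\<delta> * t) * k t) + ennreal ?L"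
      by simp
    also have "\<dots> = ennreal (exp (\<delta> * t) * k t + ?L)"
      by (rule ennreal_plus[symmetric]) (use L0 profile_nonneg[OF k, of t] in auto)
    also have "exp (\<delta> * t) * k t + ?L = \<kappa>0 + enn2real (inflow \<kappa> k t)" by simp
    also have "ennreal (\<kappa>0 + enn2real (inflow \<kappa> k t)) = ennreal \<kappa>0 + ennreal (enn2real (inflow \<kappa> k t))" using \<kappa>00 by (simp add: ennreal_plus)
    also have "ennreal (enn2real (inflow \<kappa> k t)) = inflow \<kappa> k t" using inf_fin by simp
    finally show ?thesis .
  qed
  have "\<exists>B. \<forall>t\<in>{0..T}. k t \<le> B" for T by (rule exI[of _ R]) (simp add: kR)
  then have "solution \<kappa>0 \<kappa> k c" using k c(1) eq by (simp add: solution_def)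
  then show ?thesis using c by blast
qed

lemma running_increment:
  assumes u: "profile u" and bd: "\<And>x. 0 \<le> x \<Longrightarrow> u x \<le> c" and st: "0 \<le> s" "s \<le> t"
  shows "enn2real (outflow u s) \<le> enn2real (outflow u t)"
    "enn2real (outflow u t) \<le> enn2real (outflow u s) + c / \<delta> * (exp (\<delta> * t) - exp (\<delta> * s))"
proof -
  have [measurable]: "u \<in> borel_measurable borel" using u by (rule profile_measurable)
  have c: "0 \<le> c" using order_trans[OF profile_nonneg[OF u] bd[of 0]] by simp
  have fin: "outflow u t < top" if "0 \<le> t" for t
  proof -
    have "outflow u t \<le> (\<integral>\<^sup>+s\<in>{0..t}. ennreal (exp (\<delta> * s) * c) \<partial>lborel)"
      unfolding outflow_def using bd by (intro nn_integral_mono) (auto simp: indicator_def intro!: ennreal_leI)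
    also have "\<dots> < top" using nn_integral_exp_Icc_0[of \<delta> c t] pos c that by simp
    finally show ?thesis .
  qed
  have le: "outflow u s \<le> outflow u t"
    unfolding outflow_def using st by (intro nn_integral_mono) (auto simp: indicator_def)
  then show "enn2real (outflow u s) \<le> enn2real (outflow u t)"
    using fin[of t] st by (intro enn2real_mono) auto
  have "outflow u t \<le> (\<integral>\<^sup>+x. ennreal (exp (\<delta> * x) * u x) * indicator {0..s} x + ennreal (exp (\<delta> * x) * c) * indicator {s..t} x \<partial>lborel)"
    unfolding outflow_def using bd st by (intro nn_integral_mono) (auto simp: indicator_def intro!: ennreal_leI)
  also have "\<dots> = outflow u s + ennreal (c / \<delta> * (exp (\<delta> * t) - exp (\<delta> * s)))"
    unfolding outflow_def nn_integral_exp_Icc[OF pos(3) c st(2), symmetric] by (rule nn_integral_add) measurable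
  also have "\<dots> = ennreal (enn2real (outflow u s) + c / \<delta> * (exp (\<delta> * t) - exp (\<delta> * s)))"
    using fin[OF st(1)] st pos c by (subst ennreal_plus) auto
  finally show "enn2real (outflow u t) \<le> enn2real (outflow u s) + c / \<delta> * (exp (\<delta> * t) - exp (\<delta> * s))"
    using st pos c by (intro enn2real_leI) auto
qed

lemma inflow_as_outflow: "environment \<kappa> \<Longrightarrow> profile k \<Longrightarrow> inflow \<kappa> k = outflow (\<lambda>t. F (k t) (\<kappa> t)) \<and> profile (\<lambda>t. F (k t) (\<kappa> t))"
  using F_nonneg[OF environment_range profile_nonneg] F_measurable
  by (simp add: inflow_def[abs_def] outflow_def[abs_def]) (simp add: profile_def)

lemma solution_real:
  assumes "solution \<kappa>0 \<kappa> k g" "environment \<kappa>" "0 \<le> \<kappa>0" "\<kappa>0 \<le> R" "0 \<le> t"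
  shows "exp (\<delta> * t) * k t + enn2real (outflow g t) = \<kappa>0 + enn2real (inflow \<kappa> k t)"
proof -
  note sr = subsolution_real[OF solution_imp_subsolution[OF assms(1)] assms(2-5)]
  have k: "0 \<le> k t" using assms(1) by (simp add: solution_def profile_def)
  have "ennreal (exp (\<delta> * t) * k t) + ennreal (enn2real (outflow g t)) = ennreal \<kappa>0 + ennreal (enn2real (inflow \<kappa> k t))"
    using assms sr(1,2) by (simp add: solution_def)
  then have "ennreal (exp (\<delta> * t) * k t + enn2real (outflow g t)) = ennreal (\<kappa>0 + enn2real (inflow \<kappa> k t))"
    using k assms(3) by (simp add: ennreal_plus)
  then show ?thesis using k assms(3) by (subst (asm) ennreal_inj) auto
qed

text \<open>
  On \<open>[s,t]\<close> the weighted stock changes by at most the integral of \<open>exp(\<delta> u)\<close> times \<open>max (\<delta> R) \<Lambda>\<close>;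
  removing the weight costs another \<open>\<delta> R\<close>.
\<close>

lemma solution_Lipschitz:
  assumes solution: "solution \<kappa>0 \<kappa> k g" and bd: "\<And>t. g t \<le> \<Lambda>" and environment: "environment \<kappa>" and \<kappa>0: "0 \<le> \<kappa>0" "\<kappa>0 \<le> R"
    and st: "0 \<le> s" "0 \<le> t"
  shows "\<bar>k s - k t\<bar> \<le> (2 * \<delta> * R + \<Lambda>) * \<bar>s - t\<bar>"
proof -
  have main: "\<bar>k t - k s\<bar> \<le> (2 * \<delta> * R + \<Lambda>) * (t - s)" if st: "0 \<le> s" "s \<le> t" for s t
  proof -
    have pk: "profile k" and pg: "profile g" using solution by (auto simp: solution_def)
    have kR: "k t \<le> R" if "0 \<le> t" for t by (rule subsolution_le_R[OF solution_imp_subsolution[OF solution] environment \<kappa>0 that])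
    have \<Lambda>: "0 \<le> \<Lambda>" using order_trans[OF profile_nonneg[OF pg] bd] .
    let ?w = "\<lambda>t. F (k t) (\<kappa> t)"
    have w: "?w x \<le> \<delta> * R" if "0 \<le> x" for x
      using F_le[OF environment_range[OF environment] profile_nonneg[OF pk], of x x] kR[OF that] by (simp add: max_def)
    have i: "inflow \<kappa> k = outflow ?w" "profile ?w" using inflow_as_outflow[OF environment pk] by auto
    let ?d = "exp (\<delta> * t) - exp (\<delta> * s)"
    have d0: "0 \<le> ?d" using st pos by simp
    note 1 = running_increment[OF i(2) w st] and 2 = running_increment[OF pg bd st]
    have t0: "0 \<le> t" using st by simp
    have eq: "exp (\<delta> * t) * k t - exp (\<delta> * s) * k s =
      (enn2real (outflow ?w t) - enn2real (outflow ?w s)) - (enn2real (outflow g t) - enn2real (outflow g s))"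
      using solution_real[OF solution environment \<kappa>0 t0] solution_real[OF solution environment \<kappa>0 st(1)] unfolding i(1) by simp
    have ex: "(1 - exp (- (\<delta> * (t - s)))) \<le> \<delta> * (t - s)" using exp_ge_add_one_self[of "- (\<delta> * (t - s))"] by simp
    have E: "exp (- (\<delta> * t)) * ?d = 1 - exp (- (\<delta> * (t - s)))"
      by (simp add: right_diff_distrib flip: exp_add)
    have kd: "k t - k s = exp (- (\<delta> * t)) * (exp (\<delta> * t) * k t - exp (\<delta> * s) * k s) - (1 - exp (- (\<delta> * (t - s)))) * k s"
      unfolding E[symmetric] by (simp add: algebra_simps exp_minus)
    have up: "exp (- (\<delta> * t)) * (exp (\<delta> * t) * k t - exp (\<delta> * s) * k s) \<le> R * (1 - exp (- (\<delta> * (t - s))))"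
    proof -
      have "exp (\<delta> * t) * k t - exp (\<delta> * s) * k s \<le> R * ?d" using eq 1 2 pos by simp
      then have "exp (- (\<delta> * t)) * (exp (\<delta> * t) * k t - exp (\<delta> * s) * k s) \<le> exp (- (\<delta> * t)) * (R * ?d)"
        by (intro mult_left_mono) auto
      also have "\<dots> = R * (exp (- (\<delta> * t)) * ?d)" by simp
      finally show ?thesis unfolding E .
    qed
    have lo: "- (\<Lambda> / \<delta> * (1 - exp (- (\<delta> * (t - s))))) \<le> exp (- (\<delta> * t)) * (exp (\<delta> * t) * k t - exp (\<delta> * s) * k s)"
    proof -
      have "- (\<Lambda> / \<delta> * ?d) \<le> exp (\<delta> * t) * k t - exp (\<delta> * s) * k s" using eq 1 2 pos by simp
      then have "exp (- (\<delta> * t)) * (- (\<Lambda> / \<delta> * ?d)) \<le> exp (- (\<delta> * t)) * (exp (\<delta> * t) * k t - exp (\<delta> * s) * k s)"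
        by (intro mult_left_mono) auto
      moreover have "exp (- (\<delta> * t)) * (- (\<Lambda> / \<delta> * ?d)) = - (\<Lambda> / \<delta> * (exp (- (\<delta> * t)) * ?d))" by simp
      ultimately show ?thesis unfolding E by linarith
    qed
    let ?h = "1 - exp (- (\<delta> * (t - s)))"
    have h0: "0 \<le> ?h" using pos st by simp
    have ks: "0 \<le> ?h * k s" "?h * k s \<le> ?h * R" using h0 profile_nonneg[OF pk] kR[OF st(1)] by (auto intro!: mult_left_mono)
    have hd: "?h * R \<le> \<delta> * (t - s) * R" "\<Lambda> / \<delta> * ?h \<le> \<Lambda> / \<delta> * (\<delta> * (t - s))"
      using ex pos \<Lambda> by (auto intro!: mult_left_mono mult_right_mono simp del: times_divide_eq_left)
    have "\<Lambda> / \<delta> * (\<delta> * (t - s)) = \<Lambda> * (t - s)" using pos by simp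
    then have "k t - k s \<le> \<delta> * (t - s) * R" "- (k t - k s) \<le> \<Lambda> * (t - s) + \<delta> * (t - s) * R"
      using kd up lo ks hd by (simp_all add: mult.commute[of R])
    moreover have "0 \<le> \<Lambda> * (t - s)" "0 \<le> \<delta> * (t - s) * R" using \<Lambda> st pos by auto
    ultimately show ?thesis by (simp add: algebra_simps abs_le_iff)
  qed
  show ?thesis using main[of s t] main[of t s] st by (cases "s \<le> t") (auto simp: abs_minus_commute)
qed

section \<open>Existence of optimal paths\<close>

text \<open>
  Chosen once, so that it serves all initial stocks and all externalities simultaneously.
\<close>

definition consumption_bound :: real where
  "consumption_bound = (SOME \<Lambda>. \<forall>\<kappa>0 \<kappa> k g. subsolution \<kappa>0 \<kappa> k g \<longrightarrow> environment \<kappa> \<longrightarrow> 0 \<le> \<kappa>0 \<longrightarrow> \<kappa>0 \<le> R \<longrightarrow>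
    (\<exists>h c. subsolution \<kappa>0 \<kappa> h c \<and> (\<forall>t. c t \<le> \<Lambda>) \<and> welfare g \<le> welfare c))"

lemma consumption_bound:
  assumes "subsolution \<kappa>0 \<kappa> k g" "environment \<kappa>" "0 \<le> \<kappa>0" "\<kappa>0 \<le> R"
  shows "\<exists>h c. solution \<kappa>0 \<kappa> h c \<and> (\<forall>t. c t \<le> consumption_bound) \<and> welfare g \<le> welfare c"
proof -
  let ?Q = "\<lambda>\<Lambda>. \<forall>\<kappa>0 \<kappa> k g. subsolution \<kappa>0 \<kappa> k g \<longrightarrow> environment \<kappa> \<longrightarrow> 0 \<le> \<kappa>0 \<longrightarrow> \<kappa>0 \<le> R \<longrightarrow>
    (\<exists>h c. subsolution \<kappa>0 \<kappa> h c \<and> (\<forall>t. c t \<le> \<Lambda>) \<and> welfare g \<le> welfare c)"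
  obtain \<Lambda> where "?Q \<Lambda>" using truncation by metis
  then have "?Q consumption_bound" unfolding consumption_bound_def by (rule someI[of ?Q])
  then obtain h c where h: "subsolution \<kappa>0 \<kappa> h c" "\<forall>t. c t \<le> consumption_bound" "welfare g \<le> welfare c" using assms by blast
  from no_waste[OF h(1) assms(2-4)] h(2,3) show ?thesis by blast
qed

definition value_of :: "real \<Rightarrow> (real \<Rightarrow> real) \<Rightarrow> ennreal" where
  "value_of \<kappa>0 \<kappa> = Sup (welfare ` {g. \<exists>k. subsolution \<kappa>0 \<kappa> k g})"

definition optimal :: "real \<Rightarrow> (real \<Rightarrow> real) \<Rightarrow> (real \<Rightarrow> real) \<Rightarrow> (real \<Rightarrow> real) \<Rightarrow> bool" where
  "optimal \<kappa>0 \<kappa> k g \<longleftrightarrow> solution \<kappa>0 \<kappa> k g \<and> (\<forall>t. g t \<le> consumption_bound) \<and> welfare g = value_of \<kappa>0 \<kappa>"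

lemma welfare_le_value: "subsolution \<kappa>0 \<kappa> k g \<Longrightarrow> welfare g \<le> value_of \<kappa>0 \<kappa>"
  unfolding value_of_def by (rule Sup_upper) blast

definition Lip :: real where "Lip = 2 * \<delta> * R + consumption_bound"

lemma consumption_bound_nonneg: "0 \<le> consumption_bound"
proof -
  have "subsolution 0 (\<lambda>_. a) (\<lambda>_. 0) (\<lambda>_. 0)" by (auto simp: subsolution_def profile_def outflow_def)
  moreover have "environment (\<lambda>_. a)" using pos by (auto simp: environment_def)
  ultimately obtain h c where "solution 0 (\<lambda>_. a) h c" "\<forall>t. c t \<le> consumption_bound" using consumption_bound[of 0 "\<lambda>_. a"] pos by force
  then have "0 \<le> c 0" "c 0 \<le> consumption_bound" by (auto simp: solution_def profile_def)
  then show ?thesis by linarith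
qed

lemma Lip_nonneg: "0 \<le> Lip" using consumption_bound_nonneg pos by (simp add: Lip_def)

lemma Lipschitz_paths_compact:
  assumes bd: "\<And>n t. 0 \<le> t \<Longrightarrow> 0 \<le> kn n t \<and> kn n t \<le> R"
    and lip: "\<And>n s t. 0 \<le> s \<Longrightarrow> 0 \<le> t \<Longrightarrow> \<bar>kn n s - kn n t\<bar> \<le> Lip * \<bar>s - t\<bar>"
  shows "\<exists>\<sigma> k. strict_mono (\<sigma>::nat\<Rightarrow>nat) \<and> profile k \<and> (\<forall>t\<ge>0. (\<lambda>n. kn (\<sigma> n) t) \<longlonglongrightarrow> k t)"
proof -
  let ?c = "\<lambda>p q. Lip * \<bar>p - q\<bar>"
  have K: "kn n \<in> modulus_class {0..} 0 R ?c" for n using bd lip by (auto simp: modulus_class_def)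
  have Q: "\<exists>q\<in>\<rat> \<inter> {0..}. ?c p q < e" if pe: "p \<in> {0..}" "e > 0" for p e
  proof -
    have L: "Lip + 1 > 0" using Lip_nonneg by simp
    obtain q where q: "q \<in> \<rat>" "p < q" "q < p + e / (Lip + 1)"
      using Rats_dense_in_real[of p "p + e / (Lip + 1)"] pe L by auto
    have "?c p q \<le> (Lip + 1) * (q - p)" using q Lip_nonneg by (auto intro!: mult_right_mono)
    also have "\<dots> < e" using q L by (simp add: field_simps)
    finally show ?thesis using q pe by (intro bexI[of _ q]) auto
  qed
  have cQ: "countable (\<rat> \<inter> {0..} :: real set)" by (rule countable_Int1) (rule countable_rat)
  have "\<exists>\<sigma> L. strict_mono (\<sigma>::nat\<Rightarrow>nat) \<and> L \<in> modulus_class {0..} 0 R ?c \<and> (\<forall>p\<in>{0..}. (\<lambda>n. kn (\<sigma> n) p) \<longlonglongrightarrow> L p)"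
    by (rule modulus_class_compact[where K=kn and a=0 and b=R, OF cQ _ Q K]) auto
  then obtain \<sigma> L where \<sigma>: "strict_mono (\<sigma>::nat\<Rightarrow>nat)" and L: "L \<in> modulus_class {0..} 0 R ?c"
    and lim: "\<And>t. 0 \<le> t \<Longrightarrow> (\<lambda>n. kn (\<sigma> n) t) \<longlonglongrightarrow> L t" by auto
  define k where "k t = L (max 0 t)" for t
  have kl: "\<bar>k s - k t\<bar> \<le> Lip * \<bar>s - t\<bar>" for s t
  proof -
    have "\<bar>k s - k t\<bar> \<le> Lip * \<bar>max 0 s - max 0 t\<bar>" using L by (auto simp: modulus_class_def k_def)
    also have "\<dots> \<le> Lip * \<bar>s - t\<bar>" using Lip_nonneg by (intro mult_left_mono) auto
    finally show ?thesis .
  qed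
  have "continuous_on UNIV k"
    by (rule lipschitz_on_continuous_on[of Lip]) (auto simp: lipschitz_on_def dist_real_def kl Lip_nonneg)
  then have "k \<in> borel_measurable borel" by (rule borel_measurable_continuous_onI)
  moreover have "0 \<le> k t" for t using L by (auto simp: modulus_class_def k_def)
  ultimately have "profile k" by (simp add: profile_def)
  moreover have "(\<lambda>n. kn (\<sigma> n) t) \<longlonglongrightarrow> k t" if "0 \<le> t" for t using lim[OF that] that by (simp add: k_def)
  ultimately show ?thesis using \<sigma> by blast
qed

text \<open>
  Paths converge by equicontinuity, controls by convexity.
\<close>

lemma solutions_compact:
  assumes solution: "\<And>n. solution (\<kappa>0n n) (\<kappa>n n) (kn n) (gn n)" and bd: "\<And>n t. gn n t \<le> consumption_bound"
    and environment: "\<And>n. environment (\<kappa>n n)" "environment \<kappa>" and \<kappa>0: "\<And>n. 0 \<le> \<kappa>0n n" "\<And>n. \<kappa>0n n \<le> R"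
    and lim: "\<kappa>0n \<longlonglongrightarrow> \<kappa>0" "\<And>t. 0 \<le> t \<Longrightarrow> (\<lambda>n. \<kappa>n n t) \<longlonglongrightarrow> \<kappa> t"
  shows "\<exists>\<sigma> k g. strict_mono (\<sigma>::nat\<Rightarrow>nat) \<and> (\<forall>t\<ge>0. (\<lambda>n. kn (\<sigma> n) t) \<longlonglongrightarrow> k t) \<and> solution \<kappa>0 \<kappa> k g \<and>
    (\<forall>t. g t \<le> consumption_bound) \<and> liminf (\<lambda>n. welfare (gn (\<sigma> n))) \<le> welfare g"
proof -
  have "0 \<le> kn n t \<and> kn n t \<le> R" if "0 \<le> t" for n t
    using subsolution_le_R[OF solution_imp_subsolution[OF solution] environment(1) \<kappa>0 that] solution[of n] by (auto simp: solution_def profile_def)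
  moreover have "\<bar>kn n s - kn n t\<bar> \<le> Lip * \<bar>s - t\<bar>" if "0 \<le> s" "0 \<le> t" for n s t
    unfolding Lip_def by (rule solution_Lipschitz[OF solution bd environment(1) \<kappa>0 that])
  ultimately obtain \<sigma> k where \<sigma>: "strict_mono (\<sigma>::nat\<Rightarrow>nat)" "profile k" "\<And>t. 0 \<le> t \<Longrightarrow> (\<lambda>n. kn (\<sigma> n) t) \<longlonglongrightarrow> k t"
    using Lipschitz_paths_compact[of kn] by blast
  have "\<exists>g. solution \<kappa>0 \<kappa> k g \<and> (\<forall>t. g t \<le> consumption_bound) \<and> liminf (\<lambda>n. welfare (gn (\<sigma> n))) \<le> welfare g"
  proof (rule solutions_closed[where kn="\<lambda>n. kn (\<sigma> n)" and \<kappa>n="\<lambda>n. \<kappa>n (\<sigma> n)" and \<kappa>0n="\<lambda>n. \<kappa>0n (\<sigma> n)"])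
    show "(\<lambda>n. \<kappa>0n (\<sigma> n)) \<longlonglongrightarrow> \<kappa>0" using LIMSEQ_subseq_LIMSEQ[OF lim(1) \<sigma>(1)] by (simp add: o_def)
    show "(\<lambda>n. \<kappa>n (\<sigma> n) t) \<longlonglongrightarrow> \<kappa> t" if "0 \<le> t" for t
      using LIMSEQ_subseq_LIMSEQ[OF lim(2)[OF that] \<sigma>(1)] by (simp add: o_def)
  qed (use solution bd environment \<kappa>0 \<sigma> in auto)
  then show ?thesis using \<sigma> by blast
qed

lemma optimal_exists:
  assumes environment: "environment \<kappa>" and \<kappa>0: "0 \<le> \<kappa>0" "\<kappa>0 \<le> R"
  shows "\<exists>k g. optimal \<kappa>0 \<kappa> k g"
proof -
  have "subsolution \<kappa>0 \<kappa> (\<lambda>_. 0) (\<lambda>_. 0)" by (auto simp: subsolution_def profile_def outflow_def)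
  then have "welfare ` {g. \<exists>k. subsolution \<kappa>0 \<kappa> k g} \<noteq> {}" by blast
  from ennreal_Sup_countable_SUP[OF this] obtain v where v: "incseq v"
    "range v \<subseteq> welfare ` {g. \<exists>k. subsolution \<kappa>0 \<kappa> k g}" "value_of \<kappa>0 \<kappa> = (SUP i. v i)"
    unfolding value_of_def by blast
  have "\<exists>kg. solution \<kappa>0 \<kappa> (fst kg) (snd kg) \<and> (\<forall>t. snd kg t \<le> consumption_bound) \<and> v n \<le> welfare (snd kg)" for n
  proof -
    obtain g k where g: "v n = welfare g" "subsolution \<kappa>0 \<kappa> k g" using v(2) by blast
    from consumption_bound[OF g(2) environment \<kappa>0] g(1) show ?thesis by force
  qed
  then have "\<forall>n. \<exists>kg. solution \<kappa>0 \<kappa> (fst kg) (snd kg) \<and> (\<forall>t. snd kg t \<le> consumption_bound) \<and> v n \<le> welfare (snd kg)" by blast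
  from choice[OF this] obtain kg where
    "\<forall>n. solution \<kappa>0 \<kappa> (fst (kg n)) (snd (kg n)) \<and> (\<forall>t. snd (kg n) t \<le> consumption_bound) \<and> v n \<le> welfare (snd (kg n))" ..
  then have kg: "\<And>n. solution \<kappa>0 \<kappa> (fst (kg n)) (snd (kg n))" "\<And>n t. snd (kg n) t \<le> consumption_bound" "\<And>n. v n \<le> welfare (snd (kg n))"
    by blast+
  have "\<exists>\<sigma> k g. strict_mono (\<sigma>::nat\<Rightarrow>nat) \<and> (\<forall>t\<ge>0. (\<lambda>n. fst (kg (\<sigma> n)) t) \<longlonglongrightarrow> k t) \<and> solution \<kappa>0 \<kappa> k g \<and>
    (\<forall>t. g t \<le> consumption_bound) \<and> liminf (\<lambda>n. welfare (snd (kg (\<sigma> n)))) \<le> welfare g"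
    by (rule solutions_compact[where \<kappa>0n="\<lambda>_. \<kappa>0" and \<kappa>n="\<lambda>_. \<kappa>"]) (use kg environment \<kappa>0 in auto)
  then obtain \<sigma> k g where \<sigma>: "strict_mono (\<sigma>::nat\<Rightarrow>nat)" and s: "solution \<kappa>0 \<kappa> k g" "\<forall>t. g t \<le> consumption_bound"
    "liminf (\<lambda>n. welfare (snd (kg (\<sigma> n)))) \<le> welfare g" by blast
  have "(\<lambda>n. v (\<sigma> n)) \<longlonglongrightarrow> value_of \<kappa>0 \<kappa>"
    using LIMSEQ_subseq_LIMSEQ[OF LIMSEQ_SUP[OF v(1)] \<sigma>] v(3) by (simp add: o_def)
  then have "liminf (\<lambda>n. v (\<sigma> n)) = value_of \<kappa>0 \<kappa>" by (rule lim_imp_Liminf[rotated]) simp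
  moreover have "liminf (\<lambda>n. v (\<sigma> n)) \<le> liminf (\<lambda>n. welfare (snd (kg (\<sigma> n))))"
    by (rule Liminf_mono) (simp add: kg(3))
  ultimately have "value_of \<kappa>0 \<kappa> \<le> welfare g" using s(3) by auto
  then have "welfare g = value_of \<kappa>0 \<kappa>" using welfare_le_value[OF solution_imp_subsolution[OF s(1)]] by simp
  with s show ?thesis by (auto simp: optimal_def)
qed

lemma optimal_bounds:
  assumes "optimal \<kappa>0 \<kappa> k g" "environment \<kappa>" "0 \<le> \<kappa>0" "\<kappa>0 \<le> R"
  shows "0 \<le> t \<Longrightarrow> 0 \<le> k t \<and> k t \<le> R" "0 \<le> s \<Longrightarrow> 0 \<le> t \<Longrightarrow> \<bar>k s - k t\<bar> \<le> Lip * \<bar>s - t\<bar>" "value_of \<kappa>0 \<kappa> < top"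
proof -
  have solution: "solution \<kappa>0 \<kappa> k g" and bd: "\<And>t. g t \<le> consumption_bound" and v: "welfare g = value_of \<kappa>0 \<kappa>" using assms(1) by (auto simp: optimal_def)
  show "0 \<le> k t \<and> k t \<le> R" if "0 \<le> t"
    using subsolution_le_R[OF solution_imp_subsolution[OF solution] assms(2-4) that] solution by (auto simp: solution_def profile_def)
  show "\<bar>k s - k t\<bar> \<le> Lip * \<bar>s - t\<bar>" if "0 \<le> s" "0 \<le> t"
    unfolding Lip_def by (rule solution_Lipschitz[OF solution bd assms(2-4) that])
  show "value_of \<kappa>0 \<kappa> < top" using subsolution_welfare_finite[OF solution_imp_subsolution[OF solution] assms(2-4)] v by simp
qed

section \<open>Uniqueness of optimal paths\<close>

definition mix :: "real \<Rightarrow> (real \<Rightarrow> real) \<Rightarrow> (real \<Rightarrow> real) \<Rightarrow> real \<Rightarrow> real" where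
  "mix u k h t = (1 - u) * k t + u * h t"

text \<open>
  What mixing two paths produces beyond the mixture of their productions. By strict concavity it
  is positive wherever the paths differ.
\<close>

definition gap :: "(real \<Rightarrow> real) \<Rightarrow> real \<Rightarrow> (real \<Rightarrow> real) \<Rightarrow> (real \<Rightarrow> real) \<Rightarrow> real \<Rightarrow> real" where
  "gap \<kappa> u k h s = F (mix u k h s) (\<kappa> s) - (1 - u) * F (k s) (\<kappa> s) - u * F (h s) (\<kappa> s)"

lemma gap_pos:
  assumes "environment \<kappa>" "profile k" "profile h" "0 < u" "u < 1" "k s \<noteq> h s"
  shows "0 < gap \<kappa> u k h s"
proof -
  have "s' * f x (\<kappa> s) + (1 - s') * f y (\<kappa> s) < f (s' * x + (1 - s') * y) (\<kappa> s)"
    if "x \<in> {0..}" "y \<in> {0..}" "x \<noteq> y" "0 < s'" "s' < 1" for x y s'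
    using f_concave[OF environment_range[OF assms(1), of s]] that by (auto simp: strictly_concave_on_def)
  from this[of "h s" "k s" u] show ?thesis
    using assms profile_nonneg[OF assms(2)] profile_nonneg[OF assms(3)]
    by (auto simp: gap_def mix_def F_def algebra_simps)
qed

lemma gap_nonneg:
  assumes "environment \<kappa>" "profile k" "profile h" "0 < u" "u < 1"
  shows "0 \<le> gap \<kappa> u k h s"
proof (cases "k s = h s")
  case True
  then show ?thesis by (simp add: gap_def mix_def algebra_simps)
qed (use gap_pos[OF assms] in \<open>auto intro: less_imp_le\<close>)

lemma profile_mix: "profile k \<Longrightarrow> profile h \<Longrightarrow> 0 \<le> u \<Longrightarrow> u \<le> 1 \<Longrightarrow> profile (mix u k h)"
  unfolding profile_def mix_def[abs_def] by (auto intro!: add_nonneg_nonneg mult_nonneg_nonneg)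

lemma gap_measurable:
  assumes "environment \<kappa>" "profile k" "profile h" "0 \<le> u" "u \<le> 1"
  shows "gap \<kappa> u k h \<in> borel_measurable borel"
proof -
  have [measurable]: "(\<lambda>t. F (k t) (\<kappa> t)) \<in> borel_measurable borel" "(\<lambda>t. F (h t) (\<kappa> t)) \<in> borel_measurable borel"
    "(\<lambda>t. F (mix u k h t) (\<kappa> t)) \<in> borel_measurable borel"
    using F_measurable profile_mix assms by auto
  show ?thesis unfolding gap_def[abs_def] by measurable
qed

lemma ennreal_mix:
  assumes "0 \<le> x" "0 \<le> y" "0 \<le> u" "u \<le> 1"
  shows "ennreal ((1 - u) * x + u * y) = ennreal (1 - u) * ennreal x + ennreal u * ennreal y"
  using assms by (simp add: ennreal_plus ennreal_mult)

lemma outflow_mix: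
  assumes "profile k" "profile h" "0 \<le> u" "u \<le> 1"
  shows "outflow (mix u k h) t = ennreal (1 - u) * outflow k t + ennreal u * outflow h t"
proof -
  have [measurable]: "k \<in> borel_measurable borel" "h \<in> borel_measurable borel" using assms by (auto simp: profile_def)
  have nn: "0 \<le> k s" "0 \<le> h s" for s using assms by (auto simp: profile_def)
  have "outflow (mix u k h) t = (\<integral>\<^sup>+s. ennreal (1 - u) * (ennreal (exp (\<delta> * s) * k s) * indicator {0..t} s)
      + ennreal u * (ennreal (exp (\<delta> * s) * h s) * indicator {0..t} s) \<partial>lborel)"
    unfolding outflow_def mix_def
  proof (rule nn_integral_cong)
    fix s
    have "exp (\<delta> * s) * ((1 - u) * k s + u * h s) = (1 - u) * (exp (\<delta> * s) * k s) + u * (exp (\<delta> * s) * h s)"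
      by (simp add: algebra_simps)
    moreover have "ennreal \<dots> = ennreal (1 - u) * ennreal (exp (\<delta> * s) * k s) + ennreal u * ennreal (exp (\<delta> * s) * h s)"
      by (rule ennreal_mix) (use assms nn[of s] in auto)
    ultimately show "ennreal (exp (\<delta> * s) * ((1 - u) * k s + u * h s)) * indicator {0..t} s =
      ennreal (1 - u) * (ennreal (exp (\<delta> * s) * k s) * indicator {0..t} s) + ennreal u * (ennreal (exp (\<delta> * s) * h s) * indicator {0..t} s)"
      by (simp add: indicator_def)
  qed
  also have "\<dots> = (\<integral>\<^sup>+s. ennreal (1 - u) * (ennreal (exp (\<delta> * s) * k s) * indicator {0..t} s) \<partial>lborel)
      + (\<integral>\<^sup>+s. ennreal u * (ennreal (exp (\<delta> * s) * h s) * indicator {0..t} s) \<partial>lborel)"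
    by (rule nn_integral_add) measurable
  also have "(\<integral>\<^sup>+s. ennreal (1 - u) * (ennreal (exp (\<delta> * s) * k s) * indicator {0..t} s) \<partial>lborel) = ennreal (1 - u) * outflow k t"
    unfolding outflow_def by (rule nn_integral_cmult) measurable
  also have "(\<integral>\<^sup>+s. ennreal u * (ennreal (exp (\<delta> * s) * h s) * indicator {0..t} s) \<partial>lborel) = ennreal u * outflow h t"
    unfolding outflow_def by (rule nn_integral_cmult) measurable
  finally show ?thesis .
qed

lemma outflow_add:
  assumes "profile k" "profile h" shows "outflow (\<lambda>s. k s + h s) t = outflow k t + outflow h t"
proof -
  have [measurable]: "k \<in> borel_measurable borel" "h \<in> borel_measurable borel" using assms by (auto simp: profile_def)
  have nn: "0 \<le> k s" "0 \<le> h s" for s using assms by (auto simp: profile_def)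
  have "outflow (\<lambda>s. k s + h s) t = (\<integral>\<^sup>+s. ennreal (exp (\<delta> * s) * k s) * indicator {0..t} s + ennreal (exp (\<delta> * s) * h s) * indicator {0..t} s \<partial>lborel)"
    unfolding outflow_def using nn by (intro nn_integral_cong) (auto simp: indicator_def distrib_left ennreal_plus)
  also have "\<dots> = outflow k t + outflow h t" unfolding outflow_def by (rule nn_integral_add) measurable
  finally show ?thesis .
qed

lemma subsolution_mix:
  assumes s1: "subsolution \<kappa>0 \<kappa> k g" and s2: "subsolution \<kappa>0 \<kappa> h c" and environment: "environment \<kappa>" and u: "0 < u" "u < 1" and \<kappa>0: "0 \<le> \<kappa>0" and t: "0 \<le> t"
  shows "ennreal (exp (\<delta> * t) * mix u k h t) + outflow (mix u g c) t + outflow (gap \<kappa> u k h) t \<le> ennreal \<kappa>0 + inflow \<kappa> (mix u k h) t"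
proof -
  have p: "profile k" "profile g" "profile h" "profile c" using s1 s2 by (auto simp: subsolution_def)
  have pm: "profile (mix u k h)" using profile_mix p u by simp
  let ?Fk = "\<lambda>t. F (k t) (\<kappa> t)" and ?Fh = "\<lambda>t. F (h t) (\<kappa> t)"
  have i: "inflow \<kappa> k = outflow ?Fk" "profile ?Fk" "inflow \<kappa> h = outflow ?Fh" "profile ?Fh"
    "inflow \<kappa> (mix u k h) = outflow (\<lambda>t. F (mix u k h t) (\<kappa> t))"
    using inflow_as_outflow environment p pm by auto
  have pg: "profile (gap \<kappa> u k h)" using gap_measurable[OF environment p(1,3)] gap_nonneg[OF environment p(1,3) u] u by (auto simp: profile_def)
  have "(\<lambda>t. F (mix u k h t) (\<kappa> t)) = (\<lambda>t. mix u ?Fk ?Fh t + gap \<kappa> u k h t)"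
    by (auto simp: gap_def mix_def)
  then have I: "inflow \<kappa> (mix u k h) t = ennreal (1 - u) * inflow \<kappa> k t + ennreal u * inflow \<kappa> h t + outflow (gap \<kappa> u k h) t"
    unfolding i using outflow_add[OF profile_mix[OF i(2,4)] pg, of u] outflow_mix[OF i(2,4)] u by simp
  have "exp (\<delta> * t) * mix u k h t = (1 - u) * (exp (\<delta> * t) * k t) + u * (exp (\<delta> * t) * h t)"
    by (simp add: mix_def algebra_simps)
  also have "ennreal \<dots> = ennreal (1 - u) * ennreal (exp (\<delta> * t) * k t) + ennreal u * ennreal (exp (\<delta> * t) * h t)"
    by (rule ennreal_mix) (use u profile_nonneg[OF p(1), of t] profile_nonneg[OF p(3), of t] in auto)
  finally have "ennreal (exp (\<delta> * t) * mix u k h t) + outflow (mix u g c) t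
     = ennreal (1 - u) * (ennreal (exp (\<delta> * t) * k t) + outflow g t) + ennreal u * (ennreal (exp (\<delta> * t) * h t) + outflow c t)"
    using outflow_mix[OF p(2,4), of u t] u by (simp add: distrib_left add_ac)
  also have "\<dots> \<le> ennreal (1 - u) * (ennreal \<kappa>0 + inflow \<kappa> k t) + ennreal u * (ennreal \<kappa>0 + inflow \<kappa> h t)"
    by (rule add_mono; rule mult_left_mono) (use s1 s2 t in \<open>simp_all add: subsolution_def\<close>)
  also have "\<dots> = (ennreal (1 - u) + ennreal u) * ennreal \<kappa>0 + (ennreal (1 - u) * inflow \<kappa> k t + ennreal u * inflow \<kappa> h t)"
    by (simp add: distrib_left distrib_right add_ac)
  also have "ennreal (1 - u) + ennreal u = 1" using u by (simp flip: ennreal_plus)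
  finally show ?thesis unfolding I by (simp add: add.assoc[symmetric] add_right_mono)
qed

text \<open>
  If two optimal paths differ on a set of positive measure, the gap of their midpoint has
  produced something by some time \<open>T\<close>. Consuming it at a small constant rate \<open>e\<close> during \<open>[T, T+1]\<close> is
  feasible, and together with the midpoint of the two controls it yields more than the value.
\<close>

lemma optimal_unique_AE:
  assumes s1: "subsolution \<kappa>0 \<kappa> k g" "welfare g = value_of \<kappa>0 \<kappa>" and s2: "subsolution \<kappa>0 \<kappa> h c" "welfare c = value_of \<kappa>0 \<kappa>"
    and environment: "environment \<kappa>" and \<kappa>0: "0 \<le> \<kappa>0" "\<kappa>0 \<le> R"
  shows "AE t in lborel. 0 \<le> t \<longrightarrow> k t = h t"
proof (rule ccontr)
  assume no: "\<not> ?thesis"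
  have p: "profile k" "profile g" "profile h" "profile c" using s1 s2 by (auto simp: subsolution_def)
  let ?k = "mix (1/2) k h" and ?g = "mix (1/2) g c" and ?G = "gap \<kappa> (1/2) k h"
  have [measurable]: "?G \<in> borel_measurable borel" using gap_measurable[OF environment p(1,3)] by simp
  have G0: "0 \<le> ?G s" for s by (rule gap_nonneg[OF environment p(1,3)]) auto
  have "\<exists>n. outflow ?G (real n) \<noteq> 0"
  proof (rule ccontr)
    assume "\<not> ?thesis"
    then have "AE t in lborel. ennreal (exp (\<delta> * t) * ?G t) * indicator {0..real n} t = 0" for n
      unfolding outflow_def by (subst (asm) nn_integral_0_iff_AE) auto
    then have "AE t in lborel. \<forall>n. ennreal (exp (\<delta> * t) * ?G t) * indicator {0..real n} t = 0"
      unfolding AE_all_countable by blast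
    then have "AE t in lborel. 0 \<le> t \<longrightarrow> k t = h t"
    proof eventually_elim
      case (elim t)
      show ?case
      proof
        assume t: "0 \<le> t"
        obtain n where "t \<le> real n" using real_arch_simple by blast
        then have "ennreal (exp (\<delta> * t) * ?G t) = 0" using elim[rule_format, of n] t by simp
        then have "exp (\<delta> * t) * ?G t \<le> 0" by (simp add: ennreal_eq_0_iff)
        then have "?G t \<le> 0" by (simp add: mult_le_0_iff)
        then show "k t = h t" using gap_pos[OF environment p(1,3), of "1/2" t] by fastforce
      qed
    qed
    with no show False by simp
  qed
  then obtain n where n: "outflow ?G (real n) \<noteq> 0" by blast
  let ?T = "real n"
  (* The minima keep e finite; outflow at rate e over [T, T+1] is at most the gap accumulated up
     to T. *)
  define e where "e = min 1 (enn2real (min 1 (outflow ?G ?T)) / exp (\<delta> * (?T + 1)))"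
  have m: "min 1 (outflow ?G ?T) = ennreal (enn2real (min 1 (outflow ?G ?T)))"
    by (rule ennreal_enn2real[symmetric], rule le_less_trans[of _ 1]) auto
  have epos: "0 < e"
  proof -
    have "0 < enn2real (min 1 (outflow ?G ?T))"
      unfolding enn2real_positive_iff
    proof
      show "0 < min 1 (outflow ?G ?T)" using n by (simp add: zero_less_iff_neq_zero min_def)
      show "min 1 (outflow ?G ?T) < top" by (rule le_less_trans[of _ 1]) auto
    qed
    then show ?thesis by (simp add: e_def)
  qed
  have eG: "ennreal (exp (\<delta> * (?T + 1)) * e) \<le> outflow ?G ?T"
  proof -
    have "exp (\<delta> * (?T + 1)) * e \<le> enn2real (min 1 (outflow ?G ?T))"
    proof -
      have "e \<le> enn2real (min 1 (outflow ?G ?T)) / exp (\<delta> * (?T + 1))" by (simp add: e_def)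
      then show ?thesis by (simp add: field_simps)
    qed
    then have "ennreal (exp (\<delta> * (?T + 1)) * e) \<le> min 1 (outflow ?G ?T)" using m ennreal_leI by metis
    then show ?thesis by simp
  qed
  define d where "d t = e * indicator {?T..?T + 1} t" for t
  have pd: "profile d" using epos unfolding profile_def d_def by auto
  have pk: "profile ?k" and pg: "profile ?g" using profile_mix p by auto
  have pgd: "profile (\<lambda>t. ?g t + d t)" using pg pd by (auto simp: profile_def)
  have dG: "outflow d t \<le> outflow ?G t" if t: "0 \<le> t" for t
  proof (cases "t < ?T")
    case True
    have "outflow d t = (\<integral>\<^sup>+s. 0 \<partial>(lborel :: real measure))" unfolding outflow_def d_def
      by (rule nn_integral_cong) (use True in \<open>auto simp: indicator_def\<close>)
    then show ?thesis by simp
  next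
    case False
    have "outflow d t \<le> (\<integral>\<^sup>+s. ennreal (exp (\<delta> * (?T + 1)) * e) * indicator {?T..?T + 1} s \<partial>lborel)"
      unfolding outflow_def d_def using epos pos
      by (intro nn_integral_mono) (auto simp: indicator_def intro!: ennreal_leI mult_right_mono)
    also have "\<dots> = ennreal (exp (\<delta> * (?T + 1)) * e)" by (subst nn_integral_cmult) auto
    also have "\<dots> \<le> outflow ?G ?T" by (rule eG)
    also have "\<dots> \<le> outflow ?G t" unfolding outflow_def using False by (intro nn_integral_mono) (auto simp: indicator_def)
    finally show ?thesis .
  qed
  have "subsolution \<kappa>0 \<kappa> ?k (\<lambda>t. ?g t + d t)"
    unfolding subsolution_def
  proof (intro conjI pk pgd allI impI)
    fix T :: real
    show "\<exists>B. \<forall>t\<in>{0..T}. ?k t \<le> B"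
    proof (rule exI[of _ R], rule ballI)
      fix t assume "t \<in> {0..T}"
      then have "k t \<le> R" "h t \<le> R" using subsolution_le_R[OF s1(1) environment \<kappa>0, of t] subsolution_le_R[OF s2(1) environment \<kappa>0, of t] by auto
      then show "?k t \<le> R" by (simp add: mix_def)
    qed
  next
    fix t :: real assume t: "0 \<le> t"
    have "ennreal (exp (\<delta> * t) * ?k t) + outflow (\<lambda>t. ?g t + d t) t = ennreal (exp (\<delta> * t) * ?k t) + outflow ?g t + outflow d t"
      by (simp add: outflow_add[OF pg pd] add.assoc)
    also have "\<dots> \<le> ennreal (exp (\<delta> * t) * ?k t) + outflow ?g t + outflow ?G t" by (rule add_left_mono[OF dG[OF t]])
    also have "\<dots> \<le> ennreal \<kappa>0 + inflow \<kappa> ?k t" by (rule subsolution_mix[OF s1(1) s2(1) environment _ _ \<kappa>0(1) t]) auto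
    finally show "ennreal (exp (\<delta> * t) * ?k t) + outflow (\<lambda>t. ?g t + d t) t \<le> ennreal \<kappa>0 + inflow \<kappa> ?k t" .
  qed
  note S = this
  have V: "value_of \<kappa>0 \<kappa> < top" using subsolution_welfare_finite[OF s1(1) environment \<kappa>0] s1(2) by simp
  have "welfare (\<lambda>t. ?g t + d t) \<le> value_of \<kappa>0 \<kappa>" by (rule welfare_le_value[OF S])
  moreover have "value_of \<kappa>0 \<kappa> \<le> welfare ?g"
  proof (rule ennreal_double_le_cancel)
    have "?g = (\<lambda>t. (g t + c t) / 2)" by (auto simp: mix_def)
    then show "value_of \<kappa>0 \<kappa> + value_of \<kappa>0 \<kappa> \<le> welfare ?g + welfare ?g" using welfare_midpoint[OF p(2,4)] s1(2) s2(2) by simp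
  qed
  moreover have "welfare ?g < welfare (\<lambda>t. ?g t + d t)"
  proof -
    define E where "E = (\<integral>\<^sup>+t. ennreal (exp (- r * t) * (U (?g t + e) - U (?g t))) * indicator {?T..?T + 1} t \<partial>lborel)"
    have [measurable]: "(\<lambda>t. U (?g t)) \<in> borel_measurable borel" using U_measurable[OF pg] .
    have pge: "profile (\<lambda>t. ?g t + e)" using pg epos by (auto simp: profile_def)
    have [measurable]: "(\<lambda>t. U (?g t + e)) \<in> borel_measurable borel" using U_measurable[OF pge] .
    have [measurable]: "(\<lambda>t. U (?g t + d t)) \<in> borel_measurable borel" using U_measurable[OF pgd] .
    have inc: "U (?g t) < U (?g t + e)" for t
      using strict_mono_onD[OF U_mono, of "?g t" "?g t + e"] profile_nonneg[OF pg, of t] epos by simp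
    have "E \<noteq> 0"
    proof
      assume "E = 0"
      then have "AE t in lborel. ennreal (exp (- r * t) * (U (?g t + e) - U (?g t))) * indicator {?T..?T + 1} t = 0"
        unfolding E_def by (subst (asm) nn_integral_0_iff_AE) auto
      then have "AE t in lborel. t \<notin> {?T..?T + 1}"
      proof eventually_elim
        case (elim t)
        show ?case
        proof
          assume "t \<in> {?T..?T + 1}"
          then have "exp (- r * t) * (U (?g t + e) - U (?g t)) \<le> 0" using elim by (simp add: ennreal_eq_0_iff)
          then show False using inc[of t] by (simp add: mult_le_0_iff)
        qed
      qed
      then have "emeasure lborel {?T..?T + 1} = 0" by (subst (asm) AE_iff_measurable[where N="{?T..?T + 1}"]) auto
      then show False by simp
    qed
    then have "welfare ?g < welfare ?g + E"
      using subsolution_welfare_finite[OF s1(1) environment \<kappa>0] V \<open>welfare (\<lambda>t. ?g t + d t) \<le> value_of \<kappa>0 \<kappa>\<close>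
    proof -
      have "welfare ?g \<le> welfare (\<lambda>t. ?g t + d t)"
        unfolding welfare_def using profile_nonneg[OF pg] profile_nonneg[OF pd]
        by (intro nn_integral_mono mult_right_mono ennreal_leI mult_left_mono U_le) auto
      then have "welfare ?g < top" using V \<open>welfare (\<lambda>t. ?g t + d t) \<le> value_of \<kappa>0 \<kappa>\<close> by (meson le_less_trans)
      then have "welfare ?g + 0 < welfare ?g + E" using \<open>E \<noteq> 0\<close> by (auto simp only: ennreal_add_left_cancel_less zero_less_iff_neq_zero infinity_ennreal_def)
      then show ?thesis by simp
    qed
    also have "welfare ?g + E = (\<integral>\<^sup>+t. ennreal (exp (- r * t) * U (?g t)) * indicator {0..} t + ennreal (exp (- r * t) * (U (?g t + e) - U (?g t))) * indicator {?T..?T + 1} t \<partial>lborel)"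
      unfolding welfare_def E_def by (rule nn_integral_add[symmetric]) measurable
    also have "\<dots> = welfare (\<lambda>t. ?g t + d t)"
      unfolding welfare_def
    proof (rule nn_integral_cong)
      fix t
      show "ennreal (exp (- r * t) * U (?g t)) * indicator {0..} t + ennreal (exp (- r * t) * (U (?g t + e) - U (?g t))) * indicator {?T..?T + 1} t
        = ennreal (exp (- r * t) * U (?g t + d t)) * indicator {0..} t"
      proof (cases "t \<in> {?T..?T + 1}")
        case True
        then have t: "0 \<le> t" by (auto intro: order_trans[of 0 "real n"])
        have "ennreal (exp (- r * t) * U (?g t)) + ennreal (exp (- r * t) * (U (?g t + e) - U (?g t)))
          = ennreal (exp (- r * t) * U (?g t) + exp (- r * t) * (U (?g t + e) - U (?g t)))"
          by (rule ennreal_plus[symmetric]) (use U_nonneg[OF profile_nonneg[OF pg], of t] inc[of t] in auto)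
        also have "exp (- r * t) * U (?g t) + exp (- r * t) * (U (?g t + e) - U (?g t)) = exp (- r * t) * U (?g t + d t)"
          using True by (simp add: d_def algebra_simps)
        finally show ?thesis using True t by simp
      qed (simp add: d_def)
    qed
    finally show ?thesis .
  qed
  ultimately show False by (meson leD le_less_trans)
qed

section \<open>Continuous dependence of optimal paths\<close>

definition welfare_upto :: "real \<Rightarrow> (real \<Rightarrow> real) \<Rightarrow> ennreal" where
  "welfare_upto T g = (\<integral>\<^sup>+t\<in>{0..T}. ennreal (exp (- r * t) * U (g t)) \<partial>lborel)"

lemma welfare_upto_tendsto:
  assumes "profile g" shows "(\<lambda>n. welfare_upto (real n) g) \<longlonglongrightarrow> welfare g"
proof -
  have [measurable]: "(\<lambda>t. U (g t)) \<in> borel_measurable borel" by (rule U_measurable[OF assms])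
  let ?h = "\<lambda>n t. ennreal (exp (- r * t) * U (g t)) * indicator {0..real n} t"
  have "(\<lambda>n. integral\<^sup>N lborel (?h n)) \<longlonglongrightarrow> (\<integral>\<^sup>+t. ennreal (exp (- r * t) * U (g t)) * indicator {0..} t \<partial>lborel)"
  proof (rule nn_integral_LIMSEQ)
    show "incseq ?h" by (auto simp: incseq_def le_fun_def indicator_def)
    show "?h n \<in> borel_measurable lborel" for n by measurable
    fix t
    obtain N where N: "t \<le> real N" using real_arch_simple by blast
    have "\<forall>\<^sub>F n in sequentially. ?h n t = ennreal (exp (- r * t) * U (g t)) * indicator {0..} t"
      using N by (intro eventually_sequentiallyI[of N]) (auto simp: indicator_def)
    then show "(\<lambda>n. ?h n t) \<longlonglongrightarrow> ennreal (exp (- r * t) * U (g t)) * indicator {0..} t"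
      by (rule tendsto_eventually)
  qed
  then show ?thesis by (simp add: welfare_upto_def welfare_def)
qed

lemma U_scale:
  assumes "0 \<le> x" "0 \<le> u" "u \<le> 1" shows "(1 - u) * U x \<le> U ((1 - u) * x)"
proof -
  have "(1 - u) * U x + u * U 0 \<le> U ((1 - u) * x)" using concave_onD[OF U_concave, of u x 0] assms by simp
  moreover have "0 \<le> u * U 0" using assms U_nonneg[of 0] by simp
  ultimately show ?thesis by linarith
qed

lemma welfare_upto_scale:
  assumes "profile g" "0 \<le> u" "u \<le> 1"
  shows "ennreal (1 - u) * welfare_upto T g \<le> welfare_upto T (\<lambda>t. (1 - u) * g t)"
proof -
  have [measurable]: "(\<lambda>t. U (g t)) \<in> borel_measurable borel" by (rule U_measurable[OF assms(1)])
  have "ennreal (1 - u) * welfare_upto T g = (\<integral>\<^sup>+t. ennreal (1 - u) * (ennreal (exp (- r * t) * U (g t)) * indicator {0..T} t) \<partial>lborel)"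
    unfolding welfare_upto_def by (rule nn_integral_cmult[symmetric]) measurable
  also have "\<dots> \<le> welfare_upto T (\<lambda>t. (1 - u) * g t)"
    unfolding welfare_upto_def
  proof (rule nn_integral_mono)
    fix t
    have "ennreal (1 - u) * ennreal (exp (- r * t) * U (g t)) = ennreal (exp (- r * t) * ((1 - u) * U (g t)))"
      using assms U_nonneg[OF profile_nonneg[OF assms(1)], of t] by (simp add: mult_ac flip: ennreal_mult)
    also have "\<dots> \<le> ennreal (exp (- r * t) * U ((1 - u) * g t))"
      by (intro ennreal_leI mult_left_mono U_scale profile_nonneg[OF assms(1)] assms(2,3)) auto
    finally show "ennreal (1 - u) * (ennreal (exp (- r * t) * U (g t)) * indicator {0..T} t) \<le> ennreal (exp (- r * t) * U ((1 - u) * g t)) * indicator {0..T} t"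
      by (auto simp: indicator_def)
  qed
  finally show ?thesis .
qed

text \<open>
  Stocks below \<open>k1\<close> reproduce themselves, since \<open>f\<close> is positive there.
\<close>

lemma constant_subsolution:
  assumes "environment \<kappa>" "0 < y" "y < k1" "y \<le> \<kappa>0" "\<kappa>0 \<le> R"
  shows "subsolution \<kappa>0 \<kappa> (\<lambda>_. y) (\<lambda>_. 0)"
proof -
  have "ennreal (exp (\<delta> * t) * y) + outflow (\<lambda>_. 0) t \<le> ennreal \<kappa>0 + inflow \<kappa> (\<lambda>_. y) t" if t: "0 \<le> t" for t
  proof -
    have "ennreal (y * (exp (\<delta> * t) - 1)) = (\<integral>\<^sup>+s\<in>{0..t}. ennreal (exp (\<delta> * s) * (\<delta> * y)) \<partial>lborel)"
      using nn_integral_exp_Icc_0[of \<delta> "\<delta> * y" t] pos assms t by simp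
    also have "\<dots> \<le> inflow \<kappa> (\<lambda>_. y) t"
      unfolding inflow_def
    proof (intro nn_integral_mono mult_right_mono ennreal_leI mult_left_mono)
      fix s show "\<delta> * y \<le> F y (\<kappa> s)" using f_pos[OF environment_range[OF assms(1)] assms(2,3), of s] by (simp add: F_def)
    qed auto
    finally have 1: "ennreal (y * (exp (\<delta> * t) - 1)) \<le> inflow \<kappa> (\<lambda>_. y) t" .
    have "ennreal (exp (\<delta> * t) * y) = ennreal (y + y * (exp (\<delta> * t) - 1))" by (simp add: algebra_simps)
    also have "\<dots> = ennreal y + ennreal (y * (exp (\<delta> * t) - 1))" using assms pos t by (intro ennreal_plus) auto
    also have "\<dots> \<le> ennreal \<kappa>0 + inflow \<kappa> (\<lambda>_. y) t" using assms by (intro add_mono 1 ennreal_leI)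
    finally show ?thesis by (simp add: outflow_def)
  qed
  then show ?thesis using assms by (auto simp: subsolution_def profile_def)
qed

lemma perturbation_small:
  assumes "\<And>n. environment (\<kappa>n n)" "environment \<kappa>" "profile k" "\<And>t. 0 \<le> t \<Longrightarrow> k t \<le> R"
    and "\<And>t. 0 \<le> t \<Longrightarrow> (\<lambda>n. \<kappa>n n t) \<longlonglongrightarrow> \<kappa> t"
  shows "(\<lambda>n. \<integral>\<^sup>+s\<in>{0..T}. ennreal (exp (\<delta> * s) * \<bar>f (k s) (\<kappa> s) - f (k s) (\<kappa>n n s)\<bar>) \<partial>lborel) \<longlonglongrightarrow> 0"
proof -
  have [measurable]: "(\<lambda>s. f (k s) (\<kappa> s)) \<in> borel_measurable borel" "(\<lambda>s. f (k s) (\<kappa>n n s)) \<in> borel_measurable borel" for n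
    using f_measurable assms by auto
  have Fb: "0 \<le> f (k s) K + \<delta> * k s \<and> f (k s) K + \<delta> * k s \<le> \<delta> * R" if "0 \<le> s" "K \<in> {a..b}" for s K
    using F_le[OF that(2) profile_nonneg[OF assms(3), of s]] F_nonneg[OF that(2) profile_nonneg[OF assms(3), of s]] assms(4)[OF that(1)]
    by (simp add: F_def max_def)
  have "(\<lambda>n. \<integral>\<^sup>+s\<in>{0..T}. ennreal (exp (\<delta> * s) * \<bar>f (k s) (\<kappa> s) - f (k s) (\<kappa>n n s)\<bar>) \<partial>lborel) \<longlonglongrightarrow>
     (\<integral>\<^sup>+s. 0 \<partial>(lborel :: real measure))"
  proof (rule nn_integral_dominated_convergence[where w="\<lambda>s. ennreal (exp (\<delta> * s) * (\<delta> * R)) * indicator {0..T} s"])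
    show "(\<integral>\<^sup>+s\<in>{0..T}. ennreal (exp (\<delta> * s) * (\<delta> * R)) \<partial>lborel) < \<infinity>"
      using nn_integral_exp_Icc_0[of \<delta> "\<delta> * R" T] pos by (cases "0 \<le> T") auto
    show "AE s in lborel. ennreal (exp (\<delta> * s) * \<bar>f (k s) (\<kappa> s) - f (k s) (\<kappa>n j s)\<bar>) * indicator {0..T} s
        \<le> ennreal (exp (\<delta> * s) * (\<delta> * R)) * indicator {0..T} s" for j
    proof (rule AE_I2)
      fix s
      show "ennreal (exp (\<delta> * s) * \<bar>f (k s) (\<kappa> s) - f (k s) (\<kappa>n j s)\<bar>) * indicator {0..T} s
        \<le> ennreal (exp (\<delta> * s) * (\<delta> * R)) * indicator {0..T} s"
      proof (cases "s \<in> {0..T}")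
        case True
        have "\<bar>f (k s) (\<kappa> s) - f (k s) (\<kappa>n j s)\<bar> \<le> \<delta> * R"
          using Fb[of s "\<kappa> s"] Fb[of s "\<kappa>n j s"] environment_range[OF assms(1)] environment_range[OF assms(2)] True by (simp add: abs_le_iff)
        then show ?thesis using True by (auto intro!: ennreal_leI mult_left_mono)
      qed simp
    qed
    show "AE s in lborel. (\<lambda>n. ennreal (exp (\<delta> * s) * \<bar>f (k s) (\<kappa> s) - f (k s) (\<kappa>n n s)\<bar>) * indicator {0..T} s) \<longlonglongrightarrow> 0"
    proof (rule AE_I2)
      fix s
      show "(\<lambda>n. ennreal (exp (\<delta> * s) * \<bar>f (k s) (\<kappa> s) - f (k s) (\<kappa>n n s)\<bar>) * indicator {0..T} s) \<longlonglongrightarrow> 0"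
      proof (cases "s \<in> {0..T}")
        case True
        have "(\<lambda>n. f (k s) (\<kappa>n n s)) \<longlonglongrightarrow> f (k s) (\<kappa> s)"
          by (rule f_tendsto[OF profile_nonneg[OF assms(3)] environment_range[OF assms(1)] tendsto_const assms(5)]) (use True in auto)
        then have "(\<lambda>n. exp (\<delta> * s) * \<bar>f (k s) (\<kappa> s) - f (k s) (\<kappa>n n s)\<bar>) \<longlonglongrightarrow> exp (\<delta> * s) * \<bar>f (k s) (\<kappa> s) - f (k s) (\<kappa> s)\<bar>"
          by (intro tendsto_intros)
        from tendsto_ennrealI[OF this] show ?thesis using True by simp
      qed simp
    qed
  qed measurable
  then show ?thesis by simp
qed

text \<open>
  The function \<open>\<theta>(t) = \<zeta> exp(C t)\<close> satisfies \<open>\<theta>' = C \<theta>\<close>, and lowering the stock by \<open>\<theta>\<close> lowers \<open>f\<close> by at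
  most \<open>C \<theta>\<close>, as long as the stock stays above \<open>\<eta>/2\<close>. So the lowered stock pays for its own loss of
  production, and the initial amount \<open>\<zeta>\<close> pays for the change of the initial stock and of the
  externality. After \<open>T\<close> stock and consumption are put to \<open>0\<close>.
\<close>

lemma perturbed_competitor:
  assumes subsolution: "subsolution \<kappa>0 \<kappa> k g" and environment: "environment \<kappa>" "environment \<kappa>'" and \<kappa>0: "0 \<le> \<kappa>0" "\<kappa>0 \<le> R" "0 \<le> \<kappa>0'"
    and \<eta>: "0 < \<eta>" "\<And>t. 0 \<le> t \<Longrightarrow> \<eta> \<le> k t" and T: "0 \<le> T"
    and C: "0 \<le> C" "\<And>K x y. K \<in> {a..b} \<Longrightarrow> \<eta> / 2 \<le> x \<Longrightarrow> x \<le> y \<Longrightarrow> f y K - f x K \<le> C * (y - x)"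
    and E: "(\<integral>\<^sup>+s\<in>{0..T}. ennreal (exp (\<delta> * s) * \<bar>f (k s) (\<kappa> s) - f (k s) (\<kappa>' s)\<bar>) \<partial>lborel) \<le> ennreal E" "0 \<le> E"
    and \<zeta>: "\<bar>\<kappa>0' - \<kappa>0\<bar> + E \<le> \<zeta>" "\<zeta> * exp (C * T) \<le> \<eta> / 2"
  shows "welfare_upto T g \<le> value_of \<kappa>0' \<kappa>'"
proof -
  have pk: "profile k" and pg: "profile g" using subsolution by (auto simp: subsolution_def)
  have [measurable]: "k \<in> borel_measurable borel" "g \<in> borel_measurable borel" using pk pg profile_measurable by auto
  have \<zeta>0: "0 \<le> \<zeta>" using \<zeta>(1) E(2) by linarith
  (* In weighted units the lowering grows at the rate C + \<delta>. *)
  define w where "w = C + \<delta>"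
  have w: "w > 0" using C pos by (simp add: w_def)
  define \<theta> where "\<theta> t = \<zeta> * exp (C * t)" for t
  have \<theta>0: "0 \<le> \<theta> t" for t using \<zeta>0 by (simp add: \<theta>_def)
  have \<theta>1: "\<theta> t \<le> \<eta> / 2" if "t \<le> T" for t
  proof -
    have "\<theta> t \<le> \<zeta> * exp (C * T)" unfolding \<theta>_def using \<zeta>0 C(1) that by (intro mult_left_mono) (auto intro: mult_left_mono)
    then show ?thesis using \<zeta>(2) by linarith
  qed
  have \<theta>e: "exp (\<delta> * t) * \<theta> t = \<zeta> * exp (w * t)" for t by (simp add: \<theta>_def w_def distrib_right exp_add)
  define h where "h t = (if 0 \<le> t \<and> t \<le> T then k t - \<theta> t else 0)" for t
  define c where "c t = (if 0 \<le> t \<and> t \<le> T then g t else 0)" for t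
  have [measurable]: "\<theta> \<in> borel_measurable borel" unfolding \<theta>_def by measurable
  have hk: "\<eta> / 2 \<le> h t" "h t \<le> k t" "k t = h t + \<theta> t" if "0 \<le> t" "t \<le> T" for t
    using \<eta>(2)[OF that(1)] \<theta>1[OF that(2)] \<theta>0[of t] that by (auto simp: h_def)
  have ph: "profile h"
  proof -
    have "h \<in> borel_measurable borel" unfolding h_def by measurable
    moreover have "0 \<le> h t" for t using hk(1)[of t] \<eta>(1) by (cases "0 \<le> t \<and> t \<le> T") (auto simp: h_def)
    ultimately show ?thesis by (simp add: profile_def)
  qed
  have pc: "profile c"
  proof -
    have "c \<in> borel_measurable borel" unfolding c_def by measurable
    then show ?thesis using profile_nonneg[OF pg] by (simp add: profile_def c_def)
  qed
  have [measurable]: "(\<lambda>s. F (h s) (\<kappa>' s)) \<in> borel_measurable borel" "(\<lambda>s. f (k s) (\<kappa> s)) \<in> borel_measurable borel"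
    "(\<lambda>s. f (k s) (\<kappa>' s)) \<in> borel_measurable borel"
    using F_measurable f_measurable environment ph pk by auto
  have inflow_cmp: "inflow \<kappa> k t \<le> inflow \<kappa>' h t + ennreal E + ennreal (\<zeta> * (exp (w * t) - 1))" if t: "0 \<le> t" "t \<le> T" for t
  proof -
    let ?A = "\<lambda>s. ennreal (exp (\<delta> * s) * F (h s) (\<kappa>' s)) * indicator {0..t} s"
    let ?B = "\<lambda>s. ennreal (exp (\<delta> * s) * \<bar>f (k s) (\<kappa> s) - f (k s) (\<kappa>' s)\<bar>) * indicator {0..T} s"
    let ?D = "\<lambda>s. ennreal (exp (w * s) * (w * \<zeta>)) * indicator {0..t} s"
    have "inflow \<kappa> k t \<le> (\<integral>\<^sup>+s. ?A s + ?B s + ?D s \<partial>lborel)"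
      unfolding inflow_def
    proof (rule nn_integral_mono)
      fix s
      show "ennreal (exp (\<delta> * s) * F (k s) (\<kappa> s)) * indicator {0..t} s \<le> ?A s + ?B s + ?D s"
      proof (cases "s \<in> {0..t}")
        case True
        then have s: "0 \<le> s" "s \<le> T" using t by auto
        have "f (k s) (\<kappa>' s) - f (h s) (\<kappa>' s) \<le> C * \<theta> s"
          using C(2)[OF environment_range[OF environment(2)] hk(1)[OF s] hk(2)[OF s], of s] hk(3)[OF s] by simp
        then have "F (k s) (\<kappa> s) \<le> F (h s) (\<kappa>' s) + \<bar>f (k s) (\<kappa> s) - f (k s) (\<kappa>' s)\<bar> + w * \<theta> s"
          using hk(3)[OF s] by (simp add: F_def w_def algebra_simps)
        then have "exp (\<delta> * s) * F (k s) (\<kappa> s) \<le> exp (\<delta> * s) * (F (h s) (\<kappa>' s) + \<bar>f (k s) (\<kappa> s) - f (k s) (\<kappa>' s)\<bar> + w * \<theta> s)"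
          by (intro mult_left_mono) auto
        also have "\<dots> = exp (\<delta> * s) * F (h s) (\<kappa>' s) + exp (\<delta> * s) * \<bar>f (k s) (\<kappa> s) - f (k s) (\<kappa>' s)\<bar> + w * (exp (\<delta> * s) * \<theta> s)"
          by (simp add: algebra_simps)
        also have "w * (exp (\<delta> * s) * \<theta> s) = exp (w * s) * (w * \<zeta>)" unfolding \<theta>e by simp
        finally have "ennreal (exp (\<delta> * s) * F (k s) (\<kappa> s)) \<le> ennreal (exp (\<delta> * s) * F (h s) (\<kappa>' s) + exp (\<delta> * s) * \<bar>f (k s) (\<kappa> s) - f (k s) (\<kappa>' s)\<bar> + exp (w * s) * (w * \<zeta>))"
          by (rule ennreal_leI)
        also have "\<dots> = ennreal (exp (\<delta> * s) * F (h s) (\<kappa>' s)) + ennreal (exp (\<delta> * s) * \<bar>f (k s) (\<kappa> s) - f (k s) (\<kappa>' s)\<bar>) + ennreal (exp (w * s) * (w * \<zeta>))"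
          using F_nonneg[OF environment_range[OF environment(2)] profile_nonneg[OF ph], of s s] w \<zeta>0 by (simp add: ennreal_plus)
        finally show ?thesis using True t by simp
      qed simp
    qed
    also have "\<dots> = (\<integral>\<^sup>+s. ?A s + ?B s \<partial>lborel) + (\<integral>\<^sup>+s. ?D s \<partial>lborel)" by (rule nn_integral_add) measurable
    also have "(\<integral>\<^sup>+s. ?A s + ?B s \<partial>lborel) = (\<integral>\<^sup>+s. ?A s \<partial>lborel) + (\<integral>\<^sup>+s. ?B s \<partial>lborel)" by (rule nn_integral_add) measurable
    also have "(\<integral>\<^sup>+s. ?A s \<partial>lborel) = inflow \<kappa>' h t" by (simp add: inflow_def)
    also have "(\<integral>\<^sup>+s. ?D s \<partial>lborel) = ennreal (\<zeta> * (exp (w * t) - 1))"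
      using nn_integral_exp_Icc_0[of w "w * \<zeta>" t] w \<zeta>0 t by simp
    also have "inflow \<kappa>' h t + (\<integral>\<^sup>+s. ?B s \<partial>lborel) + ennreal (\<zeta> * (exp (w * t) - 1)) \<le> inflow \<kappa>' h t + ennreal E + ennreal (\<zeta> * (exp (w * t) - 1))"
      by (intro add_mono E(1)) auto
    finally show ?thesis .
  qed
  have in_T: "ennreal (exp (\<delta> * t) * h t) + outflow c t \<le> ennreal \<kappa>0' + inflow \<kappa>' h t" if t: "0 \<le> t" "t \<le> T" for t
  proof -
    let ?z = "\<zeta> * exp (w * t)"
    have oc: "outflow c t = outflow g t"
      unfolding outflow_def c_def using t by (intro nn_integral_cong) (auto simp: indicator_def)
    have "ennreal ?z + (ennreal (exp (\<delta> * t) * h t) + outflow c t) = ennreal (exp (\<delta> * t) * k t) + outflow g t"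
    proof -
      have "ennreal (exp (\<delta> * t) * k t) = ennreal (?z + exp (\<delta> * t) * h t)"
        unfolding hk(3)[OF t] by (simp add: distrib_left \<theta>e add.commute)
      also have "\<dots> = ennreal ?z + ennreal (exp (\<delta> * t) * h t)"
        by (rule ennreal_plus) (use \<zeta>0 profile_nonneg[OF ph, of t] in auto)
      finally show ?thesis unfolding oc by (simp add: add.assoc)
    qed
    also have "\<dots> \<le> ennreal \<kappa>0 + inflow \<kappa> k t" using subsolution t by (simp add: subsolution_def)
    also have "\<dots> \<le> ennreal \<kappa>0 + (inflow \<kappa>' h t + ennreal E + ennreal (\<zeta> * (exp (w * t) - 1)))"
      by (intro add_left_mono inflow_cmp t)
    also have "\<dots> = (ennreal \<kappa>0 + ennreal E + ennreal (\<zeta> * (exp (w * t) - 1))) + inflow \<kappa>' h t" by (simp add: add_ac)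
    also have "ennreal \<kappa>0 + ennreal E + ennreal (\<zeta> * (exp (w * t) - 1)) = ennreal (\<kappa>0 + E + \<zeta> * (exp (w * t) - 1))"
      using \<kappa>0 E(2) \<zeta>0 w t by (simp add: ennreal_plus)
    also have "\<dots> \<le> ennreal (?z + \<kappa>0')"
      using \<zeta>(1) by (intro ennreal_leI) (simp add: algebra_simps abs_le_iff)
    also have "\<dots> = ennreal ?z + ennreal \<kappa>0'" by (rule ennreal_plus) (use \<zeta>0 \<kappa>0 in auto)
    finally have "ennreal ?z + (ennreal (exp (\<delta> * t) * h t) + outflow c t) \<le> ennreal ?z + (ennreal \<kappa>0' + inflow \<kappa>' h t)"
      by (auto simp: add.assoc intro: add_right_mono)
    then show ?thesis unfolding ennreal_add_left_cancel_le by simp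
  qed
  have "subsolution \<kappa>0' \<kappa>' h c"
    unfolding subsolution_def
  proof (intro conjI ph pc allI impI)
    fix S :: real
    show "\<exists>B. \<forall>t\<in>{0..S}. h t \<le> B"
    proof (rule exI[of _ R], rule ballI)
      fix t assume "t \<in> {0..S}"
      then show "h t \<le> R" using subsolution_le_R[OF subsolution environment(1) \<kappa>0(1,2), of t] hk(2)[of t] pos by (cases "t \<le> T") (auto simp: h_def)
    qed
  next
    fix t :: real assume t: "0 \<le> t"
    show "ennreal (exp (\<delta> * t) * h t) + outflow c t \<le> ennreal \<kappa>0' + inflow \<kappa>' h t"
    proof (cases "t \<le> T")
      case False
      then have "ennreal (exp (\<delta> * t) * h t) + outflow c t = outflow c t" by (simp add: h_def)
      also have "outflow c t = outflow c T"
        unfolding outflow_def c_def using False by (intro nn_integral_cong) (auto simp: indicator_def)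
      also have "\<dots> \<le> ennreal (exp (\<delta> * T) * h T) + outflow c T" by simp
      also have "\<dots> \<le> ennreal \<kappa>0' + inflow \<kappa>' h T" by (rule in_T[OF T]) simp
      also have "\<dots> \<le> ennreal \<kappa>0' + inflow \<kappa>' h t"
        unfolding inflow_def using False by (intro add_left_mono nn_integral_mono) (auto simp: indicator_def)
      finally show ?thesis .
    qed (use in_T t in blast)
  qed
  then have "welfare c \<le> value_of \<kappa>0' \<kappa>'" by (rule welfare_le_value)
  moreover have "welfare_upto T g \<le> welfare c"
    unfolding welfare_upto_def welfare_def c_def by (intro nn_integral_mono) (auto simp: indicator_def)
  ultimately show ?thesis by (rule order_trans[rotated])
qed

text \<open>
  Mix an optimal solution, with weight \<open>1 - u\<close>, with a constant path; the stock is then at least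
  \<open>\<eta> = u y\<close> at all times, and consumption keeps the fraction \<open>1 - u\<close>, hence by concavity at least
  that fraction of welfare. The perturbed competitor on \<open>[0,T]\<close> shows that nearby problems have a
  value of at least \<open>1 - u\<close> times the welfare up to \<open>T\<close>. Finally \<open>u \<rightarrow> 0\<close> and \<open>T \<rightarrow> \<infinity>\<close>.
\<close>

lemma value_lower_semicontinuous:
  assumes environment: "\<And>n. environment (\<kappa>n n)" "environment \<kappa>" and \<kappa>0: "\<And>n. 0 \<le> \<kappa>0n n" "0 < \<kappa>0" "\<kappa>0 \<le> R"
    and lim: "\<kappa>0n \<longlonglongrightarrow> \<kappa>0" "\<And>t. 0 \<le> t \<Longrightarrow> (\<lambda>n. \<kappa>n n t) \<longlonglongrightarrow> \<kappa> t"
  shows "value_of \<kappa>0 \<kappa> \<le> liminf (\<lambda>n. value_of (\<kappa>0n n) (\<kappa>n n))"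
proof -
  have \<kappa>00: "0 \<le> \<kappa>0" using \<kappa>0 by simp
  obtain k g where opt: "optimal \<kappa>0 \<kappa> k g" using optimal_exists[OF environment(2) \<kappa>00 \<kappa>0(3)] by blast
  then have s: "subsolution \<kappa>0 \<kappa> k g" and Pg: "welfare g = value_of \<kappa>0 \<kappa>" by (auto simp: optimal_def intro: solution_imp_subsolution)
  have p: "profile k" "profile g" using s by (auto simp: subsolution_def)
  define y where "y = min \<kappa>0 (k1 / 2)"
  have y: "0 < y" "y < k1" "y \<le> \<kappa>0" using \<kappa>0 pos by (auto simp: y_def)
  note sy = constant_subsolution[OF environment(2) y \<kappa>0(3)]
  have step: "ennreal (1 - u) * welfare_upto T g \<le> liminf (\<lambda>n. value_of (\<kappa>0n n) (\<kappa>n n))" if u: "0 < u" "u < 1" and T: "0 \<le> T" for u T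
  proof -
    let ?k = "mix u k (\<lambda>_. y)" and ?g = "mix u g (\<lambda>_. 0)"
    have pk: "profile ?k" and pg: "profile ?g" using profile_mix[of _ _ u] p y u by (auto simp: profile_def)
    have kR: "k t \<le> R" if "0 \<le> t" for t by (rule subsolution_le_R[OF s environment(2) \<kappa>00 \<kappa>0(3) that])
    have yR: "y \<le> R" using y \<kappa>0 by simp
    have mR: "?k t \<le> R" if "0 \<le> t" for t
    proof -
      have "(1 - u) * k t + u * y \<le> (1 - u) * R + u * R" using kR[OF that] yR u by (intro add_mono mult_left_mono) auto
      then show ?thesis by (simp add: mix_def algebra_simps)
    qed
    have sm: "subsolution \<kappa>0 \<kappa> ?k ?g"
      unfolding subsolution_def
    proof (intro conjI pk pg allI impI)
      show "\<exists>B. \<forall>t\<in>{0..T}. ?k t \<le> B" for T by (rule exI[of _ R]) (simp add: mR)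
      fix t :: real assume t: "0 \<le> t"
      show "ennreal (exp (\<delta> * t) * ?k t) + outflow ?g t \<le> ennreal \<kappa>0 + inflow \<kappa> ?k t"
        by (rule order_trans[OF _ subsolution_mix[OF s sy environment(2) u \<kappa>00 t]]) simp
    qed
    define \<eta> where "\<eta> = u * y"
    have \<eta>: "0 < \<eta>" "\<eta> \<le> ?k t" for t
      using u y profile_nonneg[OF p(1), of t] by (auto simp: \<eta>_def mix_def)
    obtain C where C: "0 \<le> C" "\<And>K x y. K \<in> {a..b} \<Longrightarrow> \<eta> / 2 \<le> x \<Longrightarrow> x \<le> y \<Longrightarrow> f y K - f x K \<le> C * (y - x)"
      using f_upper[of "\<eta> / 2"] \<eta>(1) by auto
    define E where "E n = (\<integral>\<^sup>+s\<in>{0..T}. ennreal (exp (\<delta> * s) * \<bar>f (?k s) (\<kappa> s) - f (?k s) (\<kappa>n n s)\<bar>) \<partial>lborel)" for n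
    have E0: "E \<longlonglongrightarrow> 0" unfolding E_def by (rule perturbation_small[OF environment pk mR lim(2)])
    (* With \<zeta> = 2\<epsilon> the lowering stays below \<eta>/2 up to time T. *)
    define \<epsilon> where "\<epsilon> = \<eta> / 4 * exp (- (C * T))"
    have \<epsilon>: "0 < \<epsilon>" using \<eta>(1) by (simp add: \<epsilon>_def)
    have "\<forall>\<^sub>F n in sequentially. E n < ennreal \<epsilon>" by (rule order_tendstoD(2)[OF E0]) (use \<epsilon> in simp)
    moreover have "\<forall>\<^sub>F n in sequentially. dist (\<kappa>0n n) \<kappa>0 < \<epsilon>" by (rule tendstoD[OF lim(1) \<epsilon>])
    ultimately have "\<forall>\<^sub>F n in sequentially. ennreal (1 - u) * welfare_upto T g \<le> value_of (\<kappa>0n n) (\<kappa>n n)"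
    proof eventually_elim
      case (elim n)
      have "welfare_upto T ?g \<le> value_of (\<kappa>0n n) (\<kappa>n n)"
      proof (rule perturbed_competitor[OF sm environment(2) environment(1) \<kappa>00 \<kappa>0(3) \<kappa>0(1) \<eta>(1) \<eta>(2) T C, where E=\<epsilon> and \<zeta>="2 * \<epsilon>"])
        show "(\<integral>\<^sup>+s\<in>{0..T}. ennreal (exp (\<delta> * s) * \<bar>f (?k s) (\<kappa> s) - f (?k s) (\<kappa>n n s)\<bar>) \<partial>lborel) \<le> ennreal \<epsilon>"
          using elim(1) by (simp add: E_def)
        show "\<bar>\<kappa>0n n - \<kappa>0\<bar> + \<epsilon> \<le> 2 * \<epsilon>" using elim(2) by (simp add: dist_real_def)
        have "2 * \<epsilon> * exp (C * T) = \<eta> / 2 * (exp (- (C * T)) * exp (C * T))" by (simp add: \<epsilon>_def)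
        then show "2 * \<epsilon> * exp (C * T) \<le> \<eta> / 2" by (simp flip: exp_add)
      qed (use \<epsilon> in auto)
      moreover have "?g = (\<lambda>t. (1 - u) * g t)" by (auto simp: mix_def)
      ultimately show ?case using welfare_upto_scale[OF p(2), of u T] u by (auto intro: order_trans)
    qed
    then show ?thesis by (rule Liminf_bounded)
  qed
  have "(\<lambda>n. ennreal (1 - 1 / real (Suc (Suc n))) * welfare_upto (real n) g) \<longlonglongrightarrow> ennreal (1 - 0) * welfare g"
  proof (rule tendsto_mult_ennreal)
    show "(\<lambda>n. ennreal (1 - 1 / real (Suc (Suc n)))) \<longlonglongrightarrow> ennreal (1 - 0)"
      by (intro tendsto_ennrealI tendsto_intros LIMSEQ_Suc lim_1_over_n)
    show "(\<lambda>n. welfare_upto (real n) g) \<longlonglongrightarrow> welfare g" by (rule welfare_upto_tendsto[OF p(2)])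
  qed simp
  moreover have "ennreal (1 - 1 / real (Suc (Suc n))) * welfare_upto (real n) g \<le> liminf (\<lambda>n. value_of (\<kappa>0n n) (\<kappa>n n))" for n
    by (rule step) auto
  ultimately have "ennreal (1 - 0) * welfare g \<le> liminf (\<lambda>n. value_of (\<kappa>0n n) (\<kappa>n n))"
    by (intro LIMSEQ_le_const2) auto
  then show ?thesis by (simp add: Pg)
qed

lemma AE_decreasing_points:
  assumes "AE x in lborel. Q x"
  shows "\<exists>s. decseq s \<and> s \<longlonglongrightarrow> (t :: real) \<and> (\<forall>n. t < s n \<and> Q (s n))"
proof -
  have "\<exists>x. x \<in> {t + 1 / real (Suc (Suc n)) <..< t + 1 / real (Suc n)} \<and> Q x" for n
  proof (rule ccontr)
    let ?I = "{t + 1 / real (Suc (Suc n)) <..< t + 1 / real (Suc n)}"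
    assume "\<not> ?thesis"
    then have "AE x in lborel. x \<notin> ?I" using assms by (auto elim!: eventually_mono)
    then have "emeasure lborel ?I = 0" by (subst (asm) AE_iff_measurable[where N="?I"]) auto
    moreover have "1 / real (Suc (Suc n)) < 1 / real (Suc n)" by (simp add: divide_simps)
    ultimately show False by simp
  qed
  then have "\<forall>n. \<exists>x. x \<in> {t + 1 / real (Suc (Suc n)) <..< t + 1 / real (Suc n)} \<and> Q x" by blast
  from choice[OF this] obtain s where s: "\<And>n. s n \<in> {t + 1 / real (Suc (Suc n)) <..< t + 1 / real (Suc n)}" "\<And>n. Q (s n)"
    by blast
  have sn: "t + 1 / real (Suc (Suc n)) < s n" "s n < t + 1 / real (Suc n)" for n using s(1)[of n] by auto
  have "decseq s"
  proof (rule decseq_SucI)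
    show "s (Suc n) \<le> s n" for n using sn(2)[of "Suc n"] sn(1)[of n] by linarith
  qed
  moreover have ts: "t < s n" for n
  proof -
    have "0 < 1 / real (Suc (Suc n))" by simp
    then show ?thesis using sn(1)[of n] by linarith
  qed
  moreover have "s \<longlonglongrightarrow> t"
  proof (rule real_tendsto_sandwich[of "\<lambda>_. t" _ _ "\<lambda>n. t + 1 / real (Suc n)"])
    have "(\<lambda>n. t + 1 / real (Suc n)) \<longlonglongrightarrow> t + 0" by (intro tendsto_intros lim_1_over_n[THEN LIMSEQ_Suc])
    then show "(\<lambda>n. t + 1 / real (Suc n)) \<longlonglongrightarrow> t" by simp
  qed (use ts sn(2) in \<open>auto intro!: always_eventually less_imp_le\<close>)
  ultimately show ?thesis using s(2) by blast
qed

lemma Lipschitz_tendsto: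
  assumes "\<And>s t. 0 \<le> s \<Longrightarrow> 0 \<le> t \<Longrightarrow> \<bar>k s - k t\<bar> \<le> Lip * \<bar>s - t\<bar>" "s \<longlonglongrightarrow> t" "\<And>n. 0 \<le> s n" "0 \<le> t"
  shows "(\<lambda>n. k (s n)) \<longlonglongrightarrow> (k t :: real)"
proof -
  have "(\<lambda>n. Lip * \<bar>s n - t\<bar>) \<longlonglongrightarrow> Lip * \<bar>t - t\<bar>" by (intro tendsto_intros assms(2))
  then have "(\<lambda>n. Lip * \<bar>s n - t\<bar>) \<longlonglongrightarrow> 0" by simp
  then have "(\<lambda>n. k (s n) - k t) \<longlonglongrightarrow> 0"
    by (rule Lim_null_comparison[rotated]) (use assms in auto)
  then show ?thesis by (simp add: LIM_zero_iff)
qed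

text \<open>
  Continuity from the right upgrades equality almost everywhere to equality at \<open>t\<close>. It is assumed
  in the form in which stocks of the original problem have it, along decreasing sequences.
\<close>

lemma optimal_unique:
  assumes opt: "optimal \<kappa>0 \<kappa> k g" and environment: "environment \<kappa>" and \<kappa>0: "0 \<le> \<kappa>0" "\<kappa>0 \<le> R"
    and s: "subsolution \<kappa>0 \<kappa> h c" "welfare c = value_of \<kappa>0 \<kappa>"
    and right: "\<And>s. decseq s \<Longrightarrow> s \<longlonglongrightarrow> t \<Longrightarrow> (\<And>n. t < s n) \<Longrightarrow> (\<lambda>n. h (s n)) \<longlonglongrightarrow> h t"
    and t: "0 \<le> t"
  shows "h t = k t"
proof -
  have "AE x in lborel. 0 \<le> x \<longrightarrow> k x = h x"
    by (rule optimal_unique_AE[OF _ _ s environment \<kappa>0]) (use opt in \<open>auto simp: optimal_def intro: solution_imp_subsolution\<close>)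
  from AE_decreasing_points[OF this, of t] obtain x where
    x: "decseq x" "x \<longlonglongrightarrow> t" "\<And>n. t < x n" "\<And>n. 0 \<le> x n \<longrightarrow> k (x n) = h (x n)" by blast
  have x0: "0 \<le> x n" for n using x(3)[of n] t by linarith
  have "(\<lambda>n. k (x n)) \<longlonglongrightarrow> k t"
    by (rule Lipschitz_tendsto[OF optimal_bounds(2)[OF opt environment \<kappa>0] x(2) x0 t])
  then have "(\<lambda>n. h (x n)) \<longlonglongrightarrow> k t" using x(4) x0 by simp
  then show ?thesis using LIMSEQ_unique right[OF x(1-3)] by blast
qed

text \<open>
  Every subsequence has a further one along which the solutions converge to a solution; by lower
  semicontinuity of the value the limit is optimal, and by uniqueness it is \<open>k\<close>.
\<close>

lemma optimal_continuous:
  assumes opt: "\<And>n. optimal (\<kappa>0n n) (\<kappa>n n) (kn n) (gn n)" "optimal \<kappa>0 \<kappa> k g"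
    and environment: "\<And>n. environment (\<kappa>n n)" "environment \<kappa>" and \<kappa>0: "\<And>n. 0 \<le> \<kappa>0n n" "\<And>n. \<kappa>0n n \<le> R" "0 < \<kappa>0"
    and lim: "\<kappa>0n \<longlonglongrightarrow> \<kappa>0" "\<And>t. 0 \<le> t \<Longrightarrow> (\<lambda>n. \<kappa>n n t) \<longlonglongrightarrow> \<kappa> t" and t: "0 \<le> t"
  shows "(\<lambda>n. kn n t) \<longlonglongrightarrow> k t"
proof (rule ccontr)
  assume "\<not> ?thesis"
  then obtain e where e: "e > 0" "\<not> (\<forall>\<^sub>F n in sequentially. dist (kn n t) (k t) < e)" by (auto simp: tendsto_iff)
  from not_eventually_sequentiallyD[OF e(2)]
  obtain \<sigma> where \<sigma>: "strict_mono (\<sigma>::nat\<Rightarrow>nat)" "\<And>n. \<not> dist (kn (\<sigma> n) t) (k t) < e" by blast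
  have \<kappa>0R: "\<kappa>0 \<le> R" by (rule LIMSEQ_le_const2[OF lim(1)]) (use \<kappa>0 in auto)
  have \<kappa>00: "0 \<le> \<kappa>0" using \<kappa>0 by simp
  have limsub: "(\<lambda>n. \<kappa>0n (\<rho> n)) \<longlonglongrightarrow> \<kappa>0" "\<And>t. 0 \<le> t \<Longrightarrow> (\<lambda>n. \<kappa>n (\<rho> n) t) \<longlonglongrightarrow> \<kappa> t" if "strict_mono \<rho>" for \<rho> :: "nat \<Rightarrow> nat"
    using LIMSEQ_subseq_LIMSEQ[OF lim(1) that] LIMSEQ_subseq_LIMSEQ[OF lim(2) that] by (auto simp: o_def)
  have "\<exists>\<rho> k' g'. strict_mono (\<rho>::nat\<Rightarrow>nat) \<and> (\<forall>t\<ge>0. (\<lambda>n. kn (\<sigma> (\<rho> n)) t) \<longlonglongrightarrow> k' t) \<and> solution \<kappa>0 \<kappa> k' g' \<and>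
    (\<forall>t. g' t \<le> consumption_bound) \<and> liminf (\<lambda>n. welfare (gn (\<sigma> (\<rho> n)))) \<le> welfare g'"
    by (rule solutions_compact[where kn="\<lambda>n. kn (\<sigma> n)" and gn="\<lambda>n. gn (\<sigma> n)" and \<kappa>n="\<lambda>n. \<kappa>n (\<sigma> n)" and \<kappa>0n="\<lambda>n. \<kappa>0n (\<sigma> n)"])
       (use opt(1) environment \<kappa>0 limsub[OF \<sigma>(1)] in \<open>auto simp: optimal_def\<close>)
  then obtain \<rho> k' g' where \<rho>: "strict_mono (\<rho>::nat\<Rightarrow>nat)" and k': "\<And>t. 0 \<le> t \<Longrightarrow> (\<lambda>n. kn (\<sigma> (\<rho> n)) t) \<longlonglongrightarrow> k' t"
    "solution \<kappa>0 \<kappa> k' g'" "\<And>t. g' t \<le> consumption_bound" "liminf (\<lambda>n. welfare (gn (\<sigma> (\<rho> n)))) \<le> welfare g'" by blast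
  have sr: "strict_mono (\<lambda>n. \<sigma> (\<rho> n))" using strict_mono_o[OF \<sigma>(1) \<rho>] by (simp add: o_def)
  have "value_of \<kappa>0 \<kappa> \<le> liminf (\<lambda>n. value_of (\<kappa>0n (\<sigma> (\<rho> n))) (\<kappa>n (\<sigma> (\<rho> n))))"
    by (rule value_lower_semicontinuous[OF environment(1) environment(2) \<kappa>0(1) \<kappa>0(3) \<kappa>0R limsub[OF sr]]) 
  also have "\<dots> = liminf (\<lambda>n. welfare (gn (\<sigma> (\<rho> n))))" using opt(1) by (simp add: optimal_def)
  also have "\<dots> \<le> welfare g'" by (rule k'(4))
  finally have "welfare g' = value_of \<kappa>0 \<kappa>" using welfare_le_value[OF solution_imp_subsolution[OF k'(2)]] by simp
  moreover have right: "(\<lambda>n. k' (s n)) \<longlonglongrightarrow> k' t" if "s \<longlonglongrightarrow> t" "\<And>n. t < s n" for s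
  proof (rule Lipschitz_tendsto[OF _ that(1) _ t])
    show "\<bar>k' s - k' t\<bar> \<le> Lip * \<bar>s - t\<bar>" if "0 \<le> s" "0 \<le> t" for s t
      unfolding Lip_def by (rule solution_Lipschitz[OF k'(2,3) environment(2) \<kappa>00 \<kappa>0R that])
    show "0 \<le> s n" for n using that(2)[of n] t by linarith
  qed
  ultimately have "k' t = k t"
    by (intro optimal_unique[OF opt(2) environment(2) \<kappa>00 \<kappa>0R solution_imp_subsolution[OF k'(2)] _ _ t]) auto
  with k'(1)[OF t] have "\<forall>\<^sub>F n in sequentially. dist (kn (\<sigma> (\<rho> n)) t) (k t) < e" using e(1) by (simp add: tendsto_iff)
  then show False using \<sigma>(2) by (auto simp: eventually_sequentially)
qed

end

section \<open>Measures and weighted integral inequalities\<close>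

lemma integrable_pair_product_bound:
  fixes h :: "real \<times> real \<Rightarrow> real"
  assumes h: "h \<in> borel_measurable (lborel \<Otimes>\<^sub>M lborel)" and u: "integrable lborel u" and v: "integrable lborel v"
    and bd: "\<And>x y. \<bar>h (x, y)\<bar> \<le> u x * v y" and nn: "\<And>x. 0 \<le> u x" "\<And>y. 0 \<le> (v y :: real)"
  shows "integrable (lborel \<Otimes>\<^sub>M lborel) h"
proof (rule integrableI_bounded[OF h])
  have [measurable]: "u \<in> borel_measurable borel" "v \<in> borel_measurable borel"
    using borel_measurable_integrable[OF u] borel_measurable_integrable[OF v] by auto
  have "(\<integral>\<^sup>+z. ennreal (norm (h z)) \<partial>(lborel \<Otimes>\<^sub>M lborel)) \<le> (\<integral>\<^sup>+z. ennreal (u (fst z)) * ennreal (v (snd z)) \<partial>(lborel \<Otimes>\<^sub>M lborel))"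
    using bd nn by (intro nn_integral_mono) (auto simp: split_beta intro!: ennreal_leI simp flip: ennreal_mult)
  also have "\<dots> = (\<integral>\<^sup>+x. \<integral>\<^sup>+y. ennreal (u x) * ennreal (v y) \<partial>lborel \<partial>lborel)"
    by (subst lborel.nn_integral_fst[symmetric]) auto
  also have "\<dots> = (\<integral>\<^sup>+x. ennreal (u x) \<partial>lborel) * (\<integral>\<^sup>+y. ennreal (v y) \<partial>lborel)"
    by (simp add: nn_integral_cmult nn_integral_multc)
  also have "\<dots> < \<infinity>"
    using u v nn by (simp add: nn_integral_eq_integral ennreal_mult_less_top)
  finally show "(\<integral>\<^sup>+z. ennreal (norm (h z)) \<partial>(lborel \<Otimes>\<^sub>M lborel)) < \<infinity>" .
qed

text \<open>
  Integration by parts for \<open>exp(l t) A(t)\<close>. As \<open>a\<close> is only integrable, the formula comes from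
  Fubini's theorem on the triangle \<open>0 \<le> u \<le> s \<le> t\<close>.
\<close>

lemma exp_weighted_primitive:
  fixes a A :: "real \<Rightarrow> real"
  assumes a: "\<And>T. set_integrable lborel {0..T} a" and A: "\<And>t. 0 \<le> t \<Longrightarrow> A t = A0 + (LINT s:{0..t}|lborel. a s)"
    and t: "0 \<le> t"
  shows "set_integrable lborel {0..t} (\<lambda>s. exp (l * s) * a s)"
    "set_integrable lborel {0..t} (\<lambda>s. exp (l * s) * (l * A s))"
    "exp (l * t) * A t = A0 + (LINT s:{0..t}|lborel. exp (l * s) * a s) + (LINT s:{0..t}|lborel. exp (l * s) * (l * A s))"
proof -
  let ?I = "\<lambda>S x. indicator S x :: real"
  define al where "al u = ?I {0..t} u * a u" for u
  have al: "integrable lborel al" using a[of t] by (simp add: al_def[abs_def] set_integrable_def)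
  have [measurable]: "al \<in> borel_measurable borel" using borel_measurable_integrable[OF al] by simp
  define B where "B = exp (\<bar>l\<bar> * t)"
  have B: "exp (l * s) \<le> B" if "0 \<le> s" "s \<le> t" for s
  proof -
    have "l * s \<le> \<bar>l\<bar> * s" using that by (intro mult_right_mono) auto
    also have "\<dots> \<le> \<bar>l\<bar> * t" using that by (intro mult_left_mono) auto
    finally show ?thesis by (simp add: B_def)
  qed
  have e_int: "set_integrable lborel {x..y} (\<lambda>s. c * exp (l * s))" for x y c
    by (rule borel_integrable_atLeastAtMost') (intro continuous_intros)
  show ea: "set_integrable lborel {0..t} (\<lambda>s. exp (l * s) * a s)"
    unfolding set_integrable_def
  proof (rule Bochner_Integration.integrable_bound[where f="\<lambda>s. B * al s"])
    show "integrable lborel (\<lambda>s. B * al s)" using al by simp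
    have "(\<lambda>s. ?I {0..t} s *\<^sub>R (exp (l * s) * a s)) = (\<lambda>s. exp (l * s) * al s)" by (auto simp: al_def)
    then show "(\<lambda>s. ?I {0..t} s *\<^sub>R (exp (l * s) * a s)) \<in> borel_measurable lborel" by simp
    show "AE s in lborel. norm (?I {0..t} s *\<^sub>R (exp (l * s) * a s)) \<le> norm (B * al s)"
      using B by (intro AE_I2) (auto simp: al_def abs_mult indicator_def B_def intro!: mult_right_mono)
  qed
  define H where "H = (\<lambda>(u, s). ?I {0..s} u * (?I {0..t} s * al u * (l * exp (l * s))))"
  have H_int: "integrable (lborel \<Otimes>\<^sub>M lborel) H"
  proof (rule integrable_pair_product_bound[where u="\<lambda>u. \<bar>al u\<bar>" and v="\<lambda>s. ?I {0..t} s * (\<bar>l\<bar> * B)"])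
    show "H \<in> borel_measurable (lborel \<Otimes>\<^sub>M lborel)"
      unfolding H_def indicator_def atLeastAtMost_iff of_bool_def by measurable
    show "\<bar>H (x, y)\<bar> \<le> \<bar>al x\<bar> * (?I {0..t} y * (\<bar>l\<bar> * B))" for x y
    proof (cases "y \<in> {0..t} \<and> x \<in> {0..y}")
      case True
      have "\<bar>al x\<bar> * (\<bar>l\<bar> * exp (l * y)) \<le> \<bar>al x\<bar> * (\<bar>l\<bar> * B)"
        using B[of y] True by (intro mult_left_mono) auto
      then show ?thesis using True by (simp add: H_def abs_mult)
    next
      case False
      then have "H (x, y) = 0" by (auto simp: H_def)
      then show ?thesis by (simp add: B_def)
    qed
    show "integrable lborel (\<lambda>u. \<bar>al u\<bar>)" using al by simp
    have "integrable lborel (?I {0..t})" by (rule integrable_real_indicator) (auto simp: emeasure_lborel_Icc_eq)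
    then show "integrable lborel (\<lambda>s. ?I {0..t} s * (\<bar>l\<bar> * B))" by simp
  qed (auto simp: B_def)
  have inner1: "(\<integral>u. H (u, s) \<partial>lborel) = ?I {0..t} s * (exp (l * s) * (l * (A s - A0)))" for s
  proof (cases "s \<in> {0..t}")
    case True
    have "(\<integral>u. H (u, s) \<partial>lborel) = (\<integral>u. (l * exp (l * s)) * (?I {0..s} u * a u) \<partial>lborel)"
      using True by (intro Bochner_Integration.integral_cong) (auto simp: H_def al_def indicator_def)
    also have "\<dots> = (l * exp (l * s)) * (LINT u:{0..s}|lborel. a u)" by (simp add: set_lebesgue_integral_def)
    finally show ?thesis using A[of s] True by simp
  qed (simp add: H_def)
  have inner2: "(\<integral>s. H (u, s) \<partial>lborel) = ?I {0..t} u * (a u * (exp (l * t) - exp (l * u)))" for u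
  proof (cases "u \<in> {0..t}")
    case True
    have "(\<integral>s. H (u, s) \<partial>lborel) = (\<integral>s. a u * ((l * exp (l * s)) * ?I {u..t} s) \<partial>lborel)"
      using True by (intro Bochner_Integration.integral_cong) (auto simp: H_def al_def indicator_def)
    also have "\<dots> = a u * (\<integral>s. (l * exp (l * s)) * ?I {u..t} s \<partial>lborel)" by simp
    also have "(\<integral>s. (l * exp (l * s)) * ?I {u..t} s \<partial>lborel) = exp (l * t) - exp (l * u)"
      by (rule integral_FTC_Icc_real) (use True in \<open>auto intro!: derivative_eq_intros continuous_intros\<close>)
    finally show ?thesis using True by simp
  next
    case False
    then have "H (u, s) = 0" for s by (auto simp: H_def al_def)
    then show ?thesis using False by simp
  qed
  have fub: "(\<integral>s. (\<integral>u. H (u, s) \<partial>lborel) \<partial>lborel) = (\<integral>u. (\<integral>s. H (u, s) \<partial>lborel) \<partial>lborel)"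
    using lborel_pair.Fubini_integral[of "\<lambda>u s. H (u, s)"] H_int by simp
  have i1: "set_integrable lborel {0..t} (\<lambda>s. exp (l * s) * (l * (A s - A0)))"
    using lborel_pair.integrable_snd[of "\<lambda>u s. H (u, s)"] H_int inner1 by (simp add: set_integrable_def)
  have eq1: "(LINT s:{0..t}|lborel. exp (l * s) * (l * (A s - A0))) = (LINT u:{0..t}|lborel. a u * (exp (l * t) - exp (l * u)))"
    using fub unfolding inner1 inner2 by (simp add: set_lebesgue_integral_def)
  have i2: "set_integrable lborel {0..t} (\<lambda>s. (A0 * l) * exp (l * s))" by (rule e_int)
  have "(\<lambda>s. exp (l * s) * (l * A s)) = (\<lambda>s. exp (l * s) * (l * (A s - A0)) + (A0 * l) * exp (l * s))"
    by (auto simp: algebra_simps)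
  then show "set_integrable lborel {0..t} (\<lambda>s. exp (l * s) * (l * A s))" using set_integral_add(1)[OF i1 i2] by simp
  have "(LINT s:{0..t}|lborel. exp (l * s) * (l * A s)) = (LINT s:{0..t}|lborel. exp (l * s) * (l * (A s - A0))) + (LINT s:{0..t}|lborel. (A0 * l) * exp (l * s))"
    using set_integral_add(2)[OF i1 i2] by (simp add: algebra_simps)
  also have "(LINT s:{0..t}|lborel. (A0 * l) * exp (l * s)) = A0 * (exp (l * t) - 1)"
  proof -
    have "(\<integral>s. (l * exp (l * s)) * ?I {0..t} s \<partial>lborel) = exp (l * t) - exp (l * 0)"
      by (rule integral_FTC_Icc_real) (use t in \<open>auto intro!: derivative_eq_intros continuous_intros\<close>)
    then have "A0 * (\<integral>s. (l * exp (l * s)) * ?I {0..t} s \<partial>lborel) = A0 * (exp (l * t) - 1)" by simp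
    then have "(\<integral>s. A0 * ((l * exp (l * s)) * ?I {0..t} s) \<partial>lborel) = A0 * (exp (l * t) - 1)" by simp
    moreover have "(LINT s:{0..t}|lborel. (A0 * l) * exp (l * s)) = (\<integral>s. A0 * ((l * exp (l * s)) * ?I {0..t} s) \<partial>lborel)"
      unfolding set_lebesgue_integral_def by (intro Bochner_Integration.integral_cong) auto
    ultimately show ?thesis by (simp only:)
  qed
  also have "(LINT s:{0..t}|lborel. exp (l * s) * (l * (A s - A0))) = exp (l * t) * (LINT u:{0..t}|lborel. a u) - (LINT s:{0..t}|lborel. exp (l * s) * a s)"
  proof -
    have "(LINT u:{0..t}|lborel. a u * (exp (l * t) - exp (l * u))) = (LINT u:{0..t}|lborel. exp (l * t) * a u - exp (l * u) * a u)"
      by (simp add: algebra_simps)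
    also have "\<dots> = (LINT u:{0..t}|lborel. exp (l * t) * a u) - (LINT u:{0..t}|lborel. exp (l * u) * a u)"
      by (rule set_integral_diff) (use a ea in auto)
    finally show ?thesis unfolding eq1 by simp
  qed
  finally show "exp (l * t) * A t = A0 + (LINT s:{0..t}|lborel. exp (l * s) * a s) + (LINT s:{0..t}|lborel. exp (l * s) * (l * A s))"
    using A[OF t] by (simp add: algebra_simps)
qed

lemma set_integrable_bounded_borel:
  fixes h :: "real \<Rightarrow> real"
  assumes "h \<in> borel_measurable borel" "\<And>T. \<exists>M. \<forall>t\<in>{0..T}. \<bar>h t\<bar> \<le> M" "B \<in> bounded_borel"
  shows "set_integrable lborel B h"
proof -
  obtain T where T: "B \<subseteq> {0..T}" using bounded_borel_ex_bound[OF assms(3)] by blast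
  obtain M where M: "\<And>t. t \<in> {0..T} \<Longrightarrow> \<bar>h t\<bar> \<le> M" using assms(2) by blast
  have [measurable]: "h \<in> borel_measurable borel" "B \<in> sets borel" using assms bounded_borel_sets by auto
  show ?thesis
    unfolding set_integrable_def
  proof (rule Bochner_Integration.integrable_bound[where f="\<lambda>t. indicator {0..T} t *\<^sub>R \<bar>M\<bar>"])
    have "integrable lborel (indicator {0..T} :: real \<Rightarrow> real)" by (rule integrable_real_indicator) (auto simp: emeasure_lborel_Icc_eq)
    then show "integrable lborel (\<lambda>t. indicator {0..T} t *\<^sub>R \<bar>M\<bar>)" by simp
    show "AE t in lborel. norm (indicator B t *\<^sub>R h t) \<le> norm (indicator {0..T} t *\<^sub>R \<bar>M\<bar>)"
    proof (rule AE_I2)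
      fix t show "norm (indicator B t *\<^sub>R h t) \<le> norm (indicator {0..T} t *\<^sub>R \<bar>M\<bar>)"
      proof (cases "t \<in> B")
        case True
        then show ?thesis using T M[of t] by (auto simp: indicator_def)
      qed simp
    qed
  qed simp
qed

context individual_problem
begin

lemma outflow_eq_set_integral:
  assumes "profile u" "set_integrable lborel {0..t} (\<lambda>s. exp (\<delta> * s) * u s)"
  shows "outflow u t = ennreal (LINT s:{0..t}|lborel. exp (\<delta> * s) * u s)"
proof -
  have "outflow u t = (\<integral>\<^sup>+s. ennreal (indicator {0..t} s *\<^sub>R (exp (\<delta> * s) * u s)) \<partial>lborel)"
    unfolding outflow_def by (intro nn_integral_cong) (auto simp: indicator_def)
  also have "\<dots> = ennreal (\<integral>s. indicator {0..t} s *\<^sub>R (exp (\<delta> * s) * u s) \<partial>lborel)"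
    by (rule nn_integral_eq_integral) (use assms profile_nonneg[OF assms(1)] in \<open>auto simp: set_integrable_def\<close>)
  finally show ?thesis by (simp add: set_lebesgue_integral_def)
qed

lemma f_locally_bounded:
  assumes "profile k" "environment \<kappa>" "\<exists>B. \<forall>t\<in>{0..T}. k t \<le> B"
  shows "\<exists>M. \<forall>t\<in>{0..T}. \<bar>f (k t) (\<kappa> t)\<bar> \<le> M"
proof -
  obtain B where B: "\<And>t. t \<in> {0..T} \<Longrightarrow> k t \<le> B" using assms(3) by blast
  have "\<bar>f (k t) (\<kappa> t)\<bar> \<le> \<delta> * max R B" if "t \<in> {0..T}" for t
  proof -
    have F: "0 \<le> F (k t) (\<kappa> t)" "F (k t) (\<kappa> t) \<le> \<delta> * max R (k t)"
      using F_nonneg F_le environment_range[OF assms(2)] profile_nonneg[OF assms(1)] by auto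
    have "\<delta> * max R (k t) \<le> \<delta> * max R B" "\<delta> * k t \<le> \<delta> * max R B" "0 \<le> \<delta> * k t"
      using B[OF that] pos profile_nonneg[OF assms(1), of t] by (auto intro!: mult_left_mono)
    then show ?thesis using F by (simp add: F_def abs_le_iff)
  qed
  then show ?thesis by blast
qed

text \<open>
  Let \<open>g\<close> be the density of \<open>c\<close> and \<open>A(t) = \<kappa>0 + \<integral>\<^sub>0\<^sup>t (f - g)\<close>. Since \<open>k' + c \<le> f\<close> as measures, \<open>w = A - k\<close>
  is nonnegative and nondecreasing. Adding the weight to the absolutely continuous \<open>A\<close> is
  integration by parts, and the monotonicity of \<open>w\<close> gives
  \<open>\<integral>\<^sub>0\<^sup>t \<delta> exp(\<delta> s) w(s) ds \<le> (exp(\<delta> t) - 1) w(t)\<close>, so that \<open>k\<close> is never integrated against the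
  measure \<open>k'\<close>.
\<close>

lemma feasible_imp_subsolution:
  assumes feas: "feasible f \<kappa>0 \<kappa> k c" and environment: "environment \<kappa>" and \<kappa>0: "0 \<le> \<kappa>0"
  shows "\<exists>g. subsolution \<kappa>0 \<kappa> k g \<and> payoff r U c = welfare g"
proof -
  have cM: "c \<in> Mloc" and c0: "\<And>B. B \<in> bounded_borel \<Longrightarrow> 0 \<le> c B" and k0: "\<And>t. 0 \<le> t \<Longrightarrow> 0 \<le> k t"
    using feas by (auto simp: feasible_def)
  obtain k' where k': "k' \<in> Mloc" "\<And>t. k t = \<kappa>0 + k' {0..t}"
    "\<And>B. B \<in> bounded_borel \<Longrightarrow> k' B + c B \<le> (LINT t:B|lborel. f (k t) (\<kappa> t))"
    using feas by (auto simp: feasible_def)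
  interpret c: positive_Mloc c using cM c0 by unfold_locales
  obtain g where g: "g \<in> borel_measurable borel" "\<And>t. 0 \<le> g t" "is_ac_density c g"
    using c.Lebesgue_decomposition by blast
  have pg: "profile g" using g by (simp add: profile_def)
  obtain N where N: "N \<in> null_sets lborel" "\<And>B. B \<in> bounded_borel \<Longrightarrow>
      set_integrable lborel B g \<and> c B = (LINT t:B|lborel. g t) + c (B \<inter> N)"
    using g(3) by (auto simp: is_ac_density_def)
  have cg: "(LINT t:B|lborel. g t) \<le> c B" if "B \<in> bounded_borel" for B
  proof -
    have "B \<inter> N \<in> bounded_borel" by (rule bounded_borel_subset[OF that]) (use that N(1) bounded_borel_sets in auto)
    then show ?thesis using N(2)[OF that] c0 by fastforce
  qed
  have kt: "k = (\<lambda>t. \<kappa>0 + k' {0..t})" using k'(2) by auto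
  have pk: "profile k"
  proof -
    have "k \<in> borel_measurable borel" unfolding kt using Mloc_Icc_measurable[OF k'(1)] by measurable
    moreover have "0 \<le> k t" for t
      using k0[of t] k'(2)[of t] Mloc_empty[OF k'(1)] \<kappa>0 by (cases "0 \<le> t") auto
    ultimately show ?thesis by (simp add: profile_def)
  qed
  have kb: "\<exists>B. \<forall>t\<in>{0..T}. k t \<le> B" for T
  proof -
    obtain B where "\<forall>t\<in>{0..T}. \<bar>k' {0..t}\<bar> \<le> B" using Mloc_Icc_bounded[OF k'(1)] by blast
    then have "\<forall>t\<in>{0..T}. k t \<le> \<kappa>0 + B" unfolding kt by (auto simp: abs_le_iff)
    then show ?thesis by blast
  qed
  define h where "h t = f (k t) (\<kappa> t)" for t
  have hm: "h \<in> borel_measurable borel" unfolding h_def by (rule f_measurable[OF pk environment])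
  have h_int: "set_integrable lborel B h" if "B \<in> bounded_borel" for B
    by (rule set_integrable_bounded_borel[OF hm _ that]) (use f_locally_bounded[OF pk environment kb] in \<open>simp add: h_def\<close>)
  have g_int: "set_integrable lborel B g" if "B \<in> bounded_borel" for B using N(2)[OF that] by simp
  define a where "a t = h t - g t" for t
  have a_int: "set_integrable lborel B a" and a_eq: "(LINT t:B|lborel. a t) = (LINT t:B|lborel. h t) - (LINT t:B|lborel. g t)"
    if "B \<in> bounded_borel" for B
    unfolding a_def using set_integral_diff[OF h_int[OF that] g_int[OF that]] by auto
  have incr: "k' B \<le> (LINT t:B|lborel. a t)" if "B \<in> bounded_borel" for B
    using k'(3)[OF that] cg[OF that] a_eq[OF that] by (simp add: h_def)
  define A where "A t = \<kappa>0 + (LINT s:{0..t}|lborel. a s)" for t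
  define w where "w t = A t - k t" for t
  have w0: "0 \<le> w t" if "0 \<le> t" for t
    using incr[OF bounded_borel_Icc[of 0 t]] by (simp add: w_def A_def k'(2))
  have w_mono: "w s \<le> w t" if "0 \<le> s" "s \<le> t" for s t
  proof -
    have "(LINT x:{0..t}|lborel. a x) = (LINT x:{0..s}|lborel. a x) + (LINT x:{s<..t}|lborel. a x)"
    proof -
      have "{0..t} = {0..s} \<union> {s<..t}" using that by auto
      then show ?thesis
        using set_integral_Un[of "{0..s}" "{s<..t}" lborel a] a_int bounded_borel_Icc[of 0 s] bounded_borel_Ioc[OF that(1)]
        by (auto simp: ivl_disj_int)
    qed
    moreover have "k t - k s = k' {s<..t}" using Mloc_Icc_diff[OF k'(1) that] by (simp add: k'(2))
    ultimately show ?thesis using incr[OF bounded_borel_Ioc[OF that(1), of t]] by (simp add: w_def A_def)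
  qed
  have main: "ennreal (exp (\<delta> * t) * k t) + outflow g t \<le> ennreal \<kappa>0 + inflow \<kappa> k t" if t: "0 \<le> t" for t
  proof -
    have I: "{0..T} \<in> bounded_borel" for T :: real by (rule bounded_borel_Icc) simp
    note W = exp_weighted_primitive[of a A \<kappa>0 t \<delta>, OF a_int[OF I] A_def t]
    have em: "set_integrable lborel {0..t} (\<lambda>s. exp (\<delta> * s) * u s)"
      if um: "u \<in> borel_measurable borel" and ub: "\<exists>B. \<forall>s\<in>{0..t}. \<bar>u s\<bar> \<le> B" for u :: "real \<Rightarrow> real"
    proof -
      have [measurable]: "u \<in> borel_measurable borel" by fact
      obtain B where B: "\<And>s. s \<in> {0..t} \<Longrightarrow> \<bar>u s\<bar> \<le> B" using ub by blast
      show ?thesis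
        unfolding set_integrable_def
      proof (rule Bochner_Integration.integrable_bound[where f="\<lambda>s. indicator {0..t} s *\<^sub>R (exp (\<delta> * t) * \<bar>B\<bar>)"])
        have "integrable lborel (indicator {0..t} :: real \<Rightarrow> real)" by (rule integrable_real_indicator) (auto simp: emeasure_lborel_Icc_eq)
        then show "integrable lborel (\<lambda>s. indicator {0..t} s *\<^sub>R (exp (\<delta> * t) * \<bar>B\<bar>))" by simp
        show "AE s in lborel. norm (indicator {0..t} s *\<^sub>R (exp (\<delta> * s) * u s)) \<le> norm (indicator {0..t} s *\<^sub>R (exp (\<delta> * t) * \<bar>B\<bar>))"
        proof (rule AE_I2)
          fix s show "norm (indicator {0..t} s *\<^sub>R (exp (\<delta> * s) * u s)) \<le> norm (indicator {0..t} s *\<^sub>R (exp (\<delta> * t) * \<bar>B\<bar>))"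
          proof (cases "s \<in> {0..t}")
            case True
            have "exp (\<delta> * s) * \<bar>u s\<bar> \<le> exp (\<delta> * t) * \<bar>B\<bar>"
              using B[OF True] True pos by (intro mult_mono) auto
            then show ?thesis using True by (simp add: abs_mult)
          qed simp
        qed
      qed measurable
    qed
    have ik: "set_integrable lborel {0..t} (\<lambda>s. exp (\<delta> * s) * (\<delta> * k s))"
    proof (rule em)
      obtain B where "\<forall>s\<in>{0..t}. k s \<le> B" using kb by blast
      then have "\<forall>s\<in>{0..t}. \<bar>\<delta> * k s\<bar> \<le> \<delta> * B" using profile_nonneg[OF pk] pos by (auto simp: abs_mult)
      then show "\<exists>B. \<forall>s\<in>{0..t}. \<bar>\<delta> * k s\<bar> \<le> B" by blast
    qed (use profile_measurable[OF pk] in measurable)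
    have ih: "set_integrable lborel {0..t} (\<lambda>s. exp (\<delta> * s) * h s)"
      by (rule em[OF hm]) (use f_locally_bounded[OF pk environment kb] in \<open>simp add: h_def\<close>)
    have ig: "set_integrable lborel {0..t} (\<lambda>s. exp (\<delta> * s) * g s)"
    proof -
      have "(\<lambda>s. exp (\<delta> * s) * g s) = (\<lambda>s. exp (\<delta> * s) * h s - exp (\<delta> * s) * a s)" by (auto simp: a_def algebra_simps)
      then show ?thesis using set_integral_diff(1)[OF ih W(1)] by simp
    qed
    let ?L = "\<lambda>u. LINT s:{0..t}|lborel. exp (\<delta> * s) * u s"
    have La: "?L a = ?L h - ?L g"
      using set_integral_diff(2)[OF ih ig] by (simp add: a_def algebra_simps)
    have iF: "set_integrable lborel {0..t} (\<lambda>s. exp (\<delta> * s) * F (k s) (\<kappa> s))"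
      and LF: "?L (\<lambda>s. F (k s) (\<kappa> s)) = ?L h + ?L (\<lambda>s. \<delta> * k s)"
      using set_integral_add[OF ih ik] by (simp_all add: F_def h_def distrib_left)
    have iw: "set_integrable lborel {0..t} (\<lambda>s. exp (\<delta> * s) * (\<delta> * w s))"
      and Lw: "?L (\<lambda>s. \<delta> * w s) = ?L (\<lambda>s. \<delta> * A s) - ?L (\<lambda>s. \<delta> * k s)"
      using set_integral_diff[OF W(2) ik] by (simp_all add: w_def right_diff_distrib)
    have "?L (\<lambda>s. \<delta> * w s) \<le> (LINT s:{0..t}|lborel. (\<delta> * w t) * exp (\<delta> * s))"
    proof (rule set_integral_mono[OF iw])
      show "set_integrable lborel {0..t} (\<lambda>s. (\<delta> * w t) * exp (\<delta> * s))"
        by (rule borel_integrable_atLeastAtMost') (intro continuous_intros)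
      show "exp (\<delta> * s) * (\<delta> * w s) \<le> \<delta> * w t * exp (\<delta> * s)" if "s \<in> {0..t}" for s
        using w_mono[of s t] that pos by simp
    qed
    also have "\<dots> = w t * (exp (\<delta> * t) - 1)"
    proof -
      have "(\<integral>s. (\<delta> * exp (\<delta> * s)) * indicator {0..t} s \<partial>lborel) = exp (\<delta> * t) - exp (\<delta> * 0)"
        by (rule integral_FTC_Icc_real) (use t in \<open>auto intro!: derivative_eq_intros continuous_intros\<close>)
      moreover have "(LINT s:{0..t}|lborel. (\<delta> * w t) * exp (\<delta> * s)) = (\<integral>s. w t * ((\<delta> * exp (\<delta> * s)) * indicator {0..t} s) \<partial>lborel)"
        unfolding set_lebesgue_integral_def by (intro Bochner_Integration.integral_cong) auto
      ultimately show ?thesis by simp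
    qed
    finally have Lw2: "?L (\<lambda>s. \<delta> * w s) \<le> w t * (exp (\<delta> * t) - 1)" .
    have "exp (\<delta> * t) * k t = exp (\<delta> * t) * A t - exp (\<delta> * t) * w t" by (simp add: w_def algebra_simps)
    also have "\<dots> = \<kappa>0 + ?L h - ?L g + (?L (\<lambda>s. \<delta> * w s) + ?L (\<lambda>s. \<delta> * k s)) - exp (\<delta> * t) * w t"
      unfolding W(3) La Lw by simp
    also have "\<dots> \<le> \<kappa>0 + ?L (\<lambda>s. F (k s) (\<kappa> s)) - ?L g"
      using Lw2 w0[OF t] unfolding LF by (simp add: algebra_simps)
    finally have real: "exp (\<delta> * t) * k t + ?L g \<le> \<kappa>0 + ?L (\<lambda>s. F (k s) (\<kappa> s))" by simp
    have i: "inflow \<kappa> k = outflow (\<lambda>s. F (k s) (\<kappa> s))" "profile (\<lambda>s. F (k s) (\<kappa> s))" using inflow_as_outflow[OF environment pk] by auto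
    have Lnn: "0 \<le> ?L u" if "profile u" for u
      unfolding set_lebesgue_integral_def by (rule Bochner_Integration.integral_nonneg) (simp add: profile_nonneg[OF that])
    have "ennreal (exp (\<delta> * t) * k t) + outflow g t = ennreal (exp (\<delta> * t) * k t + ?L g)"
      using profile_nonneg[OF pk, of t] Lnn[OF pg] by (simp add: outflow_eq_set_integral[OF pg ig] ennreal_plus)
    also have "\<dots> \<le> ennreal (\<kappa>0 + ?L (\<lambda>s. F (k s) (\<kappa> s)))" by (rule ennreal_leI[OF real])
    also have "\<dots> = ennreal \<kappa>0 + inflow \<kappa> k t"
      using \<kappa>0 Lnn[OF i(2)] by (simp add: i(1) outflow_eq_set_integral[OF i(2) iF] ennreal_plus)
    finally show ?thesis .
  qed
  have "subsolution \<kappa>0 \<kappa> k g" using pk pg kb main by (simp add: subsolution_def)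
  moreover have "payoff r U c = welfare g"
    unfolding payoff_def welfare_def
  proof (rule nn_integral_cong_AE)
    show "AE t in lborel. ennreal (exp (- r * t) * U (ac_density c t)) * indicator {0..} t = ennreal (exp (- r * t) * U (g t)) * indicator {0..} t"
      using ac_density_eq[OF cM g(3)] by eventually_elim (auto simp: indicator_def)
  qed
  ultimately show ?thesis by blast
qed

text \<open>
  Bounded consumption makes everything absolutely continuous, and the weight is removed by
  integrating by parts with \<open>- \<delta>\<close>. At negative times a feasible stock has the value \<open>\<kappa>0\<close>.
\<close>

lemma solution_imp_feasible:
  assumes solution: "solution \<kappa>0 \<kappa> k g" and bd: "\<And>t. g t \<le> \<Lambda>" and environment: "environment \<kappa>" and \<kappa>0: "0 \<le> \<kappa>0" "\<kappa>0 \<le> R"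
  defines "h \<equiv> \<lambda>t. if 0 \<le> t then k t else \<kappa>0"
  shows "\<exists>c. feasible f \<kappa>0 \<kappa> h c \<and> payoff r U c = welfare g"
proof -
  have pk: "profile k" and pg: "profile g" and kb: "\<And>T. \<exists>B. \<forall>t\<in>{0..T}. k t \<le> B" using solution by (auto simp: solution_def)
  have gm: "g \<in> borel_measurable borel" using pg by (rule profile_measurable)
  have g_int: "set_integrable lborel B g" if "B \<in> bounded_borel" for B
    by (rule set_integrable_bounded_borel[OF gm _ that]) (use bd profile_nonneg[OF pg] in auto)
  have fm: "(\<lambda>t. f (k t) (\<kappa> t)) \<in> borel_measurable borel" by (rule f_measurable[OF pk environment])
  have f_int: "set_integrable lborel B (\<lambda>t. f (k t) (\<kappa> t))" if "B \<in> bounded_borel" for B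
    by (rule set_integrable_bounded_borel[OF fm _ that]) (rule f_locally_bounded[OF pk environment kb])
  define k' where "k' B = (LINT t:B|lborel. f (k t) (\<kappa> t) - g t)" for B
  define c where "c B = (LINT t:B|lborel. g t)" for B
  have cM: "c \<in> Mloc" unfolding c_def by (rule set_integral_in_Mloc[OF g_int])
  have d_int: "set_integrable lborel B (\<lambda>t. f (k t) (\<kappa> t) - g t)" if "B \<in> bounded_borel" for B
    by (rule set_integral_diff(1)[OF f_int[OF that] g_int[OF that]])
  have kM: "k' \<in> Mloc" unfolding k'_def by (rule set_integral_in_Mloc[OF d_int])
  have c0: "0 \<le> c B" for B
    unfolding c_def set_lebesgue_integral_def by (rule Bochner_Integration.integral_nonneg) (simp add: profile_nonneg[OF pg])
  have I: "{0..T} \<in> bounded_borel" for T :: real by (rule bounded_borel_Icc) simp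
  have ht: "h t = \<kappa>0 + k' {0..t}" for t
  proof (cases "0 \<le> t")
    case False
    then show ?thesis by (simp add: h_def k'_def set_lebesgue_integral_def)
  next
    case t: True
    define p where "p s = exp (\<delta> * s) * (F (k s) (\<kappa> s) - g s)" for s
    have em: "u \<in> borel_measurable borel \<Longrightarrow> (\<And>T. \<exists>B. \<forall>s\<in>{0..T}. \<bar>u s\<bar> \<le> B) \<Longrightarrow> set_integrable lborel {0..T} (\<lambda>s. exp (\<delta> * s) * u s)" for u T
    proof (rule set_integrable_bounded_borel[OF _ _ I])
      assume [measurable]: "u \<in> borel_measurable borel" and b: "\<And>T. \<exists>B. \<forall>s\<in>{0..T}. \<bar>u s\<bar> \<le> B"
      show "(\<lambda>s. exp (\<delta> * s) * u s) \<in> borel_measurable borel" by measurable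
      fix T :: real
      obtain B where B: "\<And>s. s \<in> {0..T} \<Longrightarrow> \<bar>u s\<bar> \<le> B" using b by blast
      have "\<bar>exp (\<delta> * s) * u s\<bar> \<le> exp (\<delta> * T) * \<bar>B\<bar>" if "s \<in> {0..T}" for s
        unfolding abs_mult using B[OF that] that pos by (intro mult_mono) auto
      then show "\<exists>M. \<forall>s\<in>{0..T}. \<bar>exp (\<delta> * s) * u s\<bar> \<le> M" by blast
    qed
    have i: "inflow \<kappa> k = outflow (\<lambda>s. F (k s) (\<kappa> s))" "profile (\<lambda>s. F (k s) (\<kappa> s))" using inflow_as_outflow[OF environment pk] by auto
    have iF: "set_integrable lborel {0..T} (\<lambda>s. exp (\<delta> * s) * F (k s) (\<kappa> s))" for T
    proof (rule em[OF profile_measurable[OF i(2)]])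
      fix T :: real
      have "\<bar>F (k s) (\<kappa> s)\<bar> \<le> \<delta> * R" if "s \<in> {0..T}" for s
        using F_le[OF environment_range[OF environment] profile_nonneg[OF pk], of s s] profile_nonneg[OF i(2), of s]
          subsolution_le_R[OF solution_imp_subsolution[OF solution] environment \<kappa>0, of s] that by (simp add: max_def)
      then show "\<exists>B. \<forall>s\<in>{0..T}. \<bar>F (k s) (\<kappa> s)\<bar> \<le> B" by blast
    qed
    have ig: "set_integrable lborel {0..T} (\<lambda>s. exp (\<delta> * s) * g s)" for T
      by (rule em[OF gm]) (use bd profile_nonneg[OF pg] in auto)
    have ip: "set_integrable lborel {0..T} p" and Lp: "(LINT s:{0..T}|lborel. p s) =
        (LINT s:{0..T}|lborel. exp (\<delta> * s) * F (k s) (\<kappa> s)) - (LINT s:{0..T}|lborel. exp (\<delta> * s) * g s)" for T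
      using set_integral_diff[OF iF ig] by (simp_all add: p_def[abs_def] right_diff_distrib)
    have q: "exp (\<delta> * s) * k s = \<kappa>0 + (LINT x:{0..s}|lborel. p x)" if "0 \<le> s" for s
    proof -
      have Lnn: "0 \<le> (LINT x:{0..s}|lborel. exp (\<delta> * x) * u x)" if "profile u" for u
        unfolding set_lebesgue_integral_def by (rule Bochner_Integration.integral_nonneg) (simp add: profile_nonneg[OF that])
      show ?thesis
        using solution_real[OF solution environment \<kappa>0 that] Lnn[OF pg] Lnn[OF i(2)]
        unfolding i(1) outflow_eq_set_integral[OF pg ig] outflow_eq_set_integral[OF i(2) iF] Lp by simp
    qed
    note W = exp_weighted_primitive[of p "\<lambda>s. exp (\<delta> * s) * k s" \<kappa>0 t "- \<delta>", OF ip q t]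
    have "k t = \<kappa>0 + (LINT s:{0..t}|lborel. exp (- \<delta> * s) * p s) + (LINT s:{0..t}|lborel. exp (- \<delta> * s) * (- \<delta> * (exp (\<delta> * s) * k s)))"
    proof -
      have "exp (- \<delta> * t) * (exp (\<delta> * t) * k t) = k t"
        unfolding mult.assoc[symmetric] exp_add[symmetric] by simp
      from this[symmetric] W(3) show ?thesis by (rule trans)
    qed
    also have "\<dots> = \<kappa>0 + ((LINT s:{0..t}|lborel. exp (- \<delta> * s) * p s) + (LINT s:{0..t}|lborel. exp (- \<delta> * s) * (- \<delta> * (exp (\<delta> * s) * k s))))" by simp
    also have "(LINT s:{0..t}|lborel. exp (- \<delta> * s) * p s) + (LINT s:{0..t}|lborel. exp (- \<delta> * s) * (- \<delta> * (exp (\<delta> * s) * k s)))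
       = (LINT s:{0..t}|lborel. exp (- \<delta> * s) * p s + exp (- \<delta> * s) * (- \<delta> * (exp (\<delta> * s) * k s)))"
      by (rule set_integral_add(2)[OF W(1,2), symmetric])
    also have "\<dots> = k' {0..t}"
    proof -
      have "exp (- \<delta> * s) * p s + exp (- \<delta> * s) * (- \<delta> * (exp (\<delta> * s) * k s)) = f (k s) (\<kappa> s) - g s" for s
      proof -
        have e: "exp (- \<delta> * s) * exp (\<delta> * s) = 1" by (simp flip: exp_add)
        have "exp (- \<delta> * s) * p s + exp (- \<delta> * s) * (- \<delta> * (exp (\<delta> * s) * k s)) = (exp (- \<delta> * s) * exp (\<delta> * s)) * (F (k s) (\<kappa> s) - g s - \<delta> * k s)"
          by (simp add: p_def algebra_simps)
        then show ?thesis unfolding e by (simp add: F_def)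
      qed
      then show ?thesis by (simp add: k'_def)
    qed
    finally show ?thesis using t by (simp add: h_def)
  qed
  have "feasible f \<kappa>0 \<kappa> h c"
    unfolding feasible_def
  proof (intro conjI cM ballI c0 allI impI)
    show "0 \<le> h t" if "0 \<le> t" for t using that profile_nonneg[OF pk] by (simp add: h_def)
    show "\<exists>k'\<in>Mloc. (\<forall>t. h t = \<kappa>0 + k' {0..t}) \<and> (\<forall>B\<in>bounded_borel. k' B + c B \<le> (LINT t:B|lborel. f (h t) (\<kappa> t)))"
    proof (intro bexI[of _ k'] kM conjI allI ht ballI)
      fix B assume B: "B \<in> bounded_borel"
      have "k' B + c B = (LINT t:B|lborel. f (k t) (\<kappa> t))"
        unfolding k'_def c_def using set_integral_diff(2)[OF f_int[OF B] g_int[OF B]] by simp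
      also have "\<dots> = (LINT t:B|lborel. f (h t) (\<kappa> t))"
        by (rule set_lebesgue_integral_cong) (use B in \<open>auto simp: bounded_borel_def h_def\<close>)
      finally show "k' B + c B \<le> (LINT t:B|lborel. f (h t) (\<kappa> t))" by simp
    qed
  qed
  moreover have "payoff r U c = welfare g"
  proof -
    have "is_ac_density c g"
      unfolding is_ac_density_def
      by (rule bexI[of _ "{}"]) (use g_int in \<open>auto simp: c_def set_lebesgue_integral_def\<close>)
    then have ac: "AE t in lborel. 0 \<le> t \<longrightarrow> ac_density c t = g t" by (rule ac_density_eq[OF cM])
    show ?thesis
      unfolding payoff_def welfare_def
    proof (rule nn_integral_cong_AE)
      show "AE t in lborel. ennreal (exp (- r * t) * U (ac_density c t)) * indicator {0..} t = ennreal (exp (- r * t) * U (g t)) * indicator {0..} t"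
        using ac by eventually_elim (auto simp: indicator_def)
    qed
  qed
  ultimately show ?thesis by blast
qed

text \<open>
  By the two preceding lemmas both problems have the same value. A maximiser is a subsolution
  that attains it and is continuous from the right, hence is the optimal path at every time.
\<close>

theorem maximiser_characterisation:
  assumes environment: "environment \<kappa>" and \<kappa>0: "0 \<le> \<kappa>0" "\<kappa>0 \<le> R" and opt: "optimal \<kappa>0 \<kappa> k g"
  shows "(\<exists>c. maximiser f r U \<kappa>0 \<kappa> h c) \<longleftrightarrow> h = (\<lambda>t. if 0 \<le> t then k t else \<kappa>0)"
proof
  have solution: "solution \<kappa>0 \<kappa> k g" and bd: "\<And>t. g t \<le> consumption_bound" and Pg: "welfare g = value_of \<kappa>0 \<kappa>" using opt by (auto simp: optimal_def)
  let ?k = "\<lambda>t. if 0 \<le> t then k t else \<kappa>0"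
  obtain c where c: "feasible f \<kappa>0 \<kappa> ?k c" "payoff r U c = welfare g" using solution_imp_feasible[OF solution bd environment \<kappa>0] by blast
  have le: "payoff r U d \<le> value_of \<kappa>0 \<kappa>" if "feasible f \<kappa>0 \<kappa> h d" for h d
    using feasible_imp_subsolution[OF that environment \<kappa>0(1)] welfare_le_value by force
  {
    assume "h = ?k"
    then show "\<exists>c. maximiser f r U \<kappa>0 \<kappa> h c" using c le Pg by (auto simp: maximiser_def)
  }
  assume "\<exists>c. maximiser f r U \<kappa>0 \<kappa> h c"
  then obtain d where d: "feasible f \<kappa>0 \<kappa> h d" "payoff r U c \<le> payoff r U d"
    using c(1) by (auto simp: maximiser_def)
  obtain u where u: "subsolution \<kappa>0 \<kappa> h u" "payoff r U d = welfare u" using feasible_imp_subsolution[OF d(1) environment \<kappa>0(1)] by blast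
  have Pu: "welfare u = value_of \<kappa>0 \<kappa>" using le[OF d(1)] d(2) c(2) Pg u(2) by simp
  obtain k' where k': "k' \<in> Mloc" "\<And>t. h t = \<kappa>0 + k' {0..t}" using d(1) by (auto simp: feasible_def)
  show "h = ?k"
  proof
    fix t show "h t = ?k t"
    proof (cases "0 \<le> t")
      case True
      have "h t = k t"
      proof (rule optimal_unique[OF opt environment \<kappa>0 u(1) Pu _ True])
        fix s assume "decseq s" "s \<longlonglongrightarrow> t" "\<And>n. t < s n"
        then show "(\<lambda>n. h (s n)) \<longlonglongrightarrow> h t"
          unfolding k'(2) by (intro tendsto_add tendsto_const Mloc_Icc_right_limit[OF k'(1) _ _ True])
      qed
      then show ?thesis using True by simp
    next
      case False
      then show ?thesis using k' Mloc_empty[OF k'(1)] by simp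
    qed
  qed
qed

end

section \<open>The expectations map\<close>

lemma feasible_cong:
  assumes "\<And>t. 0 \<le> t \<Longrightarrow> \<kappa> t = \<kappa>' t"
  shows "feasible f \<kappa>0 \<kappa> = feasible f \<kappa>0 \<kappa>'"
proof -
  have "(LINT t:B|lborel. f (k t) (\<kappa> t)) = (LINT t:B|lborel. f (k t) (\<kappa>' t))" if "B \<in> bounded_borel" for B k
    by (rule set_lebesgue_integral_cong) (use that assms in \<open>auto simp: bounded_borel_def\<close>)
  then show ?thesis by (intro ext) (simp add: feasible_def cong: ball_cong)
qed

lemma maximiser_cong:
  assumes "\<And>t. 0 \<le> t \<Longrightarrow> \<kappa> t = \<kappa>' t"
  shows "maximiser f r U \<kappa>0 \<kappa> = maximiser f r U \<kappa>0 \<kappa>'"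
  by (intro ext) (simp add: maximiser_def feasible_cong[OF assms])

text \<open>
  The properties of \<open>S\<close> at measurable stocks with values in \<open>[0,R]\<close>: besides the Lipschitz bound,
  the equicontinuity of the images is all that enters of the compactness of \<open>S\<close>. Initial stocks
  have a positive lower bound \<open>m\<close>, because the value is lower semicontinuous only where the
  initial stock is positive.
\<close>

locale equilibrium_problem = individual_problem f U a b \<delta> R k1 r
  for f :: "real \<Rightarrow> real \<Rightarrow> real" and U :: "real \<Rightarrow> real" and a b \<delta> R k1 r :: real +
  fixes D :: "'z::euclidean_space set" and S :: "('z \<Rightarrow> real) \<Rightarrow> 'z \<Rightarrow> real" and k0 :: "'z \<Rightarrow> real" and L m :: real
  assumes D: "compact D" "D \<noteq> {}"
    and k0: "k0 \<in> borel_measurable (lebesgue_on D)" "\<And>z. z \<in> D \<Longrightarrow> m \<le> k0 z \<and> k0 z \<le> R" "0 < m"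
    and S_range: "u \<in> borel_measurable (lebesgue_on D) \<Longrightarrow> (\<And>z. z \<in> D \<Longrightarrow> 0 \<le> u z \<and> u z \<le> R) \<Longrightarrow> z \<in> D \<Longrightarrow> S u z \<in> {a..b}"
    and S_Lipschitz: "u \<in> borel_measurable (lebesgue_on D) \<Longrightarrow> (\<And>z. z \<in> D \<Longrightarrow> 0 \<le> u z \<and> u z \<le> R) \<Longrightarrow>
      v \<in> borel_measurable (lebesgue_on D) \<Longrightarrow> (\<And>z. z \<in> D \<Longrightarrow> 0 \<le> v z \<and> v z \<le> R) \<Longrightarrow>
      (\<And>z. z \<in> D \<Longrightarrow> \<bar>u z - v z\<bar> \<le> e) \<Longrightarrow> z \<in> D \<Longrightarrow> \<bar>S u z - S v z\<bar> \<le> L * e"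
    and L: "0 \<le> L"
    and S_equicontinuous: "z \<in> D \<Longrightarrow> 0 < e \<Longrightarrow> \<exists>\<rho>>0. \<forall>z'\<in>D. dist z z' < \<rho> \<longrightarrow>
      (\<forall>u\<in>borel_measurable (lebesgue_on D). (\<forall>z\<in>D. 0 \<le> u z \<and> u z \<le> R) \<longrightarrow> \<bar>S u z - S u z'\<bar> \<le> e)"
begin

definition stocks :: "('z \<Rightarrow> real) set" where
  "stocks = {u \<in> borel_measurable (lebesgue_on D). \<forall>z\<in>D. 0 \<le> u z \<and> u z \<le> R}"

text \<open>
  The best common modulus of continuity of all images of stocks under \<open>S\<close>.
\<close>

definition osc :: "'z \<Rightarrow> 'z \<Rightarrow> real" where
  "osc z z' = (SUP u\<in>stocks. \<bar>S u z - S u z'\<bar>)"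

lemma stocks_range: "u \<in> stocks \<Longrightarrow> z \<in> D \<Longrightarrow> S u z \<in> {a..b}"
  unfolding stocks_def by (rule S_range) auto

lemma stocks_nonempty: "stocks \<noteq> {}"
proof -
  have "(\<lambda>_. 0) \<in> stocks" using pos by (simp add: stocks_def)
  then show ?thesis by blast
qed

lemma osc_upper:
  assumes "u \<in> stocks" "z \<in> D" "z' \<in> D" shows "\<bar>S u z - S u z'\<bar> \<le> osc z z'"
  unfolding osc_def
proof (rule cSUP_upper[OF assms(1)], rule bdd_aboveI2[where M="b - a"])
  fix v assume "v \<in> stocks"
  then show "\<bar>S v z - S v z'\<bar> \<le> b - a" using stocks_range[of v z] stocks_range[of v z'] assms by auto
qed

lemma osc_nonneg: "z \<in> D \<Longrightarrow> z' \<in> D \<Longrightarrow> 0 \<le> osc z z'"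
  using osc_upper stocks_nonempty by (metis abs_ge_zero ex_in_conv order_trans)

lemma osc_self: "osc z z = 0"
  using stocks_nonempty by (simp add: osc_def)

lemma osc_small:
  assumes "z \<in> D" "0 < e" shows "\<exists>\<rho>>0. \<forall>z'\<in>D. dist z z' < \<rho> \<longrightarrow> osc z z' \<le> e"
proof -
  obtain \<rho> where \<rho>: "\<rho> > 0" "\<And>z' u. z' \<in> D \<Longrightarrow> dist z z' < \<rho> \<Longrightarrow> u \<in> stocks \<Longrightarrow> \<bar>S u z - S u z'\<bar> \<le> e"
    using S_equicontinuous[OF assms] unfolding stocks_def by auto
  have "osc z z' \<le> e" if "z' \<in> D" "dist z z' < \<rho>" for z'
    unfolding osc_def by (rule cSUP_least[OF stocks_nonempty]) (use \<rho>(2) that in auto)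
  then show ?thesis using \<rho>(1) by blast
qed

lemma osc_tendsto:
  assumes "\<And>n. zn n \<in> D" "z \<in> D" "zn \<longlonglongrightarrow> z" shows "(\<lambda>n. osc z (zn n)) \<longlonglongrightarrow> 0"
proof (rule tendstoI)
  fix e :: real assume "e > 0"
  then obtain \<rho> where \<rho>: "\<rho> > 0" "\<And>z'. z' \<in> D \<Longrightarrow> dist z z' < \<rho> \<Longrightarrow> osc z z' \<le> e / 2"
    using osc_small[OF assms(2), of "e/2"] by auto
  have "\<forall>\<^sub>F n in sequentially. dist (zn n) z < \<rho>" using tendstoD[OF assms(3) \<rho>(1)] .
  then show "\<forall>\<^sub>F n in sequentially. dist (osc z (zn n)) 0 < e"
  proof eventually_elim
    case (elim n)
    then have "osc z (zn n) \<le> e / 2" by (intro \<rho>(2) assms(1)) (simp add: dist_commute)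
    then show ?case using osc_nonneg[OF assms(2) assms(1), of n] \<open>e > 0\<close> by (simp add: dist_real_def)
  qed
qed

definition modulus :: "real \<times> 'z \<Rightarrow> real \<times> 'z \<Rightarrow> real" where
  "modulus p q = L * Lip * \<bar>fst p - fst q\<bar> + osc (snd p) (snd q)"

definition fields :: "(real \<times> 'z \<Rightarrow> real) set" where
  "fields = modulus_class ({0..} \<times> D) a b modulus"

lemma fields_range: "K \<in> fields \<Longrightarrow> 0 \<le> t \<Longrightarrow> z \<in> D \<Longrightarrow> K (t, z) \<in> {a..b}"
  by (auto simp: fields_def modulus_class_def)

lemma fields_modulus: "K \<in> fields \<Longrightarrow> 0 \<le> t \<Longrightarrow> 0 \<le> s \<Longrightarrow> z \<in> D \<Longrightarrow> z' \<in> D \<Longrightarrow>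
    \<bar>K (t, z) - K (s, z')\<bar> \<le> L * Lip * \<bar>t - s\<bar> + osc z z'"
  by (force simp: fields_def modulus_class_def modulus_def)

text \<open>
  Environments are defined at all real times, fields only at nonnegative ones; the value at
  negative times does not affect feasibility.
\<close>

definition section_at :: "(real \<times> 'z \<Rightarrow> real) \<Rightarrow> 'z \<Rightarrow> real \<Rightarrow> real" where
  "section_at K z t = K (max 0 t, z)"

lemma environment_section:
  assumes "K \<in> fields" "z \<in> D" shows "environment (section_at K z)"
proof -
  have LL: "0 \<le> L * Lip" using L Lip_nonneg by simp
  have "\<bar>section_at K z s - section_at K z t\<bar> \<le> L * Lip * \<bar>s - t\<bar>" for s t
  proof -
    have "\<bar>section_at K z s - section_at K z t\<bar> \<le> L * Lip * \<bar>max 0 s - max 0 t\<bar> + osc z z"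
      unfolding section_at_def by (rule fields_modulus) (use assms in auto)
    also have "\<dots> \<le> L * Lip * \<bar>s - t\<bar>" using LL by (auto simp: osc_self intro!: mult_left_mono)
    finally show ?thesis .
  qed
  then have "continuous_on UNIV (section_at K z)"
    by (intro lipschitz_on_continuous_on[of "L * Lip"]) (auto simp: lipschitz_on_def dist_real_def LL)
  then have "section_at K z \<in> borel_measurable borel" by (rule borel_measurable_continuous_onI)
  moreover have "section_at K z t \<in> {a..b}" for t
    unfolding section_at_def by (rule fields_range) (use assms in auto)
  ultimately show ?thesis by (simp add: environment_def)
qed

text \<open>
  The initial stock is a separate argument because \<open>k0\<close> is only measurable: \<open>capital\<close> is continuous
  in \<open>(\<kappa>0, z)\<close>, while the stock at \<open>z\<close> is obtained by inserting \<open>\<kappa>0 = k0 z\<close>.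
\<close>

definition capital :: "real \<Rightarrow> (real \<times> 'z \<Rightarrow> real) \<Rightarrow> 'z \<Rightarrow> real \<Rightarrow> real" where
  "capital \<kappa>0 K z = kopt f r U \<kappa>0 (\<lambda>t. K (t, z))"

lemma capital:
  assumes "K \<in> fields" "z \<in> D" "0 \<le> \<kappa>0" "\<kappa>0 \<le> R"
  shows "\<exists>!k. \<exists>c. maximiser f r U \<kappa>0 (\<lambda>t. K (t, z)) k c"
    "\<exists>k g. optimal \<kappa>0 (section_at K z) k g \<and> (\<forall>t\<ge>0. capital \<kappa>0 K z t = k t)"
proof -
  have eq: "maximiser f r U \<kappa>0 (\<lambda>t. K (t, z)) = maximiser f r U \<kappa>0 (section_at K z)"
    by (rule maximiser_cong) (simp add: section_at_def)
  note environment = environment_section[OF assms(1,2)]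
  obtain k g where opt: "optimal \<kappa>0 (section_at K z) k g" using optimal_exists[OF environment assms(3,4)] by blast
  have ch: "(\<exists>c. maximiser f r U \<kappa>0 (\<lambda>t. K (t, z)) h c) \<longleftrightarrow> h = (\<lambda>t. if 0 \<le> t then k t else \<kappa>0)" for h
    unfolding eq by (rule maximiser_characterisation[OF environment assms(3,4) opt])
  show "\<exists>!k. \<exists>c. maximiser f r U \<kappa>0 (\<lambda>t. K (t, z)) k c" unfolding ch by simp
  have "capital \<kappa>0 K z = (\<lambda>t. if 0 \<le> t then k t else \<kappa>0)" unfolding capital_def kopt_def ch by simp
  then show "\<exists>k g. optimal \<kappa>0 (section_at K z) k g \<and> (\<forall>t\<ge>0. capital \<kappa>0 K z t = k t)" using opt by auto
qed

lemma capital_range: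
  assumes "K \<in> fields" "z \<in> D" "0 \<le> \<kappa>0" "\<kappa>0 \<le> R" "0 \<le> t"
  shows "0 \<le> capital \<kappa>0 K z t \<and> capital \<kappa>0 K z t \<le> R"
  using capital(2)[OF assms(1-4)] optimal_bounds(1)[OF _ environment_section[OF assms(1,2)] assms(3-5)] assms(5) by metis

lemma capital_Lipschitz:
  assumes "K \<in> fields" "z \<in> D" "0 \<le> \<kappa>0" "\<kappa>0 \<le> R" "0 \<le> t" "0 \<le> s"
  shows "\<bar>capital \<kappa>0 K z s - capital \<kappa>0 K z t\<bar> \<le> Lip * \<bar>s - t\<bar>"
  using capital(2)[OF assms(1-4)] optimal_bounds(2)[OF _ environment_section[OF assms(1,2)] assms(3,4,6,5)] assms(5,6) by metis

lemma capital_tendsto: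
  assumes Kn: "\<And>n. Kn n \<in> fields" "K \<in> fields" "\<And>t z. 0 \<le> t \<Longrightarrow> z \<in> D \<Longrightarrow> (\<lambda>n. Kn n (t, z)) \<longlonglongrightarrow> K (t, z)"
    and z: "\<And>n. zn n \<in> D" "z \<in> D" "zn \<longlonglongrightarrow> z"
    and \<kappa>0: "\<And>n. m \<le> \<kappa>0n n" "\<And>n. \<kappa>0n n \<le> R" "\<kappa>0n \<longlonglongrightarrow> \<kappa>0" and t: "0 \<le> t"
  shows "(\<lambda>n. capital (\<kappa>0n n) (Kn n) (zn n) t) \<longlonglongrightarrow> capital \<kappa>0 K z t"
proof -
  have \<kappa>0n0: "0 \<le> \<kappa>0n n" for n using \<kappa>0(1)[of n] k0(3) by linarith
  have "m \<le> \<kappa>0" by (rule LIMSEQ_le_const[OF \<kappa>0(3)]) (use \<kappa>0 in auto)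
  then have \<kappa>00: "0 < \<kappa>0" using k0(3) by linarith
  have \<kappa>0R: "\<kappa>0 \<le> R" by (rule LIMSEQ_le_const2[OF \<kappa>0(3)]) (use \<kappa>0 in auto)
  have "\<forall>n. \<exists>kg. optimal (\<kappa>0n n) (section_at (Kn n) (zn n)) (fst kg) (snd kg) \<and> (\<forall>t\<ge>0. capital (\<kappa>0n n) (Kn n) (zn n) t = fst kg t)"
    using capital(2)[OF Kn(1) z(1) \<kappa>0n0 \<kappa>0(2)] by force
  from choice[OF this] obtain kg where
    kg: "\<forall>n. optimal (\<kappa>0n n) (section_at (Kn n) (zn n)) (fst (kg n)) (snd (kg n)) \<and> (\<forall>t\<ge>0. capital (\<kappa>0n n) (Kn n) (zn n) t = fst (kg n) t)" ..
  obtain k g where k: "optimal \<kappa>0 (section_at K z) k g" "\<And>t. 0 \<le> t \<Longrightarrow> capital \<kappa>0 K z t = k t"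
    using capital(2)[OF Kn(2) z(2) less_imp_le[OF \<kappa>00] \<kappa>0R] by blast
  have "(\<lambda>n. fst (kg n) t) \<longlonglongrightarrow> k t"
  proof (rule optimal_continuous[OF _ k(1) environment_section[OF Kn(1) z(1)] environment_section[OF Kn(2) z(2)] \<kappa>0n0 \<kappa>0(2) \<kappa>00 \<kappa>0(3) _ t])
    show "optimal (\<kappa>0n n) (section_at (Kn n) (zn n)) (fst (kg n)) (snd (kg n))" for n using kg by simp
    fix s :: real assume s: "0 \<le> s"
    have "(\<lambda>n. Kn n (s, z) - Kn n (s, zn n)) \<longlonglongrightarrow> 0"
    proof (rule Lim_null_comparison[OF _ osc_tendsto[OF z]], rule always_eventually, rule allI)
      fix n
      show "norm (Kn n (s, z) - Kn n (s, zn n)) \<le> osc z (zn n)"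
        using fields_modulus[OF Kn(1) s s z(2) z(1), of n n] by simp
    qed
    from tendsto_diff[OF Kn(3)[OF s z(2)] this] have "(\<lambda>n. Kn n (s, zn n)) \<longlonglongrightarrow> K (s, z)" by simp
    then show "(\<lambda>n. section_at (Kn n) (zn n) s) \<longlonglongrightarrow> section_at K z s" using s by (simp add: section_at_def)
  qed
  then show ?thesis using kg k(2)[OF t] t by simp
qed

definition stock_at :: "(real \<times> 'z \<Rightarrow> real) \<Rightarrow> real \<Rightarrow> 'z \<Rightarrow> real" where
  "stock_at K t z = capital (k0 z) K z t"

lemma k0_range: "z \<in> D \<Longrightarrow> 0 \<le> k0 z" "z \<in> D \<Longrightarrow> k0 z \<le> R"
  using k0(2)[of z] k0(3) by auto

text \<open>
  The composition of \<open>z \<mapsto> (k0 z, z)\<close>, which is measurable, with a continuous function.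
\<close>

lemma stock_at_in_stocks:
  assumes K: "K \<in> fields" and t: "0 \<le> t" shows "stock_at K t \<in> stocks"
proof -
  define Z where "Z = {m..R} \<times> D"
  have "continuous_on Z (\<lambda>(\<kappa>0, z). capital \<kappa>0 K z t)"
    unfolding continuous_on_sequentially
  proof (intro allI ballI impI, elim conjE)
    fix x and p assume p: "p \<in> Z" and x: "\<forall>n. x n \<in> Z" and lim: "x \<longlonglongrightarrow> p"
    have "(\<lambda>n. capital (fst (x n)) K (snd (x n)) t) \<longlonglongrightarrow> capital (fst p) K (snd p) t"
    proof (rule capital_tendsto[OF K K tendsto_const _ _ tendsto_snd[OF lim] _ _ tendsto_fst[OF lim] t])
      fix n
      have "x n \<in> Z" using x by simp
      then show "snd (x n) \<in> D" "m \<le> fst (x n)" "fst (x n) \<le> R" by (auto simp: Z_def)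
      show "snd p \<in> D" using p by (auto simp: Z_def)
    qed
    then show "((\<lambda>(\<kappa>0, z). capital \<kappa>0 K z t) \<circ> x) \<longlonglongrightarrow> (\<lambda>(\<kappa>0, z). capital \<kappa>0 K z t) p"
      by (simp add: o_def split_beta)
  qed
  then have cm: "(\<lambda>(\<kappa>0, z). capital \<kappa>0 K z t) \<in> borel_measurable (restrict_space borel Z)"
    by (rule borel_measurable_continuous_on_restrict)
  have "(\<lambda>z. (k0 z, z)) \<in> lebesgue_on D \<rightarrow>\<^sub>M restrict_space borel Z"
  proof (rule measurable_restrict_space2)
    show "(\<lambda>z. (k0 z, z)) \<in> space (lebesgue_on D) \<rightarrow> Z" using k0 by (auto simp: Z_def)
    have "(\<lambda>z. z) \<in> borel_measurable (lebesgue_on D)"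
      by (rule measurable_restrict_space1) (rule measurable_completion, simp)
    then show "(\<lambda>z. (k0 z, z)) \<in> borel_measurable (lebesgue_on D)" using k0(1) by measurable
  qed
  from measurable_compose[OF this cm] have "stock_at K t \<in> borel_measurable (lebesgue_on D)"
    by (simp add: stock_at_def[abs_def])
  moreover have "0 \<le> stock_at K t z \<and> stock_at K t z \<le> R" if "z \<in> D" for z
    unfolding stock_at_def by (rule capital_range[OF K that k0_range[OF that] t])
  ultimately show ?thesis by (simp add: stocks_def)
qed

definition expectations_map :: "(real \<times> 'z \<Rightarrow> real) \<Rightarrow> real \<times> 'z \<Rightarrow> real" where
  "expectations_map K p = S (stock_at K (fst p)) (snd p)"

lemma S_Lip: "u \<in> stocks \<Longrightarrow> v \<in> stocks \<Longrightarrow> (\<And>z. z \<in> D \<Longrightarrow> \<bar>u z - v z\<bar> \<le> e) \<Longrightarrow> z \<in> D \<Longrightarrow> \<bar>S u z - S v z\<bar> \<le> L * e"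
  by (rule S_Lipschitz) (auto simp: stocks_def)

lemma expectations_map_in_fields:
  assumes K: "K \<in> fields" shows "expectations_map K \<in> fields"
  unfolding fields_def modulus_class_def
proof (intro CollectI ballI conjI)
  fix p :: "real \<times> 'z" assume p: "p \<in> {0..} \<times> D"
  then have s1: "stock_at K (fst p) \<in> stocks" using stock_at_in_stocks[OF K] by auto
  show "a \<le> expectations_map K p" "expectations_map K p \<le> b"
    using stocks_range[OF s1, of "snd p"] p by (auto simp: expectations_map_def)
  fix q :: "real \<times> 'z" assume q: "q \<in> {0..} \<times> D"
  then have s2: "stock_at K (fst q) \<in> stocks" using stock_at_in_stocks[OF K] by auto
  have "\<bar>S (stock_at K (fst p)) (snd p) - S (stock_at K (fst q)) (snd p)\<bar> \<le> L * (Lip * \<bar>fst p - fst q\<bar>)"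
  proof (rule S_Lip[OF s1 s2])
    show "\<bar>stock_at K (fst p) z - stock_at K (fst q) z\<bar> \<le> Lip * \<bar>fst p - fst q\<bar>" if "z \<in> D" for z
      unfolding stock_at_def by (rule capital_Lipschitz[OF K that k0_range[OF that]]) (use p q in auto)
  qed (use p in auto)
  moreover have "\<bar>S (stock_at K (fst q)) (snd p) - S (stock_at K (fst q)) (snd q)\<bar> \<le> osc (snd p) (snd q)"
    by (rule osc_upper[OF s2]) (use p q in auto)
  ultimately show "\<bar>expectations_map K p - expectations_map K q\<bar> \<le> modulus p q"
    by (simp add: expectations_map_def modulus_def)
qed

text \<open>
  \<open>S\<close> requires uniform convergence of the stocks. The stock at \<open>z\<close> is \<open>capital\<close> at the point \<open>(k0 z, z)\<close>
  of the compact set \<open>[m,R] \<times> D\<close>, on which \<open>capital_tendsto\<close> is convergence along arbitrary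
  convergent sequences of points, hence uniform.
\<close>

lemma expectations_map_continuous:
  assumes Kn: "\<And>n. Kn n \<in> fields" "K \<in> fields" "\<And>p. p \<in> {0..} \<times> D \<Longrightarrow> (\<lambda>n. Kn n p) \<longlonglongrightarrow> K p"
    and p: "p \<in> {0..} \<times> D"
  shows "(\<lambda>n. expectations_map (Kn n) p) \<longlonglongrightarrow> expectations_map K p"
proof -
  obtain t z where tz: "p = (t, z)" "0 \<le> t" "z \<in> D" using p by auto
  have Kl: "(\<lambda>n. Kn n (s, y)) \<longlonglongrightarrow> K (s, y)" if "0 \<le> s" "y \<in> D" for s y using Kn(3) that by auto
  have unif: "\<forall>\<^sub>F n in sequentially. \<forall>y\<in>D. \<bar>stock_at (Kn n) t y - stock_at K t y\<bar> \<le> e" if e: "e > 0" for e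
  proof (rule ccontr)
    assume "\<not> ?thesis"
    from not_eventually_sequentiallyD[OF this] obtain \<sigma> where
      \<sigma>: "strict_mono (\<sigma>::nat\<Rightarrow>nat)" "\<forall>n. \<not> (\<forall>y\<in>D. \<bar>stock_at (Kn (\<sigma> n)) t y - stock_at K t y\<bar> \<le> e)" by blast
    then have "\<forall>n. \<exists>y. y \<in> D \<and> \<bar>stock_at (Kn (\<sigma> n)) t y - stock_at K t y\<bar> > e" by (meson not_le)
    from choice[OF this] obtain y where y: "\<And>n. y n \<in> D" "\<And>n. \<bar>stock_at (Kn (\<sigma> n)) t (y n) - stock_at K t (y n)\<bar> > e" by blast
    define x where "x n = (k0 (y n), y n)" for n
    have "compact ({m..R} \<times> D)" using D by (intro compact_Times) auto
    then have "seq_compact ({m..R} \<times> D)" by (rule compact_imp_seq_compact)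
    moreover have "\<forall>n. x n \<in> {m..R} \<times> D" using k0(2) y(1) by (auto simp: x_def)
    ultimately obtain l \<rho> where l: "l \<in> {m..R} \<times> D" "strict_mono (\<rho>::nat\<Rightarrow>nat)" "(x \<circ> \<rho>) \<longlonglongrightarrow> l"
      by (rule seq_compactE)
    have lim: "(\<lambda>n. k0 (y (\<rho> n))) \<longlonglongrightarrow> fst l" "(\<lambda>n. y (\<rho> n)) \<longlonglongrightarrow> snd l"
      using tendsto_fst[OF l(3)] tendsto_snd[OF l(3)] by (auto simp: o_def x_def)
    have lD: "snd l \<in> D" using l(1) by auto
    have sr: "strict_mono (\<lambda>n. \<sigma> (\<rho> n))" using strict_mono_o[OF \<sigma>(1) l(2)] by (simp add: o_def)
    have "(\<lambda>n. stock_at (Kn (\<sigma> (\<rho> n))) t (y (\<rho> n))) \<longlonglongrightarrow> capital (fst l) K (snd l) t"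
      unfolding stock_at_def
    proof (rule capital_tendsto[OF Kn(1) Kn(2) _ y(1) lD lim(2) _ _ lim(1) tz(2)])
      show "(\<lambda>n. Kn (\<sigma> (\<rho> n)) (s, x)) \<longlonglongrightarrow> K (s, x)" if "0 \<le> s" "x \<in> D" for s x
        using LIMSEQ_subseq_LIMSEQ[OF Kl[OF that] sr] by (simp add: o_def)
    qed (use k0(2) y(1) in auto)
    moreover have "(\<lambda>n. stock_at K t (y (\<rho> n))) \<longlonglongrightarrow> capital (fst l) K (snd l) t"
      unfolding stock_at_def
      by (rule capital_tendsto[OF Kn(2) Kn(2) tendsto_const y(1) lD lim(2) _ _ lim(1) tz(2)]) (use k0(2) y(1) in auto)
    ultimately have "(\<lambda>n. \<bar>stock_at (Kn (\<sigma> (\<rho> n))) t (y (\<rho> n)) - stock_at K t (y (\<rho> n))\<bar>) \<longlonglongrightarrow> \<bar>capital (fst l) K (snd l) t - capital (fst l) K (snd l) t\<bar>"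
      by (intro tendsto_intros)
    then have "e \<le> \<bar>capital (fst l) K (snd l) t - capital (fst l) K (snd l) t\<bar>"
      by (rule LIMSEQ_le_const) (use y(2) in \<open>auto intro: less_imp_le\<close>)
    then show False using e by simp
  qed
  have "(\<lambda>n. S (stock_at (Kn n) t) z) \<longlonglongrightarrow> S (stock_at K t) z"
  proof (rule tendstoI)
    fix e :: real assume e: "e > 0"
    have e2: "e / (2 * (L + 1)) > 0" using e L by simp
    from unif[OF e2] show "\<forall>\<^sub>F n in sequentially. dist (S (stock_at (Kn n) t) z) (S (stock_at K t) z) < e"
    proof eventually_elim
      case (elim n)
      have "\<bar>S (stock_at (Kn n) t) z - S (stock_at K t) z\<bar> \<le> L * (e / (2 * (L + 1)))"
        by (rule S_Lip[OF stock_at_in_stocks[OF Kn(1) tz(2)] stock_at_in_stocks[OF Kn(2) tz(2)] _ tz(3)]) (use elim in auto)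
      also have "\<dots> \<le> (L + 1) * (e / (2 * (L + 1)))" using e2 by (intro mult_right_mono) auto
      also have "\<dots> = e / 2" using L by (simp add: field_simps)
      finally show ?case using e by (simp add: dist_real_def)
    qed
  qed
  then show ?thesis by (simp add: expectations_map_def tz)
qed

theorem expectations_map_fixed_point: "\<exists>K\<in>fields. \<forall>p\<in>{0..} \<times> D. expectations_map K p = K p"
  unfolding fields_def
proof -
  obtain T where T: "countable T" "T \<subseteq> D" "D \<subseteq> closure T" using separable by metis
  show "\<exists>K\<in>modulus_class ({0..} \<times> D) a b modulus. \<forall>p\<in>{0..} \<times> D. expectations_map K p = K p"
  proof (rule modulus_class_fixed_point[where Q="(\<rat> \<inter> {0..}) \<times> T"])
    have "(\<lambda>_. a) \<in> fields"
      unfolding fields_def modulus_class_def modulus_def using pos L Lip_nonneg osc_nonneg by auto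
    then show "modulus_class ({0..} \<times> D) a b modulus \<noteq> {}" unfolding fields_def by blast
    show "countable ((\<rat> \<inter> {0..}) \<times> T)" using T(1) countable_rat by (intro countable_SIGMA countable_Int1) auto
    show "(\<rat> \<inter> {0..}) \<times> T \<subseteq> {0..} \<times> D" using T(2) by auto
    show "\<exists>q\<in>(\<rat> \<inter> {0..}) \<times> T. modulus p q < e" if p: "p \<in> {0..} \<times> D" and e: "e > 0" for p e
    proof -
      have LL: "0 \<le> L * Lip" using L Lip_nonneg by simp
      define \<eta> where "\<eta> = e / (2 * (L * Lip + 1))"
      have \<eta>: "\<eta> > 0" using e LL by (simp add: \<eta>_def)
      obtain x where x: "x \<in> \<rat>" "fst p < x" "x < fst p + \<eta>" using Rats_dense_in_real[of "fst p" "fst p + \<eta>"] \<eta> by auto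
      have "L * Lip * \<bar>fst p - x\<bar> \<le> L * Lip * \<eta>" using x LL by (intro mult_left_mono) auto
      also have "\<dots> < (L * Lip + 1) * \<eta>" using \<eta> by simp
      also have "\<dots> = e / 2" using LL by (simp add: \<eta>_def field_simps)
      finally have 1: "L * Lip * \<bar>fst p - x\<bar> < e / 2" .
      have pD: "snd p \<in> D" using p by auto
      obtain \<rho> where \<rho>: "\<rho> > 0" "\<And>z'. z' \<in> D \<Longrightarrow> dist (snd p) z' < \<rho> \<Longrightarrow> osc (snd p) z' \<le> e / 2"
        using osc_small[OF pD, of "e/2"] e by auto
      have "snd p \<in> closure T" using pD T(3) by auto
      then obtain z where z: "z \<in> T" "dist z (snd p) < \<rho>" using \<rho>(1) by (auto simp: closure_approachable)
      have "osc (snd p) z \<le> e / 2" using \<rho>(2)[of z] z T(2) by (auto simp: dist_commute)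
      then have "modulus p (x, z) < e" using 1 by (simp add: modulus_def)
      moreover have "(x, z) \<in> (\<rat> \<inter> {0..}) \<times> T" using x z p by auto
      ultimately show ?thesis by blast
    qed
    show "expectations_map K \<in> modulus_class ({0..} \<times> D) a b modulus" if "K \<in> modulus_class ({0..} \<times> D) a b modulus" for K
      using expectations_map_in_fields[of K] that unfolding fields_def .
    show "(\<lambda>n. expectations_map (K n) p) \<longlonglongrightarrow> expectations_map L p"
      if "\<And>n. K n \<in> modulus_class ({0..} \<times> D) a b modulus" "L \<in> modulus_class ({0..} \<times> D) a b modulus"
        "\<And>p. p \<in> {0..} \<times> D \<Longrightarrow> (\<lambda>n::nat. K n p) \<longlonglongrightarrow> L p" "p \<in> {0..} \<times> D" for K L p
      by (rule expectations_map_continuous) (use that in \<open>auto simp: fields_def\<close>)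
  qed
qed

end

section \<open>Existence of equilibrium\<close>

lemma individual_problem_of_assumptions:
  assumes prod: "production_function I f" and util: "utility_function U" and r: "r > 0"
    and ab: "0 < a" "a \<le> b" "{a..b} \<subseteq> I" and R: "R > 0" "\<And>x K. K \<in> {a..b} \<Longrightarrow> R \<le> x \<Longrightarrow> f x K \<le> 0"
  shows "\<exists>\<delta> k1. individual_problem f U a b \<delta> R k1 r"
proof -
  note P = prod[unfolded production_function_def]
  have cont: "continuous_on ({0..} \<times> {0..}) (\<lambda>(k, K). f k K)" by (rule P[THEN conjunct1])
  have f0: "f 0 K = 0" if "K \<in> I" for K using P[THEN conjunct2, THEN conjunct1] that by (rule bspec)
  have conc: "strictly_concave_on {0..} (\<lambda>k. f k K)" if "K \<in> I" for K
    using P[THEN conjunct2, THEN conjunct2, THEN conjunct2, THEN conjunct2, THEN conjunct2] that by (rule bspec)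
  obtain k1 where k1: "k1 > 0" "\<And>K k. K \<in> I \<Longrightarrow> 0 < k \<Longrightarrow> k < k1 \<Longrightarrow> 0 < f k K"
    using P[THEN conjunct2, THEN conjunct2, THEN conjunct2, THEN conjunct2, THEN conjunct1] by blast
  obtain fk fK where Q: "(\<forall>k>0. \<forall>K>0. ((\<lambda>x. f x K) has_real_derivative fk k K) (at k) \<and>
                      ((\<lambda>y. f k y) has_real_derivative fK k K) (at K)) \<and>
        continuous_on ({0<..} \<times> {0<..}) (\<lambda>(k, K). fk k K) \<and>
        continuous_on ({0<..} \<times> {0<..}) (\<lambda>(k, K). fK k K) \<and>
        (\<exists>\<delta>>0. \<forall>k>0. \<forall>K>0. - \<delta> \<le> fk k K) \<and>
        (\<forall>a>0. \<forall>b>0. \<exists>C. \<forall>k\<ge>a. \<forall>K. 0 < K \<and> K \<le> b \<longrightarrow> fk k K \<le> C)"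
    using P[THEN conjunct2, THEN conjunct2, THEN conjunct1] by (elim exE) (rule that)
  have fk: "((\<lambda>x. f x K) has_real_derivative fk k K) (at k)" if "0 < k" "0 < K" for k K
    using Q[THEN conjunct1] that by simp
  obtain \<delta> where \<delta>: "\<delta> > 0" "\<And>k K. 0 < k \<Longrightarrow> 0 < K \<Longrightarrow> - \<delta> \<le> fk k K"
    using Q[THEN conjunct2, THEN conjunct2, THEN conjunct2, THEN conjunct1] by blast
  have up: "\<exists>C. \<forall>k\<ge>a. \<forall>K. 0 < K \<and> K \<le> b \<longrightarrow> fk k K \<le> C" if "0 < a" "0 < b" for a b
    using Q[THEN conjunct2, THEN conjunct2, THEN conjunct2, THEN conjunct2] that by simp
  have contx: "continuous_on {x..y} (\<lambda>x. f x K)" if "0 \<le> x" "K \<in> {a..b}" for x y K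
  proof -
    have "continuous_on {x..y} ((\<lambda>(k, K). f k K) \<circ> (\<lambda>x. (x, K)))"
      by (rule continuous_on_compose, intro continuous_intros, rule continuous_on_subset[OF cont]) (use that ab in auto)
    then show ?thesis by (simp add: o_def)
  qed
  have util': "\<And>c. c \<ge> 0 \<Longrightarrow> 0 \<le> U c" "concave_on {0..} U" "strict_mono_on {0..} U" "continuous_on {0..} U"
    "\<And>c. c > 0 \<Longrightarrow> U differentiable (at c)" "(deriv U \<longlongrightarrow> 0) at_top"
    using util by (auto simp: utility_function_def)
  have "individual_problem f U a b \<delta> R k1 r"
  proof
    show "0 < a" "a \<le> b" "0 < \<delta>" "0 < R" "0 < k1" "0 < r" using ab \<delta> R k1 r by auto
    show "continuous_on ({0..} \<times> {a..b}) (\<lambda>(x, K). f x K)" by (rule continuous_on_subset[OF cont]) (use ab in auto)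
    show "f 0 K = 0" if "K \<in> {a..b}" for K using f0 that ab by auto
    show "f x K + \<delta> * x \<le> f y K + \<delta> * y" if K: "K \<in> {a..b}" and xy: "0 \<le> x" "x \<le> y" for K x y
    proof (rule DERIV_nonneg_imp_increasing_open[OF xy(2)])
      fix t assume t: "x < t" "t < y"
      have tK: "0 < t" "0 < K" using t xy K ab by auto
      have "((\<lambda>x. f x K + \<delta> * x) has_real_derivative fk t K + \<delta>) (at t)"
        using fk[OF tK] by (auto intro!: derivative_eq_intros)
      then show "\<exists>d. ((\<lambda>x. f x K + \<delta> * x) has_real_derivative d) (at t) \<and> d \<ge> 0"
        using \<delta>(2)[OF tK] by (intro exI[of _ "fk t K + \<delta>"]) auto
    qed (intro continuous_intros contx xy K)
    show "\<exists>C\<ge>0. \<forall>K\<in>{a..b}. \<forall>x y. \<eta> \<le> x \<and> x \<le> y \<longrightarrow> f y K - f x K \<le> C * (y - x)" if \<eta>: "\<eta> > 0" for \<eta>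
    proof -
      obtain C where C: "\<And>k K. \<eta> \<le> k \<Longrightarrow> 0 < K \<Longrightarrow> K \<le> b \<Longrightarrow> fk k K \<le> C" using up[OF \<eta>, of b] ab by auto
      have "f y K - f x K \<le> max 0 C * (y - x)" if K: "K \<in> {a..b}" and xy: "\<eta> \<le> x" "x \<le> y" for K x y
      proof -
        have "max 0 C * x - f x K \<le> max 0 C * y - f y K"
        proof (rule DERIV_nonneg_imp_increasing_open[OF xy(2)])
          fix t assume t: "x < t" "t < y"
          have tK: "0 < t" "0 < K" using t xy K ab \<eta> by auto
          have "((\<lambda>x. max 0 C * x - f x K) has_real_derivative max 0 C - fk t K) (at t)"
            using fk[OF tK] by (auto intro!: derivative_eq_intros)
          moreover have "fk t K \<le> C" using C[of t K] t xy tK K by auto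
          ultimately show "\<exists>d. ((\<lambda>x. max 0 C * x - f x K) has_real_derivative d) (at t) \<and> d \<ge> 0"
            by (intro exI[of _ "max 0 C - fk t K"]) auto
        qed (intro continuous_intros contx K, use xy \<eta> in simp)
        then show ?thesis by (simp add: algebra_simps)
      qed
      then show ?thesis by (intro exI[of _ "max 0 C"]) auto
    qed
    show "f x K \<le> 0" if "K \<in> {a..b}" "R \<le> x" for K x by (rule R(2)[OF that])
    show "0 < f x K" if "K \<in> {a..b}" "0 < x" "x < k1" for K x using k1(2) that ab by auto
    show "strictly_concave_on {0..} (\<lambda>x. f x K)" if "K \<in> {a..b}" for K using conc that ab by auto
    show "0 \<le> U x" if "0 \<le> x" for x using util'(1) that by simp
    show "concave_on {0..} U" "strict_mono_on {0..} U" "continuous_on {0..} U" by (fact util')+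
    show "\<exists>\<Lambda>\<ge>m. \<forall>x\<ge>\<Lambda>. U x - U \<Lambda> \<le> p * (x - \<Lambda>)" if p: "p > 0" for p m
    proof -
      have "\<forall>\<^sub>F x in at_top. deriv U x < p" by (rule order_tendstoD(2)[OF util'(6) p])
      then obtain N where N: "\<And>x. x \<ge> N \<Longrightarrow> deriv U x < p" by (auto simp: eventually_at_top_linorder)
      define \<Lambda> where "\<Lambda> = max (max m 1) N"
      have \<Lambda>: "\<Lambda> \<ge> m" "\<Lambda> > 0" "deriv U \<Lambda> < p" using N by (auto simp: \<Lambda>_def)
      have "U x - U \<Lambda> \<le> p * (x - \<Lambda>)" if x: "x \<ge> \<Lambda>" for x
      proof -
        have conv: "convex_on {0..} (\<lambda>x. - U x)" using util'(2) by (simp add: concave_on_def)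
        have "(U has_field_derivative deriv U \<Lambda>) (at \<Lambda>)"
          using util'(5)[OF \<Lambda>(2)] by (simp add: DERIV_deriv_iff_real_differentiable)
        then have d: "((\<lambda>x. - U x) has_field_derivative - deriv U \<Lambda>) (at \<Lambda> within {0..})"
          by (rule has_field_derivative_at_within[OF DERIV_minus])
        have "- U x - - U \<Lambda> \<ge> - deriv U \<Lambda> * (x - \<Lambda>)"
          by (rule convex_on_imp_above_tangent[OF conv _ _ _ d]) (use x \<Lambda> in auto)
        moreover have "deriv U \<Lambda> * (x - \<Lambda>) \<le> p * (x - \<Lambda>)" using \<Lambda>(3) x by (intro mult_right_mono) auto
        ultimately show ?thesis by simp
      qed
      then show ?thesis using \<Lambda>(1) by blast
    qed
  qed
  then show ?thesis by blast
qed

lemma bounded_measurable_Linf: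
  assumes u: "u \<in> borel_measurable (lebesgue_on D)" and B: "\<And>z. z \<in> D \<Longrightarrow> \<bar>u z\<bar> \<le> B" "0 \<le> B"
  shows "u \<in> Linf D" "Linf_norm D u \<le> B"
proof -
  have "esssup (lebesgue_on D) (\<lambda>x. ennreal \<bar>u x\<bar>) \<le> ennreal B"
  proof (rule esssup_I)
    show "(\<lambda>x. ennreal \<bar>u x\<bar>) \<in> borel_measurable (lebesgue_on D)" using u by measurable
    show "AE x in lebesgue_on D. ennreal \<bar>u x\<bar> \<le> ennreal B"
      by (rule AE_I2) (use B in \<open>auto simp: space_restrict_space intro!: ennreal_leI\<close>)
  qed
  then show "u \<in> Linf D" "Linf_norm D u \<le> B"
    using u B(2) by (auto simp: Linf_def Linf_norm_def intro!: enn2real_leI intro: le_less_trans)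
qed

lemma Cspace_range: "v \<in> mspace (Cspace D I) \<Longrightarrow> z \<in> D \<Longrightarrow> v z \<in> I"
  by (auto simp: Cspace_def)

lemma Cspace_continuous: "v \<in> mspace (Cspace D I) \<Longrightarrow> continuous_on D v"
  by (auto simp: Cspace_def mtopology_of_submetric continuous_map_in_subtopology)

lemma Cspace_dist_le:
  assumes "u \<in> mspace (Cspace D I)" "v \<in> mspace (Cspace D I)" "z \<in> D"
  shows "\<bar>u z - v z\<bar> \<le> mdist (Cspace D I) u v"
  using mdist_cfunspace_imp_mdist_le[OF assms(1,2)[unfolded Cspace_def], of "mdist (Cspace D I) u v" z] assms(3)
  by (simp add: Cspace_def dist_real_def)

text \<open>
  Uniform convergence along a subsequence, evaluated at convergent points.
\<close>

lemma Cspace_compact_sequences: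
  assumes D: "compact D" and C: "compactin (mtopology_of (Cspace D I)) C"
    and u: "\<And>n. u n \<in> C" and z: "\<And>n. z n \<in> D"
  shows "\<exists>\<sigma> v y. strict_mono (\<sigma>::nat\<Rightarrow>nat) \<and> v \<in> mspace (Cspace D I) \<and> y \<in> D \<and> (\<lambda>n. z (\<sigma> n)) \<longlonglongrightarrow> y \<and>
    (\<lambda>n. u (\<sigma> n) (z (\<sigma> n))) \<longlonglongrightarrow> v y \<and> (\<forall>x\<in>D. (\<lambda>n. u (\<sigma> n) x) \<longlonglongrightarrow> v x)"
proof -
  let ?M = "Cspace D I"
  interpret M: Metric_space "mspace ?M" "mdist ?M" by (rule Metric_space_mspace_mdist)
  have C': "compactin M.mtopology C" using C by (simp add: mtopology_of_def)
  have CM: "C \<subseteq> mspace ?M" using C' by (simp add: M.compactin_sequentially)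
  have "range u \<subseteq> C" using u by auto
  then have "\<exists>l r. l \<in> C \<and> strict_mono r \<and> limitin M.mtopology (u \<circ> r) l sequentially"
    using C' unfolding M.compactin_sequentially by blast
  then obtain v \<rho> where v: "v \<in> C" "strict_mono (\<rho>::nat\<Rightarrow>nat)" "limitin M.mtopology (u \<circ> \<rho>) v sequentially"
    by (elim exE conjE)
  have d0: "(\<lambda>n. mdist ?M (u (\<rho> n)) v) \<longlonglongrightarrow> 0" using v(3) by (simp add: M.limitin_metric_dist_null o_def)
  have "seq_compact D" using D by (rule compact_imp_seq_compact)
  moreover have "\<forall>n. (z \<circ> \<rho>) n \<in> D" using z by simp
  ultimately obtain y \<tau> where y: "y \<in> D" "strict_mono (\<tau>::nat\<Rightarrow>nat)" "((z \<circ> \<rho>) \<circ> \<tau>) \<longlonglongrightarrow> y" by (rule seq_compactE)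
  have st: "strict_mono (\<lambda>n. \<rho> (\<tau> n))" using strict_mono_o[OF v(2) y(2)] by (simp add: o_def)
  have d1: "(\<lambda>n. mdist ?M (u (\<rho> (\<tau> n))) v) \<longlonglongrightarrow> 0" using LIMSEQ_subseq_LIMSEQ[OF d0 y(2)] by (simp add: o_def)
  have vM: "v \<in> mspace ?M" "\<And>n. u n \<in> mspace ?M" using CM v(1) u by auto
  have zy: "(\<lambda>n. z (\<rho> (\<tau> n))) \<longlonglongrightarrow> y" using y(3) by (simp add: o_def)
  have near: "(\<lambda>n. u (\<rho> (\<tau> n)) (x n) - v (x n)) \<longlonglongrightarrow> 0" if "\<And>n. x n \<in> D" for x
    by (rule Lim_null_comparison[OF _ d1], rule always_eventually) (use Cspace_dist_le[OF vM(2) vM(1) that] in auto)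
  have vz: "(\<lambda>n. v (z (\<rho> (\<tau> n)))) \<longlonglongrightarrow> v y"
    by (rule continuous_on_tendsto_compose[OF Cspace_continuous[OF vM(1)] zy y(1)]) (use z in auto)
  have "(\<lambda>n. u (\<rho> (\<tau> n)) (z (\<rho> (\<tau> n)))) \<longlonglongrightarrow> v y"
    using tendsto_add[OF near[of "\<lambda>n. z (\<rho> (\<tau> n))"] vz] z by simp
  moreover have "(\<lambda>n. u (\<rho> (\<tau> n)) x) \<longlonglongrightarrow> v x" if "x \<in> D" for x
    using tendsto_add[OF near[of "\<lambda>n. x"] tendsto_const[of "v x"]] that by simp
  ultimately show ?thesis using st vM(1) y(1) zy by blast
qed

theorem theorem4p2:
  fixes D :: "(real ^ 2) set"
    and Ibar :: "real set"
    and S :: "(real ^ 2 \<Rightarrow> real) \<Rightarrow> real ^ 2 \<Rightarrow> real"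
    and f :: "real \<Rightarrow> real \<Rightarrow> real"
    and U :: "real \<Rightarrow> real"
    and r :: real
    and k0 :: "real ^ 2 \<Rightarrow> real"
  assumes "compact D"
    and "is_interval Ibar" and "Ibar \<subseteq> {0<..}"
    and "admissible_S D Ibar S"
    and "production_function Ibar f"
    and "utility_function U"
    and "r > 0"
    and "k0 \<in> borel_measurable (lebesgue_on D)" and "bounded (k0 ` D)"
    and "\<exists>m>0. \<forall>z\<in>D. m \<le> k0 z"
  shows "\<exists>K\<in>Y_space D. K \<in> T_dom D Ibar f r U k0 \<and>
           (\<forall>t\<ge>0. \<forall>z\<in>D. T_op S f r U k0 K t z = K t z) \<and>
           rational_expectations_equilibrium D Ibar S f r U k0 K"
proof (cases "D = {}")
  case True
  have "kstar f r U k0 (\<lambda>t z. 0) t \<in> Linf D" for t :: real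
  proof (rule bounded_measurable_Linf(1)[where B=0])
    show "kstar f r U k0 (\<lambda>t z. 0) t \<in> borel_measurable (lebesgue_on D)"
      unfolding True by (simp add: measurable_def space_restrict_space)
  qed (use True in auto)
  (* Over the empty domain every condition at a location is void. *)
  then have "(\<lambda>t z. 0) \<in> T_dom D Ibar f r U k0" using True by (simp add: T_dom_def)
  moreover have "(\<lambda>t z. 0) \<in> Y_space D" using True by (simp add: Y_space_def Y_norm_def bot_ennreal)
  ultimately show ?thesis using True by (auto simp: rational_expectations_equilibrium_def intro!: bexI[of _ "\<lambda>t z. 0"])
next
  case False
  obtain m where m: "m > 0" "\<And>z. z \<in> D \<Longrightarrow> m \<le> k0 z" using assms(10) by blast
  obtain B0 where B0: "\<And>z. z \<in> D \<Longrightarrow> \<bar>k0 z\<bar> \<le> B0" using assms(9) by (auto simp: bounded_iff)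
  let ?X = "Cspace D Ibar"
  have SX: "S u \<in> mspace ?X" if "u \<in> Linf D" for u using assms(4) that by (auto simp: admissible_S_def)
  obtain L0 where L0: "\<And>u v. u \<in> Linf D \<Longrightarrow> v \<in> Linf D \<Longrightarrow> mdist ?X (S u) (S v) \<le> L0 * Linf_norm D (\<lambda>x. u x - v x)"
    using assms(4)[unfolded admissible_S_def, THEN conjunct2, THEN conjunct1] by blast
  (* If the norm vanishes identically on D, the Lipschitz constant may be negative. *)
  define L where "L = max 0 L0"
  have L: "0 \<le> L" by (simp add: L_def)
  have S_Lip: "\<bar>S u z - S v z\<bar> \<le> L * e" if "u \<in> Linf D" "v \<in> Linf D" "\<And>z. z \<in> D \<Longrightarrow> \<bar>u z - v z\<bar> \<le> e" "z \<in> D" for u v e z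
  proof -
    have e: "0 \<le> e" using that(3)[OF that(4)] by linarith
    have "\<bar>S u z - S v z\<bar> \<le> mdist ?X (S u) (S v)" by (rule Cspace_dist_le[OF SX[OF that(1)] SX[OF that(2)] that(4)])
    also have "\<dots> \<le> L0 * Linf_norm D (\<lambda>x. u x - v x)" by (rule L0[OF that(1,2)])
    also have "\<dots> \<le> L * Linf_norm D (\<lambda>x. u x - v x)" by (rule mult_right_mono) (auto simp: L_def Linf_norm_def)
    also have "\<dots> \<le> L * e"
      by (rule mult_left_mono[OF bounded_measurable_Linf(2) L]) (use that e in \<open>auto simp: Linf_def\<close>)
    finally show ?thesis .
  qed
  have zero: "(\<lambda>_. 0) \<in> Linf D" by (rule bounded_measurable_Linf(1)[where B=0]) auto
  have "compact (S (\<lambda>_. 0) ` D)"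
    by (rule compact_continuous_image[OF Cspace_continuous[OF SX[OF zero]] assms(1)])
  then obtain s0 where s0: "\<And>z. z \<in> D \<Longrightarrow> S (\<lambda>_. 0) z \<le> s0"
    using compact_imp_bounded by (force simp: bounded_iff abs_le_iff)
  obtain kbar where kbar: "\<And>M k K. 0 \<le> k \<Longrightarrow> 0 \<le> K \<Longrightarrow> K \<le> M \<Longrightarrow> kbar M \<le> k \<Longrightarrow> f k K \<le> 0" "kbar \<in> o[at_top](\<lambda>M. M)"
    using assms(5)[unfolded production_function_def, THEN conjunct2, THEN conjunct2, THEN conjunct2, THEN conjunct1] by blast
  (* Stocks bounded by R have images bounded by s0 + L R. M is chosen such that, with R = |B0| +
     1 + |kbar M|, the part L |kbar M| takes up at most half of M and the remaining terms at
     most the other half. *)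
  have "\<forall>\<^sub>F M in at_top. norm (kbar M) \<le> 1 / (2 * (L + 1)) * norm M"
    by (rule landau_o.smallD[OF kbar(2)]) (use L in simp)
  moreover have "\<forall>\<^sub>F M in at_top. max 1 (2 * (\<bar>s0\<bar> + L * (\<bar>B0\<bar> + 1))) \<le> M" by (rule eventually_ge_at_top)
  ultimately have "\<forall>\<^sub>F M in at_top. norm (kbar M) \<le> 1 / (2 * (L + 1)) * norm M \<and> max 1 (2 * (\<bar>s0\<bar> + L * (\<bar>B0\<bar> + 1))) \<le> M"
    by (rule eventually_conj)
  then obtain M where M: "\<bar>kbar M\<bar> \<le> 1 / (2 * (L + 1)) * M" "1 \<le> M" "2 * (\<bar>s0\<bar> + L * (\<bar>B0\<bar> + 1)) \<le> M"
    by (auto simp: eventually_at_top_linorder)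
  define R where "R = \<bar>B0\<bar> + 1 + \<bar>kbar M\<bar>"
  have R: "0 < R" "kbar M \<le> R" "\<And>z. z \<in> D \<Longrightarrow> k0 z \<le> R"
    unfolding R_def using B0 by (force simp: abs_le_iff)+
  have LR: "L * R + s0 \<le> M"
  proof -
    have "L * \<bar>kbar M\<bar> \<le> (L + 1) * (1 / (2 * (L + 1)) * M)" using L M by (intro mult_mono) auto
    also have "\<dots> = M / 2" using L by (simp add: field_simps)
    finally have 1: "L * R \<le> L * (\<bar>B0\<bar> + 1) + M / 2" unfolding R_def by (simp add: distrib_left)
    define q where "q = L * (\<bar>B0\<bar> + 1)"
    have "L * R + s0 \<le> (q + M / 2) + \<bar>s0\<bar>" by (rule add_mono) (use 1 in \<open>simp_all add: q_def\<close>)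
    also have "\<dots> \<le> M" using M(3) by (simp add: q_def field_simps)
    finally show ?thesis .
  qed
  define W where "W = {u \<in> borel_measurable (lebesgue_on D). \<forall>z\<in>D. 0 \<le> u z \<and> u z \<le> R}"
  have WL: "u \<in> Linf D" "Linf_norm D u \<le> R" if "u \<in> W" for u
    using bounded_measurable_Linf[of u D R] that R(1) by (auto simp: W_def)
  obtain C where C: "compactin (mtopology_of ?X) C" "S ` W \<subseteq> C"
  proof -
    have "W \<subseteq> Linf D" "\<exists>R. \<forall>u\<in>W. Linf_norm D u \<le> R" using WL by blast+
    then have "\<exists>C. compactin (mtopology_of ?X) C \<and> S ` W \<subseteq> C"
      using assms(4)[unfolded admissible_S_def, THEN conjunct2, THEN conjunct2] by blast
    then show thesis using that by blast
  qed
  have zW: "(\<lambda>_. 0) \<in> W" using R(1) by (simp add: W_def)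
  define V where "V = {S u z | u z. u \<in> W \<and> z \<in> D}"
  have VI: "V \<subseteq> Ibar" using Cspace_range[OF SX[OF WL(1)]] by (auto simp: V_def)
  have V_ne: "V \<noteq> {}" using zW False by (auto simp: V_def)
  have VM: "v \<le> M" if "v \<in> V" for v
  proof -
    obtain u z where uz: "v = S u z" "u \<in> W" "z \<in> D" using \<open>v \<in> V\<close> by (auto simp: V_def)
    have "\<bar>S u z - S (\<lambda>_. 0) z\<bar> \<le> L * R"
      by (rule S_Lip[OF WL(1)[OF uz(2)] zero _ uz(3)]) (use uz in \<open>auto simp: W_def\<close>)
    then show ?thesis using s0[OF uz(3)] LR uz(1) by linarith
  qed
  (* Ibar need not be closed, but V has compact closure in it: limits of values of S are values
     of limits, which lie in Ibar. *)
  have V_limits: "x \<in> Ibar" if vn: "\<And>n. vn n \<in> V" and "vn \<longlonglongrightarrow> x" for vn x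
  proof -
    have "\<forall>n. \<exists>uz. vn n = S (fst uz) (snd uz) \<and> fst uz \<in> W \<and> snd uz \<in> D" using vn by (force simp: V_def)
    from choice[OF this] obtain uz where uz: "\<forall>n. vn n = S (fst (uz n)) (snd (uz n)) \<and> fst (uz n) \<in> W \<and> snd (uz n) \<in> D" ..
    have "\<exists>\<sigma> v y. strict_mono (\<sigma>::nat\<Rightarrow>nat) \<and> v \<in> mspace ?X \<and> y \<in> D \<and> (\<lambda>n. snd (uz (\<sigma> n))) \<longlonglongrightarrow> y \<and>
      (\<lambda>n. S (fst (uz (\<sigma> n))) (snd (uz (\<sigma> n)))) \<longlonglongrightarrow> v y \<and> (\<forall>x\<in>D. (\<lambda>n. S (fst (uz (\<sigma> n))) x) \<longlonglongrightarrow> v x)"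
      by (rule Cspace_compact_sequences[OF assms(1) C(1), where u="\<lambda>n. S (fst (uz n))"]) (use uz C(2) in auto)
    then obtain \<sigma> v y where s: "strict_mono (\<sigma>::nat\<Rightarrow>nat)" "v \<in> mspace ?X" "y \<in> D" "(\<lambda>n. vn (\<sigma> n)) \<longlonglongrightarrow> v y"
      using uz by auto
    have "(\<lambda>n. vn (\<sigma> n)) \<longlonglongrightarrow> x" using LIMSEQ_subseq_LIMSEQ[OF \<open>vn \<longlonglongrightarrow> x\<close> s(1)] by (simp add: o_def)
    then have "x = v y" using s(4) LIMSEQ_unique by blast
    then show ?thesis using Cspace_range[OF s(2,3)] by simp
  qed
  have V_bdd: "bdd_above V" "bdd_below V"
  proof -
    show "bdd_above V" by (rule bdd_aboveI[OF VM])
    show "bdd_below V" by (rule bdd_belowI[of _ 0]) (use VI assms(3) in force)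
  qed
  define a where "a = Inf V"
  define b where "b = Sup V"
  have ab: "a \<in> Ibar" "b \<in> Ibar" "a \<le> b" "b \<le> M"
  proof -
    have lim: "x \<in> Ibar" if "x \<in> closure V" for x
    proof -
      from that obtain p where p: "\<forall>n. p n \<in> V" "p \<longlonglongrightarrow> x" unfolding closure_sequential by (elim exE conjE)
      show ?thesis by (rule V_limits[OF _ p(2)]) (use p(1) in simp)
    qed
    show "a \<in> Ibar" unfolding a_def by (rule lim[OF closure_contains_Inf[OF V_ne V_bdd(2)]])
    show "b \<in> Ibar" unfolding b_def by (rule lim[OF closure_contains_Sup[OF V_ne V_bdd(1)]])
    show "a \<le> b" unfolding a_def b_def by (rule cInf_le_cSup[OF V_ne V_bdd])
    show "b \<le> M" unfolding b_def by (rule cSup_least[OF V_ne VM])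
  qed
  have abI: "{a..b} \<subseteq> Ibar" using mem_is_interval_1_I[OF assms(2) ab(1,2)] by auto
  have a0: "0 < a" using ab(1) assms(3) by auto
  have "\<exists>\<delta> k1. individual_problem f U a b \<delta> R k1 r"
  proof (rule individual_problem_of_assumptions[OF assms(5,6,7) a0 ab(3) abI R(1)])
    show "f x K \<le> 0" if "K \<in> {a..b}" "R \<le> x" for x K
      by (rule kbar(1)[of x K M]) (use that a0 ab(4) R in auto)
  qed
  then obtain \<delta> k1 where ip: "individual_problem f U a b \<delta> R k1 r" by blast
  interpret individual_problem f U a b \<delta> R k1 r by (rule ip)
  interpret E: equilibrium_problem f U a b \<delta> R k1 r D S k0 L m
  proof
    show "compact D" "D \<noteq> {}" "k0 \<in> borel_measurable (lebesgue_on D)" "0 < m" "0 \<le> L" using assms(1,8) False m L by auto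
    show "m \<le> k0 z \<and> k0 z \<le> R" if "z \<in> D" for z using m(2)[OF that] R(3)[OF that] by simp
    show "S u z \<in> {a..b}" if "u \<in> borel_measurable (lebesgue_on D)" "\<And>z. z \<in> D \<Longrightarrow> 0 \<le> u z \<and> u z \<le> R" "z \<in> D" for u z
    proof -
      have "S u z \<in> V" using that by (auto simp: V_def W_def)
      then show ?thesis using cInf_lower[OF _ V_bdd(2)] cSup_upper[OF _ V_bdd(1)] by (auto simp: a_def b_def)
    qed
    show "\<bar>S u z - S v z\<bar> \<le> L * e" if "u \<in> borel_measurable (lebesgue_on D)" "\<And>z. z \<in> D \<Longrightarrow> 0 \<le> u z \<and> u z \<le> R"
      "v \<in> borel_measurable (lebesgue_on D)" "\<And>z. z \<in> D \<Longrightarrow> 0 \<le> v z \<and> v z \<le> R" "\<And>z. z \<in> D \<Longrightarrow> \<bar>u z - v z\<bar> \<le> e" "z \<in> D" for u v e z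
      by (rule S_Lip[OF WL(1) WL(1) that(5,6)]) (use that in \<open>auto simp: W_def\<close>)
    show "\<exists>\<rho>>0. \<forall>z'\<in>D. dist z z' < \<rho> \<longrightarrow> (\<forall>u\<in>borel_measurable (lebesgue_on D). (\<forall>z\<in>D. 0 \<le> u z \<and> u z \<le> R) \<longrightarrow> \<bar>S u z - S u z'\<bar> \<le> e)"
      if z: "z \<in> D" and e: "0 < e" for z e
    proof (rule ccontr)
      assume no: "\<not> ?thesis"
      have "\<exists>p. fst p \<in> D \<and> dist z (fst p) < 1 / real (Suc n) \<and> snd p \<in> W \<and> e < \<bar>S (snd p) z - S (snd p) (fst p)\<bar>" for n
      proof -
        have "1 / real (Suc n) > 0" by simp
        with no obtain y u where "y \<in> D" "dist z y < 1 / real (Suc n)" "u \<in> W" "\<not> \<bar>S u z - S u y\<bar> \<le> e"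
          unfolding W_def by blast
        then show ?thesis by (intro exI[of _ "(y, u)"]) auto
      qed
      then have "\<forall>n. \<exists>p. fst p \<in> D \<and> dist z (fst p) < 1 / real (Suc n) \<and> snd p \<in> W \<and> e < \<bar>S (snd p) z - S (snd p) (fst p)\<bar>" by blast
      from choice[OF this] obtain p where p: "\<forall>n. fst (p n) \<in> D \<and> dist z (fst (p n)) < 1 / real (Suc n) \<and> snd (p n) \<in> W \<and>
        e < \<bar>S (snd (p n)) z - S (snd (p n)) (fst (p n))\<bar>" ..
      have pz: "(\<lambda>n. fst (p n)) \<longlonglongrightarrow> z"
      proof (rule metric_LIMSEQ_I)
        fix \<epsilon> :: real assume "\<epsilon> > 0"
        then obtain N where N: "1 / real (Suc N) < \<epsilon>" using nat_approx_posE by blast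
        have "dist (fst (p n)) z < \<epsilon>" if "n \<ge> N" for n
        proof -
          have "dist (fst (p n)) z < 1 / real (Suc n)" using p by (simp add: dist_commute)
          also have "\<dots> \<le> 1 / real (Suc N)" using that by (intro divide_left_mono) auto
          finally show ?thesis using N by linarith
        qed
        then show "\<exists>N. \<forall>n\<ge>N. dist (fst (p n)) z < \<epsilon>" by blast
      qed
      have "\<exists>\<sigma> v y. strict_mono (\<sigma>::nat\<Rightarrow>nat) \<and> v \<in> mspace ?X \<and> y \<in> D \<and> (\<lambda>n. fst (p (\<sigma> n))) \<longlonglongrightarrow> y \<and>
        (\<lambda>n. S (snd (p (\<sigma> n))) (fst (p (\<sigma> n)))) \<longlonglongrightarrow> v y \<and> (\<forall>x\<in>D. (\<lambda>n. S (snd (p (\<sigma> n))) x) \<longlonglongrightarrow> v x)"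
        by (rule Cspace_compact_sequences[OF assms(1) C(1), where u="\<lambda>n. S (snd (p n))"]) (use p C(2) in auto)
      then obtain \<sigma> v y where s: "strict_mono (\<sigma>::nat\<Rightarrow>nat)" "(\<lambda>n. fst (p (\<sigma> n))) \<longlonglongrightarrow> y"
        "(\<lambda>n. S (snd (p (\<sigma> n))) (fst (p (\<sigma> n)))) \<longlonglongrightarrow> v y" "\<forall>x\<in>D. (\<lambda>n. S (snd (p (\<sigma> n))) x) \<longlonglongrightarrow> v x" by auto
      have "(\<lambda>n. fst (p (\<sigma> n))) \<longlonglongrightarrow> z" using LIMSEQ_subseq_LIMSEQ[OF pz s(1)] by (simp add: o_def)
      then have "y = z" using s(2) LIMSEQ_unique by blast
      then have "(\<lambda>n. \<bar>S (snd (p (\<sigma> n))) z - S (snd (p (\<sigma> n))) (fst (p (\<sigma> n)))\<bar>) \<longlonglongrightarrow> \<bar>v z - v z\<bar>"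
        using s(3,4) z by (intro tendsto_intros) auto
      then have "e \<le> \<bar>v z - v z\<bar>" by (rule LIMSEQ_le_const) (use p in \<open>auto intro: less_imp_le\<close>)
      then show False using e by simp
    qed
  qed
  obtain K where K: "K \<in> E.fields" "\<And>t z. 0 \<le> t \<Longrightarrow> z \<in> D \<Longrightarrow> E.expectations_map K (t, z) = K (t, z)"
    using E.expectations_map_fixed_point by fastforce
  define Kc where "Kc t z = K (t, z)" for t z
  have kst: "kstar f r U k0 Kc t = E.stock_at K t" for t
    by (auto simp: kstar_def Kc_def E.stock_at_def E.capital_def)
  have range: "Kc t z \<in> {a..b}" if "0 \<le> t" "z \<in> D" for t z
    unfolding Kc_def by (rule E.fields_range[OF K(1) that])
  have cont: "continuous_on ({0..} \<times> D) (\<lambda>(t, z). Kc t z)"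
    unfolding continuous_on_sequentially
  proof (intro allI ballI impI, elim conjE)
    fix x and p :: "real \<times> (real ^ 2)" assume p: "p \<in> {0..} \<times> D" and x: "\<forall>n. x n \<in> {0..} \<times> D" and lim: "x \<longlonglongrightarrow> p"
    have xn: "0 \<le> fst (x n)" "snd (x n) \<in> D" for n using x[rule_format, of n] by auto
    have pp: "0 \<le> fst p" "snd p \<in> D" using p by auto
    have "(\<lambda>n. L * Lip * \<bar>fst p - fst (x n)\<bar> + E.osc (snd p) (snd (x n))) \<longlonglongrightarrow> L * Lip * \<bar>fst p - fst p\<bar> + 0"
      by (intro tendsto_intros E.osc_tendsto xn pp lim)
    then have z0: "(\<lambda>n. L * Lip * \<bar>fst p - fst (x n)\<bar> + E.osc (snd p) (snd (x n))) \<longlonglongrightarrow> 0" by simp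
    have "(\<lambda>n. K p - K (x n)) \<longlonglongrightarrow> 0"
    proof (rule Lim_null_comparison[OF _ z0], rule always_eventually, rule allI)
      fix n
      show "norm (K p - K (x n)) \<le> L * Lip * \<bar>fst p - fst (x n)\<bar> + E.osc (snd p) (snd (x n))"
        using E.fields_modulus[OF K(1) pp(1) xn(1) pp(2) xn(2), of n n] by simp
    qed
    from tendsto_diff[OF tendsto_const[of "K p"] this] have "(\<lambda>n. K (x n)) \<longlonglongrightarrow> K p" by simp
    then show "((\<lambda>(t, z). Kc t z) \<circ> x) \<longlonglongrightarrow> (\<lambda>(t, z). Kc t z) p" by (simp add: o_def split_beta Kc_def)
  qed
  have abs_le: "\<bar>Kc t z\<bar> \<le> b" if "0 \<le> t" "z \<in> D" for t z using range[OF that] a0 by auto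
  have dom: "Kc \<in> T_dom D Ibar f r U k0"
    unfolding T_dom_def
  proof (intro CollectI conjI cont ballI allI impI)
    show "bounded ((\<lambda>(t, z). Kc t z) ` ({0..} \<times> D))" unfolding bounded_iff using abs_le by (intro exI[of _ b]) auto
    show "Kc t z \<in> Ibar" if "0 \<le> t" "z \<in> D" for t z using range[OF that] abI by blast
    show "\<exists>!k. \<exists>c. maximiser f r U (k0 z) (\<lambda>t. Kc t z) k c" if "z \<in> D" for z
      unfolding Kc_def by (rule E.capital(1)[OF K(1) that E.k0_range[OF that]])
    show "kstar f r U k0 Kc t \<in> Linf D" if "0 \<le> t" for t
      using WL(1) E.stock_at_in_stocks[OF K(1) that] unfolding kst by (simp add: W_def E.stocks_def)
  qed
  have fixed: "T_op S f r U k0 Kc t z = Kc t z" if "0 \<le> t" "z \<in> D" for t z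
    using K(2)[OF that] by (simp add: T_op_def kst E.expectations_map_def Kc_def)
  have "Y_norm D Kc < top"
  proof -
    have "(SUP (t, z)\<in>{0..real n} \<times> D. ennreal \<bar>Kc t z\<bar>) \<le> ennreal b" for n
      by (rule SUP_least) (auto intro!: ennreal_leI abs_le)
    then have "Y_norm D Kc \<le> (\<Sum>n. ennreal ((1 / 2) ^ n) * ennreal b)"
      unfolding Y_norm_def by (intro suminf_le mult_left_mono) auto
    also have "\<dots> = (\<Sum>n. ennreal ((1 / 2) ^ n * b))" using a0 ab(3) by (simp add: ennreal_mult)
    also have "\<dots> < top"
    proof -
      have "summable (\<lambda>n. (1 / 2 :: real) ^ n * b)" by (intro summable_mult2 summable_geometric) simp
      then show ?thesis using a0 ab(3) by (subst suminf_ennreal2) auto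
    qed
    finally show ?thesis .
  qed
  then have "Kc \<in> Y_space D" using cont by (simp add: Y_space_def)
  moreover have "rational_expectations_equilibrium D Ibar S f r U k0 Kc"
    using dom fixed by (simp add: rational_expectations_equilibrium_def)
  ultimately show ?thesis using dom fixed by blast
qed

end
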